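(* Let $(M,g_0)$ be one of the Riemannian manifolds $S^{2n}$, $S^{2n-1}$, $P^n\mathbb{C}$, $P^n\mathbb{H}$ ($n\geq 1$) and $P^2\mathrm{Ca}$, endowed with its standard metric. Then there exists a Killing vector field $V$ on $(M,g_0)$ such that, for every small enough irrational number $\alpha$, setting $\delta=-\alpha V$ and $\beta=1-\alpha^2 g_0(V,V)$, the standard stationary spacetime $(M\times\mathbb{R},l)$ with $$l(x,t)[(v,\tau),(v,\tau)]=g_0(x)[v,v]+2g_0(x)[\delta(x),v]\,\tau-\beta(x)\tau^2$$ has, up to equivalence, exactly $2n$, $2n$, $n(n+1)$, $2n(n+1)$ and $24$ $t$-periodic lightlike geodesics, respectively.
   Context: $S^k$ is the round sphere, $P^n\mathbb{C}$ and $P^n\mathbb{H}$ are the complex and quaternionic projective spaces of complex, respectively quaternionic, dimension $n$, and $P^2\mathrm{Ca}$ is the Cayley projective plane; the standard metrics are normalized so that all geodesics are closed with the same minimal period $2\pi$. "Small enough" includes that $\alpha^2 g_0(V,V)<1$ on $M$, so that $\beta>0$. A lightlike geodesic $\gamma=(x,t):[0,1]\to M\times\mathbb{R}$ is $t$-periodic if there is a real number $T>0$ such that $x$ is a smooth closed curve in $M$ (so $x(0)=x(1)$ and $\dot x(0)=\dot x(1)$), $t(1)=t(0)+T$ and $\dot t(1)=\dot t(0)$. Two $t$-periodic lightlike geodesics are equivalent if their images coincide up to a constant translation in the time component $t$. Here images are those of the geodesics extended to all of $\mathbb{R}$ (by $x(s+1)=x(s)$, $t(s+1)=t(s)+T$),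 so that iterations of one and the same trajectory are equivalent. *)

theory Defs
  imports "HOL-Analysis.Analysis"
begin

section \<open>Smoothness\<close>

primrec Ck_on :: "nat \<Rightarrow> 'a::real_normed_vector set \<Rightarrow> ('a \<Rightarrow> 'b::real_normed_vector) \<Rightarrow> bool" where
  "Ck_on 0 S f \<longleftrightarrow> continuous_on S f"
| "Ck_on (Suc k) S f \<longleftrightarrow> (\<forall>x\<in>S. f differentiable (at x)) \<and>
     (\<forall>v. Ck_on k S (\<lambda>x. frechet_derivative f (at x) v))"

text \<open>Meant for open \<open>S\<close>.\<close>
definition smooth_on :: "'a::real_normed_vector set \<Rightarrow> ('a \<Rightarrow> 'b::real_normed_vector) \<Rightarrow> bool" where
  "smooth_on S f \<longleftrightarrow> (\<forall>k. Ck_on k S f)"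

text \<open>Smoothness of a map defined on a subset \<open>M\<close> (a submanifold) of a Euclidean space:
  local existence of smooth extensions.\<close>
definition smooth_map_on :: "'a::real_normed_vector set \<Rightarrow> ('a \<Rightarrow> 'b::real_normed_vector) \<Rightarrow> bool" where
  "smooth_map_on M f \<longleftrightarrow>
     (\<forall>x\<in>M. \<exists>W F. open W \<and> x \<in> W \<and> smooth_on W F \<and> (\<forall>y\<in>W \<inter> M. F y = f y))"

text \<open>Derivative of a curve on an interval \<open>S\<close>, one-sided at the end points that belong to \<open>S\<close>.\<close>
definition velocity :: "real set \<Rightarrow> (real \<Rightarrow> 'a::real_normed_vector) \<Rightarrow> real \<Rightarrow> 'a" where
  "velocity S c = (\<lambda>s. vector_derivative c (at s within S))"

definition smooth_curve_on :: "real set \<Rightarrow> (real \<Rightarrow> 'a::real_normed_vector) \<Rightarrow> bool" where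
  "smooth_curve_on S c \<longleftrightarrow> (\<forall>k. (velocity S ^^ k) c differentiable_on S)"


section \<open>Semi-Riemannian geometry of embedded submanifolds\<close>

text \<open>
  A manifold is a subset \<open>N\<close> of a Euclidean space \<open>'a\<close> that is an embedded submanifold. A
  \<open>d\<close>-dimensional coordinate space is realised as \<open>span B\<close>, where \<open>B\<close> consists of \<open>d\<close> vectors of
  the standard basis of \<open>'a\<close>; \<open>U \<inter> span B\<close> is then an open subset of the coordinate space.
  That \<open>\<phi>\<close> is given on all of the open set \<open>U\<close> of \<open>'a\<close> is no restriction (compose with the
  orthogonal projection to \<open>span B\<close>); only its values on \<open>U \<inter> span B\<close> matter.
\<close>
definition local_param ::
  "'a::euclidean_space set \<Rightarrow> 'a set \<Rightarrow> 'a set \<Rightarrow> ('a \<Rightarrow> 'a) \<Rightarrow> bool" where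
  "local_param N B U \<phi> \<longleftrightarrow>
     B \<subseteq> Basis \<and> open U \<and> smooth_on U \<phi> \<and>
     openin (top_of_set N) (\<phi> ` (U \<inter> span B)) \<and>
     (\<exists>\<psi>. homeomorphism (U \<inter> span B) (\<phi> ` (U \<inter> span B)) \<phi> \<psi>) \<and>
     (\<forall>u\<in>U \<inter> span B. inj_on (frechet_derivative \<phi> (at u)) (span B))"

text \<open>A metric \<open>g\<close> assigns to each point \<open>x\<close> of the manifold a symmetric bilinear form \<open>g x\<close>;
  only its values on tangent vectors at \<open>x\<close> matter.\<close>
type_synonym 'a metric = "'a \<Rightarrow> 'a \<Rightarrow> 'a \<Rightarrow> real"

text \<open>The components \<open>g\<^sub>i\<^sub>j\<close> of \<open>g\<close> in the parametrisation \<open>\<phi>\<close>.\<close>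
definition metric_coeff ::
  "'a::euclidean_space metric \<Rightarrow> ('a \<Rightarrow> 'a) \<Rightarrow> 'a \<Rightarrow> 'a \<Rightarrow> 'a \<Rightarrow> real" where
  "metric_coeff g \<phi> i j u =
     g (\<phi> u) (frechet_derivative \<phi> (at u) i) (frechet_derivative \<phi> (at u) j)"

text \<open>Partial derivative, as a derivative along a line: the functions it is applied to are only
  meaningful on \<open>U \<inter> span B\<close>.\<close>
definition partial :: "('a::euclidean_space \<Rightarrow> 'b::real_normed_vector) \<Rightarrow> 'a \<Rightarrow> 'a \<Rightarrow> 'b" where
  "partial f k u = vector_derivative (\<lambda>s. f (u + s *\<^sub>R k)) (at 0)"

definition christoffel_first ::
  "'a::euclidean_space metric \<Rightarrow> ('a \<Rightarrow> 'a) \<Rightarrow> 'a \<Rightarrow> 'a \<Rightarrow> 'a \<Rightarrow> 'a \<Rightarrow> real" where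
  "christoffel_first g \<phi> l i j u =
     (partial (metric_coeff g \<phi> j l) i u + partial (metric_coeff g \<phi> i l) j u
      - partial (metric_coeff g \<phi> i j) l u) / 2"

text \<open>The vector with components \<open>\<Gamma>\<^sup>k\<^sub>i\<^sub>j\<close>, \<open>k \<in> B\<close>: the Christoffel symbols of the first kind with
  the index raised, so that it represents the Levi-Civita derivative of the \<open>j\<close>-th coordinate
  field along the \<open>i\<close>-th one.\<close>
definition christoffel ::
  "'a::euclidean_space metric \<Rightarrow> 'a set \<Rightarrow> ('a \<Rightarrow> 'a) \<Rightarrow> 'a \<Rightarrow> 'a \<Rightarrow> 'a \<Rightarrow> 'a" where
  "christoffel g B \<phi> i j u =
     (THE G. G \<in> span B \<and>
        (\<forall>l\<in>B. (\<Sum>k\<in>B. metric_coeff g \<phi> l k u * (G \<bullet> k)) = christoffel_first g \<phi> l i j u))"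

text \<open>A smooth curve in \<open>N\<close>, parametrised by the interval \<open>S\<close>, that satisfies in local coordinates
  the equation \<open>u'' + \<Gamma>(u',u') = 0\<close>; here \<open>w = u'\<close> and \<open>a = u''(s)\<close>. As the equation is
  independent of the coordinates, one parametrisation near each point is enough.\<close>
definition geodesic_on ::
  "'a::euclidean_space set \<Rightarrow> 'a metric \<Rightarrow> real set \<Rightarrow> (real \<Rightarrow> 'a) \<Rightarrow> bool" where
  "geodesic_on N g S c \<longleftrightarrow>
     smooth_curve_on S c \<and> c ` S \<subseteq> N \<and>
     (\<forall>s\<in>S. \<exists>B U \<phi> J u w a. local_param N B U \<phi> \<and> open J \<and> s \<in> J \<and>
        (\<forall>r\<in>J \<inter> S. u r \<in> U \<inter> span B \<and> \<phi> (u r) = c r \<and>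
           (u has_vector_derivative w r) (at r within S)) \<and>
        (w has_vector_derivative a) (at s within S) \<and>
        a + (\<Sum>i\<in>B. \<Sum>j\<in>B. ((w s \<bullet> i) * (w s \<bullet> j)) *\<^sub>R christoffel g B \<phi> i j (u s)) = 0)"

text \<open>\<open>lie_coeff g B \<phi> v i j\<close> is the \<open>(i,j)\<close> component of the Lie derivative of \<open>g\<close> along the
  vector field with coordinate representation \<open>v\<close>.\<close>
definition lie_coeff ::
  "'a::euclidean_space metric \<Rightarrow> 'a set \<Rightarrow> ('a \<Rightarrow> 'a) \<Rightarrow> ('a \<Rightarrow> 'a) \<Rightarrow> 'a \<Rightarrow> 'a \<Rightarrow> 'a \<Rightarrow> real" where
  "lie_coeff g B \<phi> v i j u =
     (\<Sum>k\<in>B. (v u \<bullet> k) * partial (metric_coeff g \<phi> i j) k u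
            + metric_coeff g \<phi> k j u * (partial v i u \<bullet> k)
            + metric_coeff g \<phi> i k u * (partial v j u \<bullet> k))"

text \<open>A smooth vector field along which the Lie derivative of \<open>g\<close> vanishes. Tangency of \<open>V\<close> is
  contained in the existence of the coordinate representation \<open>v\<close>.\<close>
definition killing_field :: "'a::euclidean_space set \<Rightarrow> 'a metric \<Rightarrow> ('a \<Rightarrow> 'a) \<Rightarrow> bool" where
  "killing_field M g V \<longleftrightarrow>
     smooth_map_on M V \<and>
     (\<forall>x\<in>M. \<exists>B U \<phi> v. local_param M B U \<phi> \<and> x \<in> \<phi> ` (U \<inter> span B) \<and>
        (\<forall>u\<in>U \<inter> span B. v u \<in> span B \<and> V (\<phi> u) = frechet_derivative \<phi> (at u) (v u) \<and>
           (\<forall>i\<in>B. \<forall>j\<in>B. lie_coeff g B \<phi> v i j u = 0)))"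


section \<open>Standard stationary spacetimes and their periodic light rays\<close>

text \<open>The polarisation of \<open>(v,\<tau>) \<mapsto> g\<^sub>0(v,v) + 2 g\<^sub>0(\<delta>,v) \<tau> - \<beta> \<tau>\<^sup>2\<close>.\<close>
definition stationary_metric ::
  "'a metric \<Rightarrow> ('a \<Rightarrow> 'a) \<Rightarrow> ('a \<Rightarrow> real) \<Rightarrow> ('a \<times> real) metric" where
  "stationary_metric g \<delta> \<beta> = (\<lambda>(x, t) (v, \<tau>) (w, \<sigma>).
     g x v w + g x (\<delta> x) v * \<sigma> + g x (\<delta> x) w * \<tau> - \<beta> x * \<tau> * \<sigma>)"

definition lightlike_geodesic ::
  "'a::euclidean_space set \<Rightarrow> 'a metric \<Rightarrow> (real \<Rightarrow> 'a) \<Rightarrow> bool" where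
  "lightlike_geodesic N l c \<longleftrightarrow> geodesic_on N l {0..1} c \<and>
     (\<forall>s\<in>{0..1}. velocity {0..1} c s \<noteq> 0 \<and>
        l (c s) (velocity {0..1} c s) (velocity {0..1} c s) = 0)"

text \<open>Curves on \<open>[0,1]\<close> are functions on all of \<open>real\<close>; their values outside \<open>[0,1]\<close> are
  irrelevant, and are ignored by \<open>light_ray_equiv\<close> below.\<close>
definition t_periodic ::
  "'a::euclidean_space set \<Rightarrow> ('a \<times> real) metric \<Rightarrow> (real \<Rightarrow> 'a \<times> real) \<Rightarrow> bool" where
  "t_periodic M l c \<longleftrightarrow> lightlike_geodesic (M \<times> UNIV) l c \<and>
     (\<exists>T>0. fst (c 1) = fst (c 0) \<and> snd (c 1) = snd (c 0) + T \<and>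
        velocity {0..1} c 1 = velocity {0..1} c 0)"

text \<open>Image of the extension of \<open>c = (x,t)\<close> by \<open>x(s+1) = x(s)\<close>, \<open>t(s+1) = t(s) + T\<close>, where
  \<open>T = t(1) - t(0)\<close>.\<close>
definition extended_image :: "(real \<Rightarrow> 'a \<times> real) \<Rightarrow> ('a \<times> real) set" where
  "extended_image c =
     range (\<lambda>s. (fst (c (frac s)), snd (c (frac s)) + of_int \<lfloor>s\<rfloor> * (snd (c 1) - snd (c 0))))"

definition light_ray_equiv ::
  "'a::euclidean_space set \<Rightarrow> ('a \<times> real) metric \<Rightarrow> (real \<Rightarrow> 'a \<times> real) rel" where
  "light_ray_equiv M l = {(c, d). t_periodic M l c \<and> t_periodic M l d \<and>
     (\<exists>b. extended_image d = (\<lambda>(x, t). (x, t + b)) ` extended_image c)}"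

definition periodic_light_rays ::
  "'a::euclidean_space set \<Rightarrow> ('a \<times> real) metric \<Rightarrow> (real \<Rightarrow> 'a \<times> real) set set" where
  "periodic_light_rays M l = {c. t_periodic M l c} // light_ray_equiv M l"


section \<open>The model spaces\<close>

text \<open>Cayley-Dickson doubling, starting from \<open>complex\<close>. The library inner product on the product
  types is the standard one of the quaternions and octonions.\<close>
definition cd_mult :: "('a \<Rightarrow> 'a \<Rightarrow> 'a) \<Rightarrow> ('a \<Rightarrow> 'a) \<Rightarrow>
    'a \<times> 'a \<Rightarrow> 'a \<times> 'a \<Rightarrow> ('a::ab_group_add) \<times> 'a" where
  "cd_mult mul cj = (\<lambda>(a, b) (c, d). (mul a c - mul (cj d) b, mul d a + mul b (cj c)))"

definition cd_cnj :: "('a \<Rightarrow> 'a) \<Rightarrow> 'a \<times> 'a \<Rightarrow> ('a::ab_group_add) \<times> 'a" where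
  "cd_cnj cj = (\<lambda>(a, b). (cj a, - b))"

type_synonym quat = "complex \<times> complex"
type_synonym oct = "quat \<times> quat"

definition quat_mult :: "quat \<Rightarrow> quat \<Rightarrow> quat" where "quat_mult = cd_mult (*) cnj"
definition quat_cnj :: "quat \<Rightarrow> quat" where "quat_cnj = cd_cnj cnj"
definition oct_mult :: "oct \<Rightarrow> oct \<Rightarrow> oct" where "oct_mult = cd_mult quat_mult quat_cnj"
definition oct_cnj :: "oct \<Rightarrow> oct" where "oct_cnj = cd_cnj quat_cnj"
definition oct_one :: oct where "oct_one = ((1, 0), (0, 0))"

definition unit_sphere :: "(real^'m) set" where
  "unit_sphere = sphere 0 1"

definition round_metric :: "(real^'m) metric" where
  "round_metric x v w = v \<bullet> w"

text \<open>The point \<open>[v]\<close> of a projective space, \<open>v\<close> a unit vector, is represented by the matrix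
  \<open>v v\<^sup>*\<close> of the orthogonal projection to the (right) line spanned by \<open>v\<close>; two unit vectors have
  the same matrix iff they span the same line.\<close>
definition complex_projective_space :: "(complex^'m^'m) set" where
  "complex_projective_space = {(\<chi> i j. v $ i * cnj (v $ j)) | v. norm v = 1}"

definition quaternionic_projective_space :: "(quat^'m^'m) set" where
  "quaternionic_projective_space = {(\<chi> i j. quat_mult (v $ i) (quat_cnj (v $ j))) | v. norm v = 1}"

text \<open>The Hermitian idempotents of trace one in the Jordan algebra of \<open>3 \<times> 3\<close> octonionic
  Hermitian matrices.\<close>
definition cayley_plane :: "(oct^3^3) set" where
  "cayley_plane = {A. (\<forall>i j. A $ j $ i = oct_cnj (A $ i $ j)) \<and>
     (\<forall>i j. (\<Sum>k\<in>UNIV. oct_mult (A $ i $ k) (A $ k $ j)) = A $ i $ j) \<and>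
     (\<Sum>i\<in>UNIV. A $ i $ i) = oct_one}"

text \<open>On Hermitian matrices \<open>A \<bullet> B = Re (tr (A B))\<close>. With the factor 2 the projective lines are
  isometric to unit spheres (e.g. the complex one is \<open>S\<^sup>2\<close>) and totally geodesic, so that all
  geodesics are closed with minimal period \<open>2\<pi>\<close>.\<close>
definition projective_metric :: "('a::real_inner^'m^'m) metric" where
  "projective_metric x v w = 2 * (v \<bullet> w)"

end

theory Submission
  imports Defs
begin

text \<open>
  \<open>V\<close> is the generator of a linear torus action \<open>\<Phi>\<close> with pairwise distinct nonzero rational weights.
  The map \<open>(x, t) \<mapsto> (\<Phi>\<^sub>-\<^sub>\<alpha>\<^sub>t x, t)\<close> turns the stationary metric into the product metric, so that a
  light ray is \<open>x(t) = \<Phi>\<^sub>\<alpha>\<^sub>t y(t)\<close> for a unit speed geodesic \<open>y\<close>. In the given embeddings all geodesics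
  are circles \<open>C + cos t X + sin t Y\<close>, so the component of \<open>x\<close> in the plane of weight \<open>\<theta>\<close> has the
  frequencies \<open>\<alpha> \<theta>\<close> and \<open>\<alpha> \<theta> \<plusminus> 1\<close>. If \<open>x\<close> is periodic, then the frequencies that occur are pairwise
  commensurable; as \<open>\<alpha>\<close> is irrational and the \<open>\<theta>\<close> are rational with distinct absolute values, only
  one frequency \<open>\<alpha> \<theta> \<plusminus> 1\<close> occurs. Then \<open>y\<close> runs through a circle in a single weight plane, in one of
  two directions, and the number of light rays is twice the number of weight planes.

  The projective spaces are treated at once as sets of Hermitian matrices over a composition algebra.
  For the Cayley plane transitivity comes from Givens rotations and the Moufang identity, and the
  torus from triality.
\<close>

section \<open>Calculus of smooth maps\<close>

text \<open>The counts come from the weight planes: \<open>n\<close> of them for the spheres; for a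
  projective space one (complex), two (quaternionic) or four (octonionic) per entry above the
  diagonal, hence n(n+1)/2, n(n+1) and 12.

  Suppose that the plane of weight a carries the frequency \<alpha>a + p and the plane of weight b
  the frequency \<alpha>b + q, with p nonzero. If both close up after the same time, irrationality
  of \<alpha> makes (b, q) proportional to (a, p). So nonzero weights exclude q = 0 and the opposite
  direction in the same plane, and distinct absolute values exclude a second plane.

  Two obstacles shape the proof. The torus fixes further directions (an axis of an even-dimensional
  sphere, the diagonal of a Hermitian matrix), on which the frequencies say nothing; that nothing
  moves there has to come from the geometry of \<open>M\<close>. And octonionic matrices do not act
  associatively, so points of the Cayley plane are represented by vectors with at most two
  coordinates outside the nucleus.\<close>

lemma Ck_on_cong:
  assumes "open S" "\<And>x. x \<in> S \<Longrightarrow> f x = g x" "Ck_on k S f"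
  shows "Ck_on k S g"
  using assms(2,3)
proof (induction k arbitrary: f g)
  case 0
  then show ?case by (auto cong: continuous_on_cong)
next
  case (Suc k)
  have *: "(g has_derivative frechet_derivative f (at x)) (at x)" if "x \<in> S" for x
  proof (rule has_derivative_transform_within_open[OF _ assms(1) that])
    show "(f has_derivative frechet_derivative f (at x)) (at x)"
      using Suc.prems(2) that unfolding Ck_on.simps frechet_derivative_works by blast
  qed (use Suc.prems in auto)
  have eq: "frechet_derivative f (at x) = frechet_derivative g (at x)" if "x \<in> S" for x
    using frechet_derivative_at[OF *[OF that]] .
  have "Ck_on k S (\<lambda>x. frechet_derivative g (at x) v)" for v
    using Suc.IH[of "\<lambda>x. frechet_derivative f (at x) v" "\<lambda>x. frechet_derivative g (at x) v"]
      Suc.prems eq by auto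
  moreover have "\<forall>x\<in>S. g differentiable (at x)"
    using * by (auto simp: differentiable_def)
  ultimately show ?case by simp
qed

text \<open>Any explicit derivative may stand for the choice made by
  \<open>frechet_derivative\<close>; each closure property below is then one differentiation rule
  and an induction on \<open>k\<close>.\<close>

lemma Ck_on_SucI:
  assumes "open S" "\<And>x. x \<in> S \<Longrightarrow> (f has_derivative f' x) (at x)" "\<And>v. Ck_on k S (\<lambda>x. f' x v)"
  shows "Ck_on (Suc k) S f"
proof -
  have "f' x = frechet_derivative f (at x)" if "x \<in> S" for x
    using frechet_derivative_at assms(2) that by blast
  then have "Ck_on k S (\<lambda>x. frechet_derivative f (at x) v)" for v
    using Ck_on_cong[OF assms(1), of "\<lambda>x. f' x v" "\<lambda>x. frechet_derivative f (at x) v"] assms(3) by auto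
  then show ?thesis using assms(2) by (auto simp: differentiable_def)
qed

lemma Ck_on_SucD:
  assumes "Ck_on (Suc k) S f"
  shows "x \<in> S \<Longrightarrow> (f has_derivative frechet_derivative f (at x)) (at x)"
    "Ck_on k S (\<lambda>x. frechet_derivative f (at x) v)"
  using assms unfolding Ck_on.simps frechet_derivative_works by blast+

lemma Ck_on_lower: "Ck_on (Suc k) S f \<Longrightarrow> Ck_on k S f"
proof (induction k arbitrary: f)
  case 0
  then have "f differentiable_on S"
    by (intro differentiable_at_imp_differentiable_on) simp
  then show ?case by (simp add: differentiable_imp_continuous_on)
next
  case (Suc k)
  then show ?case by simp
qed

lemma smooth_on_Ck: "smooth_on S f \<Longrightarrow> Ck_on k S f"
  by (simp add: smooth_on_def)

lemma Ck_on_const: "open S \<Longrightarrow> Ck_on k S (\<lambda>x. c)"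
proof (induction k arbitrary: c)
  case (Suc k)
  show ?case by (rule Ck_on_SucI[where f' = "\<lambda>_ _. 0"]) (use Suc in auto)
qed auto

lemma Ck_on_linear_comp:
  assumes "open S" "bounded_linear L" "Ck_on k S f"
  shows "Ck_on k S (\<lambda>x. L (f x))"
  using assms(3)
proof (induction k arbitrary: f)
  case 0
  then show ?case by (auto intro: bounded_linear.continuous_on[OF assms(2)])
next
  case (Suc k)
  show ?case
  proof (rule Ck_on_SucI[OF assms(1)])
    fix x assume "x \<in> S"
    then show "((\<lambda>x. L (f x)) has_derivative (\<lambda>v. L (frechet_derivative f (at x) v))) (at x)"
      by (intro bounded_linear.has_derivative[OF assms(2)] Ck_on_SucD(1)[OF Suc.prems])
  qed (intro Suc.IH Ck_on_SucD(2)[OF Suc.prems])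
qed

lemma Ck_on_id: "open S \<Longrightarrow> Ck_on k S (\<lambda>x. x)"
proof (induction k)
  case (Suc k)
  show ?case by (rule Ck_on_SucI[where f' = "\<lambda>_ v. v"]) (use Suc Ck_on_const in auto)
qed auto

lemma Ck_on_linear: "open S \<Longrightarrow> bounded_linear L \<Longrightarrow> Ck_on k S L"
  using Ck_on_linear_comp[OF _ _ Ck_on_id] by blast

lemma Ck_on_add:
  assumes "open S" "Ck_on k S f" "Ck_on k S g"
  shows "Ck_on k S (\<lambda>x. f x + g x)"
  using assms(2,3)
proof (induction k arbitrary: f g)
  case 0
  then show ?case by (auto intro: continuous_on_add)
next
  case (Suc k)
  show ?case
  proof (rule Ck_on_SucI[OF assms(1)])
    fix x assume "x \<in> S"
    then show "((\<lambda>x. f x + g x) has_derivative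
        (\<lambda>v. frechet_derivative f (at x) v + frechet_derivative g (at x) v)) (at x)"
      by (intro has_derivative_add Ck_on_SucD(1)[OF Suc.prems(1)] Ck_on_SucD(1)[OF Suc.prems(2)])
  qed (intro Suc.IH Ck_on_SucD(2)[OF Suc.prems(1)] Ck_on_SucD(2)[OF Suc.prems(2)])
qed

lemma Ck_on_sum:
  assumes "open S" "\<And>i. i \<in> I \<Longrightarrow> Ck_on k S (f i)"
  shows "Ck_on k S (\<lambda>x. \<Sum>i\<in>I. f i x)"
  using assms(2)
  by (induction I rule: infinite_finite_induct) (auto intro: Ck_on_const Ck_on_add assms(1))

text \<open>The Leibniz rule multiplies a derivative with an undifferentiated factor, whose
  regularity is lowered by \<open>Ck_on_lower\<close> to fit the induction. The products used later
  are instances.\<close>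

lemma Ck_on_bilinear:
  assumes "open S" "bounded_bilinear p" "Ck_on k S f" "Ck_on k S g"
  shows "Ck_on k S (\<lambda>x. p (f x) (g x))"
  using assms(3,4)
proof (induction k arbitrary: f g)
  case 0
  then show ?case by (auto intro: bounded_bilinear.continuous_on[OF assms(2)])
next
  case (Suc k)
  show ?case
  proof (rule Ck_on_SucI[OF assms(1)])
    fix x assume "x \<in> S"
    then show "((\<lambda>x. p (f x) (g x)) has_derivative
        (\<lambda>v. p (f x) (frechet_derivative g (at x) v) + p (frechet_derivative f (at x) v) (g x))) (at x)"
      by (intro bounded_bilinear.FDERIV[OF assms(2)] Ck_on_SucD(1)[OF Suc.prems(1)]
          Ck_on_SucD(1)[OF Suc.prems(2)])
  next
    fix v
    show "Ck_on k S (\<lambda>x. p (f x) (frechet_derivative g (at x) v) + p (frechet_derivative f (at x) v) (g x))"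
      by (intro Ck_on_add assms(1) Suc.IH Ck_on_lower[OF Suc.prems(1)] Ck_on_lower[OF Suc.prems(2)]
          Ck_on_SucD(2)[OF Suc.prems(1)] Ck_on_SucD(2)[OF Suc.prems(2)])
  qed
qed

lemma Ck_on_scaleR:
  "open S \<Longrightarrow> Ck_on k S f \<Longrightarrow> Ck_on k S g \<Longrightarrow> Ck_on k S (\<lambda>x. f x *\<^sub>R g x)"
  by (rule Ck_on_bilinear[OF _ bounded_bilinear_scaleR])

lemma Ck_on_mult:
  fixes f g :: "'a::real_normed_vector \<Rightarrow> real"
  shows "open S \<Longrightarrow> Ck_on k S f \<Longrightarrow> Ck_on k S g \<Longrightarrow> Ck_on k S (\<lambda>x. f x * g x)"
  by (rule Ck_on_bilinear[OF _ bounded_bilinear_mult])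

lemma Ck_on_inner:
  "open S \<Longrightarrow> Ck_on k S f \<Longrightarrow> Ck_on k S g \<Longrightarrow> Ck_on k S (\<lambda>x. f x \<bullet> g x)"
  by (rule Ck_on_bilinear[OF _ bounded_bilinear_inner])

lemma Ck_on_minus: "open S \<Longrightarrow> Ck_on k S f \<Longrightarrow> Ck_on k S (\<lambda>x. - f x)"
  by (rule Ck_on_linear_comp[where L = uminus]) (auto intro: bounded_linear_minus bounded_linear_ident)

lemma Ck_on_diff:
  "open S \<Longrightarrow> Ck_on k S f \<Longrightarrow> Ck_on k S g \<Longrightarrow> Ck_on k S (\<lambda>x. f x - g x)"
  using Ck_on_add[OF _ _ Ck_on_minus, of S k f g] by simp

lemma Ck_on_inverse:
  fixes f :: "'a::real_normed_vector \<Rightarrow> real"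
  assumes "open S" "Ck_on k S f" "\<And>x. x \<in> S \<Longrightarrow> f x \<noteq> 0"
  shows "Ck_on k S (\<lambda>x. inverse (f x))"
  using assms(2)
proof (induction k)
  case 0
  then show ?case using assms(3) by (auto intro!: continuous_on_inverse)
next
  case (Suc k)
  show ?case
  proof (rule Ck_on_SucI[OF assms(1)])
    fix x assume "x \<in> S"
    then show "((\<lambda>x. inverse (f x)) has_derivative
        (\<lambda>v. - (inverse (f x) * frechet_derivative f (at x) v * inverse (f x)))) (at x)"
      by (intro Deriv.has_derivative_inverse Ck_on_SucD(1)[OF Suc.prems] assms(3))
  qed (intro Ck_on_minus Ck_on_mult assms(1) Suc.IH Ck_on_lower[OF Suc.prems] Ck_on_SucD(2)[OF Suc.prems])
qed

text \<open>The derivative of either function contains the other, so only the conjunction is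
  inductive.\<close>

lemma Ck_on_cos_sin:
  fixes f :: "'a::real_normed_vector \<Rightarrow> real"
  assumes "open S" "Ck_on k S f"
  shows "Ck_on k S (\<lambda>x. cos (f x)) \<and> Ck_on k S (\<lambda>x. sin (f x))"
  using assms(2)
proof (induction k)
  case 0
  then show ?case by (auto intro!: continuous_intros)
next
  case (Suc k)
  have 1: "Ck_on k S (\<lambda>x. cos (f x))" "Ck_on k S (\<lambda>x. sin (f x))"
    using Suc.IH Ck_on_lower[OF Suc.prems] by auto
  have "Ck_on (Suc k) S (\<lambda>x. cos (f x))"
  proof (rule Ck_on_SucI[OF assms(1)])
    fix x assume "x \<in> S"
    then show "((\<lambda>x. cos (f x)) has_derivative
        (\<lambda>v. frechet_derivative f (at x) v * - sin (f x))) (at x)"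
      using has_derivative_cos[OF Ck_on_SucD(1)[OF Suc.prems]] by simp
  qed (intro Ck_on_minus Ck_on_mult assms(1) 1 Ck_on_SucD(2)[OF Suc.prems])
  moreover have "Ck_on (Suc k) S (\<lambda>x. sin (f x))"
  proof (rule Ck_on_SucI[OF assms(1)])
    fix x assume "x \<in> S"
    then show "((\<lambda>x. sin (f x)) has_derivative
        (\<lambda>v. frechet_derivative f (at x) v * cos (f x))) (at x)"
      using has_derivative_sin[OF Ck_on_SucD(1)[OF Suc.prems]] by simp
  qed (intro Ck_on_mult assms(1) 1 Ck_on_SucD(2)[OF Suc.prems])
  ultimately show ?case by simp
qed

lemmas Ck_on_cos = Ck_on_cos_sin[THEN conjunct1]
lemmas Ck_on_sin = Ck_on_cos_sin[THEN conjunct2]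

lemma Ck_on_precomp_linear:
  assumes "open S" "bounded_linear L" "Ck_on k S f"
  shows "Ck_on k (L -` S) (\<lambda>x. f (L x))"
  using assms(3)
proof (induction k arbitrary: f)
  case 0
  have "continuous_on (L -` S) L" using assms(2) by (rule linear_continuous_on)
  then show ?case using 0 by (auto intro: continuous_on_compose2)
next
  case (Suc k)
  have o: "open (L -` S)"
    using assms(1,2) by (intro open_vimage linear_continuous_on)
  show ?case
  proof (rule Ck_on_SucI[OF o])
    fix x assume "x \<in> L -` S"
    then have "(f has_derivative frechet_derivative f (at (L x))) (at (L x))"
      by (intro Ck_on_SucD(1)[OF Suc.prems]) auto
    then show "((\<lambda>x. f (L x)) has_derivative (\<lambda>v. frechet_derivative f (at (L x)) (L v))) (at x)"
      using has_derivative_compose bounded_linear_imp_has_derivative[OF assms(2)] by blast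
  qed (rule Suc.IH, rule Ck_on_SucD(2)[OF Suc.prems])
qed

lemma bounded_linear_axis: "bounded_linear (axis i :: 'b::real_normed_vector \<Rightarrow> 'b^'i::finite)"
proof (rule bounded_linear_intro[where K = 1])
  fix x :: 'b
  have "(norm ((axis i x :: 'b^'i) $ j))\<^sup>2 = (if j = i then (norm x)\<^sup>2 else 0)" for j
    by (simp add: axis_def)
  then show "norm (axis i x :: 'b^'i) \<le> norm x * 1"
    by (simp add: norm_vec_def L2_set_def)
qed (auto simp: vec_eq_iff axis_def)

lemma Ck_on_vec_lambda:
  fixes f :: "'a::real_normed_vector \<Rightarrow> 'i::finite \<Rightarrow> 'b::real_normed_vector"
  assumes "open S" "\<And>i. Ck_on k S (\<lambda>x. f x i)"
  shows "Ck_on k S (\<lambda>x. \<chi> i. f x i)"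
proof -
  have "Ck_on k S (\<lambda>x. \<Sum>i\<in>UNIV. axis i (f x i))"
    by (intro Ck_on_sum assms Ck_on_linear_comp[where L = "axis _"] bounded_linear_axis)
  moreover have "(\<Sum>i\<in>UNIV. axis i (f x i)) = (\<chi> i. f x i)" for x
    by (simp add: vec_eq_iff axis_def if_distrib cong: if_cong)
  ultimately show ?thesis by simp
qed

section \<open>Second derivatives and their symmetry\<close>

text \<open>The second derivative, with \<open>v\<close> the direction of the second
  differentiation. Expanding \<open>w\<close> in the standard basis makes it linear in
  \<open>w\<close> by construction; linearity in \<open>v\<close> comes from its being a derivative,
  and symmetry is the theorem of Schwarz below.\<close>

definition hess :: "('a::euclidean_space \<Rightarrow> 'b::real_normed_vector) \<Rightarrow> 'a \<Rightarrow> 'a \<Rightarrow> 'a \<Rightarrow> 'b" where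
  "hess f x v w = (\<Sum>i\<in>Basis. (w \<bullet> i) *\<^sub>R
     frechet_derivative (\<lambda>z. frechet_derivative f (at z) i) (at x) v)"

lemma frechet_derivative_basis_sum:
  fixes f :: "'a::euclidean_space \<Rightarrow> 'b::real_normed_vector"
  assumes "Ck_on (Suc k) S f" "x \<in> S"
  shows "frechet_derivative f (at x) w = (\<Sum>i\<in>Basis. (w \<bullet> i) *\<^sub>R frechet_derivative f (at x) i)"
proof -
  interpret bounded_linear "frechet_derivative f (at x)"
    using Ck_on_SucD(1)[OF assms] by (rule has_derivative_bounded_linear)
  have "frechet_derivative f (at x) (\<Sum>i\<in>Basis. (w \<bullet> i) *\<^sub>R i) =
     (\<Sum>i\<in>Basis. (w \<bullet> i) *\<^sub>R frechet_derivative f (at x) i)"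
    by (simp add: sum scale)
  then show ?thesis by (simp add: euclidean_representation)
qed

lemma has_derivative_frechet_hess:
  fixes f :: "'a::euclidean_space \<Rightarrow> 'b::real_normed_vector"
  assumes "open S" "Ck_on (Suc (Suc k)) S f" "x \<in> S"
  shows "((\<lambda>z. frechet_derivative f (at z) w) has_derivative (\<lambda>v. hess f x v w)) (at x)"
proof -
  have "((\<lambda>z. \<Sum>i\<in>Basis. (w \<bullet> i) *\<^sub>R frechet_derivative f (at z) i) has_derivative (\<lambda>v. hess f x v w)) (at x)"
    unfolding hess_def
    by (intro has_derivative_sum has_derivative_scaleR_right Ck_on_SucD(1)[OF Ck_on_SucD(2)[OF assms(2)] assms(3)])
  then show ?thesis
    by (rule has_derivative_transform_within_open[OF _ assms(1,3)])
      (metis frechet_derivative_basis_sum assms(2))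
qed

lemma hess_sum_right: "hess f x v (\<Sum>i\<in>I. c i *\<^sub>R w i) = (\<Sum>i\<in>I. c i *\<^sub>R hess f x v (w i))"
proof -
  have "hess f x v (\<Sum>i\<in>I. c i *\<^sub>R w i) =
    (\<Sum>b\<in>Basis. \<Sum>i\<in>I. (c i * (w i \<bullet> b)) *\<^sub>R frechet_derivative (\<lambda>z. frechet_derivative f (at z) b) (at x) v)"
    by (simp add: hess_def inner_sum_left scaleR_sum_left)
  also have "\<dots> = (\<Sum>i\<in>I. c i *\<^sub>R hess f x v (w i))"
    by (subst sum.swap) (simp add: hess_def scaleR_sum_right)
  finally show ?thesis .
qed

text \<open>The second difference over the parallelogram spanned by \<open>t *\<^sub>R v\<close> and
  \<open>t *\<^sub>R w\<close> is evaluated by two applications of the mean value theorem, first in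
  the direction \<open>v\<close>, then in the direction \<open>w\<close>.\<close>

lemma hess_real_mvt:
  fixes f :: "'a::euclidean_space \<Rightarrow> real"
  assumes S: "open S" and C: "Ck_on (Suc (Suc 0)) S f" and t: "0 < t"
    and sub: "\<And>a b. a \<in> {0..t} \<Longrightarrow> b \<in> {0..t} \<Longrightarrow> x + a *\<^sub>R v + b *\<^sub>R w \<in> S"
  shows "\<exists>a\<in>{0..t}. \<exists>b\<in>{0..t}.
     f (x + t *\<^sub>R v + t *\<^sub>R w) - f (x + t *\<^sub>R v) - f (x + t *\<^sub>R w) + f x
      = t * t * hess f (x + a *\<^sub>R v + b *\<^sub>R w) w v"
proof -
  define k where "k = (\<lambda>s. f (x + s *\<^sub>R v + t *\<^sub>R w) - f (x + s *\<^sub>R v))"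
  define D where "D = (\<lambda>z. frechet_derivative f (at z))"
  have dk: "(k has_real_derivative (D (x + s *\<^sub>R v + t *\<^sub>R w) v - D (x + s *\<^sub>R v) v)) (at s)"
    if s: "s \<in> {0..t}" for s
  proof -
    have d: "((\<lambda>s. f (x + s *\<^sub>R v + b *\<^sub>R w)) has_real_derivative D (x + s *\<^sub>R v + b *\<^sub>R w) v) (at s)"
      if b: "b \<in> {0..t}" for b
    proof -
      have "((\<lambda>s. f (x + s *\<^sub>R v + b *\<^sub>R w)) has_derivative (\<lambda>h. D (x + s *\<^sub>R v + b *\<^sub>R w) (h *\<^sub>R v))) (at s)"
        by (rule has_derivative_compose[where f = "\<lambda>s. x + s *\<^sub>R v + b *\<^sub>R w"])
           (auto simp: D_def intro!: derivative_eq_intros Ck_on_SucD(1)[OF C] sub s b)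
      moreover have "D (x + s *\<^sub>R v + b *\<^sub>R w) (h *\<^sub>R v) = D (x + s *\<^sub>R v + b *\<^sub>R w) v * h" for h
        using linear_scale[OF has_derivative_linear[OF Ck_on_SucD(1)[OF C sub[OF s b]]]]
        by (simp add: D_def)
      ultimately show ?thesis by (simp add: has_field_derivative_def mult_commute_abs)
    qed
    from d[of t] d[of 0] t show ?thesis unfolding k_def by (auto intro!: derivative_eq_intros)
  qed
  from MVT2[OF t, of k, OF dk] obtain a where a: "0 < a" "a < t"
    "k t - k 0 = t * (D (x + a *\<^sub>R v + t *\<^sub>R w) v - D (x + a *\<^sub>R v) v)" by auto
  define m where "m = (\<lambda>s. D (x + a *\<^sub>R v + s *\<^sub>R w) v)"
  have dm: "(m has_real_derivative hess f (x + a *\<^sub>R v + s *\<^sub>R w) w v) (at s)" if s: "s \<in> {0..t}" for s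
  proof -
    let ?p = "x + a *\<^sub>R v + s *\<^sub>R w"
    have p: "?p \<in> S" using sub a s by auto
    have h: "((\<lambda>z. D z v) has_derivative (\<lambda>y. hess f ?p y v)) (at ?p)"
      unfolding D_def by (rule has_derivative_frechet_hess[OF S C p])
    have "(m has_derivative (\<lambda>h. hess f ?p (h *\<^sub>R w) v)) (at s)"
      unfolding m_def
      by (rule has_derivative_compose[where f = "\<lambda>s. x + a *\<^sub>R v + s *\<^sub>R w"])
         (auto intro!: derivative_eq_intros h)
    moreover have "hess f ?p (h *\<^sub>R w) v = hess f ?p w v * h" for h
      using linear_scale[OF has_derivative_linear[OF h]] by simp
    ultimately show ?thesis by (simp add: has_field_derivative_def mult_commute_abs)
  qed
  from MVT2[OF t, of m, OF dm] obtain b where b: "0 < b" "b < t"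
    "m t - m 0 = t * hess f (x + a *\<^sub>R v + b *\<^sub>R w) w v" by auto
  have "f (x + t *\<^sub>R v + t *\<^sub>R w) - f (x + t *\<^sub>R v) - f (x + t *\<^sub>R w) + f x = k t - k 0"
    by (simp add: k_def)
  also have "\<dots> = t * t * hess f (x + a *\<^sub>R v + b *\<^sub>R w) w v"
    using a(3) b(3) by (simp add: m_def)
  finally show ?thesis using a b by (intro bexI[of _ a] bexI[of _ b]) auto
qed

text \<open>The second difference is symmetric in the two directions, so
  \<open>hess_real_mvt\<close> equates values of the two mixed derivatives at points near
  \<open>x\<close>; continuity at \<open>x\<close> does the rest.\<close>

lemma hess_real_commute:
  fixes f :: "'a::euclidean_space \<Rightarrow> real"
  assumes S: "open S" and C: "Ck_on (Suc (Suc 0)) S f" and x: "x \<in> S"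
  shows "hess f x v w = hess f x w v"
proof -
  have cont: "isCont (\<lambda>z. hess f z v w) x" for v w
  proof -
    have "continuous_on S (\<lambda>z. hess f z v w)"
      unfolding hess_def using C
      by (intro continuous_on_sum continuous_on_scaleR continuous_on_const) simp
    then show ?thesis using S x by (simp add: continuous_on_eq_continuous_at)
  qed
  have "\<bar>hess f x v w - hess f x w v\<bar> \<le> e + e" if e: "e > 0" for e
  proof -
    obtain d1 where d1: "d1 > 0" "\<And>z. dist z x < d1 \<Longrightarrow> dist (hess f z v w) (hess f x v w) < e"
      using cont[of v w] e unfolding continuous_at_eps_delta by (auto simp: dist_commute)
    obtain d2 where d2: "d2 > 0" "\<And>z. dist z x < d2 \<Longrightarrow> dist (hess f z w v) (hess f x w v) < e"
      using cont[of w v] e unfolding continuous_at_eps_delta by (auto simp: dist_commute)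
    obtain d3 where d3: "d3 > 0" "ball x d3 \<subseteq> S" using S x open_contains_ball by blast
    define d where "d = Min {d1, d2, d3}"
    have d: "d > 0" "d \<le> d1" "d \<le> d2" "d \<le> d3" using d1 d2 d3 by (auto simp: d_def)
    \<comment> \<open>With this side length the parallelogram stays within distance \<open>d\<close>
      of \<open>x\<close>; the summand 1 keeps the denominator positive if \<open>v\<close> and
      \<open>w\<close> vanish.\<close>
    define t where "t = d / (norm v + norm w + 1)"
    have t: "t > 0" using d by (simp add: t_def add_nonneg_pos)
    have small: "dist (x + a *\<^sub>R v + b *\<^sub>R w) x < d" if "a \<in> {0..t}" "b \<in> {0..t}" for a b
    proof -
      have "dist (x + a *\<^sub>R v + b *\<^sub>R w) x = norm (a *\<^sub>R v + b *\<^sub>R w)" by (simp add: dist_norm algebra_simps)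
      also have "\<dots> \<le> a * norm v + b * norm w"
        using that by (intro order_trans[OF norm_triangle_ineq]) auto
      also have "\<dots> \<le> t * norm v + t * norm w" using that by (intro add_mono mult_right_mono) auto
      also have "\<dots> < t * (norm v + norm w + 1)" using t by (simp add: algebra_simps)
      also have "\<dots> = d" unfolding t_def using norm_ge_zero[of v] norm_ge_zero[of w]
        by (smt (verit) nonzero_eq_divide_eq)
      finally show ?thesis .
    qed
    have inS: "x + a *\<^sub>R v + b *\<^sub>R w \<in> S" if "a \<in> {0..t}" "b \<in> {0..t}" for a b
      using small[OF that] d d3 by (auto simp: dist_commute subset_iff)
    have inS': "x + a *\<^sub>R w + b *\<^sub>R v \<in> S" if "a \<in> {0..t}" "b \<in> {0..t}" for a b
      using inS[OF that(2,1)] by (simp add: algebra_simps)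
    obtain a b where ab: "a \<in> {0..t}" "b \<in> {0..t}"
       "f (x + t *\<^sub>R v + t *\<^sub>R w) - f (x + t *\<^sub>R v) - f (x + t *\<^sub>R w) + f x
      = t * t * hess f (x + a *\<^sub>R v + b *\<^sub>R w) w v"
      using hess_real_mvt[OF S C t inS] by blast
    obtain a' b' where ab': "a' \<in> {0..t}" "b' \<in> {0..t}"
       "f (x + t *\<^sub>R w + t *\<^sub>R v) - f (x + t *\<^sub>R w) - f (x + t *\<^sub>R v) + f x
      = t * t * hess f (x + a' *\<^sub>R w + b' *\<^sub>R v) v w"
      using hess_real_mvt[OF S C t inS'] by blast
    have "t * t * hess f (x + a *\<^sub>R v + b *\<^sub>R w) w v = t * t * hess f (x + a' *\<^sub>R w + b' *\<^sub>R v) v w"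
      using ab(3) ab'(3) by (simp add: algebra_simps)
    then have "hess f (x + a *\<^sub>R v + b *\<^sub>R w) w v = hess f (x + a' *\<^sub>R w + b' *\<^sub>R v) v w" using t by simp
    moreover have "x + a' *\<^sub>R w + b' *\<^sub>R v = x + b' *\<^sub>R v + a' *\<^sub>R w" by (simp add: algebra_simps)
    ultimately show ?thesis
      using d1(2)[of "x + a' *\<^sub>R w + b' *\<^sub>R v"] d2(2)[of "x + a *\<^sub>R v + b *\<^sub>R w"] small ab ab' d
      unfolding dist_real_def by (smt (verit))
  qed
  then have "\<bar>hess f x v w - hess f x w v\<bar> \<le> e" if "e > 0" for e
    using that by (metis field_sum_of_halves half_gt_zero)
  then show ?thesis using field_le_epsilon[of "\<bar>hess f x v w - hess f x w v\<bar>" 0] by simp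
qed

lemma hess_commute:
  fixes f :: "'a::euclidean_space \<Rightarrow> 'b::euclidean_space"
  assumes S: "open S" and C: "Ck_on (Suc (Suc 0)) S f" and x: "x \<in> S"
  shows "hess f x v w = hess f x w v"
proof (rule euclidean_eqI)
  fix b :: 'b
  have bl: "bounded_linear (\<lambda>y. y \<bullet> b)" by (rule bounded_linear_inner_left)
  have C': "Ck_on (Suc (Suc 0)) S (\<lambda>z. f z \<bullet> b)" by (rule Ck_on_linear_comp[OF S bl C])
  have 1: "frechet_derivative (\<lambda>z. f z \<bullet> b) (at z) u = frechet_derivative f (at z) u \<bullet> b" if "z \<in> S" for z u
    using bounded_linear.has_derivative[OF bl Ck_on_SucD(1)[OF C that]]
    by (metis frechet_derivative_at)
  have 2: "hess (\<lambda>z. f z \<bullet> b) x v w = hess f x v w \<bullet> b" for v w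
  proof -
    have "((\<lambda>z. frechet_derivative (\<lambda>z. f z \<bullet> b) (at z) w) has_derivative (\<lambda>v. hess (\<lambda>z. f z \<bullet> b) x v w)) (at x)"
      by (rule has_derivative_frechet_hess[OF S C' x])
    then have "((\<lambda>z. frechet_derivative f (at z) w \<bullet> b) has_derivative (\<lambda>v. hess (\<lambda>z. f z \<bullet> b) x v w)) (at x)"
      by (rule has_derivative_transform_within_open[OF _ S x]) (rule 1)
    moreover have "((\<lambda>z. frechet_derivative f (at z) w \<bullet> b) has_derivative (\<lambda>v. hess f x v w \<bullet> b)) (at x)"
      by (rule bounded_linear.has_derivative[OF bl has_derivative_frechet_hess[OF S C x]])
    ultimately show ?thesis using has_derivative_unique by metis
  qed
  show "hess f x v w \<bullet> b = hess f x w v \<bullet> b"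
    using hess_real_commute[OF S C' x, of v w] by (simp add: 2)
qed

section \<open>Tangent vectors and coordinates\<close>

lemma has_vector_derivative_cong_open:
  assumes "(f has_vector_derivative D) (at s within S)" "open J" "s \<in> J" "s \<in> S"
    "\<And>r. r \<in> J \<Longrightarrow> r \<in> S \<Longrightarrow> f r = g r"
  shows "(g has_vector_derivative D) (at s within S)"
proof -
  obtain e where "e > 0" "ball s e \<subseteq> J" using assms(2,3) open_contains_ball by blast
  then show ?thesis
    using assms(5)
    by (intro has_vector_derivative_transform_within[OF assms(1) _ assms(4)])
      (auto simp: dist_commute subset_iff)
qed

lemma has_vector_derivative_quotient:
  assumes "(f has_vector_derivative D) (at s within S)"
  shows "((\<lambda>r. (1 / (r - s)) *\<^sub>R (f r - f s)) \<longlongrightarrow> D) (at s within S)"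
  using assms unfolding has_vector_derivative_def has_derivative_within
  proof (elim conjE)
    assume "((\<lambda>y. (1 / norm (y - s)) *\<^sub>R (f y - (f s + (y - s) *\<^sub>R D))) \<longlongrightarrow> 0) (at s within S)"
    then have "((\<lambda>y. norm ((1 / norm (y - s)) *\<^sub>R (f y - (f s + (y - s) *\<^sub>R D)))) \<longlongrightarrow> 0) (at s within S)"
      by (rule tendsto_norm_zero)
    moreover have "\<forall>\<^sub>F y in at s within S. norm ((1 / norm (y - s)) *\<^sub>R (f y - (f s + (y - s) *\<^sub>R D)))
        = norm ((1 / (y - s)) *\<^sub>R (f y - f s) - D)"
    proof -
      have "norm ((1 / norm (y - s)) *\<^sub>R (f y - (f s + (y - s) *\<^sub>R D)))
        = norm ((1 / (y - s)) *\<^sub>R (f y - f s) - D)" if "y \<noteq> s" for y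
      proof -
        have "(1 / (y - s)) *\<^sub>R (f y - f s) - D = (1 / (y - s)) *\<^sub>R (f y - (f s + (y - s) *\<^sub>R D))"
          using that by (simp add: diff_diff_eq[symmetric] scaleR_diff_right)
        then show ?thesis by simp
      qed
      then show ?thesis by (simp add: eventually_at_filter)
    qed
    ultimately have "((\<lambda>y. norm ((1 / (y - s)) *\<^sub>R (f y - f s) - D)) \<longlongrightarrow> 0) (at s within S)"
      by (rule Lim_transform_eventually)
    then show ?thesis by (rule LIM_zero_cancel[OF tendsto_norm_zero_cancel])
  qed

text \<open>The difference quotients stay in the subspace, which is closed. This keeps the
  coordinate velocity and acceleration of a curve inside \<open>span B\<close>.\<close>

lemma has_vector_derivative_in_subspace:
  fixes f :: "real \<Rightarrow> 'a::euclidean_space"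
  assumes "(f has_vector_derivative D) (at s within S)" "open J" "s \<in> J" "s \<in> S"
    "\<And>r. r \<in> J \<Longrightarrow> r \<in> S \<Longrightarrow> f r \<in> V" "subspace V" "at s within S \<noteq> bot"
  shows "D \<in> V"
proof (rule Lim_in_closed_set[OF closed_subspace[OF assms(6)] _ assms(7)])
  show "((\<lambda>r. (1 / (r - s)) *\<^sub>R (f r - f s)) \<longlongrightarrow> D) (at s within S)"
    using assms(1) by (rule has_vector_derivative_quotient)
  have "\<forall>\<^sub>F r in at s within S. r \<in> J" using assms(2,3) by (auto simp: eventually_at_topological)
  moreover have "\<forall>\<^sub>F r in at s within S. r \<in> S" by (simp add: eventually_at_filter)
  ultimately show "\<forall>\<^sub>F r in at s within S. (1 / (r - s)) *\<^sub>R (f r - f s) \<in> V"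
    by eventually_elim (intro subspace_scale subspace_diff assms)
qed

lemma bounded_linear_frechet_derivative:
  "Ck_on (Suc k) S f \<Longrightarrow> x \<in> S \<Longrightarrow> bounded_linear (frechet_derivative f (at x))"
  by (rule has_derivative_bounded_linear[OF Ck_on_SucD(1)])

lemma has_vector_derivative_along_line:
  assumes "(f has_derivative f') (at u)"
  shows "((\<lambda>s. f (u + s *\<^sub>R h)) has_vector_derivative f' h) (at 0)"
proof -
  have "((\<lambda>s. f (u + s *\<^sub>R h)) has_derivative (\<lambda>s. f' (s *\<^sub>R h))) (at 0)"
    by (rule has_derivative_compose[where f = "\<lambda>s. u + s *\<^sub>R h"])
       (auto intro!: derivative_eq_intros simp: assms)
  then show ?thesis
    using linear_scale[OF has_derivative_linear[OF assms]] by (simp add: has_vector_derivative_def)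
qed

lemma eventually_line_in:
  fixes u h :: "'a::real_normed_vector"
  assumes "open U" "u \<in> U"
  shows "\<forall>\<^sub>F s in nhds (0::real). u + s *\<^sub>R h \<in> U"
proof -
  have "((\<lambda>s. u + s *\<^sub>R h) \<longlongrightarrow> u + 0 *\<^sub>R h) (nhds 0)" by (intro tendsto_intros filterlim_ident)
  then show ?thesis using assms topological_tendstoD by fastforce
qed

text \<open>Velocities at time 0 of curves that may be arbitrary elsewhere. No chart is involved, so
  maps between submanifolds act on tangent vectors at once (\<open>tangent_image\<close>); the link
  to charts is \<open>tangent_local_param\<close>.\<close>

definition tangent :: "'a::real_normed_vector set \<Rightarrow> 'a \<Rightarrow> 'a set" where
  "tangent N p = {v. \<exists>\<gamma>. (\<forall>\<^sub>F s in nhds (0::real). \<gamma> s \<in> N) \<and> \<gamma> 0 = p \<and>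
     (\<gamma> has_vector_derivative v) (at 0)}"

lemma tangentI:
  "\<lbrakk>\<forall>\<^sub>F s in nhds (0::real). \<gamma> s \<in> N; \<gamma> 0 = p; (\<gamma> has_vector_derivative v) (at 0)\<rbrakk> \<Longrightarrow> v \<in> tangent N p"
  by (auto simp: tangent_def)

lemma tangent_image:
  assumes "v \<in> tangent N p" "(F has_derivative F') (at p)" "\<And>q. q \<in> N \<Longrightarrow> F q \<in> N'"
  shows "F' v \<in> tangent N' (F p)"
proof -
  obtain \<gamma> where g: "\<forall>\<^sub>F s in nhds (0::real). \<gamma> s \<in> N" "\<gamma> 0 = p" "(\<gamma> has_vector_derivative v) (at 0)"
    using assms(1) by (auto simp: tangent_def)
  show ?thesis
  proof (rule tangentI[where \<gamma> = "\<lambda>s. F (\<gamma> s)"])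
    show "\<forall>\<^sub>F s in nhds (0::real). F (\<gamma> s) \<in> N'"
      using g(1) by eventually_elim (rule assms(3))
    show "((\<lambda>s. F (\<gamma> s)) has_vector_derivative F' v) (at 0)"
      using vector_derivative_diff_chain_within[of \<gamma> v 0 UNIV F F'] g assms(2)
        has_derivative_at_withinI by (auto simp: o_def)
  qed (simp add: g)
qed

lemma local_param_range: "local_param N B U \<phi> \<Longrightarrow> u \<in> U \<inter> span B \<Longrightarrow> \<phi> u \<in> N"
  unfolding local_param_def openin_open by blast

text \<open>The continuous inverse of a parametrisation is Lipschitz along a differentiable curve in the
  submanifold, because the derivative of the parametrisation is injective; hence the difference
  quotients of the curve approach the closed subspace on the right.\<close>
lemma tangent_local_param:
  fixes N :: "'a::euclidean_space set"
  assumes lp: "local_param N B U \<phi>" and u0: "u0 \<in> U \<inter> span B"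
  shows "tangent N (\<phi> u0) = frechet_derivative \<phi> (at u0) ` span B"
proof
  have oU: "open U" and sm: "smooth_on U \<phi>"
    and op: "openin (top_of_set N) (\<phi> ` (U \<inter> span B))"
    and inj: "inj_on (frechet_derivative \<phi> (at u0)) (span B)"
    using lp u0 by (auto simp: local_param_def)
  define L where "L = frechet_derivative \<phi> (at u0)"
  have der: "(\<phi> has_derivative L) (at u0)"
    unfolding L_def using Ck_on_SucD(1)[OF smooth_on_Ck[OF sm]] u0 by blast
  have bl: "bounded_linear L" using der by (rule has_derivative_bounded_linear)
  show "frechet_derivative \<phi> (at u0) ` span B \<subseteq> tangent N (\<phi> u0)"
  proof
    fix v assume "v \<in> frechet_derivative \<phi> (at u0) ` span B"
    then obtain h where h: "h \<in> span B" "v = L h" by (auto simp: L_def)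
    show "v \<in> tangent N (\<phi> u0)"
    proof (rule tangentI[where \<gamma> = "\<lambda>s. \<phi> (u0 + s *\<^sub>R h)"])
      have "\<forall>\<^sub>F s in nhds (0::real). u0 + s *\<^sub>R h \<in> U" using eventually_line_in[OF oU] u0 by blast
      then show "\<forall>\<^sub>F s in nhds (0::real). \<phi> (u0 + s *\<^sub>R h) \<in> N"
        by eventually_elim (use local_param_range[OF lp] u0 h in \<open>auto intro: span_add span_scale\<close>)
    qed (use has_vector_derivative_along_line[OF der] h in auto)
  qed
  show "tangent N (\<phi> u0) \<subseteq> frechet_derivative \<phi> (at u0) ` span B"
  proof
    fix v assume "v \<in> tangent N (\<phi> u0)"
    then obtain \<gamma> where g: "\<forall>\<^sub>F s in nhds (0::real). \<gamma> s \<in> N" "\<gamma> 0 = \<phi> u0"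
      "(\<gamma> has_vector_derivative v) (at 0)" by (auto simp: tangent_def)
    obtain \<psi> where hom: "homeomorphism (U \<inter> span B) (\<phi> ` (U \<inter> span B)) \<phi> \<psi>"
      using lp by (auto simp: local_param_def)
    obtain W where W: "open W" "\<phi> ` (U \<inter> span B) = N \<inter> W" using op by (auto simp: openin_open)
    have cg: "isCont \<gamma> 0" using has_vector_derivative_continuous[OF g(3)] .
    then have "\<forall>\<^sub>F s in nhds (0::real). \<gamma> s \<in> W"
      using W u0 g(2) unfolding continuous_at_open eventually_nhds by (metis IntE image_eqI)
    with g(1) have ev: "\<forall>\<^sub>F s in nhds (0::real). \<gamma> s \<in> \<phi> ` (U \<inter> span B)"
      by eventually_elim (simp add: W)
    \<comment> \<open>\<open>u0\<close> is a default value that keeps \<open>u s\<close> in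
      \<open>span B\<close> for every \<open>s\<close>; what matters is \<open>s\<close> near 0,
      where \<open>\<phi> (u s) = \<gamma> s\<close>.\<close>
    define u where "u = (\<lambda>s. if \<gamma> s \<in> \<phi> ` (U \<inter> span B) then \<psi> (\<gamma> s) else u0)"
    have u_in: "u s \<in> span B" for s
      using hom u0 by (auto simp: u_def homeomorphism_def)
    have u_eq: "\<forall>\<^sub>F s in nhds (0::real). \<phi> (u s) = \<gamma> s"
      using ev by eventually_elim (use hom in \<open>auto simp: u_def homeomorphism_def\<close>)
    have ct: "(u \<longlongrightarrow> u0) (at 0)"
    proof -
      have c: "continuous_on (\<phi> ` (U \<inter> span B)) \<psi>" using hom by (simp add: homeomorphism_def)
      have "((\<lambda>s. \<psi> (\<gamma> s)) \<longlongrightarrow> \<psi> (\<phi> u0)) (at 0)"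
        by (rule continuous_on_tendsto_compose[OF c])
          (use cg g(2) u0 ev in \<open>auto simp: isCont_def eventually_at_filter elim: eventually_mono\<close>)
      then have "((\<lambda>s. \<psi> (\<gamma> s)) \<longlongrightarrow> u0) (at 0)" using hom u0 by (simp add: homeomorphism_def)
      then show ?thesis
        by (rule Lim_transform_eventually)
          (use ev in \<open>auto simp: u_def eventually_at_filter elim: eventually_mono\<close>)
    qed
    obtain m where m: "m > 0" "\<And>h. h \<in> span B \<Longrightarrow> m * norm h \<le> norm (L h)"
    proof -
      have "\<forall>x\<in>span B. L x = 0 \<longrightarrow> x = 0"
        using inj linear_0[OF bounded_linear.linear[OF bl]]
        unfolding L_def inj_on_def by (metis span_zero)
      then show ?thesis
        using injective_imp_isometric[OF closed_span subspace_span bl] that by blast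
    qed
    have ev': "\<forall>\<^sub>F s in at 0. \<phi> (u s) = \<gamma> s" using u_eq by (simp add: eventually_at_filter eventually_mono)
    have small: "\<forall>\<^sub>F s in at 0. norm (\<gamma> s - \<gamma> 0 - L (u s - u0)) \<le> e * norm (u s - u0)" if e: "e > 0" for e
    proof -
      obtain d where d: "d > 0" "\<And>y. norm (y - u0) < d \<Longrightarrow> norm (\<phi> y - \<phi> u0 - L (y - u0)) \<le> e * norm (y - u0)"
        using der e unfolding has_derivative_at_alt by metis
      have "\<forall>\<^sub>F s in at 0. dist (u s) u0 < d" using ct d(1) by (rule tendstoD)
      with ev' show ?thesis
      proof eventually_elim
        case (elim s)
        then show ?case using d(2)[of "u s"] g(2) by (simp add: dist_norm)
      qed
    qed
    have lip: "\<forall>\<^sub>F s in at 0. norm (u s - u0) \<le> (2 / m) * norm (\<gamma> s - \<gamma> 0)"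
      using small[OF half_gt_zero[OF m(1)]]
    proof eventually_elim
      case (elim s)
      have "m * norm (u s - u0) \<le> norm (L (u s - u0))" using m(2) u_in u0 by (simp add: span_diff)
      also have "\<dots> \<le> norm (\<gamma> s - \<gamma> 0) + norm (\<gamma> s - \<gamma> 0 - L (u s - u0))"
        using norm_triangle_ineq4[of "\<gamma> s - \<gamma> 0" "\<gamma> s - \<gamma> 0 - L (u s - u0)"] by simp
      also have "\<dots> \<le> norm (\<gamma> s - \<gamma> 0) + m / 2 * norm (u s - u0)" using elim by simp
      finally show ?case using m(1) by (simp add: field_simps)
    qed
    have quot: "((\<lambda>s. (1 / s) *\<^sub>R (\<gamma> s - \<gamma> 0)) \<longlongrightarrow> v) (at 0)"
      using has_vector_derivative_quotient[OF g(3)] by simp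
    have diff0: "((\<lambda>s. (1 / s) *\<^sub>R (\<gamma> s - \<gamma> 0) - (1 / s) *\<^sub>R L (u s - u0)) \<longlongrightarrow> 0) (at 0)"
    proof (rule tendstoI)
      fix e :: real assume e: "e > 0"
      define c where "c = (2 / m) * (norm v + 1)"
      have c: "c > 0" using m(1) by (simp add: c_def add_nonneg_pos)
      have ec: "e / (2 * c) > 0" using e c by simp
      have q1: "\<forall>\<^sub>F s in at 0. norm ((1 / s) *\<^sub>R (\<gamma> s - \<gamma> 0)) < norm v + 1"
        using tendsto_norm[OF quot] by (rule order_tendstoD) simp
      show "\<forall>\<^sub>F s in at 0. dist ((1 / s) *\<^sub>R (\<gamma> s - \<gamma> 0) - (1 / s) *\<^sub>R L (u s - u0)) 0 < e"
        using small[OF ec] lip q1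
      proof eventually_elim
        case (elim s)
        have "norm ((1 / s) *\<^sub>R (\<gamma> s - \<gamma> 0) - (1 / s) *\<^sub>R L (u s - u0)) =
            (1 / \<bar>s\<bar>) * norm (\<gamma> s - \<gamma> 0 - L (u s - u0))"
          by (simp flip: scaleR_diff_right)
        also have "\<dots> \<le> (1 / \<bar>s\<bar>) * (e / (2 * c) * ((2 / m) * norm (\<gamma> s - \<gamma> 0)))"
        proof (rule mult_left_mono)
          have "e / (2 * c) * norm (u s - u0) \<le> e / (2 * c) * ((2 / m) * norm (\<gamma> s - \<gamma> 0))"
            using elim(2) e c by (intro mult_left_mono) auto
          then show "norm (\<gamma> s - \<gamma> 0 - L (u s - u0)) \<le> e / (2 * c) * ((2 / m) * norm (\<gamma> s - \<gamma> 0))"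
            using elim(1) by linarith
        qed simp
        also have "\<dots> = e / (2 * c) * ((2 / m) * norm ((1 / s) *\<^sub>R (\<gamma> s - \<gamma> 0)))" by simp
        also have "\<dots> \<le> e / (2 * c) * ((2 / m) * (norm v + 1))"
          using elim(3) e c m(1) by (intro mult_left_mono) auto
        also have "\<dots> = e / (2 * c) * c" by (simp add: c_def)
        also have "\<dots> < e" using e c by simp
        finally show ?case by simp
      qed
    qed
    have "((\<lambda>s. (1 / s) *\<^sub>R (\<gamma> s - \<gamma> 0) - ((1 / s) *\<^sub>R (\<gamma> s - \<gamma> 0) - (1 / s) *\<^sub>R L (u s - u0)))
        \<longlongrightarrow> v - 0) (at 0)"
      by (rule tendsto_diff[OF quot diff0])
    then have lim: "((\<lambda>s. (1 / s) *\<^sub>R L (u s - u0)) \<longlongrightarrow> v) (at 0)" by simp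
    have sub: "subspace (L ` span B)"
      by (rule linear_subspace_image[OF bounded_linear.linear[OF bl] subspace_span])
    have "v \<in> L ` span B"
    proof (rule Lim_in_closed_set[OF closed_subspace[OF sub] _ _ lim])
      show "\<forall>\<^sub>F s in at 0. (1 / s) *\<^sub>R L (u s - u0) \<in> L ` span B"
        using u_in u0 by (intro always_eventually allI subspace_scale[OF sub] imageI) (simp add: span_diff)
    qed simp
    then show "v \<in> frechet_derivative \<phi> (at u0) ` span B" by (simp add: L_def)
  qed
qed

lemma tangent_prod_UNIV:
  fixes M :: "'a::euclidean_space set" and t :: real
  shows "(v, \<tau>) \<in> tangent (M \<times> UNIV) (x, t) \<longleftrightarrow> v \<in> tangent M x"
proof
  assume "(v, \<tau>) \<in> tangent (M \<times> UNIV) (x, t)"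
  from tangent_image[OF this bounded_linear_imp_has_derivative[OF bounded_linear_fst], of M]
  show "v \<in> tangent M x" by auto
next
  assume "v \<in> tangent M x"
  then obtain \<gamma> where g: "\<forall>\<^sub>F s in nhds (0::real). \<gamma> s \<in> M" "\<gamma> 0 = x"
    "(\<gamma> has_vector_derivative v) (at 0)" by (auto simp: tangent_def)
  show "(v, \<tau>) \<in> tangent (M \<times> UNIV) (x, t)"
    by (rule tangentI[where \<gamma> = "\<lambda>s. (\<gamma> s, t + s * \<tau>)"])
       (use g in \<open>auto intro!: derivative_eq_intros has_vector_derivative_Pair\<close>)
qed

text \<open>Used in both directions: with an inverse chart, to give a curve in the manifold
  coordinates with two derivatives, and with a parametrisation, to express the acceleration of the
  curve through them.\<close>

lemma chain_second_derivative:
  fixes g :: "'a::euclidean_space \<Rightarrow> 'b::euclidean_space"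
  assumes W: "open W" "Ck_on (Suc (Suc 0)) W g" and J: "open J" "s \<in> J" "s \<in> S"
    and y: "\<And>r. r \<in> J \<Longrightarrow> r \<in> S \<Longrightarrow> y r \<in> W"
      "\<And>r. r \<in> J \<Longrightarrow> r \<in> S \<Longrightarrow> (y has_vector_derivative y1 r) (at r within S)"
      "(y1 has_vector_derivative y2) (at s within S)"
  shows "\<And>r. r \<in> J \<Longrightarrow> r \<in> S \<Longrightarrow>
      ((\<lambda>r. g (y r)) has_vector_derivative frechet_derivative g (at (y r)) (y1 r)) (at r within S)"
    and "((\<lambda>r. frechet_derivative g (at (y r)) (y1 r)) has_vector_derivative
        frechet_derivative g (at (y s)) y2 + hess g (y s) (y1 s) (y1 s)) (at s within S)"
proof -
  show "((\<lambda>r. g (y r)) has_vector_derivative frechet_derivative g (at (y r)) (y1 r)) (at r within S)"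
    if r: "r \<in> J" "r \<in> S" for r
    using vector_derivative_diff_chain_within[OF y(2)[OF r]
        has_derivative_at_withinI[OF Ck_on_SucD(1)[OF W(2) y(1)[OF r]]]] by (simp add: o_def)
  have b: "((\<lambda>r. frechet_derivative g (at (y r)) b) has_vector_derivative
      frechet_derivative (\<lambda>z. frechet_derivative g (at z) b) (at (y s)) (y1 s)) (at s within S)" for b
    using vector_derivative_diff_chain_within[OF y(2)[OF J(2,3)]
        has_derivative_at_withinI[OF Ck_on_SucD(1)[OF Ck_on_SucD(2)[OF W(2)] y(1)[OF J(2,3)]]]]
    by (simp add: o_def)
  have "((\<lambda>r. \<Sum>i\<in>Basis. (y1 r \<bullet> i) *\<^sub>R frechet_derivative g (at (y r)) i) has_vector_derivative
     (\<Sum>i\<in>Basis. (y1 s \<bullet> i) *\<^sub>R frechet_derivative (\<lambda>z. frechet_derivative g (at z) i) (at (y s)) (y1 s)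
        + (y2 \<bullet> i) *\<^sub>R frechet_derivative g (at (y s)) i)) (at s within S)"
    by (intro has_vector_derivative_sum has_vector_derivative_scaleR b)
       (use bounded_linear.has_vector_derivative[OF bounded_linear_inner_left y(3)] in
         \<open>simp add: has_real_derivative_iff_has_vector_derivative\<close>)
  then have "((\<lambda>r. \<Sum>i\<in>Basis. (y1 r \<bullet> i) *\<^sub>R frechet_derivative g (at (y r)) i) has_vector_derivative
     frechet_derivative g (at (y s)) y2 + hess g (y s) (y1 s) (y1 s)) (at s within S)"
    unfolding frechet_derivative_basis_sum[OF W(2) y(1)[OF J(2,3)], of y2]
    by (simp add: hess_def sum.distrib add.commute)
  then show "((\<lambda>r. frechet_derivative g (at (y r)) (y1 r)) has_vector_derivative
        frechet_derivative g (at (y s)) y2 + hess g (y s) (y1 s) (y1 s)) (at s within S)"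
    by (rule has_vector_derivative_cong_open[OF _ J]) (metis frechet_derivative_basis_sum[OF W(2)] y(1))
qed

lemma bounded_linear_hess:
  "open S \<Longrightarrow> Ck_on (Suc (Suc k)) S f \<Longrightarrow> x \<in> S \<Longrightarrow> bounded_linear (\<lambda>v. hess f x v w)"
  by (rule has_derivative_bounded_linear[OF has_derivative_frechet_hess])

lemma span_subset_Basis_expand:
  fixes B :: "'a::euclidean_space set"
  assumes "B \<subseteq> Basis" "x \<in> span B"
  shows "(\<Sum>k\<in>B. (x \<bullet> k) *\<^sub>R k) = x"
proof -
  have "x \<bullet> k = 0" if "k \<in> Basis - B" for k
    using assms(2)
  proof (induction rule: span_induct_alt)
    case (step c b y)
    then show ?case using that assms(1) by (auto simp: inner_add_left inner_Basis subset_iff)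
  qed simp
  then have "(\<Sum>k\<in>B. (x \<bullet> k) *\<^sub>R k) = (\<Sum>k\<in>Basis. (x \<bullet> k) *\<^sub>R k)"
    using assms(1) by (intro sum.mono_neutral_left) auto
  then show ?thesis by (simp add: euclidean_representation)
qed

section \<open>Geodesics and Killing fields of an induced metric\<close>

text \<open>If \<open>g\<close> is in the parametrisation \<open>\<phi>\<close> the pull-back of a constant bilinear form \<open>p\<close> under a
  map \<open>f\<close>, then the Christoffel symbols are given by the Hessian of \<open>f\<close> (Gauss formula), and
  the geodesic equation says that the second derivative of \<open>f \<circ> u\<close> is \<open>p\<close>-normal.\<close>

locale pulled_back_metric =
  fixes g :: "'a::euclidean_space metric" and B :: "'a set" and U :: "'a set" and \<phi> :: "'a \<Rightarrow> 'a"
    and p :: "'b::euclidean_space \<Rightarrow> 'b \<Rightarrow> real" and f :: "'a \<Rightarrow> 'b"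
  assumes BB: "B \<subseteq> Basis" and oU: "open U" and Cf: "Ck_on (Suc (Suc 0)) U f"
    and bil: "bounded_bilinear p" and sym: "p x y = p y x"
    and coeff: "\<lbrakk>u \<in> U \<inter> span B; i \<in> B; j \<in> B\<rbrakk> \<Longrightarrow>
      metric_coeff g \<phi> i j u = p (frechet_derivative f (at u) i) (frechet_derivative f (at u) j)"
begin

lemma bl_p: "bounded_linear (\<lambda>x. p x y)"
  using bil by (rule bounded_bilinear.bounded_linear_left)

lemma finB: "finite B" using BB finite_Basis by (rule finite_subset)

lemma partial_metric_coeff:
  assumes u: "u \<in> U \<inter> span B" and ijk: "i \<in> B" "j \<in> B" "k \<in> B"
  shows "partial (metric_coeff g \<phi> i j) k u =
     p (hess f u k i) (frechet_derivative f (at u) j) + p (frechet_derivative f (at u) i) (hess f u k j)"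
proof -
  have d: "((\<lambda>s. frechet_derivative f (at (u + s *\<^sub>R k)) w) has_vector_derivative hess f u k w) (at 0)" for w
    by (rule has_vector_derivative_along_line[OF has_derivative_frechet_hess[OF oU Cf]]) (use u in auto)
  have 1: "((\<lambda>s. p (frechet_derivative f (at (u + s *\<^sub>R k)) i) (frechet_derivative f (at (u + s *\<^sub>R k)) j))
     has_vector_derivative p (frechet_derivative f (at u) i) (hess f u k j)
       + p (hess f u k i) (frechet_derivative f (at u) j)) (at 0)"
    using bounded_bilinear.has_vector_derivative[OF bil d[of i] d[of j]] by simp
  obtain J where J: "open J" "0 \<in> J" "\<And>s. s \<in> J \<Longrightarrow> u + s *\<^sub>R k \<in> U"
    using eventually_line_in[OF oU, of u k] u unfolding eventually_nhds by auto
  have "((\<lambda>s. metric_coeff g \<phi> i j (u + s *\<^sub>R k)) has_vector_derivative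
      p (frechet_derivative f (at u) i) (hess f u k j) + p (hess f u k i) (frechet_derivative f (at u) j)) (at 0)"
    by (rule has_vector_derivative_cong_open[OF 1 J(1,2)])
       (use J u ijk in \<open>auto simp: coeff span_add span_scale span_base\<close>)
  then show ?thesis unfolding partial_def by (simp add: vector_derivative_at add.commute)
qed

text \<open>Each of the three derivatives contributes two Hessian terms; by the symmetry of the
  Hessian four of the six cancel in pairs and the other two are equal.\<close>

lemma christoffel_first_eq:
  assumes u: "u \<in> U \<inter> span B" and ij: "l \<in> B" "i \<in> B" "j \<in> B"
  shows "christoffel_first g \<phi> l i j u = p (hess f u i j) (frechet_derivative f (at u) l)"
proof -
  have uU: "u \<in> U" using u by simp
  note c = hess_commute[OF oU Cf uU]
  show ?thesis
    unfolding christoffel_first_def partial_metric_coeff[OF u ij(3,1,2)]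
      partial_metric_coeff[OF u ij(2,1,3)] partial_metric_coeff[OF u ij(2,3,1)]
    using c[of l i] c[of l j] c[of i j] by (simp add: sym)
qed

text \<open>An indefinite \<open>p\<close> may degenerate on the image of an injective derivative,
  so this is a condition of its own.\<close>

definition nondegenerate_at :: "'a \<Rightarrow> bool" where
  "nondegenerate_at u \<longleftrightarrow> (\<forall>h\<in>span B. (\<forall>l\<in>B. p (frechet_derivative f (at u) h) (frechet_derivative f (at u) l) = 0) \<longrightarrow> h = 0)"

lemma lin_df: "u \<in> U \<Longrightarrow> linear (frechet_derivative f (at u))"
  using bounded_linear_frechet_derivative[OF Cf] bounded_linear.linear by blast

lemma sum_coeff:
  assumes u: "u \<in> U \<inter> span B" and l: "l \<in> B" and G: "G \<in> span B"
  shows "(\<Sum>k\<in>B. metric_coeff g \<phi> l k u * (G \<bullet> k)) =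
     p (frechet_derivative f (at u) G) (frechet_derivative f (at u) l)"
proof -
  have uU: "u \<in> U" using u by simp
  let ?D = "frechet_derivative f (at u)"
  have "?D G = ?D (\<Sum>k\<in>B. (G \<bullet> k) *\<^sub>R k)" using span_subset_Basis_expand[OF BB G] by simp
  also have "\<dots> = (\<Sum>k\<in>B. (G \<bullet> k) *\<^sub>R ?D k)"
    by (simp add: linear_sum[OF lin_df[OF uU]] linear_scale[OF lin_df[OF uU]])
  finally have "p (?D G) (?D l) = (\<Sum>k\<in>B. p ((G \<bullet> k) *\<^sub>R ?D k) (?D l))"
    by (simp add: linear_sum[OF bounded_linear.linear[OF bl_p]])
  also have "\<dots> = (\<Sum>k\<in>B. metric_coeff g \<phi> l k u * (G \<bullet> k))"
    by (intro sum.cong refl)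
      (simp add: linear_scale[OF bounded_linear.linear[OF bl_p]] coeff[OF u l] sym[of "?D l"])
  finally show ?thesis by simp
qed

text \<open>The definite description in \<open>christoffel\<close> is meaningful because the Gram
  matrix of the coordinate fields is invertible. What it denotes is the tangential part of the
  Hessian.\<close>

lemma christoffel_eq:
  assumes u: "u \<in> U \<inter> span B" and nd: "nondegenerate_at u" and ij: "i \<in> B" "j \<in> B"
  shows "christoffel g B \<phi> i j u \<in> span B \<and>
    (\<forall>l\<in>B. p (frechet_derivative f (at u) (christoffel g B \<phi> i j u)) (frechet_derivative f (at u) l)
       = p (hess f u i j) (frechet_derivative f (at u) l))"
proof -
  have uU: "u \<in> U" using u by simp
  let ?D = "frechet_derivative f (at u)"
  \<comment> \<open>The Gram matrix as an endomorphism of \<open>span B\<close>; injective by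
    nondegeneracy, hence onto.\<close>
  define T where "T = (\<lambda>G. \<Sum>l\<in>B. p (?D G) (?D l) *\<^sub>R l)"
  have pl: "linear (\<lambda>G. p (?D G) (?D l))" for l
    using linear_compose[OF lin_df[OF uU] bounded_linear.linear[OF bl_p]] by (simp add: o_def)
  have linT: "linear T"
    by (rule linearI) (simp_all add: T_def linear_add[OF pl] linear_scale[OF pl] scaleR_add_left
        sum.distrib scaleR_sum_right)
  have comp: "T G \<bullet> l = p (?D G) (?D l)" if "l \<in> B" for G l
  proof -
    have "T G \<bullet> l = (\<Sum>k\<in>B. if k = l then p (?D G) (?D k) else 0)"
      unfolding T_def inner_sum_left using BB that
      by (intro sum.cong) (auto simp: inner_Basis subset_iff)
    then show ?thesis using that finB by simp
  qed
  have injT: "inj_on T (span B)"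
  proof (rule inj_onI)
    fix x y assume xy: "x \<in> span B" "y \<in> span B" "T x = T y"
    then have "T (x - y) = 0" using linear_diff[OF linT] by simp
    then have "\<forall>l\<in>B. p (?D (x - y)) (?D l) = 0" using comp by (metis inner_zero_left)
    then show "x = y" using nd xy by (auto simp: nondegenerate_at_def span_diff)
  qed
  have sub: "T ` span B \<subseteq> span B"
    unfolding T_def by (auto intro: span_sum span_scale span_base)
  have Tsp: "T ` span B = span B"
    by (rule subspace_dim_equal)
       (use sub linear_subspace_image[OF linT subspace_span] dim_image_eq[OF linT, of "span B"] injT in
         \<open>auto simp: span_span\<close>)
  define c where "c = (\<Sum>l\<in>B. p (hess f u i j) (?D l) *\<^sub>R l)"
  have "c \<in> span B" unfolding c_def by (auto intro: span_sum span_scale span_base)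
  then have "c \<in> T ` span B" unfolding Tsp .
  then obtain G where G: "G \<in> span B" "T G = c" by blast
  have cl: "c \<bullet> l = p (hess f u i j) (?D l)" if "l \<in> B" for l
  proof -
    have "c \<bullet> l = (\<Sum>k\<in>B. if k = l then p (hess f u i j) (?D k) else 0)"
      unfolding c_def inner_sum_left using BB that
      by (intro sum.cong) (auto simp: inner_Basis subset_iff)
    then show ?thesis using that finB by simp
  qed
  let ?P = "\<lambda>G. G \<in> span B \<and>
        (\<forall>l\<in>B. (\<Sum>k\<in>B. metric_coeff g \<phi> l k u * (G \<bullet> k)) = christoffel_first g \<phi> l i j u)"
  have P: "?P H \<longleftrightarrow> H \<in> span B \<and> (\<forall>l\<in>B. p (?D H) (?D l) = p (hess f u i j) (?D l))" for H
    using sum_coeff[OF u] christoffel_first_eq[OF u _ ij] by auto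
  have "p (?D G) (?D l) = p (hess f u i j) (?D l)" if "l \<in> B" for l
    using comp[OF that, of G] cl[OF that] G(2) by simp
  then have PG: "?P G" unfolding P using G(1) by blast
  have "H = G" if "?P H" for H
  proof -
    have "H \<in> span B" "\<forall>l\<in>B. p (?D H) (?D l) = p (?D G) (?D l)"
      using that PG unfolding P by simp_all
    then have "\<forall>l\<in>B. p (?D (H - G)) (?D l) = 0"
      using linear_diff[OF pl] by simp
    then show ?thesis using nd \<open>H \<in> span B\<close> G(1) by (auto simp: nondegenerate_at_def span_diff)
  qed
  then have "christoffel g B \<phi> i j u = G" unfolding christoffel_def by (rule the_equality[where P = ?P, OF PG])
  then show ?thesis using PG unfolding P by simp
qed

text \<open>By nondegeneracy, pairing the left-hand side with the coordinate fields loses nothing,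
  and the pairing turns each Christoffel symbol into a Hessian.\<close>

lemma geodesic_equation_iff:
  assumes u: "u \<in> U \<inter> span B" and nd: "nondegenerate_at u" and a: "a \<in> span B" and w: "w \<in> span B"
  shows "a + (\<Sum>i\<in>B. \<Sum>j\<in>B. ((w \<bullet> i) * (w \<bullet> j)) *\<^sub>R christoffel g B \<phi> i j u) = 0 \<longleftrightarrow>
    (\<forall>l\<in>B. p (frechet_derivative f (at u) a + hess f u w w) (frechet_derivative f (at u) l) = 0)"
proof -
  have uU: "u \<in> U" using u by simp
  let ?D = "frechet_derivative f (at u)"
  let ?G = "\<lambda>i j. christoffel g B \<phi> i j u"
  define X where "X = a + (\<Sum>i\<in>B. \<Sum>j\<in>B. ((w \<bullet> i) * (w \<bullet> j)) *\<^sub>R ?G i j)"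
  note G = christoffel_eq[OF u nd]
  have Xs: "X \<in> span B" unfolding X_def using a G by (auto intro!: span_add span_sum span_scale)
  have hw: "hess f u w w = (\<Sum>i\<in>B. \<Sum>j\<in>B. ((w \<bullet> i) * (w \<bullet> j)) *\<^sub>R hess f u i j)"
  proof -
    have l: "linear (\<lambda>v. hess f u v k)" for k
      using bounded_linear.linear[OF bounded_linear_hess[OF oU Cf uU]] .
    have "hess f u w w = hess f u (\<Sum>i\<in>B. (w \<bullet> i) *\<^sub>R i) (\<Sum>j\<in>B. (w \<bullet> j) *\<^sub>R j)"
      using span_subset_Basis_expand[OF BB w] by simp
    also have "\<dots> = (\<Sum>i\<in>B. \<Sum>j\<in>B. ((w \<bullet> i) * (w \<bullet> j)) *\<^sub>R hess f u i j)"
      unfolding linear_sum[OF l] linear_scale[OF l] hess_sum_right scaleR_sum_right scaleR_scaleR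
      by (subst sum.swap) (simp add: mult.commute)
    finally show ?thesis .
  qed
  have eq: "p (?D X) (?D l) = p (?D a + hess f u w w) (?D l)" if l: "l \<in> B" for l
  proof -
    have pl: "linear (\<lambda>x. p x (?D l))" using bounded_linear.linear[OF bl_p] .
    have "p (?D X) (?D l) = p (?D a) (?D l) + (\<Sum>i\<in>B. \<Sum>j\<in>B. ((w \<bullet> i) * (w \<bullet> j)) * p (?D (?G i j)) (?D l))"
      unfolding X_def
      by (simp add: linear_add[OF lin_df[OF uU]] linear_sum[OF lin_df[OF uU]] linear_scale[OF lin_df[OF uU]]
          linear_add[OF pl] linear_sum[OF pl] linear_scale[OF pl])
    also have "\<dots> = p (?D a) (?D l) + (\<Sum>i\<in>B. \<Sum>j\<in>B. ((w \<bullet> i) * (w \<bullet> j)) * p (hess f u i j) (?D l))"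
      using G l by (simp cong: sum.cong)
    also have "\<dots> = p (?D a + hess f u w w) (?D l)"
      by (simp add: hw linear_add[OF pl] linear_sum[OF pl] linear_scale[OF pl])
    finally show ?thesis .
  qed
  have "X = 0 \<longleftrightarrow> (\<forall>l\<in>B. p (?D X) (?D l) = 0)"
    using nd Xs linear_0[OF lin_df[OF uU]] linear_0[OF bounded_linear.linear[OF bl_p]]
    by (auto simp: nondegenerate_at_def)
  then show ?thesis using eq unfolding X_def by simp
qed

end

section \<open>Charts with smooth inverse, and a criterion for Killing fields\<close>

text \<open>Unlike in \<open>local_param\<close>, the inverse is a smooth map on an open set of the
  ambient space, so that a differentiable curve in \<open>M\<close> has differentiable coordinates
  by the chain rule.\<close>

definition smooth_chart :: "'a::euclidean_space set \<Rightarrow> 'a set \<Rightarrow> 'a set \<Rightarrow> ('a \<Rightarrow> 'a) \<Rightarrow> 'a set \<Rightarrow> ('a \<Rightarrow> 'a) \<Rightarrow> bool" where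
  "smooth_chart M B U \<phi> W \<psi> \<longleftrightarrow> B \<subseteq> Basis \<and> open U \<and> smooth_on U \<phi> \<and> open W \<and> smooth_on W \<psi> \<and>
     \<phi> ` (U \<inter> span B) = M \<inter> W \<and> (\<forall>u\<in>U \<inter> span B. \<psi> (\<phi> u) = u)"

text \<open>\<open>\<psi>\<close> inverts \<open>\<phi>\<close> only on \<open>span B\<close>, so
  the identity is differentiated along lines in \<open>span B\<close>.\<close>

lemma smooth_chart_inverse_derivative:
  assumes c: "smooth_chart M B U \<phi> W \<psi>" and u: "u \<in> U \<inter> span B" and h: "h \<in> span B"
  shows "frechet_derivative \<psi> (at (\<phi> u)) (frechet_derivative \<phi> (at u) h) = h"
proof -
  have oU: "open U" and Cphi: "\<And>k. Ck_on k U \<phi>" and Cpsi: "\<And>k. Ck_on k W \<psi>" and W: "\<phi> u \<in> W"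
    and inv: "\<And>u. u \<in> U \<inter> span B \<Longrightarrow> \<psi> (\<phi> u) = u"
    using c u by (auto simp: smooth_chart_def smooth_on_def)
  have "((\<lambda>z. \<psi> (\<phi> z)) has_derivative (\<lambda>v. frechet_derivative \<psi> (at (\<phi> u)) (frechet_derivative \<phi> (at u) v))) (at u)"
    by (rule has_derivative_compose[OF Ck_on_SucD(1)[OF Cphi] Ck_on_SucD(1)[OF Cpsi W]]) (use u in auto)
  from has_vector_derivative_along_line[OF this, of h]
  have 1: "((\<lambda>s. \<psi> (\<phi> (u + s *\<^sub>R h))) has_vector_derivative
      frechet_derivative \<psi> (at (\<phi> u)) (frechet_derivative \<phi> (at u) h)) (at 0)" .
  obtain J where J: "open J" "0 \<in> J" "\<And>s. s \<in> J \<Longrightarrow> u + s *\<^sub>R h \<in> U"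
    using eventually_line_in[OF oU, of u h] u unfolding eventually_nhds by auto
  have "((\<lambda>s. u + s *\<^sub>R h) has_vector_derivative
      frechet_derivative \<psi> (at (\<phi> u)) (frechet_derivative \<phi> (at u) h)) (at 0)"
    by (rule has_vector_derivative_cong_open[OF 1 J(1,2)])
       (use J(3) u h inv in \<open>auto intro: span_add span_scale\<close>)
  moreover have "((\<lambda>s. u + s *\<^sub>R h) has_vector_derivative h) (at 0)"
    by (auto intro!: derivative_eq_intros)
  ultimately show ?thesis using vector_derivative_unique_at by blast
qed

lemma smooth_chart_local_param:
  assumes "smooth_chart M B U \<phi> W \<psi>"
  shows "local_param M B U \<phi>"
proof -
  have c: "B \<subseteq> Basis" "open U" "smooth_on U \<phi>" "open W" "\<And>k. Ck_on k W \<psi>"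
     "\<phi> ` (U \<inter> span B) = M \<inter> W" "\<And>u. u \<in> U \<inter> span B \<Longrightarrow> \<psi> (\<phi> u) = u"
    using assms by (auto simp: smooth_chart_def smooth_on_def)
  have "openin (top_of_set M) (\<phi> ` (U \<inter> span B))" using c(4,6) by (auto simp: openin_open)
  moreover have "homeomorphism (U \<inter> span B) (\<phi> ` (U \<inter> span B)) \<phi> \<psi>"
  proof (rule homeomorphismI)
    show "continuous_on (U \<inter> span B) \<phi>"
      using smooth_on_Ck[OF c(3), of 0] by (auto intro: continuous_on_subset)
    show "continuous_on (\<phi> ` (U \<inter> span B)) \<psi>"
      using c(5)[of 0] c(6) by (auto intro: continuous_on_subset)
  qed (use c(7) in auto)
  moreover have "inj_on (frechet_derivative \<phi> (at u)) (span B)" if "u \<in> U \<inter> span B" for u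
    using smooth_chart_inverse_derivative[OF assms that] by (rule inj_on_inverseI)
  ultimately show ?thesis using c(1-3) unfolding local_param_def by blast
qed

lemma bounded_bilinear_scaled_inner: "bounded_bilinear (\<lambda>v w. \<kappa> * (v \<bullet> w))"
proof -
  have eq: "(\<lambda>v w. \<kappa> * (v \<bullet> w)) = (\<lambda>x. (\<bullet>) (\<kappa> *\<^sub>R x))" by (simp add: fun_eq_iff)
  show ?thesis unfolding eq
    by (rule bounded_bilinear.comp1[OF bounded_bilinear_inner bounded_linear_scaleR_right])
qed

text \<open>Differentiating the coordinate expression of \<open>D\<close> in a direction
  \<open>k\<close> gives \<open>D (?D k) = ?D (v' k) + hess \<phi> u (v u) k\<close>. Inserting this
  turns the Lie derivative of the metric into the symmetric part of \<open>D\<close> on tangent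
  vectors, which vanishes by skewness.\<close>

lemma killing_fieldI:
  fixes M :: "'a::euclidean_space set"
  assumes D: "bounded_linear D" and skew: "\<And>x y. D x \<bullet> y = - (x \<bullet> D y)"
    and tang: "\<And>x. x \<in> M \<Longrightarrow> D x \<in> tangent M x"
    and chart: "\<And>x. x \<in> M \<Longrightarrow> \<exists>B U \<phi> W \<psi>. smooth_chart M B U \<phi> W \<psi> \<and> x \<in> W"
  shows "killing_field M (\<lambda>x v w. \<kappa> * (v \<bullet> w)) D"
  unfolding killing_field_def
proof (intro conjI ballI)
  show "smooth_map_on M D"
    unfolding smooth_map_on_def smooth_on_def
    by (intro ballI exI[of _ UNIV] exI[of _ D]) (auto intro: Ck_on_linear D)
next
  fix x assume x: "x \<in> M"
  obtain B U \<phi> W \<psi> where c: "smooth_chart M B U \<phi> W \<psi>" "x \<in> W" using chart[OF x] by blast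
  have cc: "B \<subseteq> Basis" "open U" "\<And>k. Ck_on k U \<phi>" "open W" "\<And>k. Ck_on k W \<psi>"
     "\<phi> ` (U \<inter> span B) = M \<inter> W" "\<And>u. u \<in> U \<inter> span B \<Longrightarrow> \<psi> (\<phi> u) = u"
    using c(1) by (auto simp: smooth_chart_def smooth_on_def)
  note lp = smooth_chart_local_param[OF c(1)]
  \<comment> \<open>The coordinate field, written as a sum of products of differentiable functions
    so that it is visibly differentiable.\<close>
  define v where "v = (\<lambda>u. \<Sum>b\<in>Basis. (D (\<phi> u) \<bullet> b) *\<^sub>R frechet_derivative \<psi> (at (\<phi> u)) b)"
  interpret pm: pulled_back_metric "\<lambda>x v w. \<kappa> * (v \<bullet> w)" B U \<phi> "\<lambda>v w. \<kappa> * (v \<bullet> w)" \<phi>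
    by (rule pulled_back_metric.intro)
      (use cc in \<open>auto simp: metric_coeff_def inner_commute bounded_bilinear_scaled_inner\<close>)
  have vin: "v u \<in> span B \<and> D (\<phi> u) = frechet_derivative \<phi> (at u) (v u)" if u: "u \<in> U \<inter> span B" for u
  proof -
    have W: "\<phi> u \<in> W" "\<phi> u \<in> M" using cc(6) u by auto
    obtain h where h: "h \<in> span B" "D (\<phi> u) = frechet_derivative \<phi> (at u) h"
      using tang[OF W(2)] tangent_local_param[OF lp u] by auto
    have "v u = frechet_derivative \<psi> (at (\<phi> u)) (D (\<phi> u))"
      unfolding v_def using frechet_derivative_basis_sum[OF cc(5) W(1), symmetric] .
    also have "\<dots> = h" using smooth_chart_inverse_derivative[OF c(1) u h(1)] h(2) by simp
    finally show ?thesis using h by simp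
  qed
  have lie0: "lie_coeff (\<lambda>x v w. \<kappa> * (v \<bullet> w)) B \<phi> v i j u = 0"
    if u: "u \<in> U \<inter> span B" and ij: "i \<in> B" "j \<in> B" for u i j
  proof -
    have uU: "u \<in> U" and W: "\<phi> u \<in> W" using cc(6) u by auto
    let ?D = "frechet_derivative \<phi> (at u)"
    obtain v' where v': "(v has_derivative v') (at u)"
    proof -
      have dphi: "(\<phi> has_derivative ?D) (at u)" using Ck_on_SucD(1)[OF cc(3) uU] .
      have "(\<lambda>u. frechet_derivative \<psi> (at (\<phi> u)) b) differentiable (at u)" for b
        using has_derivative_compose[OF dphi Ck_on_SucD(1)[OF Ck_on_SucD(2)[OF cc(5)] W]]
        by (auto simp: differentiable_def)
      moreover have "(\<lambda>u. D (\<phi> u)) differentiable (at u)"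
        using bounded_linear.has_derivative[OF D dphi] by (auto simp: differentiable_def)
      ultimately have "v differentiable (at u)" unfolding v_def
        by (intro differentiable_sum differentiable_scaleR differentiable_inner differentiable_const) auto
      then show ?thesis using that by (auto simp: differentiable_def)
    qed
    have along: "v' k \<in> span B \<and> partial v k u = v' k \<and> D (?D k) = ?D (v' k) + hess \<phi> u (v u) k" if k: "k \<in> B" for k
    proof -
      have vk: "((\<lambda>s. v (u + s *\<^sub>R k)) has_vector_derivative v' k) (at 0)"
        by (rule has_vector_derivative_along_line[OF v'])
      obtain J where J: "open J" "0 \<in> J" "\<And>s. s \<in> J \<Longrightarrow> u + s *\<^sub>R k \<in> U"
        using eventually_line_in[OF cc(2), of u k] u unfolding eventually_nhds by auto
      have in_s: "u + s *\<^sub>R k \<in> U \<inter> span B" if "s \<in> J" for s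
        using J(3)[OF that] u k by (simp add: span_add span_scale span_base)
      have 1: "v' k \<in> span B"
        by (rule has_vector_derivative_in_subspace[OF vk J(1,2)]) (use vin in_s in auto)
      have pk: "partial v k u = v' k" using vk by (simp add: partial_def vector_derivative_at)
      have "((\<lambda>s. \<Sum>b\<in>Basis. (v (u + s *\<^sub>R k) \<bullet> b) *\<^sub>R frechet_derivative \<phi> (at (u + s *\<^sub>R k)) b) has_vector_derivative
         (\<Sum>b\<in>Basis. (v (u + 0 *\<^sub>R k) \<bullet> b) *\<^sub>R hess \<phi> u k b
            + (v' k \<bullet> b) *\<^sub>R frechet_derivative \<phi> (at (u + 0 *\<^sub>R k)) b)) (at 0)"
        by (intro has_vector_derivative_sum has_vector_derivative_scaleR
             has_vector_derivative_along_line has_derivative_frechet_hess[OF cc(2,3) uU])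
           (use bounded_linear.has_vector_derivative[OF bounded_linear_inner_left vk] in
             \<open>simp add: has_real_derivative_iff_has_vector_derivative\<close>)
      moreover have "(\<Sum>b\<in>Basis. (v u \<bullet> b) *\<^sub>R hess \<phi> u k b) = hess \<phi> u k (v u)"
        using hess_sum_right[of \<phi> u k "\<lambda>b. v u \<bullet> b" "\<lambda>b. b" Basis] by (simp add: euclidean_representation)
      moreover have "(\<Sum>b\<in>Basis. (v' k \<bullet> b) *\<^sub>R ?D b) = ?D (v' k)"
        by (rule frechet_derivative_basis_sum[OF cc(3) uU, symmetric])
      ultimately have "((\<lambda>s. \<Sum>b\<in>Basis. (v (u + s *\<^sub>R k) \<bullet> b) *\<^sub>R frechet_derivative \<phi> (at (u + s *\<^sub>R k)) b) has_vector_derivative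
         hess \<phi> u k (v u) + ?D (v' k)) (at 0)" by (simp add: sum.distrib)
      then have "((\<lambda>s. D (\<phi> (u + s *\<^sub>R k))) has_vector_derivative hess \<phi> u k (v u) + ?D (v' k)) (at 0)"
        by (rule has_vector_derivative_cong_open[OF _ J(1,2)])
           (use in_s vin frechet_derivative_basis_sum[OF cc(3), symmetric] in auto)
      moreover have "((\<lambda>s. D (\<phi> (u + s *\<^sub>R k))) has_vector_derivative D (?D k)) (at 0)"
        by (rule has_vector_derivative_along_line[OF bounded_linear.has_derivative[OF D Ck_on_SucD(1)[OF cc(3) uU]]])
      ultimately have "D (?D k) = hess \<phi> u k (v u) + ?D (v' k)" using vector_derivative_unique_at by blast
      then show ?thesis using 1 pk hess_commute[OF cc(2,3) uU, of k "v u"] by (simp add: add.commute)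
    qed
    have vsp: "v u \<in> span B" using vin[OF u] by simp
    have lin: "linear (\<lambda>y. hess \<phi> u y k)" for k
      using bounded_linear.linear[OF bounded_linear_hess[OF cc(2,3) uU]] .
    have hs: "(\<Sum>k\<in>B. (v u \<bullet> k) *\<^sub>R hess \<phi> u k l) = hess \<phi> u (v u) l" for l
      using linear_sum[OF lin, of "\<lambda>k. (v u \<bullet> k) *\<^sub>R k" B l] span_subset_Basis_expand[OF cc(1) vsp]
      by (simp add: linear_scale[OF lin])
    have "lie_coeff (\<lambda>x v w. \<kappa> * (v \<bullet> w)) B \<phi> v i j u =
       (\<Sum>k\<in>B. (v u \<bullet> k) * (\<kappa> * (hess \<phi> u k i \<bullet> ?D j) + \<kappa> * (?D i \<bullet> hess \<phi> u k j)))
       + (\<Sum>k\<in>B. metric_coeff (\<lambda>x v w. \<kappa> * (v \<bullet> w)) \<phi> j k u * (v' i \<bullet> k))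
       + (\<Sum>k\<in>B. metric_coeff (\<lambda>x v w. \<kappa> * (v \<bullet> w)) \<phi> i k u * (v' j \<bullet> k))"
      unfolding lie_coeff_def sum.distrib[symmetric]
      by (intro sum.cong refl) (use along ij pm.partial_metric_coeff[OF u] in
         \<open>auto simp: metric_coeff_def inner_commute\<close>)
    also have "(\<Sum>k\<in>B. (v u \<bullet> k) * (\<kappa> * (hess \<phi> u k i \<bullet> ?D j) + \<kappa> * (?D i \<bullet> hess \<phi> u k j))) =
       \<kappa> * (hess \<phi> u (v u) i \<bullet> ?D j) + \<kappa> * (?D i \<bullet> hess \<phi> u (v u) j)"
      unfolding hs[symmetric] by (simp add: inner_sum_left inner_sum_right sum_distrib_left sum.distrib algebra_simps)
    also have "(\<Sum>k\<in>B. metric_coeff (\<lambda>x v w. \<kappa> * (v \<bullet> w)) \<phi> j k u * (v' i \<bullet> k)) = \<kappa> * (?D (v' i) \<bullet> ?D j)"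
      using along ij by (intro pm.sum_coeff u) auto
    also have "(\<Sum>k\<in>B. metric_coeff (\<lambda>x v w. \<kappa> * (v \<bullet> w)) \<phi> i k u * (v' j \<bullet> k)) = \<kappa> * (?D (v' j) \<bullet> ?D i)"
      using along ij by (intro pm.sum_coeff u) auto
    also have "\<kappa> * (hess \<phi> u (v u) i \<bullet> ?D j) + \<kappa> * (?D i \<bullet> hess \<phi> u (v u) j) + \<kappa> * (?D (v' i) \<bullet> ?D j) + \<kappa> * (?D (v' j) \<bullet> ?D i)
       = \<kappa> * (D (?D i) \<bullet> ?D j) + \<kappa> * (?D i \<bullet> D (?D j))"
      using along[OF ij(1)] along[OF ij(2)] by (simp add: algebra_simps inner_add_left inner_add_right inner_commute)
    also have "\<dots> = 0" using skew[of "?D i" "?D j"] by simp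
    finally show ?thesis .
  qed
  have "x \<in> \<phi> ` (U \<inter> span B)" using cc(6) x c(2) by auto
  with lp vin lie0 show "\<exists>B U \<phi> v. local_param M B U \<phi> \<and> x \<in> \<phi> ` (U \<inter> span B) \<and>
        (\<forall>u\<in>U \<inter> span B. v u \<in> span B \<and> D (\<phi> u) = frechet_derivative \<phi> (at u) (v u) \<and>
           (\<forall>i\<in>B. \<forall>j\<in>B. lie_coeff (\<lambda>x v w. \<kappa> * (v \<bullet> w)) B \<phi> v i j u = 0))"
    by blast
qed

section \<open>A flow of rotations\<close>

locale rotation_flow =
  fixes L :: "'l set" and e f :: "'l \<Rightarrow> 'w::euclidean_space" and \<theta> :: "'l \<Rightarrow> real"
  assumes finL: "finite L"
    and ee: "\<lbrakk>l \<in> L; m \<in> L\<rbrakk> \<Longrightarrow> e l \<bullet> e m = (if l = m then 1 else 0)"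
    and ff: "\<lbrakk>l \<in> L; m \<in> L\<rbrakk> \<Longrightarrow> f l \<bullet> f m = (if l = m then 1 else 0)"
    and ef: "\<lbrakk>l \<in> L; m \<in> L\<rbrakk> \<Longrightarrow> e l \<bullet> f m = 0"
begin

lemma fe: "\<lbrakk>l \<in> L; m \<in> L\<rbrakk> \<Longrightarrow> f l \<bullet> e m = 0"
  using ef by (simp add: inner_commute)

definition emb :: "'l \<Rightarrow> real \<Rightarrow> real \<Rightarrow> 'w" where
  "emb l a b = a *\<^sub>R e l + b *\<^sub>R f l"

definition gen :: "'w \<Rightarrow> 'w" where
  "gen x = (\<Sum>l\<in>L. emb l (- \<theta> l * (x \<bullet> f l)) (\<theta> l * (x \<bullet> e l)))"

text \<open>The identity plus a correction in each plane, so that the orthogonal complement of the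
  planes is fixed without being named.\<close>

definition flow :: "real \<Rightarrow> 'w \<Rightarrow> 'w" where
  "flow s x = x + (\<Sum>l\<in>L. emb l ((cos (\<theta> l * s) - 1) * (x \<bullet> e l) - sin (\<theta> l * s) * (x \<bullet> f l))
     ((cos (\<theta> l * s) - 1) * (x \<bullet> f l) + sin (\<theta> l * s) * (x \<bullet> e l)))"

lemma emb_inner:
  "\<lbrakk>l \<in> L; m \<in> L\<rbrakk> \<Longrightarrow> emb l a b \<bullet> e m = (if l = m then a else 0)"
  "\<lbrakk>l \<in> L; m \<in> L\<rbrakk> \<Longrightarrow> emb l a b \<bullet> f m = (if l = m then b else 0)"
  by (auto simp: emb_def inner_add_left ee ff ef fe)

lemma sum_emb_inner:
  assumes "m \<in> L"
  shows "(\<Sum>l\<in>L. emb l (a l) (b l)) \<bullet> e m = a m" "(\<Sum>l\<in>L. emb l (a l) (b l)) \<bullet> f m = b m"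
  using assms finL by (simp_all add: inner_sum_left emb_inner cong: sum.cong)

lemma emb_add: "emb l a b + emb l a' b' = emb l (a + a') (b + b')"
  by (simp add: emb_def algebra_simps)

lemma gen_inner:
  assumes "l \<in> L" shows "gen x \<bullet> e l = - \<theta> l * (x \<bullet> f l)" "gen x \<bullet> f l = \<theta> l * (x \<bullet> e l)"
  unfolding gen_def sum_emb_inner[OF assms] by simp_all

lemma flow_inner:
  assumes "l \<in> L"
  shows "flow s x \<bullet> e l = cos (\<theta> l * s) * (x \<bullet> e l) - sin (\<theta> l * s) * (x \<bullet> f l)"
    "flow s x \<bullet> f l = cos (\<theta> l * s) * (x \<bullet> f l) + sin (\<theta> l * s) * (x \<bullet> e l)"
  unfolding flow_def inner_add_left sum_emb_inner[OF assms] by (simp_all add: algebra_simps)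

lemma flow_0 [simp]: "flow 0 x = x"
  by (simp add: flow_def emb_def)

lemma flow_flow: "flow s (flow t x) = flow (s + t) x"
proof -
  have "flow s (flow t x) = flow t x + (\<Sum>l\<in>L. emb l ((cos (\<theta> l * s) - 1) * (flow t x \<bullet> e l) - sin (\<theta> l * s) * (flow t x \<bullet> f l))
     ((cos (\<theta> l * s) - 1) * (flow t x \<bullet> f l) + sin (\<theta> l * s) * (flow t x \<bullet> e l)))"
    by (subst flow_def) simp
  also have "\<dots> = x + (\<Sum>l\<in>L. emb l ((cos (\<theta> l * t) - 1) * (x \<bullet> e l) - sin (\<theta> l * t) * (x \<bullet> f l))
     ((cos (\<theta> l * t) - 1) * (x \<bullet> f l) + sin (\<theta> l * t) * (x \<bullet> e l))
     + emb l ((cos (\<theta> l * s) - 1) * (flow t x \<bullet> e l) - sin (\<theta> l * s) * (flow t x \<bullet> f l))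
     ((cos (\<theta> l * s) - 1) * (flow t x \<bullet> f l) + sin (\<theta> l * s) * (flow t x \<bullet> e l)))"
    by (subst flow_def) (simp add: sum.distrib)
  also have "\<dots> = flow (s + t) x"
    unfolding flow_def[of "s + t"]
  proof (intro arg_cong[where f = "(+) x"] sum.cong refl)
    fix l assume l: "l \<in> L"
    have 1: "(cos (\<theta> l * t) - 1) * (x \<bullet> e l) - sin (\<theta> l * t) * (x \<bullet> f l)
        + ((cos (\<theta> l * s) - 1) * (flow t x \<bullet> e l) - sin (\<theta> l * s) * (flow t x \<bullet> f l))
      = (cos (\<theta> l * (s + t)) - 1) * (x \<bullet> e l) - sin (\<theta> l * (s + t)) * (x \<bullet> f l)"
      by (simp add: flow_inner[OF l] distrib_left cos_add sin_add) (simp add: algebra_simps)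
    have 2: "(cos (\<theta> l * t) - 1) * (x \<bullet> f l) + sin (\<theta> l * t) * (x \<bullet> e l)
        + ((cos (\<theta> l * s) - 1) * (flow t x \<bullet> f l) + sin (\<theta> l * s) * (flow t x \<bullet> e l))
      = (cos (\<theta> l * (s + t)) - 1) * (x \<bullet> f l) + sin (\<theta> l * (s + t)) * (x \<bullet> e l)"
      by (simp add: flow_inner[OF l] distrib_left cos_add sin_add) (simp add: algebra_simps)
    show "emb l ((cos (\<theta> l * t) - 1) * (x \<bullet> e l) - sin (\<theta> l * t) * (x \<bullet> f l))
       ((cos (\<theta> l * t) - 1) * (x \<bullet> f l) + sin (\<theta> l * t) * (x \<bullet> e l))
       + emb l ((cos (\<theta> l * s) - 1) * (flow t x \<bullet> e l) - sin (\<theta> l * s) * (flow t x \<bullet> f l))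
       ((cos (\<theta> l * s) - 1) * (flow t x \<bullet> f l) + sin (\<theta> l * s) * (flow t x \<bullet> e l))
      = emb l ((cos (\<theta> l * (s + t)) - 1) * (x \<bullet> e l) - sin (\<theta> l * (s + t)) * (x \<bullet> f l))
       ((cos (\<theta> l * (s + t)) - 1) * (x \<bullet> f l) + sin (\<theta> l * (s + t)) * (x \<bullet> e l))"
      unfolding emb_add 1 2 ..
  qed
  finally show ?thesis .
qed

lemma flow_adjoint: "flow s x \<bullet> y = x \<bullet> flow (- s) y"
  unfolding flow_def emb_def inner_add_left inner_add_right inner_sum_left inner_sum_right
  by (simp add: algebra_simps inner_commute)

lemma flow_isometry [simp]: "flow s x \<bullet> flow s y = x \<bullet> y"
  by (simp add: flow_adjoint flow_flow)

lemma bounded_linear_flow: "bounded_linear (flow s)"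
proof -
  have "linear (flow s)"
    by (rule linearI)
       (simp_all add: flow_def emb_def inner_add_left algebra_simps sum.distrib scaleR_sum_right sum_subtractf)
  then show ?thesis by (simp add: linear_conv_bounded_linear)
qed

lemma bounded_linear_gen: "bounded_linear gen"
proof -
  have "linear gen"
    by (rule linearI)
       (simp_all add: gen_def emb_def inner_add_left algebra_simps sum.distrib scaleR_sum_right sum_subtractf
          sum_negf)
  then show ?thesis by (simp add: linear_conv_bounded_linear)
qed

lemma gen_skew: "gen x \<bullet> y = - (x \<bullet> gen y)"
  unfolding gen_def emb_def inner_add_left inner_add_right inner_sum_left inner_sum_right sum_negf[symmetric]
  by (intro sum.cong refl) (simp add: algebra_simps inner_commute)

lemma flow_gen: "flow s (gen x) = (\<Sum>l\<in>L. emb l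
    (- \<theta> l * (cos (\<theta> l * s) * (x \<bullet> f l) + sin (\<theta> l * s) * (x \<bullet> e l)))
    (\<theta> l * (cos (\<theta> l * s) * (x \<bullet> e l) - sin (\<theta> l * s) * (x \<bullet> f l))))"
  unfolding flow_def
  by (simp add: gen_inner cong: sum.cong)
     (simp add: gen_def sum.distrib[symmetric] emb_add algebra_simps cong: sum.cong)

text \<open>Joint derivative in point and time: the velocity receives the generator as a drift and
  is then rotated along. It is the differential of the change of coordinates that unwinds the
  spacetime.\<close>

lemma flow_has_derivative:
  "((\<lambda>z. flow (\<alpha> * snd z) (fst z)) has_derivative
     (\<lambda>\<xi>. flow (\<alpha> * snd z) (fst \<xi> + (\<alpha> * snd \<xi>) *\<^sub>R gen (fst z)))) (at z within A)"
proof -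
  define x where "x = fst z" define t where "t = snd z"
  have d: "((\<lambda>z. emb l ((cos (\<theta> l * (\<alpha> * snd z)) - 1) * (fst z \<bullet> e l) - sin (\<theta> l * (\<alpha> * snd z)) * (fst z \<bullet> f l))
     ((cos (\<theta> l * (\<alpha> * snd z)) - 1) * (fst z \<bullet> f l) + sin (\<theta> l * (\<alpha> * snd z)) * (fst z \<bullet> e l)))
     has_derivative (\<lambda>\<xi>. emb l ((cos (\<theta> l * (\<alpha> * t)) - 1) * (fst \<xi> \<bullet> e l) - sin (\<theta> l * (\<alpha> * t)) * (fst \<xi> \<bullet> f l))
     ((cos (\<theta> l * (\<alpha> * t)) - 1) * (fst \<xi> \<bullet> f l) + sin (\<theta> l * (\<alpha> * t)) * (fst \<xi> \<bullet> e l))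
    + (\<alpha> * snd \<xi>) *\<^sub>R emb l
    (- \<theta> l * (cos (\<theta> l * (\<alpha> * t)) * (x \<bullet> f l) + sin (\<theta> l * (\<alpha> * t)) * (x \<bullet> e l)))
    (\<theta> l * (cos (\<theta> l * (\<alpha> * t)) * (x \<bullet> e l) - sin (\<theta> l * (\<alpha> * t)) * (x \<bullet> f l)))))
     (at z within A)" for l
    unfolding emb_def
    by (rule derivative_eq_intros | rule refl)+ (auto simp: fun_eq_iff x_def t_def algebra_simps)
  have "((\<lambda>z. flow (\<alpha> * snd z) (fst z)) has_derivative
     (\<lambda>\<xi>. fst \<xi> + (\<Sum>l\<in>L. emb l ((cos (\<theta> l * (\<alpha> * t)) - 1) * (fst \<xi> \<bullet> e l) - sin (\<theta> l * (\<alpha> * t)) * (fst \<xi> \<bullet> f l))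
     ((cos (\<theta> l * (\<alpha> * t)) - 1) * (fst \<xi> \<bullet> f l) + sin (\<theta> l * (\<alpha> * t)) * (fst \<xi> \<bullet> e l))
    + (\<alpha> * snd \<xi>) *\<^sub>R emb l
    (- \<theta> l * (cos (\<theta> l * (\<alpha> * t)) * (x \<bullet> f l) + sin (\<theta> l * (\<alpha> * t)) * (x \<bullet> e l)))
    (\<theta> l * (cos (\<theta> l * (\<alpha> * t)) * (x \<bullet> e l) - sin (\<theta> l * (\<alpha> * t)) * (x \<bullet> f l)))))) (at z within A)"
    unfolding flow_def by (intro has_derivative_add has_derivative_sum d derivative_intros)
  moreover have "fst \<xi> + (\<Sum>l\<in>L. emb l ((cos (\<theta> l * (\<alpha> * t)) - 1) * (fst \<xi> \<bullet> e l) - sin (\<theta> l * (\<alpha> * t)) * (fst \<xi> \<bullet> f l))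
     ((cos (\<theta> l * (\<alpha> * t)) - 1) * (fst \<xi> \<bullet> f l) + sin (\<theta> l * (\<alpha> * t)) * (fst \<xi> \<bullet> e l))
    + (\<alpha> * snd \<xi>) *\<^sub>R emb l
    (- \<theta> l * (cos (\<theta> l * (\<alpha> * t)) * (x \<bullet> f l) + sin (\<theta> l * (\<alpha> * t)) * (x \<bullet> e l)))
    (\<theta> l * (cos (\<theta> l * (\<alpha> * t)) * (x \<bullet> e l) - sin (\<theta> l * (\<alpha> * t)) * (x \<bullet> f l))))
    = flow (\<alpha> * t) (fst \<xi> + (\<alpha> * snd \<xi>) *\<^sub>R gen x)" for \<xi> :: "'w \<times> real"
  proof -
    have "flow (\<alpha> * t) (fst \<xi> + (\<alpha> * snd \<xi>) *\<^sub>R gen x) = flow (\<alpha> * t) (fst \<xi>) + (\<alpha> * snd \<xi>) *\<^sub>R flow (\<alpha> * t) (gen x)"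
      using bounded_linear.linear[OF bounded_linear_flow] by (simp add: linear_add linear_scale)
    then show ?thesis unfolding flow_gen by (simp add: flow_def sum.distrib scaleR_sum_right)
  qed
  ultimately show ?thesis by (simp add: x_def t_def)
qed

lemma flow_has_vector_derivative:
  assumes "(x has_vector_derivative x') (at s within A)" "(t has_vector_derivative t') (at s within A)"
  shows "((\<lambda>s. flow (\<alpha> * t s) (x s)) has_vector_derivative
    flow (\<alpha> * t s) (x' + (\<alpha> * t') *\<^sub>R gen (x s))) (at s within A)"
  using vector_derivative_diff_chain_within[OF has_vector_derivative_Pair[OF assms] flow_has_derivative[of \<alpha>]]
  by (simp add: o_def)

lemma Ck_on_flow:
  assumes "open S" "Ck_on k S x" "Ck_on k S t"
  shows "Ck_on k S (\<lambda>u. flow (\<alpha> * t u) (x u))"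
  unfolding flow_def emb_def
  by (intro Ck_on_add Ck_on_sum Ck_on_scaleR Ck_on_mult Ck_on_diff Ck_on_inner Ck_on_cos Ck_on_sin
      Ck_on_const assms)

end

section \<open>Light rays of the stationary metric\<close>

lemma span_Times_UNIV:
  fixes B :: "'a::euclidean_space set"
  shows "span ((\<lambda>b. (b, 0::real)) ` B \<union> {(0, 1)}) = span B \<times> UNIV" (is "span ?B = _")
proof
  have "?B \<subseteq> span B \<times> UNIV" by (auto intro: span_base span_zero)
  then show "span ?B \<subseteq> span B \<times> UNIV"
    by (rule span_minimal) (intro subspace_Times subspace_span subspace_UNIV)
  show "span B \<times> UNIV \<subseteq> span ?B"
  proof
    fix z assume "z \<in> span B \<times> (UNIV :: real set)"
    then obtain x t where z: "z = (x, t)" "x \<in> span B" by auto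
    have lin: "linear (\<lambda>b::'a. (b, 0::real))" by (auto intro!: linearI)
    have "(x, 0::real) \<in> span ((\<lambda>b. (b, 0)) ` B)" using z(2) by (auto simp: linear_span_image[OF lin])
    then have "(x, 0) \<in> span ?B" using span_mono[of _ ?B] by blast
    moreover have "t *\<^sub>R (0, 1) \<in> span ?B" by (intro span_scale span_base) simp
    ultimately have "(x, 0) + t *\<^sub>R (0, 1) \<in> span ?B" by (rule span_add)
    then show "z \<in> span ?B" using z by simp
  qed
qed

lemma smooth_chart_Times_UNIV:
  fixes M :: "'a::euclidean_space set"
  assumes "smooth_chart M B U \<phi> W \<psi>"
  shows "smooth_chart (M \<times> (UNIV::real set)) ((\<lambda>b. (b, 0)) ` B \<union> {(0, 1)}) (U \<times> UNIV)
     (\<lambda>z. (\<phi> (fst z), snd z)) (W \<times> UNIV) (\<lambda>z. (\<psi> (fst z), snd z))"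
proof -
  have c: "B \<subseteq> Basis" "open U" "\<And>k. Ck_on k U \<phi>" "open W" "\<And>k. Ck_on k W \<psi>"
     "\<phi> ` (U \<inter> span B) = M \<inter> W" "\<And>u. u \<in> U \<inter> span B \<Longrightarrow> \<psi> (\<phi> u) = u"
    using assms by (auto simp: smooth_chart_def smooth_on_def)
  have sm: "Ck_on k (V \<times> (UNIV::real set)) (\<lambda>z. (h (fst z), snd z))"
    if V: "open V" "Ck_on k V h" for k V and h :: "'a \<Rightarrow> 'a"
  proof -
    have o: "open (V \<times> (UNIV::real set))" using V(1) by (simp add: open_Times)
    have eq: "fst -` V = V \<times> (UNIV::real set)" by auto
    have "Ck_on k (V \<times> (UNIV::real set)) (\<lambda>z. h (fst z))"
      using Ck_on_precomp_linear[OF V(1) _ V(2), of "fst :: 'a \<times> real \<Rightarrow> 'a"] by (simp add: eq bounded_linear_fst)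
    then have 1: "Ck_on k (V \<times> (UNIV::real set)) (\<lambda>z. (h (fst z), 0::real))"
      by (rule Ck_on_linear_comp[OF o, where L = "\<lambda>x. (x, 0)", rotated])
         (auto intro!: bounded_linear_intro[where K = 1] simp: norm_Pair)
    have 2: "Ck_on k (V \<times> (UNIV::real set)) (\<lambda>z. (0::'a, snd z))"
      by (rule Ck_on_linear[OF o]) (auto intro!: bounded_linear_intro[where K = 1] simp: norm_Pair norm_snd_le)
    show ?thesis using Ck_on_add[OF o 1 2] by simp
  qed
  have "(\<lambda>b. (b, 0)) ` B \<union> {(0, 1)} \<subseteq> (Basis :: ('a \<times> real) set)"
    using c(1) by (auto simp: Basis_prod_def)
  moreover have "(U \<times> UNIV) \<inter> (span B \<times> UNIV) = (U \<inter> span B) \<times> (UNIV :: real set)" by auto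
  moreover have "(\<lambda>z. (\<phi> (fst z), snd z)) ` ((U \<inter> span B) \<times> UNIV) = (M \<times> (UNIV::real set)) \<inter> W \<times> UNIV"
  proof -
    have "(\<lambda>z. (\<phi> (fst z), snd z)) ` ((U \<inter> span B) \<times> UNIV) = (\<phi> ` (U \<inter> span B)) \<times> (UNIV::real set)"
      by force
    then show ?thesis using c(6) by auto
  qed
  ultimately show ?thesis
    unfolding smooth_chart_def span_Times_UNIV smooth_on_def
    using sm[OF c(2,3)] sm[OF c(4,5)] c(2,4,7) by (auto simp: open_Times)
qed

abbreviation (input) I01 :: "real set" where "I01 \<equiv> {0..1}"

lemma at_within_I01_nontrivial: "s \<in> I01 \<Longrightarrow> at s within I01 \<noteq> bot"
  by (simp add: trivial_limit_within islimpt_Icc)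

lemma vector_derivative_I01_unique:
  "\<lbrakk>(c has_vector_derivative D) (at s within I01); (c has_vector_derivative D') (at s within I01); s \<in> I01\<rbrakk> \<Longrightarrow> D = D'"
  by (rule vector_derivative_unique_within[OF at_within_I01_nontrivial])

lemma velocity_I01:
  "\<lbrakk>(c has_vector_derivative D) (at s within I01); s \<in> I01\<rbrakk> \<Longrightarrow> velocity I01 c s = D"
  unfolding velocity_def by (rule vector_derivative_within[OF at_within_I01_nontrivial])

locale stationary_model = rotation_flow L e f \<theta>
  for L :: "'l set" and e f :: "'l \<Rightarrow> 'w::euclidean_space" and \<theta> +
  fixes M :: "'w set" and \<kappa> :: real
  assumes kpos: "\<kappa> > 0"
    and flow_M: "x \<in> M \<Longrightarrow> flow s x \<in> M"
    and charts: "x \<in> M \<Longrightarrow> \<exists>B U \<phi> W \<psi>. smooth_chart M B U \<phi> W \<psi> \<and> x \<in> W"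
begin

abbreviation N :: "('w \<times> real) set" where "N \<equiv> M \<times> UNIV"

definition lm :: "real \<Rightarrow> ('w \<times> real) metric" where
  "lm \<alpha> = stationary_metric (\<lambda>x v w. \<kappa> * (v \<bullet> w)) (\<lambda>x. - (\<alpha> *\<^sub>R gen x))
     (\<lambda>x. 1 - \<alpha>\<^sup>2 * (\<kappa> * (gen x \<bullet> gen x)))"

definition pb :: "'w \<times> real \<Rightarrow> 'w \<times> real \<Rightarrow> real" where
  "pb a b = \<kappa> * (fst a \<bullet> fst b) - snd a * snd b"

definition shift :: "real \<Rightarrow> 'w \<times> real \<Rightarrow> 'w \<times> real" where
  "shift \<alpha> z = (flow (\<alpha> * snd z) (fst z), snd z)"

definition shift' :: "real \<Rightarrow> 'w \<times> real \<Rightarrow> 'w \<times> real \<Rightarrow> 'w \<times> real" where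
  "shift' \<alpha> z \<xi> = (flow (\<alpha> * snd z) (fst \<xi> + (\<alpha> * snd \<xi>) *\<^sub>R gen (fst z)), snd \<xi>)"

lemma shift_has_derivative: "(shift \<alpha> has_derivative shift' \<alpha> z) (at z within A)"
  unfolding shift_def[abs_def] shift'_def[abs_def]
  by (intro has_derivative_Pair flow_has_derivative derivative_intros)

lemma shift_inverse: "shift \<alpha> (shift (- \<alpha>) z) = z"
  by (simp add: shift_def flow_flow)

lemma shift_N: "z \<in> N \<Longrightarrow> shift \<alpha> z \<in> N"
  by (auto simp: shift_def flow_M)

lemma shift'_inverse: "shift' \<alpha> (shift (- \<alpha>) z) (shift' (- \<alpha>) z \<xi>) = \<xi>"
proof -
  have "(shift \<alpha> \<circ> shift (- \<alpha>) has_derivative shift' \<alpha> (shift (- \<alpha>) z) \<circ> shift' (- \<alpha>) z) (at z)"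
    by (rule diff_chain_at) (rule shift_has_derivative)+
  moreover have "shift \<alpha> \<circ> shift (- \<alpha>) = (\<lambda>z. z)" by (simp add: fun_eq_iff shift_inverse)
  ultimately have "((\<lambda>z. z) has_derivative shift' \<alpha> (shift (- \<alpha>) z) \<circ> shift' (- \<alpha>) z) (at z)" by simp
  then have "shift' \<alpha> (shift (- \<alpha>) z) \<circ> shift' (- \<alpha>) z = (\<lambda>\<xi>. \<xi>)"
    using has_derivative_unique has_derivative_ident by blast
  from fun_cong[OF this, of \<xi>] show ?thesis by simp
qed

text \<open>Completing the square: the stationary form on \<open>(v, \<tau>)\<close> is \<kappa>
  times the squared norm of \<open>v - (\<alpha> * \<tau>) *\<^sub>R gen x\<close>, minus the square
  of \<open>\<tau>\<close>; and the flow is an isometry. So the stationary metric is the pull-back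
  of the product metric under \<open>shift (- \<alpha>)\<close>.\<close>

lemma lm_shift: "lm \<alpha> z \<xi> \<eta> = pb (shift' (- \<alpha>) z \<xi>) (shift' (- \<alpha>) z \<eta>)"
  by (cases z; cases \<xi>; cases \<eta>)
     (simp add: lm_def stationary_metric_def pb_def shift'_def inner_add_left inner_add_right
       inner_diff_left inner_diff_right algebra_simps power2_eq_square inner_commute)

lemma pb_bilinear: "bounded_bilinear pb"
proof -
  have 1: "bounded_bilinear (\<lambda>(a :: 'w \<times> real) (b :: 'w \<times> real). \<kappa> * (fst a \<bullet> fst b))"
    by (rule bounded_bilinear.comp[OF bounded_bilinear_scaled_inner bounded_linear_fst bounded_linear_fst])
  have 2: "bounded_bilinear (\<lambda>(a :: 'w \<times> real) (b :: 'w \<times> real). snd a * snd b)"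
    by (rule bounded_bilinear.comp[OF bounded_bilinear_mult bounded_linear_snd bounded_linear_snd])
  have "pb = (\<lambda>a b. \<kappa> * (fst a \<bullet> fst b) - snd a * snd b)" by (simp add: pb_def fun_eq_iff)
  moreover obtain K1 where K1: "\<And>(a :: 'w \<times> real) (b :: 'w \<times> real). norm (\<kappa> * (fst a \<bullet> fst b)) \<le> norm a * norm b * K1"
    using bounded_bilinear.bounded[OF 1] by blast
  obtain K2 where K2: "\<And>(a :: 'w \<times> real) (b :: 'w \<times> real). norm (snd a * snd b) \<le> norm a * norm b * K2"
    using bounded_bilinear.bounded[OF 2] by blast
  show ?thesis
  proof (rule bounded_bilinear.intro)
    show "\<exists>K. \<forall>a b. norm (pb a b) \<le> norm a * norm b * K"
    proof (intro exI allI)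
      fix a b :: "'w \<times> real"
      show "norm (pb a b) \<le> norm a * norm b * (K1 + K2)"
        using K1[of a b] K2[of a b] norm_triangle_ineq4[of "\<kappa> * (fst a \<bullet> fst b)" "snd a * snd b"]
        by (simp add: pb_def distrib_left)
    qed
  qed (simp_all add: pb_def inner_add_left inner_add_right algebra_simps)
qed

lemma pb_commute: "pb a b = pb b a"
  by (simp add: pb_def inner_commute)

lemma zero_in_tangent: "p \<in> A \<Longrightarrow> 0 \<in> tangent A p"
  by (rule tangentI[where \<gamma> = "\<lambda>_. p"]) auto

text \<open>Tangent spaces of \<open>N\<close> are products, so normality can be tested separately
  on \<open>(0, 1)\<close> and on spatial vectors.\<close>

lemma pb_normal_iff:
  assumes "q \<in> N"
  shows "(\<forall>\<xi>\<in>tangent N q. pb z \<xi> = 0) \<longleftrightarrow> snd z = 0 \<and> (\<forall>\<eta>\<in>tangent M (fst q). fst z \<bullet> \<eta> = 0)"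
proof
  assume h: "\<forall>\<xi>\<in>tangent N q. pb z \<xi> = 0"
  have t: "(\<eta>, \<tau>) \<in> tangent N q" if "\<eta> \<in> tangent M (fst q)" for \<eta> \<tau>
    using that tangent_prod_UNIV[of \<eta> \<tau> M "fst q" "snd q"] by simp
  have "(0, 1) \<in> tangent N q" using assms by (intro t zero_in_tangent) auto
  then have "snd z = 0" using h by (auto simp: pb_def)
  moreover have "fst z \<bullet> \<eta> = 0" if "\<eta> \<in> tangent M (fst q)" for \<eta>
    using h t[OF that, of 0] kpos by (auto simp: pb_def)
  ultimately show "snd z = 0 \<and> (\<forall>\<eta>\<in>tangent M (fst q). fst z \<bullet> \<eta> = 0)" by blast
next
  assume h: "snd z = 0 \<and> (\<forall>\<eta>\<in>tangent M (fst q). fst z \<bullet> \<eta> = 0)"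
  show "\<forall>\<xi>\<in>tangent N q. pb z \<xi> = 0"
  proof
    fix \<xi> assume "\<xi> \<in> tangent N q"
    then have "fst \<xi> \<in> tangent M (fst q)"
      using tangent_prod_UNIV[of "fst \<xi>" "snd \<xi>" M "fst q" "snd q"] by simp
    then show "pb z \<xi> = 0" using h by (simp add: pb_def)
  qed
qed

lemma tangent_shift: "shift' \<alpha> z ` tangent N z = tangent N (shift \<alpha> z)"
proof
  show "shift' \<alpha> z ` tangent N z \<subseteq> tangent N (shift \<alpha> z)" for \<alpha> z
    using tangent_image[OF _ shift_has_derivative shift_N] by blast
  then have *: "shift' (- \<alpha>) (shift \<alpha> z) ` tangent N (shift \<alpha> z) \<subseteq> tangent N z"
    using shift_inverse[of "- \<alpha>" z] by (metis minus_minus)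
  show "tangent N (shift \<alpha> z) \<subseteq> shift' \<alpha> z ` tangent N z"
  proof
    fix \<xi> assume "\<xi> \<in> tangent N (shift \<alpha> z)"
    then have "shift' (- \<alpha>) (shift \<alpha> z) \<xi> \<in> tangent N z" using * by blast
    moreover have "shift' \<alpha> z (shift' (- \<alpha>) (shift \<alpha> z) \<xi>) = \<xi>"
      using shift'_inverse[of \<alpha> "shift \<alpha> z" \<xi>] shift_inverse[of "- \<alpha>" z] by simp
    ultimately show "\<xi> \<in> shift' \<alpha> z ` tangent N z" by (metis imageI)
  qed
qed

context
  fixes B U \<phi> and \<alpha> :: real
  assumes lp: "local_param N B U \<phi>"
begin

lemma Ck_shifted_param: "Ck_on k U (\<lambda>u. shift (- \<alpha>) (\<phi> u))"
proof -
  have o: "open U" and c: "Ck_on k U \<phi>" using lp by (auto simp: local_param_def smooth_on_def)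
  have c1: "Ck_on k U (\<lambda>u. fst (\<phi> u))" and c2: "Ck_on k U (\<lambda>u. snd (\<phi> u))"
    by (rule Ck_on_linear_comp[OF o bounded_linear_fst c], rule Ck_on_linear_comp[OF o bounded_linear_snd c])
  have 1: "Ck_on k U (\<lambda>u. (flow (- \<alpha> * snd (\<phi> u)) (fst (\<phi> u)), 0::real))"
    by (rule Ck_on_linear_comp[OF o, where L = "\<lambda>x. (x, 0)", OF _ Ck_on_flow[OF o c1 c2]])
       (auto intro!: bounded_linear_intro[where K = 1] simp: norm_Pair)
  have 2: "Ck_on k U (\<lambda>u. (0::'w, snd (\<phi> u)))"
    by (rule Ck_on_linear_comp[OF o, where L = "\<lambda>x. (0, x)", OF _ c2])
       (auto intro!: bounded_linear_intro[where K = 1] simp: norm_Pair)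
  show ?thesis using Ck_on_add[OF o 1 2] by (simp add: shift_def)
qed

lemma shifted_param_derivative:
  assumes "u \<in> U"
  shows "frechet_derivative (\<lambda>u. shift (- \<alpha>) (\<phi> u)) (at u) h =
    shift' (- \<alpha>) (\<phi> u) (frechet_derivative \<phi> (at u) h)"
proof -
  have c: "Ck_on (Suc 0) U \<phi>" using lp unfolding local_param_def smooth_on_def by blast
  have "((\<lambda>u. shift (- \<alpha>) (\<phi> u)) has_derivative
      (\<lambda>h. shift' (- \<alpha>) (\<phi> u) (frechet_derivative \<phi> (at u) h))) (at u)"
    by (rule has_derivative_compose[OF Ck_on_SucD(1)[OF c assms] shift_has_derivative])
  then show ?thesis using frechet_derivative_at by metis
qed

lemma pulled_back: "pulled_back_metric (lm \<alpha>) B U \<phi> pb (\<lambda>u. shift (- \<alpha>) (\<phi> u))"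
proof (rule pulled_back_metric.intro)
  show "B \<subseteq> Basis" "open U" using lp by (auto simp: local_param_def)
  show "Ck_on (Suc (Suc 0)) U (\<lambda>u. shift (- \<alpha>) (\<phi> u))" by (rule Ck_shifted_param)
  show "metric_coeff (lm \<alpha>) \<phi> i j u =
       pb (frechet_derivative (\<lambda>u. shift (- \<alpha>) (\<phi> u)) (at u) i)
          (frechet_derivative (\<lambda>u. shift (- \<alpha>) (\<phi> u)) (at u) j)"
    if "u \<in> U \<inter> span B" for u i j
    using that by (simp add: shifted_param_derivative metric_coeff_def lm_shift)
qed (rule pb_bilinear pb_commute)+

lemma shifted_param_range:
  assumes u: "u \<in> U \<inter> span B"
  shows "frechet_derivative (\<lambda>u. shift (- \<alpha>) (\<phi> u)) (at u) ` span B = tangent N (shift (- \<alpha>) (\<phi> u))"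
proof -
  have "frechet_derivative (\<lambda>u. shift (- \<alpha>) (\<phi> u)) (at u) ` span B
      = shift' (- \<alpha>) (\<phi> u) ` frechet_derivative \<phi> (at u) ` span B"
    using u by (auto simp: shifted_param_derivative image_image)
  then show ?thesis by (simp add: tangent_local_param[OF lp u, symmetric] tangent_shift)
qed

lemma normal_span_iff:
  assumes u: "u \<in> U \<inter> span B"
  shows "(\<forall>l\<in>B. pb z (frechet_derivative (\<lambda>u. shift (- \<alpha>) (\<phi> u)) (at u) l) = 0) \<longleftrightarrow>
    (\<forall>\<xi>\<in>tangent N (shift (- \<alpha>) (\<phi> u)). pb z \<xi> = 0)"
proof -
  let ?D = "frechet_derivative (\<lambda>u. shift (- \<alpha>) (\<phi> u)) (at u)"
  have "linear ?D"
    using bounded_linear_frechet_derivative[OF Ck_shifted_param[of "Suc 0"]] u bounded_linear.linear by blast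
  moreover have "linear (pb z)" by (rule bounded_linear.linear[OF bounded_bilinear.bounded_linear_right[OF pb_bilinear]])
  ultimately have l: "linear (\<lambda>h. pb z (?D h))" using linear_compose by (auto simp: o_def)
  have "(\<forall>l\<in>B. pb z (?D l) = 0) \<longleftrightarrow> (\<forall>h\<in>span B. pb z (?D h) = 0)"
  proof
    assume "\<forall>l\<in>B. pb z (?D l) = 0"
    then show "\<forall>h\<in>span B. pb z (?D h) = 0"
      using linear_eq_0_on_span[OF l] by blast
  qed (auto intro: span_base)
  then show ?thesis unfolding shifted_param_range[OF u, symmetric] by blast
qed

text \<open>A tangent vector normal to all tangent vectors has no time component, and its spatial
  part is tangent to \<open>M\<close> and hence orthogonal to itself.\<close>

lemma nondegenerate:
  assumes u: "u \<in> U \<inter> span B"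
  shows "pulled_back_metric.nondegenerate_at B pb (\<lambda>u. shift (- \<alpha>) (\<phi> u)) u"
  unfolding pulled_back_metric.nondegenerate_at_def[OF pulled_back]
proof (intro ballI impI)
  fix h assume h: "h \<in> span B" and 0: "\<forall>l\<in>B. pb (frechet_derivative (\<lambda>u. shift (- \<alpha>) (\<phi> u)) (at u) h)
           (frechet_derivative (\<lambda>u. shift (- \<alpha>) (\<phi> u)) (at u) l) = 0"
  define z where "z = frechet_derivative (\<lambda>u. shift (- \<alpha>) (\<phi> u)) (at u) h"
  have N: "shift (- \<alpha>) (\<phi> u) \<in> N" by (rule shift_N[OF local_param_range[OF lp u]])
  have "z \<in> tangent N (shift (- \<alpha>) (\<phi> u))" using h shifted_param_range[OF u] z_def by blast
  then have zt: "fst z \<in> tangent M (fst (shift (- \<alpha>) (\<phi> u)))"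
    using tangent_prod_UNIV by (metis prod.collapse)
  have "\<forall>\<xi>\<in>tangent N (shift (- \<alpha>) (\<phi> u)). pb z \<xi> = 0" using 0 normal_span_iff[OF u, of z] by (simp add: z_def)
  then have "snd z = 0" "fst z \<bullet> fst z = 0" using zt unfolding pb_normal_iff[OF N] by auto
  then have "z = 0" by (simp add: prod_eq_iff)
  then have "shift' (- \<alpha>) (\<phi> u) (frechet_derivative \<phi> (at u) h) = 0"
    using u by (simp add: z_def shifted_param_derivative)
  then have "frechet_derivative \<phi> (at u) h = shift' \<alpha> (shift (- \<alpha>) (\<phi> u)) 0"
    using shift'_inverse[of \<alpha> "\<phi> u" "frechet_derivative \<phi> (at u) h"] by simp
  also have "\<dots> = 0" using linear_0[OF bounded_linear.linear[OF bounded_linear_flow]]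
    by (simp add: shift'_def prod_eq_iff)
  finally have "frechet_derivative \<phi> (at u) h = 0" .
  moreover have "inj_on (frechet_derivative \<phi> (at u)) (span B)" using lp u by (simp add: local_param_def)
  moreover have "frechet_derivative \<phi> (at u) 0 = 0"
    using linear_0[OF bounded_linear.linear[OF bounded_linear_frechet_derivative[of 0 U \<phi> u]]] lp u
    unfolding local_param_def smooth_on_def by blast
  ultimately show "h = 0" using h span_zero by (metis inj_onD)
qed

end

text \<open>Undoing the flow turns the stationary metric into the product metric, whose geodesics have
  an affine time component and an acceleration normal to \<open>M\<close>.\<close>
definition unwound_geodesic :: "real \<Rightarrow> (real \<Rightarrow> 'w \<times> real) \<Rightarrow> (real \<Rightarrow> 'w \<times> real) \<Rightarrow> (real \<Rightarrow> 'w \<times> real) \<Rightarrow> bool" where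
  "unwound_geodesic \<alpha> c z1 z2 \<longleftrightarrow> (\<forall>s\<in>I01.
     ((\<lambda>s. shift (- \<alpha>) (c s)) has_vector_derivative z1 s) (at s within I01) \<and>
     (z1 has_vector_derivative z2 s) (at s within I01) \<and>
     snd (z2 s) = 0 \<and> (\<forall>\<eta>\<in>tangent M (fst (shift (- \<alpha>) (c s))). fst (z2 s) \<bullet> \<eta> = 0))"

lemma geodesic_unwound:
  assumes g: "geodesic_on N (lm \<alpha>) I01 c"
  shows "\<exists>z1 z2. unwound_geodesic \<alpha> c z1 z2"
proof -
  define z where "z = (\<lambda>s. shift (- \<alpha>) (c s))"
  \<comment> \<open>The parametrisation provided by \<open>geodesic_on\<close> depends on
    \<open>s\<close>; with derivatives of \<open>z\<close> taken globally, the local computations at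
    different \<open>s\<close> speak of the same functions.\<close>
  define z1 where "z1 = velocity I01 z"
  define z2 where "z2 = velocity I01 z1"
  have "(z has_vector_derivative z1 s) (at s within I01) \<and>
     (z1 has_vector_derivative z2 s) (at s within I01) \<and>
     snd (z2 s) = 0 \<and> (\<forall>\<eta>\<in>tangent M (fst (z s)). fst (z2 s) \<bullet> \<eta> = 0)" if s: "s \<in> I01" for s
  proof -
    note gs = bspec[OF g[unfolded geodesic_on_def, THEN conjunct2, THEN conjunct2] s]
    obtain B U \<phi> J u w a where lp: "local_param N B U \<phi>" and J: "open J" "s \<in> J"
      and u0: "\<forall>r\<in>J \<inter> I01. u r \<in> U \<inter> span B \<and> \<phi> (u r) = c r \<and>
           (u has_vector_derivative w r) (at r within I01)"
      and w: "(w has_vector_derivative a) (at s within I01)"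
      and eq: "a + (\<Sum>i\<in>B. \<Sum>j\<in>B. ((w s \<bullet> i) * (w s \<bullet> j)) *\<^sub>R christoffel (lm \<alpha>) B \<phi> i j (u s)) = 0"
      using gs by (elim exE conjE) (rule that)
    have u: "u r \<in> U \<inter> span B" "\<phi> (u r) = c r" "(u has_vector_derivative w r) (at r within I01)"
      if "r \<in> J" "r \<in> I01" for r
      using bspec[OF u0 IntI[OF that]] by blast+
    interpret pulled_back_metric "lm \<alpha>" B U \<phi> pb "\<lambda>u. shift (- \<alpha>) (\<phi> u)"
      by (rule pulled_back[OF lp])
    let ?f = "\<lambda>u. shift (- \<alpha>) (\<phi> u)"
    let ?D = "\<lambda>u. frechet_derivative ?f (at u)"
    have us: "u s \<in> U \<inter> span B" by (rule u(1)[OF J(2) s])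
    have w_span: "w r \<in> span B" if r: "r \<in> J" "r \<in> I01" for r
      by (rule has_vector_derivative_in_subspace[OF u(3)[OF r] J(1) r])
         (use u(1) r at_within_I01_nontrivial in auto)
    have a_span: "a \<in> span B"
      by (rule has_vector_derivative_in_subspace[OF w J s])
         (use w_span s at_within_I01_nontrivial in auto)
    have uU: "\<And>r. r \<in> J \<Longrightarrow> r \<in> I01 \<Longrightarrow> u r \<in> U" using u(1) by blast
    have fz: "?f (u r) = z r" if "r \<in> J" "r \<in> I01" for r using u(2)[OF that] by (simp add: z_def)
    have d1: "(z has_vector_derivative ?D (u r) (w r)) (at r within I01)" if r: "r \<in> J" "r \<in> I01" for r
      by (rule has_vector_derivative_cong_open[OF
            chain_second_derivative(1)[OF oU Cf J s uU u(3) w r] J(1) r fz])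
    have z1: "z1 r = ?D (u r) (w r)" if "r \<in> J" "r \<in> I01" for r
      unfolding z1_def by (rule velocity_I01[OF d1[OF that] that(2)])
    have d2: "(z1 has_vector_derivative ?D (u s) a + hess ?f (u s) (w s) (w s)) (at s within I01)"
      by (rule has_vector_derivative_cong_open[OF
            chain_second_derivative(2)[OF oU Cf J s uU u(3) w] J s]) (simp_all only: z1)
    have z2: "z2 s = ?D (u s) a + hess ?f (u s) (w s) (w s)"
      unfolding z2_def by (rule velocity_I01[OF d2 s])
    have "\<forall>l\<in>B. pb (z2 s) (?D (u s) l) = 0"
      unfolding z2
      by (rule iffD1[OF geodesic_equation_iff[OF us nondegenerate[OF lp us] a_span w_span[OF J(2) s]] eq])
    then have "\<forall>\<xi>\<in>tangent N (z s). pb (z2 s) \<xi> = 0"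
      unfolding normal_span_iff[OF lp us] using fz[OF J(2) s] by simp
    moreover have "z s \<in> N"
      using shift_N[OF local_param_range[OF lp us], of "- \<alpha>"] fz[OF J(2) s] by simp
    ultimately have "snd (z2 s) = 0 \<and> (\<forall>\<eta>\<in>tangent M (fst (z s)). fst (z2 s) \<bullet> \<eta> = 0)"
      using pb_normal_iff[OF \<open>z s \<in> N\<close>] by simp
    then show ?thesis using d1[OF J(2) s] d2 z1[OF J(2) s] z2 by simp
  qed
  then show ?thesis unfolding unwound_geodesic_def z_def by blast
qed

text \<open>\<open>geodesic_on\<close> asks for coordinates with two derivatives. They are obtained
  by applying the inverse of a product chart to \<open>c\<close>; the equivalence with the geodesic
  equation is then read backwards.\<close>

lemma unwound_imp_geodesic:
  assumes sm: "smooth_curve_on I01 c" and cN: "\<And>s. s \<in> I01 \<Longrightarrow> c s \<in> N"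
    and g: "unwound_geodesic \<alpha> c z1 z2"
  shows "geodesic_on N (lm \<alpha>) I01 c"
  unfolding geodesic_on_def
proof (intro conjI ballI)
  show "smooth_curve_on I01 c" "c ` I01 \<subseteq> N" using sm cN by blast+
  fix s assume s: "s \<in> I01"
  define c1 where "c1 = velocity I01 c"
  define c2 where "c2 = velocity I01 c1"
  have "c differentiable_on I01" using sm unfolding smooth_curve_on_def by (metis funpow_0)
  moreover have "c1 differentiable_on I01"
    using sm[unfolded smooth_curve_on_def, rule_format, of "Suc 0"] by (simp add: c1_def)
  ultimately have c1: "\<And>r. r \<in> I01 \<Longrightarrow> (c has_vector_derivative c1 r) (at r within I01)"
    and c2: "\<And>r. r \<in> I01 \<Longrightarrow> (c1 has_vector_derivative c2 r) (at r within I01)"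
    unfolding c1_def c2_def velocity_def differentiable_on_def by (auto simp: vector_derivative_works)
  have "fst (c s) \<in> M" using cN[OF s] by (simp add: mem_Times_iff)
  from charts[OF this] obtain B0 U0 \<phi>0 W0 \<psi>0 where c0: "smooth_chart M B0 U0 \<phi>0 W0 \<psi>0" "fst (c s) \<in> W0"
    by blast
  obtain B U \<phi> W \<psi> where ch: "smooth_chart N B U \<phi> W \<psi>" "c s \<in> W"
    by (rule that[OF smooth_chart_Times_UNIV[OF c0(1)]]) (simp add: c0(2) mem_Times_iff)
  have cc: "B \<subseteq> Basis" "open U" "open W" "\<And>k. Ck_on k W \<psi>"
     "\<phi> ` (U \<inter> span B) = N \<inter> W" "\<And>u. u \<in> U \<inter> span B \<Longrightarrow> \<psi> (\<phi> u) = u"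
    using ch(1) by (auto simp: smooth_chart_def smooth_on_def)
  note lp = smooth_chart_local_param[OF ch(1)]
  interpret pulled_back_metric "lm \<alpha>" B U \<phi> pb "\<lambda>u. shift (- \<alpha>) (\<phi> u)"
    by (rule pulled_back[OF lp])
  let ?f = "\<lambda>u. shift (- \<alpha>) (\<phi> u)"
  let ?D = "\<lambda>u. frechet_derivative ?f (at u)"
  have "continuous_on I01 c"
    unfolding continuous_on_eq_continuous_within
    by (intro ballI has_vector_derivative_continuous[OF c1])
  from this[unfolded continuous_on_topological, rule_format, OF s cc(3) ch(2)] obtain J where J: "open J" "s \<in> J" and JW: "\<And>r. r \<in> J \<Longrightarrow> r \<in> I01 \<Longrightarrow> c r \<in> W"
    by blast
  define u where "u = (\<lambda>r. \<psi> (c r))"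
  define w where "w = (\<lambda>r. frechet_derivative \<psi> (at (c r)) (c1 r))"
  define a where "a = frechet_derivative \<psi> (at (c s)) (c2 s) + hess \<psi> (c s) (c1 s) (c1 s)"
  have u: "u r \<in> U \<inter> span B" "\<phi> (u r) = c r" "(u has_vector_derivative w r) (at r within I01)"
    if r: "r \<in> J" "r \<in> I01" for r
  proof -
    have "c r \<in> N \<inter> W" using JW[OF r] cN r by auto
    then have "c r \<in> \<phi> ` (U \<inter> span B)" unfolding cc(5) .
    then obtain v where v: "v \<in> U \<inter> span B" "c r = \<phi> v" by blast
    then show "u r \<in> U \<inter> span B" "\<phi> (u r) = c r" using cc(6) by (auto simp: u_def)
    show "(u has_vector_derivative w r) (at r within I01)"
      unfolding u_def w_def
      by (rule chain_second_derivative(1)[OF cc(3) cc(4) J s JW c1 c2[OF s] r])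
  qed
  have w: "(w has_vector_derivative a) (at s within I01)"
    unfolding w_def a_def by (rule chain_second_derivative(2)[OF cc(3) cc(4) J s JW c1 c2[OF s]])
  have us: "u s \<in> U \<inter> span B" by (rule u(1)[OF J(2) s])
  have w_span: "w r \<in> span B" if r: "r \<in> J" "r \<in> I01" for r
    by (rule has_vector_derivative_in_subspace[OF u(3)[OF r] J(1) r])
       (use u(1) r at_within_I01_nontrivial in auto)
  have a_span: "a \<in> span B"
    by (rule has_vector_derivative_in_subspace[OF w J s])
       (use w_span s at_within_I01_nontrivial in auto)
  have uU: "\<And>r. r \<in> J \<Longrightarrow> r \<in> I01 \<Longrightarrow> u r \<in> U" using u(1) by blast
  have d1: "((\<lambda>s. shift (- \<alpha>) (c s)) has_vector_derivative ?D (u r) (w r)) (at r within I01)" if r: "r \<in> J" "r \<in> I01" for r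
    by (rule has_vector_derivative_cong_open[OF
          chain_second_derivative(1)[OF oU Cf J s uU u(3) w r] J(1) r]) (simp_all only: u(2))
  have g1: "((\<lambda>s. shift (- \<alpha>) (c s)) has_vector_derivative z1 r) (at r within I01)"
     "(z1 has_vector_derivative z2 r) (at r within I01)"
     "snd (z2 r) = 0 \<and> (\<forall>\<eta>\<in>tangent M (fst (shift (- \<alpha>) (c r))). fst (z2 r) \<bullet> \<eta> = 0)" if "r \<in> I01" for r
    using g that unfolding unwound_geodesic_def by auto
  have z1: "z1 r = ?D (u r) (w r)" if r: "r \<in> J" "r \<in> I01" for r
    by (rule vector_derivative_I01_unique[OF g1(1)[OF r(2)] d1[OF r] r(2)])
  have d2: "(z1 has_vector_derivative ?D (u s) a + hess ?f (u s) (w s) (w s)) (at s within I01)"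
    by (rule has_vector_derivative_cong_open[OF
          chain_second_derivative(2)[OF oU Cf J s uU u(3) w] J s]) (simp_all only: z1)
  have z2: "z2 s = ?D (u s) a + hess ?f (u s) (w s) (w s)"
    by (rule vector_derivative_I01_unique[OF g1(2)[OF s] d2 s])
  have "shift (- \<alpha>) (c s) \<in> N" by (rule shift_N[OF cN[OF s]])
  from pb_normal_iff[OF this] have "\<forall>\<xi>\<in>tangent N (shift (- \<alpha>) (c s)). pb (z2 s) \<xi> = 0"
    using g1(3)[OF s] by simp
  then have "\<forall>l\<in>B. pb (z2 s) (?D (u s) l) = 0"
    unfolding normal_span_iff[OF lp us] using u(2)[OF J(2) s] by simp
  then have "a + (\<Sum>i\<in>B. \<Sum>j\<in>B. ((w s \<bullet> i) * (w s \<bullet> j)) *\<^sub>R christoffel (lm \<alpha>) B \<phi> i j (u s)) = 0"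
    unfolding z2
    by (rule iffD2[OF geodesic_equation_iff[OF us nondegenerate[OF lp us] a_span w_span[OF J(2) s]]])
  moreover have "\<forall>r\<in>J \<inter> I01. u r \<in> U \<inter> span B \<and> \<phi> (u r) = c r \<and>
           (u has_vector_derivative w r) (at r within I01)" using u by blast
  ultimately show "\<exists>B U \<phi> J u w a. local_param N B U \<phi> \<and> open J \<and> s \<in> J \<and>
        (\<forall>r\<in>J \<inter> I01. u r \<in> U \<inter> span B \<and> \<phi> (u r) = c r \<and>
           (u has_vector_derivative w r) (at r within I01)) \<and>
        (w has_vector_derivative a) (at s within I01) \<and>
        a + (\<Sum>i\<in>B. \<Sum>j\<in>B. ((w s \<bullet> i) * (w s \<bullet> j)) *\<^sub>R christoffel (lm \<alpha>) B \<phi> i j (u s)) = 0"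
    using lp J w by (intro exI conjI)
qed

lemma gen_tangent: "x \<in> M \<Longrightarrow> gen x \<in> tangent M x"
proof (rule tangentI[where \<gamma> = "\<lambda>s. flow s x"])
  show "((\<lambda>s. flow s x) has_vector_derivative gen x) (at 0)"
    using flow_has_vector_derivative[of "\<lambda>_. x" 0 0 UNIV "\<lambda>s. s" 1 1] by (simp add: has_vector_derivative_id)
qed (auto simp: flow_M)

lemma killing: "killing_field M (\<lambda>x v w. \<kappa> * (v \<bullet> w)) gen"
  by (rule killing_fieldI[OF bounded_linear_gen gen_skew gen_tangent charts])

end

section \<open>Classification of the periodic light rays\<close>

lemma smooth_curve_velocity:
  assumes "smooth_curve_on I01 c" "s \<in> I01"
  shows "((velocity I01 ^^ k) c has_vector_derivative (velocity I01 ^^ Suc k) c s) (at s within I01)"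
proof -
  have "(velocity I01 ^^ k) c differentiable (at s within I01)"
    using assms unfolding smooth_curve_on_def differentiable_on_def by blast
  then show ?thesis by (simp add: vector_derivative_works velocity_def)
qed

lemma constant_on_I01:
  fixes g :: "real \<Rightarrow> 'a::real_normed_vector"
  assumes "\<And>s. s \<in> I01 \<Longrightarrow> (g has_vector_derivative 0) (at s within I01)" "s \<in> I01"
  shows "g s = g 0"
proof -
  obtain k where "\<And>x. x \<in> I01 \<Longrightarrow> g x = k"
    using has_vector_derivative_zero_constant[of I01 g] assms(1) by auto
  then show ?thesis using assms(2) by simp
qed

text \<open>\<open>y + (1 / T^2) y2\<close> is a first integral and gives the centre
  \<open>C\<close>; the pair of \<open>y - C\<close> and \<open>y1 / T\<close>, rotated back by the
  angle \<open>T * s\<close>, is constant and gives \<open>X\<close> and \<open>Y\<close>.\<close>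

lemma harmonic_motion:
  fixes y :: "real \<Rightarrow> 'a::real_normed_vector"
  assumes T: "T \<noteq> 0"
    and d: "\<And>s. s \<in> I01 \<Longrightarrow> (y has_vector_derivative y1 s) (at s within I01)"
      "\<And>s. s \<in> I01 \<Longrightarrow> (y1 has_vector_derivative y2 s) (at s within I01)"
      "\<And>s. s \<in> I01 \<Longrightarrow> (y2 has_vector_derivative - (T\<^sup>2) *\<^sub>R y1 s) (at s within I01)"
  shows "\<exists>C X Y. \<forall>s\<in>I01. y s = C + cos (T * s) *\<^sub>R X + sin (T * s) *\<^sub>R Y"
proof -
  define C where "C = y 0 + (1 / T\<^sup>2) *\<^sub>R y2 0"
  have "((\<lambda>s. y s + (1 / T\<^sup>2) *\<^sub>R y2 s) has_vector_derivative 0) (at s within I01)" if "s \<in> I01" for s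
    by (rule has_vector_derivative_eq_rhs, rule has_vector_derivative_add[OF d(1)[OF that]],
        rule bounded_linear.has_vector_derivative[OF bounded_linear_scaleR_right d(3)[OF that]])
       (use T in simp)
  then have "y s + (1 / T\<^sup>2) *\<^sub>R y2 s = C" if "s \<in> I01" for s
    unfolding C_def by (rule constant_on_I01[OF _ that])
  then have y2: "y2 s = T\<^sup>2 *\<^sub>R (C - y s)" if "s \<in> I01" for s
    using that T by (metis (no_types, lifting) add_diff_cancel_left' divide_self_if mult.commute
        power_not_zero scaleR_one scaleR_scaleR times_divide_eq_right mult.right_neutral)
  define X where "X = (\<lambda>s. cos (T * s) *\<^sub>R (y s - C) - (sin (T * s) / T) *\<^sub>R y1 s)"
  define Y where "Y = (\<lambda>s. sin (T * s) *\<^sub>R (y s - C) + (cos (T * s) / T) *\<^sub>R y1 s)"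
  have dc: "((\<lambda>s. cos (T * s)) has_real_derivative - (T * sin (T * s))) (at s within I01)"
    and ds: "((\<lambda>s. sin (T * s)) has_real_derivative T * cos (T * s)) (at s within I01)"
    and dc': "((\<lambda>s. cos (T * s) / T) has_real_derivative - sin (T * s)) (at s within I01)"
    and ds': "((\<lambda>s. sin (T * s) / T) has_real_derivative cos (T * s)) (at s within I01)" for s
    using T by (auto intro!: derivative_eq_intros)
  have dy: "((\<lambda>s. y s - C) has_vector_derivative y1 s) (at s within I01)" if "s \<in> I01" for s
    using has_vector_derivative_diff[OF d(1)[OF that] has_vector_derivative_const] by simp
  have "(X has_vector_derivative 0) (at s within I01)" if s: "s \<in> I01" for s
    unfolding X_def
    by (rule has_vector_derivative_eq_rhs, rule has_vector_derivative_diff,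
        rule has_vector_derivative_scaleR[OF dc dy[OF s]], rule has_vector_derivative_scaleR[OF ds' d(2)[OF s]])
       (use T in \<open>simp add: y2[OF s] power2_eq_square algebra_simps\<close>)
  then have X: "X s = X 0" if "s \<in> I01" for s by (rule constant_on_I01[OF _ that])
  have "(Y has_vector_derivative 0) (at s within I01)" if s: "s \<in> I01" for s
    unfolding Y_def
    by (rule has_vector_derivative_eq_rhs, rule has_vector_derivative_add,
        rule has_vector_derivative_scaleR[OF ds dy[OF s]], rule has_vector_derivative_scaleR[OF dc' d(2)[OF s]])
       (use T in \<open>simp add: y2[OF s] power2_eq_square algebra_simps\<close>)
  then have Y: "Y s = Y 0" if "s \<in> I01" for s by (rule constant_on_I01[OF _ that])
  have "cos (T * s) *\<^sub>R X s + sin (T * s) *\<^sub>R Y s = y s - C" for s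
  proof -
    have id: "a *\<^sub>R (a *\<^sub>R v - (b / T) *\<^sub>R q) + b *\<^sub>R (b *\<^sub>R v + (a / T) *\<^sub>R q) = (a * a + b * b) *\<^sub>R v" for a b and v q :: 'a
      by (simp add: algebra_simps)
    have "cos (T * s) *\<^sub>R X s + sin (T * s) *\<^sub>R Y s
       = (cos (T * s) * cos (T * s) + sin (T * s) * sin (T * s)) *\<^sub>R (y s - C)"
      unfolding X_def Y_def by (rule id)
    also have "cos (T * s) * cos (T * s) + sin (T * s) * sin (T * s) = 1"
      by (simp add: power2_eq_square[symmetric])
    finally show ?thesis by simp
  qed
  then have "y s = C + cos (T * s) *\<^sub>R X 0 + sin (T * s) *\<^sub>R Y 0" if "s \<in> I01" for s
    using X[OF that] Y[OF that] by (metis add.assoc add_diff_cancel_left' diff_add_cancel add.commute)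
  then show ?thesis by blast
qed

lemma cis_eq_one: "cis x = 1 \<Longrightarrow> \<exists>k::int. x = 2 * pi * k"
proof -
  assume "cis x = 1"
  then have "cos x = 1" by (metis cis.simps(1) one_complex.simps(1))
  then obtain k :: int where "x = of_int k * 2 * pi" by (auto simp: cos_one_2pi_int)
  then show ?thesis by (intro exI[of _ k]) simp
qed

text \<open>Cross-multiplication gives \<open>\<alpha> * (a * k - b * j) = q * j - p * k\<close>,
  where everything but \<open>\<alpha>\<close> is rational; so both sides vanish and
  \<open>r\<close> is \<open>k / j\<close>. For \<open>j = 0\<close> one would have
  \<open>\<alpha> * a = - p\<close> with \<open>p\<close> nonzero, against irrationality.\<close>

lemma irrational_frequencies:
  fixes \<alpha> T a b p q :: real and j k :: int
  assumes irr: "\<alpha> \<notin> \<rat>" and T: "T > 0" and rat: "a \<in> \<rat>" "b \<in> \<rat>" "p \<in> \<rat>" "q \<in> \<rat>" and p: "p \<noteq> 0"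
    and 1: "(\<alpha> * a + p) * T = 2 * pi * j" and 2: "(\<alpha> * b + q) * T = 2 * pi * k"
  shows "\<exists>r. b = r * a \<and> q = r * p"
proof -
  have ra: "u = 0" if "\<alpha> * u = v" "u \<in> \<rat>" "v \<in> \<rat>" for u v
    using that irr by (metis Rats_divide nonzero_mult_div_cancel_right)
  have "j \<noteq> 0"
  proof
    assume "j = 0"
    then have "\<alpha> * a = - p" using 1 T by simp
    then have "a = 0" using ra rat by auto
    then show False using \<open>\<alpha> * a = - p\<close> p by simp
  qed
  have "((\<alpha> * a + p) * k) * T = ((\<alpha> * b + q) * j) * T"
    using 1 2 by (metis mult.assoc mult.commute)
  then have "(\<alpha> * a + p) * k = (\<alpha> * b + q) * j" using T by simp
  then have eq: "\<alpha> * (a * k - b * j) = q * j - p * k" by (simp add: algebra_simps)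
  have "a * k - b * j = 0" by (rule ra[OF eq]) (use rat in auto)
  moreover from this have "q * j - p * k = 0" using eq by simp
  ultimately show ?thesis using \<open>j \<noteq> 0\<close>
    by (intro exI[of _ "real_of_int k / real_of_int j"]) (simp add: field_simps)
qed

text \<open>\<open>Q\<close> labels the elements and \<open>R\<close> is equality of labels, so the
  classes are the fibres of the labelling, all of them nonempty.\<close>

lemma card_quotient_classes:
  assumes uniq: "\<And>c. c \<in> A \<Longrightarrow> \<exists>!i. i \<in> I \<and> Q c i"
    and eqv: "\<And>c d. c \<in> A \<Longrightarrow> d \<in> A \<Longrightarrow> (c, d) \<in> R \<longleftrightarrow> (\<exists>i\<in>I. Q c i \<and> Q d i)"
    and sub: "R \<subseteq> A \<times> A" and ne: "\<And>i. i \<in> I \<Longrightarrow> \<exists>c\<in>A. Q c i"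
  shows "card (A // R) = card I"
proof -
  define cl where "cl = (\<lambda>i. {c \<in> A. Q c i})"
  have cls: "R `` {c} = cl i" if c: "c \<in> A" "i \<in> I" "Q c i" for c i
  proof (intro set_eqI iffI)
    fix d assume "d \<in> R `` {c}"
    then have cd: "(c, d) \<in> R" by simp
    then have "d \<in> A" using sub by blast
    with cd eqv[OF c(1)] obtain j where "j \<in> I" "Q c j" "Q d j" by blast
    then show "d \<in> cl i" using uniq[OF c(1)] c \<open>d \<in> A\<close> unfolding cl_def by blast
  next
    fix d assume "d \<in> cl i"
    then show "d \<in> R `` {c}" using eqv[OF c(1)] c unfolding cl_def by blast
  qed
  have "A // R = cl ` I"
  proof (intro set_eqI iffI)
    fix K assume "K \<in> A // R"
    then obtain c where c: "c \<in> A" "K = R `` {c}" by (rule quotientE)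
    obtain i where "i \<in> I" "Q c i" using uniq[OF c(1)] by blast
    then show "K \<in> cl ` I" using cls[OF c(1)] c(2) by blast
  next
    fix K assume "K \<in> cl ` I"
    then obtain i where i: "i \<in> I" "K = cl i" by blast
    obtain c where c: "c \<in> A" "Q c i" using ne[OF i(1)] by blast
    have "K = R `` {c}" using cls[OF c(1) i(1) c(2)] i(2) by simp
    then show "K \<in> A // R" using c(1) by (simp add: quotientI)
  qed
  moreover have "inj_on cl I"
  proof (rule inj_onI)
    fix i j assume ij: "i \<in> I" "j \<in> I" "cl i = cl j"
    then obtain c where "c \<in> A" "Q c i" using ne by blast
    moreover from this have "Q c j" using ij unfolding cl_def by blast
    ultimately show "i = j" using uniq ij by blast
  qed
  ultimately show ?thesis by (simp add: card_image)
qed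

text \<open>Point and velocity determine the acceleration up to a tangent vector, since the Hessian
  term in a chart depends on nothing else. Two normal accelerations thus differ by a vector
  orthogonal to itself. This compares the ends of a periodic ray, where the definition matches
  positions and velocities only.\<close>

lemma normal_acceleration_unique:
  assumes ch: "smooth_chart M B U \<phi> W \<psi>" "p \<in> W" "p \<in> M"
    and M: "\<And>s. s \<in> I01 \<Longrightarrow> y s \<in> M" "\<And>s. s \<in> I01 \<Longrightarrow> y' s \<in> M"
    and y: "\<And>s. s \<in> I01 \<Longrightarrow> (y has_vector_derivative y1 s) (at s within I01)"
      "\<And>s. s \<in> I01 \<Longrightarrow> (y1 has_vector_derivative y2 s) (at s within I01)"
    and y': "\<And>s. s \<in> I01 \<Longrightarrow> (y' has_vector_derivative y1' s) (at s within I01)"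
      "\<And>s. s \<in> I01 \<Longrightarrow> (y1' has_vector_derivative y2' s) (at s within I01)"
    and ab: "a \<in> I01" "b \<in> I01" "y a = p" "y' b = p" "y1 a = y1' b"
    and nor: "\<And>\<eta>. \<eta> \<in> tangent M p \<Longrightarrow> y2 a \<bullet> \<eta> = 0" "\<And>\<eta>. \<eta> \<in> tangent M p \<Longrightarrow> y2' b \<bullet> \<eta> = 0"
  shows "y2 a = y2' b"
proof -
  have cc: "B \<subseteq> Basis" "open U" "\<And>k. Ck_on k U \<phi>" "open W" "\<And>k. Ck_on k W \<psi>"
     "\<phi> ` (U \<inter> span B) = M \<inter> W" "\<And>u. u \<in> U \<inter> span B \<Longrightarrow> \<psi> (\<phi> u) = u"
    using ch(1) by (auto simp: smooth_chart_def smooth_on_def)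
  note lp = smooth_chart_local_param[OF ch(1)]
  have up: "\<psi> p \<in> U \<inter> span B" "\<phi> (\<psi> p) = p"
  proof -
    have "p \<in> \<phi> ` (U \<inter> span B)" using ch cc(6) by auto
    then obtain v where "v \<in> U \<inter> span B" "p = \<phi> v" by blast
    then show "\<psi> p \<in> U \<inter> span B" "\<phi> (\<psi> p) = p" using cc(7) by auto
  qed
  have key: "\<exists>a. a \<in> span B \<and> y2 s = frechet_derivative \<phi> (at (\<psi> p)) a
      + hess \<phi> (\<psi> p) (frechet_derivative \<psi> (at p) (y1 s)) (frechet_derivative \<psi> (at p) (y1 s))"
    if M: "\<And>s. s \<in> I01 \<Longrightarrow> y s \<in> M"
    and y: "\<And>s. s \<in> I01 \<Longrightarrow> (y has_vector_derivative y1 s) (at s within I01)"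
      "\<And>s. s \<in> I01 \<Longrightarrow> (y1 has_vector_derivative y2 s) (at s within I01)"
    and s: "s \<in> I01" "y s = p" for y y1 y2 s
  proof -
    have "continuous_on I01 y"
      unfolding continuous_on_eq_continuous_within
      by (intro ballI has_vector_derivative_continuous[OF y(1)])
    from this[unfolded continuous_on_topological, rule_format, OF s(1) cc(4)] s(2) ch(2)
    obtain J where J: "open J" "s \<in> J" and JW: "\<And>r. r \<in> J \<Longrightarrow> r \<in> I01 \<Longrightarrow> y r \<in> W" by blast
    define u where "u = (\<lambda>r. \<psi> (y r))"
    define w where "w = (\<lambda>r. frechet_derivative \<psi> (at (y r)) (y1 r))"
    define a where "a = frechet_derivative \<psi> (at (y s)) (y2 s) + hess \<psi> (y s) (y1 s) (y1 s)"
    have u: "u r \<in> U \<inter> span B" "\<phi> (u r) = y r" "(u has_vector_derivative w r) (at r within I01)"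
      if r: "r \<in> J" "r \<in> I01" for r
    proof -
      have "y r \<in> M \<inter> W" using JW[OF r] M r by auto
      then have "y r \<in> \<phi> ` (U \<inter> span B)" unfolding cc(6) .
      then obtain v where v: "v \<in> U \<inter> span B" "y r = \<phi> v" by blast
      then show "u r \<in> U \<inter> span B" "\<phi> (u r) = y r" using cc(7) by (auto simp: u_def)
      show "(u has_vector_derivative w r) (at r within I01)"
        unfolding u_def w_def
        by (rule chain_second_derivative(1)[OF cc(4) cc(5) J s(1) JW y(1) y(2)[OF s(1)] r])
    qed
    have w: "(w has_vector_derivative a) (at s within I01)"
      unfolding w_def a_def by (rule chain_second_derivative(2)[OF cc(4) cc(5) J s(1) JW y(1) y(2)[OF s(1)]])
    have w_span: "w r \<in> span B" if r: "r \<in> J" "r \<in> I01" for r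
      by (rule has_vector_derivative_in_subspace[OF u(3)[OF r] J(1) r])
         (use u(1) r at_within_I01_nontrivial in auto)
    have a_span: "a \<in> span B"
      by (rule has_vector_derivative_in_subspace[OF w J s(1)])
         (use w_span s at_within_I01_nontrivial in auto)
    have uU: "\<And>r. r \<in> J \<Longrightarrow> r \<in> I01 \<Longrightarrow> u r \<in> U" using u(1) by blast
    have d1: "(y has_vector_derivative frechet_derivative \<phi> (at (u r)) (w r)) (at r within I01)"
      if r: "r \<in> J" "r \<in> I01" for r
      by (rule has_vector_derivative_cong_open[OF
            chain_second_derivative(1)[OF cc(2) cc(3) J s(1) uU u(3) w r] J(1) r]) (simp_all only: u(2))
    have y1: "y1 r = frechet_derivative \<phi> (at (u r)) (w r)" if r: "r \<in> J" "r \<in> I01" for r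
      by (rule vector_derivative_I01_unique[OF y(1)[OF r(2)] d1[OF r] r(2)])
    have "(y1 has_vector_derivative frechet_derivative \<phi> (at (u s)) a + hess \<phi> (u s) (w s) (w s)) (at s within I01)"
      by (rule has_vector_derivative_cong_open[OF
            chain_second_derivative(2)[OF cc(2) cc(3) J s(1) uU u(3) w] J s(1)]) (simp_all only: y1)
    then have "y2 s = frechet_derivative \<phi> (at (u s)) a + hess \<phi> (u s) (w s) (w s)"
      by (rule vector_derivative_I01_unique[OF y(2)[OF s(1)] _ s(1)])
    then show ?thesis using a_span s(2) by (auto simp: u_def w_def)
  qed
  from key[OF M(1) y ab(1,3)] obtain v where v: "v \<in> span B" "y2 a = frechet_derivative \<phi> (at (\<psi> p)) v
      + hess \<phi> (\<psi> p) (frechet_derivative \<psi> (at p) (y1 a)) (frechet_derivative \<psi> (at p) (y1 a))" by blast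
  from key[OF M(2) y' ab(2,4)] obtain v' where v': "v' \<in> span B" "y2' b = frechet_derivative \<phi> (at (\<psi> p)) v'
      + hess \<phi> (\<psi> p) (frechet_derivative \<psi> (at p) (y1' b)) (frechet_derivative \<psi> (at p) (y1' b))" by blast
  have "linear (frechet_derivative \<phi> (at (\<psi> p)))"
    using bounded_linear_frechet_derivative[OF cc(3)[of "Suc 0"]] up(1) bounded_linear.linear by blast
  then have "y2 a - y2' b = frechet_derivative \<phi> (at (\<psi> p)) (v - v')"
    using v v' ab(5) by (simp add: linear_diff)
  then have "y2 a - y2' b \<in> tangent M p"
    using tangent_local_param[OF lp up(1)] up(2) v(1) v'(1) by (auto simp: span_diff)
  then have "(y2 a - y2' b) \<bullet> (y2 a - y2' b) = 0"
    using nor by (simp add: inner_diff_left)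
  then show ?thesis by simp
qed

text \<open>By \<open>geo\<close> the geodesics of \<open>M\<close> are circles. The circle about \<open>cen l\<close> in the plane of \<open>e l\<close> and
  \<open>f l\<close> is a closed geodesic by \<open>circle_M\<close> and \<open>circle_normal\<close>; \<open>rigid\<close> and \<open>single\<close> make it the only
  one whose nonconstant part lies in that plane.\<close>
locale light_model = stationary_model L e f \<theta> M \<kappa>
  for L :: "'l set" and e f :: "'l \<Rightarrow> 'w::euclidean_space" and \<theta> M \<kappa> +
  fixes cen :: "'l \<Rightarrow> 'w"
  assumes \<theta>_rat: "l \<in> L \<Longrightarrow> \<theta> l \<in> \<rat>" and \<theta>_nz: "l \<in> L \<Longrightarrow> \<theta> l \<noteq> 0"
    and \<theta>_inj: "inj_on (\<lambda>l. \<bar>\<theta> l\<bar>) L"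
    and bounded_M: "bounded M"
    and geo: "\<lbrakk>\<And>s. s \<in> I01 \<Longrightarrow> y s \<in> M;
      \<And>s. s \<in> I01 \<Longrightarrow> (y has_vector_derivative y1 s) (at s within I01);
      \<And>s. s \<in> I01 \<Longrightarrow> (y1 has_vector_derivative y2 s) (at s within I01);
      \<And>s. s \<in> I01 \<Longrightarrow> (y2 has_vector_derivative y3 s) (at s within I01);
      \<And>s \<eta>. s \<in> I01 \<Longrightarrow> \<eta> \<in> tangent M (y s) \<Longrightarrow> y2 s \<bullet> \<eta> = 0; s \<in> I01\<rbrakk>
      \<Longrightarrow> y3 s = - (\<kappa> * (y1 s \<bullet> y1 s)) *\<^sub>R y1 s"
    and rigid: "\<lbrakk>\<And>\<tau>::real. y \<tau> \<in> M; continuous_on UNIV y;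
      \<And>l \<tau>. l \<in> L \<Longrightarrow> (y \<tau> \<bullet> e l)\<^sup>2 + (y \<tau> \<bullet> f l)\<^sup>2 = r l\<rbrakk>
      \<Longrightarrow> \<exists>C. \<forall>\<tau>. y \<tau> = C + (\<Sum>l\<in>L. emb l (y \<tau> \<bullet> e l) (y \<tau> \<bullet> f l))"
    and single: "\<lbrakk>x \<in> M; l \<in> L; \<And>m. m \<in> L \<Longrightarrow> m \<noteq> l \<Longrightarrow> x \<bullet> e m = 0 \<and> x \<bullet> f m = 0;
      \<kappa> * ((x \<bullet> e l)\<^sup>2 + (x \<bullet> f l)\<^sup>2) = 1\<rbrakk> \<Longrightarrow> x = cen l + emb l (x \<bullet> e l) (x \<bullet> f l)"
    and circle_M: "\<lbrakk>l \<in> L; \<kappa> * (a\<^sup>2 + b\<^sup>2) = 1\<rbrakk> \<Longrightarrow> cen l + emb l a b \<in> M"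
    and cen_perp: "\<lbrakk>l \<in> L; m \<in> L\<rbrakk> \<Longrightarrow> cen l \<bullet> e m = 0 \<and> cen l \<bullet> f m = 0"
    and circle_normal: "\<lbrakk>l \<in> L; \<kappa> * (a\<^sup>2 + b\<^sup>2) = 1; v \<in> tangent M (cen l + emb l a b)\<rbrakk>
      \<Longrightarrow> emb l a b \<bullet> v = 0"
begin

text \<open>Complex coordinate in the plane \<open>l\<close>, on which the flow acts as
  multiplication by \<open>cis (\<theta> l * s)\<close>.\<close>

definition zc :: "'l \<Rightarrow> 'w \<Rightarrow> complex" where "zc l x = Complex (x \<bullet> e l) (x \<bullet> f l)"

definition E :: "'l \<Rightarrow> complex \<Rightarrow> 'w" where "E l z = emb l (Re z) (Im z)"

lemma zc_linear: "linear (zc l)"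
  by (rule linearI) (simp_all add: zc_def inner_add_left complex_eq_iff)

lemma E_linear: "linear (E l)"
  by (rule linearI) (simp_all add: E_def emb_def algebra_simps)

lemma zc_flow: "l \<in> L \<Longrightarrow> zc l (flow s x) = cis (\<theta> l * s) * zc l x"
  by (simp add: zc_def flow_inner complex_eq_iff)

lemma zc_E: "l \<in> L \<Longrightarrow> m \<in> L \<Longrightarrow> zc m (E l z) = (if l = m then z else 0)"
  by (simp add: zc_def E_def emb_inner complex_eq_iff)

lemma zc_cen: "l \<in> L \<Longrightarrow> m \<in> L \<Longrightarrow> zc m (cen l) = 0"
  by (simp add: zc_def cen_perp complex_eq_iff)

lemma E_inner: "l \<in> L \<Longrightarrow> E l z \<bullet> E l z = (cmod z)\<^sup>2"
  unfolding cmod_power2 by (simp add: E_def emb_def inner_add_left inner_add_right ee ff ef fe power2_eq_square)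

lemma flow_eqI:
  assumes "\<And>m. m \<in> L \<Longrightarrow> zc m x = 0"
  shows "flow s x = x"
  using assms by (simp add: flow_def zc_def emb_def complex_eq_iff)

lemma flow_circle:
  assumes l: "l \<in> L"
  shows "flow s (cen l + E l z) = cen l + E l (cis (\<theta> l * s) * z)"
proof -
  have "flow s (E l z) = E l (cis (\<theta> l * s) * z)"
  proof -
    have "flow s (E l z) = E l z + (\<Sum>m\<in>L. if m = l then emb l ((cos (\<theta> l * s) - 1) * Re z - sin (\<theta> l * s) * Im z)
     ((cos (\<theta> l * s) - 1) * Im z + sin (\<theta> l * s) * Re z) else 0)"
      unfolding flow_def using l
      by (intro arg_cong2[where f = "(+)"] sum.cong refl) (auto simp: E_def emb_inner, simp add: emb_def)
    then show ?thesis using l finL by (simp add: E_def emb_add algebra_simps)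
  qed
  moreover have "flow s (cen l) = cen l" by (rule flow_eqI) (simp add: zc_cen l)
  ultimately show ?thesis
    using linear_add[OF bounded_linear.linear[OF bounded_linear_flow]] by metis
qed

lemma shift_derivative:
  assumes "(c has_vector_derivative c') (at s within I01)"
  shows "((\<lambda>s. shift \<alpha> (c s)) has_vector_derivative shift' \<alpha> (c s) c') (at s within I01)"
  using vector_derivative_diff_chain_within[OF assms shift_has_derivative] by (simp add: o_def)

lemma flow_tangent: "\<eta> \<in> tangent M x \<Longrightarrow> flow s \<eta> \<in> tangent M (flow s x)"
  by (rule tangent_image[OF _ bounded_linear_imp_has_derivative[OF bounded_linear_flow] flow_M])

text \<open>At first the unwound curve is known only as an arc of a circle, over the parameter
  interval \<open>[0, T]\<close>. The isometry \<open>flow (\<alpha> * T)\<close> preserves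
  \<open>M\<close> and carries position, velocity and acceleration at the end of the arc to those at
  its beginning. This gives the equations for \<open>C\<close>, \<open>X\<close> and
  \<open>Y\<close>, and it continues the arc inside \<open>M\<close> to the whole circle.\<close>

lemma unwound_circle:
  assumes tp: "t_periodic M (lm \<alpha>) c"
  shows "\<exists>t0 T C X Y. T > 0 \<and>
     (\<forall>s\<in>I01. c s = (flow (\<alpha> * (t0 + T * s)) (C + cos (T * s) *\<^sub>R X + sin (T * s) *\<^sub>R Y), t0 + T * s)) \<and>
     (\<forall>\<tau>. C + cos \<tau> *\<^sub>R X + sin \<tau> *\<^sub>R Y \<in> M) \<and> \<kappa> * (Y \<bullet> Y) = 1 \<and>
     flow (\<alpha> * T) C = C \<and> flow (\<alpha> * T) (cos T *\<^sub>R X + sin T *\<^sub>R Y) = X \<and>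
     flow (\<alpha> * T) (cos T *\<^sub>R Y - sin T *\<^sub>R X) = Y"
proof -
  obtain T where ll: "lightlike_geodesic N (lm \<alpha>) c" and T: "T > 0" "fst (c 1) = fst (c 0)"
     "snd (c 1) = snd (c 0) + T" "velocity I01 c 1 = velocity I01 c 0"
    using tp unfolding t_periodic_def by blast
  have geod: "geodesic_on N (lm \<alpha>) I01 c" and
    null: "\<And>s. s \<in> I01 \<Longrightarrow> lm \<alpha> (c s) (velocity I01 c s) (velocity I01 c s) = 0"
    using ll unfolding lightlike_geodesic_def by auto
  have sm: "smooth_curve_on I01 c" and cN: "\<And>s. s \<in> I01 \<Longrightarrow> c s \<in> N"
    using geod unfolding geodesic_on_def by blast+
  define V where "V = (\<lambda>k. (velocity I01 ^^ k) c)"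
  have V: "(V k has_vector_derivative V (Suc k) s) (at s within I01)" if "s \<in> I01" for k s
    unfolding V_def by (rule smooth_curve_velocity[OF sm that])
  have V0: "V 0 = c" "V (Suc 0) = velocity I01 c" by (simp_all add: V_def)
  obtain z1 z2 where uw: "unwound_geodesic \<alpha> c z1 z2" using geodesic_unwound[OF geod] by blast
  define y where "y = (\<lambda>s. fst (shift (- \<alpha>) (c s)))"
  define t where "t = (\<lambda>s. snd (c s))"
  have z: "((\<lambda>s. shift (- \<alpha>) (c s)) has_vector_derivative z1 s) (at s within I01)"
     "(z1 has_vector_derivative z2 s) (at s within I01)" "snd (z2 s) = 0"
     "\<And>\<eta>. \<eta> \<in> tangent M (y s) \<Longrightarrow> fst (z2 s) \<bullet> \<eta> = 0" if "s \<in> I01" for s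
    using uw that unfolding unwound_geodesic_def y_def by auto
  have yd: "(y has_vector_derivative fst (z1 s)) (at s within I01)" if "s \<in> I01" for s
    unfolding y_def using bounded_linear.has_vector_derivative[OF bounded_linear_fst z(1)[OF that]] .
  have y1d: "((\<lambda>s. fst (z1 s)) has_vector_derivative fst (z2 s)) (at s within I01)" if "s \<in> I01" for s
    using bounded_linear.has_vector_derivative[OF bounded_linear_fst z(2)[OF that]] .
  have td: "(t has_vector_derivative snd (z1 s)) (at s within I01)" if "s \<in> I01" for s
    using bounded_linear.has_vector_derivative[OF bounded_linear_snd z(1)[OF that]]
    by (simp add: t_def shift_def)
  have t1d: "((\<lambda>s. snd (z1 s)) has_vector_derivative 0) (at s within I01)" if "s \<in> I01" for s
    using bounded_linear.has_vector_derivative[OF bounded_linear_snd z(2)[OF that]] z(3)[OF that] by simp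
  define t0 where "t0 = t 0"
  have t1c: "snd (z1 s) = snd (z1 0)" if "s \<in> I01" for s
    by (rule constant_on_I01[OF t1d that])
  have "((\<lambda>s. t s - s * snd (z1 0)) has_vector_derivative 0) (at s within I01)" if "s \<in> I01" for s
    by (rule has_vector_derivative_eq_rhs, rule has_vector_derivative_diff[OF td[OF that]])
       (auto intro!: derivative_eq_intros simp: t1c[OF that] simp flip: has_real_derivative_iff_has_vector_derivative)
  then have tt: "t s - s * snd (z1 0) = t 0" if "s \<in> I01" for s
    using constant_on_I01[of "\<lambda>s. t s - s * snd (z1 0)" s] that by simp
  have "snd (z1 0) = T" using tt[of 1] T(3) by (simp add: t_def)
  then have t1T: "snd (z1 s) = T" if "s \<in> I01" for s using t1c[OF that] by simp
  have ts: "t s = t0 + T * s" if "s \<in> I01" for s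
    using tt[OF that] \<open>snd (z1 0) = T\<close> by (simp add: t0_def algebra_simps)
  have yM: "y s \<in> M" if "s \<in> I01" for s
    using shift_N[OF cN[OF that]] unfolding y_def by (simp add: mem_Times_iff)
  have z1_eq: "z1 s = shift' (- \<alpha>) (c s) (velocity I01 c s)" if "s \<in> I01" for s
    using vector_derivative_I01_unique[OF z(1)[OF that] shift_derivative[OF V[of s 0, unfolded V0]] that] that
    by simp
  have speed: "\<kappa> * (fst (z1 s) \<bullet> fst (z1 s)) = T\<^sup>2" if "s \<in> I01" for s
    using null[OF that] t1T[OF that] unfolding lm_shift z1_eq[OF that, symmetric] pb_def
    by (simp add: power2_eq_square)
  define x where "x = (\<lambda>k s. fst (V k s))"
  have xd: "(x k has_vector_derivative x (Suc k) s) (at s within I01)" if "s \<in> I01" for k s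
    unfolding x_def by (rule bounded_linear.has_vector_derivative[OF bounded_linear_fst V[OF that]])
  \<comment> \<open>Successive derivatives of the unwound curve, carried back to the frame of
    \<open>x\<close>. They supply the third derivative, which \<open>unwound_geodesic\<close> does
    not contain.\<close>
  define X1 where "X1 = (\<lambda>k s. x (Suc k) s + (- \<alpha> * T) *\<^sub>R gen (x k s))"
  define X2 where "X2 = (\<lambda>k s. X1 (Suc k) s + (- \<alpha> * T) *\<^sub>R gen (X1 k s))"
  define X3 where "X3 = (\<lambda>s. X2 (Suc 0) s + (- \<alpha> * T) *\<^sub>R gen (X2 0 s))"
  have X1d: "(X1 k has_vector_derivative X1 (Suc k) s) (at s within I01)" if "s \<in> I01" for k s
    unfolding X1_def
    by (intro has_vector_derivative_add xd that
        bounded_linear.has_vector_derivative[OF bounded_linear_scaleR_right]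
        bounded_linear.has_vector_derivative[OF bounded_linear_gen])
  have X2d: "(X2 k has_vector_derivative X2 (Suc k) s) (at s within I01)" if "s \<in> I01" for k s
    unfolding X2_def
    by (intro has_vector_derivative_add X1d that
        bounded_linear.has_vector_derivative[OF bounded_linear_scaleR_right]
        bounded_linear.has_vector_derivative[OF bounded_linear_gen])
  have taff: "((\<lambda>s. t0 + T * s) has_vector_derivative T) (at s within I01)" for s
    by (auto intro!: derivative_eq_intros simp flip: has_real_derivative_iff_has_vector_derivative)
  have f0: "((\<lambda>s. flow (- \<alpha> * (t0 + T * s)) (x 0 s)) has_vector_derivative flow (- \<alpha> * (t0 + T * s)) (X1 0 s)) (at s within I01)"
    if "s \<in> I01" for s
    using flow_has_vector_derivative[OF xd[OF that, of 0] taff, of "- \<alpha>"] by (simp add: X1_def)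
  have f1: "((\<lambda>s. flow (- \<alpha> * (t0 + T * s)) (X1 0 s)) has_vector_derivative flow (- \<alpha> * (t0 + T * s)) (X2 0 s)) (at s within I01)"
    if "s \<in> I01" for s
    using flow_has_vector_derivative[OF X1d[OF that, of 0] taff, of "- \<alpha>"] by (simp add: X2_def)
  have f2: "((\<lambda>s. flow (- \<alpha> * (t0 + T * s)) (X2 0 s)) has_vector_derivative flow (- \<alpha> * (t0 + T * s)) (X3 s)) (at s within I01)"
    if "s \<in> I01" for s
    using flow_has_vector_derivative[OF X2d[OF that, of 0] taff, of "- \<alpha>"] by (simp add: X3_def)
  have y_flow: "y s = flow (- \<alpha> * (t0 + T * s)) (x 0 s)" if "s \<in> I01" for s
    using ts[OF that] by (simp add: y_def shift_def t_def x_def V0)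
  have y1_flow: "fst (z1 s) = flow (- \<alpha> * (t0 + T * s)) (X1 0 s)" if s: "s \<in> I01" for s
    by (rule vector_derivative_I01_unique[OF yd[OF s] has_vector_derivative_cong_open[OF f0[OF s] open_UNIV UNIV_I s] s])
       (simp add: y_flow)
  have y2_flow: "fst (z2 s) = flow (- \<alpha> * (t0 + T * s)) (X2 0 s)" if s: "s \<in> I01" for s
    by (rule vector_derivative_I01_unique[OF y1d[OF s] has_vector_derivative_cong_open[OF f1[OF s] open_UNIV UNIV_I s] s])
       (simp add: y1_flow)
  have y2d: "((\<lambda>s. fst (z2 s)) has_vector_derivative flow (- \<alpha> * (t0 + T * s)) (X3 s)) (at s within I01)" if s: "s \<in> I01" for s
    by (rule has_vector_derivative_cong_open[OF f2[OF s] open_UNIV UNIV_I s]) (simp add: y2_flow)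
  have y3: "flow (- \<alpha> * (t0 + T * s)) (X3 s) = - (T\<^sup>2) *\<^sub>R fst (z1 s)" if s: "s \<in> I01" for s
    using geo[OF yM yd y1d y2d z(4) s] speed[OF s] by simp
  obtain C X Y where CXY: "\<And>s. s \<in> I01 \<Longrightarrow> y s = C + cos (T * s) *\<^sub>R X + sin (T * s) *\<^sub>R Y"
    using harmonic_motion[OF _ yd y1d, of T] y2d y3 T(1) by force
  define Yh where "Yh = (\<lambda>\<tau>. C + cos \<tau> *\<^sub>R X + sin \<tau> *\<^sub>R Y)"
  have d1: "((\<lambda>s. C + cos (T * s) *\<^sub>R X + sin (T * s) *\<^sub>R Y) has_vector_derivative
      T *\<^sub>R (cos (T * s) *\<^sub>R Y - sin (T * s) *\<^sub>R X)) (at s within I01)" for s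
    by (rule has_vector_derivative_eq_rhs,
        (rule has_vector_derivative_add has_vector_derivative_const has_vector_derivative_scaleR
          | rule derivative_eq_intros refl)+) (simp add: algebra_simps)
  have d2: "((\<lambda>s. T *\<^sub>R (cos (T * s) *\<^sub>R Y - sin (T * s) *\<^sub>R X)) has_vector_derivative
      - (T\<^sup>2) *\<^sub>R (cos (T * s) *\<^sub>R X + sin (T * s) *\<^sub>R Y)) (at s within I01)" for s
    by (rule has_vector_derivative_eq_rhs,
        (rule has_vector_derivative_diff has_vector_derivative_const has_vector_derivative_scaleR
          | rule derivative_eq_intros refl)+) (simp add: algebra_simps power2_eq_square)
  have y1: "fst (z1 s) = T *\<^sub>R (cos (T * s) *\<^sub>R Y - sin (T * s) *\<^sub>R X)" if s: "s \<in> I01" for s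
    by (rule vector_derivative_I01_unique[OF yd[OF s] has_vector_derivative_cong_open[OF d1 open_UNIV UNIV_I s] s])
       (simp add: CXY)
  have y2: "fst (z2 s) = - (T\<^sup>2) *\<^sub>R (cos (T * s) *\<^sub>R X + sin (T * s) *\<^sub>R Y)" if s: "s \<in> I01" for s
    by (rule vector_derivative_I01_unique[OF y1d[OF s] has_vector_derivative_cong_open[OF d2 open_UNIV UNIV_I s] s])
       (simp add: y1)
  let ?P = "flow (\<alpha> * T)"
  have linP: "linear ?P" by (rule bounded_linear.linear[OF bounded_linear_flow])
  have "X1 0 1 = X1 0 0"
    using T(2,4) by (simp add: X1_def x_def V0)
  then have P1: "?P (fst (z1 1)) = fst (z1 0)"
    using y1_flow[of 1] y1_flow[of 0] by (simp add: flow_flow algebra_simps)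
  have P0: "?P (y 1) = y 0"
    using y_flow[of 1] y_flow[of 0] T(2) by (simp add: flow_flow algebra_simps x_def V0)
  \<comment> \<open>The accelerations agree because both are normal to \<open>M\<close> at the same
    point and belong to the same velocity.\<close>
  have P2: "fst (z2 0) = ?P (fst (z2 1))"
  proof -
    have 0: "y 0 \<in> M" by (rule yM) simp
    obtain B U \<phi> W \<psi> where ch: "smooth_chart M B U \<phi> W \<psi>" "y 0 \<in> W" using charts[OF 0] by blast
    show ?thesis
    proof (rule normal_acceleration_unique[OF ch 0 yM _ yd y1d, where y' = "\<lambda>s. ?P (y s)" and y1' = "\<lambda>s. ?P (fst (z1 s))"
          and y2' = "\<lambda>s. ?P (fst (z2 s))" and b = 1])
      show "?P (y s) \<in> M" if "s \<in> I01" for s using yM[OF that] by (rule flow_M)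
      show "((\<lambda>s. ?P (y s)) has_vector_derivative ?P (fst (z1 s))) (at s within I01)"
        "((\<lambda>s. ?P (fst (z1 s))) has_vector_derivative ?P (fst (z2 s))) (at s within I01)" if "s \<in> I01" for s
        by (rule bounded_linear.has_vector_derivative[OF bounded_linear_flow yd[OF that]],
            rule bounded_linear.has_vector_derivative[OF bounded_linear_flow y1d[OF that]])
      show "?P (y 1) = y 0" by (rule P0)
      show "fst (z1 0) = ?P (fst (z1 1))" using P1 by simp
      show "fst (z2 0) \<bullet> \<eta> = 0" if "\<eta> \<in> tangent M (y 0)" for \<eta> by (rule z(4)[OF _ that]) simp
      show "?P (fst (z2 1)) \<bullet> \<eta> = 0" if h: "\<eta> \<in> tangent M (y 0)" for \<eta>
      proof -
        have "flow (- (\<alpha> * T)) \<eta> \<in> tangent M (y 1)"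
          using flow_tangent[OF h, of "- (\<alpha> * T)"] unfolding P0[symmetric] by (simp add: flow_flow)
        then have "fst (z2 1) \<bullet> flow (- (\<alpha> * T)) \<eta> = 0" by (rule z(4)[rotated]) simp
        then show ?thesis by (simp add: flow_adjoint)
      qed
    qed auto
  qed
  have PX: "?P (cos T *\<^sub>R X + sin T *\<^sub>R Y) = X"
    using P2 y2[of 0] y2[of 1] T(1) by (simp add: linear_scale[OF linP] linear_neg[OF linP])
  have PY: "?P (cos T *\<^sub>R Y - sin T *\<^sub>R X) = Y"
    using P1 y1[of 0] y1[of 1] T(1) by (simp add: linear_scale[OF linP])
  have PC: "?P C = C"
  proof -
    have "?P (C + (cos T *\<^sub>R X + sin T *\<^sub>R Y)) = C + X"
      using P0 CXY[of 0] CXY[of 1] by (simp add: add.assoc)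
    then show ?thesis using PX by (simp add: linear_add[OF linP])
  qed
  have step: "?P (Yh (\<tau> + T)) = Yh \<tau>" for \<tau>
  proof -
    have 1: "Yh (\<tau> + T) = C + cos \<tau> *\<^sub>R (cos T *\<^sub>R X + sin T *\<^sub>R Y) + sin \<tau> *\<^sub>R (cos T *\<^sub>R Y - sin T *\<^sub>R X)"
      by (simp add: Yh_def cos_add sin_add algebra_simps)
    have 2: "?P (C + a *\<^sub>R U + b *\<^sub>R V) = ?P C + a *\<^sub>R ?P U + b *\<^sub>R ?P V" for a b U V
      by (simp add: linear_add[OF linP] linear_scale[OF linP])
    show ?thesis unfolding 1 2 PC PX PY by (simp add: Yh_def)
  qed
  \<comment> \<open>Shifting the parameter by \<open>T\<close> preserves membership in
    \<open>M\<close>, so every \<open>\<tau>\<close> can be moved into the known arc.\<close>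
  have stepn: "Yh (\<tau> + real n * T) \<in> M \<longleftrightarrow> Yh \<tau> \<in> M" for \<tau> n
  proof (induction n)
    case (Suc n)
    have 1: "?P (Yh (\<tau> + real (Suc n) * T)) = Yh (\<tau> + real n * T)"
      using step[of "\<tau> + real n * T"] by (simp add: algebra_simps)
    moreover from this have "Yh (\<tau> + real (Suc n) * T) = flow (- (\<alpha> * T)) (Yh (\<tau> + real n * T))"
      by (metis flow_flow flow_0 add.left_inverse)
    ultimately show ?case using flow_M Suc.IH by metis
  qed simp
  have YhM: "Yh \<tau> \<in> M" for \<tau>
  proof -
    define s where "s = frac (\<tau> / T)" define n where "n = \<lfloor>\<tau> / T\<rfloor>"
    have s01: "s \<in> I01" by (simp add: s_def frac_ge_0 less_imp_le[OF frac_lt_1])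
    have "\<tau> / T = n + s" by (simp add: s_def n_def frac_def)
    then have tau: "\<tau> = T * s + n * T" using T(1) by (simp add: field_simps)
    have sM: "Yh (T * s) \<in> M" using yM[OF s01] CXY[OF s01] by (simp add: Yh_def)
    show ?thesis
    proof (cases "n \<ge> 0")
      case True
      then have "\<tau> = T * s + real (nat n) * T" using tau by simp
      then show ?thesis using stepn sM by metis
    next
      case False
      then have "T * s = \<tau> + real (nat (- n)) * T" using tau by simp
      then show ?thesis using stepn sM by metis
    qed
  qed
  have "\<kappa> * (Y \<bullet> Y) = 1"
    using speed[of 0] y1[of 0] T(1) by (simp add: power2_eq_square)
  moreover have "c s = (flow (\<alpha> * (t0 + T * s)) (C + cos (T * s) *\<^sub>R X + sin (T * s) *\<^sub>R Y), t0 + T * s)"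
    if s: "s \<in> I01" for s
  proof -
    have "c s = shift \<alpha> (shift (- \<alpha>) (c s))" by (simp add: shift_inverse)
    also have "shift (- \<alpha>) (c s) = (y s, t s)" by (simp add: prod_eq_iff y_def t_def shift_def)
    finally show ?thesis using CXY[OF s] ts[OF s] by (simp add: shift_def)
  qed
  ultimately show ?thesis using T(1) YhM PC PX PY unfolding Yh_def by blast
qed

definition ray_point :: "real \<Rightarrow> 'l \<Rightarrow> real \<Rightarrow> complex \<Rightarrow> real \<Rightarrow> 'w" where
  "ray_point \<alpha> l \<sigma> w \<tau> = cen l + E l (cis ((\<alpha> * \<theta> l + \<sigma>) * \<tau>) * w)"

text \<open>The circle is decomposed into Fourier components in each weight plane, of which
  \<open>irrational_frequencies\<close> leaves a single one; \<open>rigid\<close> and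
  \<open>single\<close> then determine the part that the flow fixes.\<close>

lemma periodic_ray_form:
  assumes irr: "\<alpha> \<notin> \<rat>" and tp: "t_periodic M (lm \<alpha>) c"
  shows "\<exists>l\<in>L. \<exists>\<sigma>\<in>{1, -1}. \<exists>w t0 T. \<exists>k::int. T > 0 \<and> \<kappa> * (cmod w)\<^sup>2 = 1 \<and>
    (\<alpha> * \<theta> l + \<sigma>) * T = 2 * pi * k \<and> (\<forall>s\<in>I01. c s = (ray_point \<alpha> l \<sigma> w (T * s), t0 + T * s))"
proof -
  from unwound_circle[OF tp] obtain t0 T C X Y where T: "T > 0"
    and cs: "\<And>s. s \<in> I01 \<Longrightarrow> c s = (flow (\<alpha> * (t0 + T * s)) (C + cos (T * s) *\<^sub>R X + sin (T * s) *\<^sub>R Y), t0 + T * s)"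
    and M: "\<And>\<tau>. C + cos \<tau> *\<^sub>R X + sin \<tau> *\<^sub>R Y \<in> M" and speed: "\<kappa> * (Y \<bullet> Y) = 1"
    and PC: "flow (\<alpha> * T) C = C" and PX: "flow (\<alpha> * T) (cos T *\<^sub>R X + sin T *\<^sub>R Y) = X"
    and PY: "flow (\<alpha> * T) (cos T *\<^sub>R Y - sin T *\<^sub>R X) = Y"
    by blast
  define Yh where "Yh = (\<lambda>\<tau>. C + cos \<tau> *\<^sub>R X + sin \<tau> *\<^sub>R Y)"
  \<comment> \<open>Twice the Fourier coefficient of \<open>zc l (Yh \<tau>)\<close> at the
    frequency \<open>\<sigma>\<close>.\<close>
  define amp where "amp = (\<lambda>l (\<sigma>::real). zc l X - of_real \<sigma> * \<i> * zc l Y)"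
  have zadd: "zc l (x + y) = zc l x + zc l y" "zc l (x - y) = zc l x - zc l y" "zc l (r *\<^sub>R x) = of_real r * zc l x" for l x y r
    by (simp_all add: linear_add[OF zc_linear] linear_diff[OF zc_linear] linear_scale[OF zc_linear] scaleR_conv_of_real)
  have zY: "zc l (Yh \<tau>) = zc l C + of_real (cos \<tau>) * zc l X + of_real (sin \<tau>) * zc l Y" for l \<tau>
    by (simp add: Yh_def zadd)
  have freqC: "\<exists>k::int. (\<alpha> * \<theta> l + 0) * T = 2 * pi * k" if l: "l \<in> L" and "zc l C \<noteq> 0" for l
  proof -
    have "cis (\<theta> l * (\<alpha> * T)) * zc l C = zc l C" using zc_flow[OF l, of "\<alpha> * T" C] PC by simp
    then have "cis (\<theta> l * (\<alpha> * T)) = 1" using that(2) by simp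
    from cis_eq_one[OF this] show ?thesis by (simp add: algebra_simps)
  qed
  have freq: "\<exists>k::int. (\<alpha> * \<theta> l + \<sigma>) * T = 2 * pi * k"
    if l: "l \<in> L" and \<sigma>: "\<sigma> \<in> {1, -1}" and "amp l \<sigma> \<noteq> 0" for l \<sigma>
  proof -
    have 1: "cis (\<theta> l * (\<alpha> * T)) * (of_real (cos T) * zc l X + of_real (sin T) * zc l Y) = zc l X"
      using zc_flow[OF l, of "\<alpha> * T" "cos T *\<^sub>R X + sin T *\<^sub>R Y"] unfolding PX by (simp add: zadd)
    have 2: "cis (\<theta> l * (\<alpha> * T)) * (of_real (cos T) * zc l Y - of_real (sin T) * zc l X) = zc l Y"
      using zc_flow[OF l, of "\<alpha> * T" "cos T *\<^sub>R Y - sin T *\<^sub>R X"] unfolding PY by (simp add: zadd)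
    have "amp l \<sigma> = cis (\<theta> l * (\<alpha> * T)) * (of_real (cos T) * zc l X + of_real (sin T) * zc l Y)
       - of_real \<sigma> * \<i> * (cis (\<theta> l * (\<alpha> * T)) * (of_real (cos T) * zc l Y - of_real (sin T) * zc l X))"
      unfolding 1 2 amp_def ..
    also have "\<dots> = cis (\<theta> l * (\<alpha> * T)) * cis (\<sigma> * T) * amp l \<sigma>"
      using \<sigma> by (auto simp: amp_def cis.ctr complex_eq_iff algebra_simps)
    finally have "cis ((\<alpha> * \<theta> l + \<sigma>) * T) = 1" using that(3) by (simp add: cis_mult algebra_simps)
    from cis_eq_one[OF this] show ?thesis .
  qed
  \<comment> \<open>Otherwise all plane coordinates are constant, \<open>rigid\<close> makes
    \<open>Yh\<close> constant, and \<open>Y = 0\<close> contradicts unit speed.\<close>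
  have "\<exists>l\<in>L. \<exists>\<sigma>\<in>{1,-1}. amp l \<sigma> \<noteq> 0"
  proof (rule ccontr)
    assume "\<not> ?thesis"
    then have a: "amp l 1 = 0" "amp l (-1) = 0" if "l \<in> L" for l using that by auto
    have "zc l X = 0 \<and> zc l Y = 0" if "l \<in> L" for l
    proof -
      have "zc l X = (amp l 1 + amp l (-1)) / 2" "zc l Y = \<i> * (amp l 1 - amp l (-1)) / 2"
        by (simp_all add: amp_def algebra_simps)
      then show ?thesis using a[OF that] by simp
    qed
    then have comp: "Yh \<tau> \<bullet> e l = C \<bullet> e l \<and> Yh \<tau> \<bullet> f l = C \<bullet> f l" if "l \<in> L" for l \<tau>
      using zY[of l \<tau>] that by (auto simp: zc_def complex_eq_iff)
    have "\<exists>D. \<forall>\<tau>. Yh \<tau> = D + (\<Sum>l\<in>L. emb l (Yh \<tau> \<bullet> e l) (Yh \<tau> \<bullet> f l))"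
      by (rule rigid[where r = "\<lambda>l. (C \<bullet> e l)\<^sup>2 + (C \<bullet> f l)\<^sup>2"])
         (use M comp in \<open>auto simp: Yh_def intro!: continuous_intros\<close>)
    then obtain D where D: "\<And>\<tau>. Yh \<tau> = D + (\<Sum>l\<in>L. emb l (Yh \<tau> \<bullet> e l) (Yh \<tau> \<bullet> f l))" by blast
    have "Yh \<tau> = Yh 0" for \<tau>
      using D[of \<tau>] D[of 0] comp by (simp cong: sum.cong)
    then have "Yh (pi / 2) = Yh (- pi / 2)" by metis
    then have "Y = 0" by (simp add: Yh_def eq_neg_iff_add_eq_0 flip: scaleR_2)
    then show False using speed by simp
  qed
  then obtain l \<sigma> where l: "l \<in> L" and \<sigma>: "\<sigma> \<in> {1, -1}" and nz: "amp l \<sigma> \<noteq> 0" by blast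
  obtain k :: int where k: "(\<alpha> * \<theta> l + \<sigma>) * T = 2 * pi * k" using freq[OF l \<sigma> nz] by blast
  have rat: "\<sigma> \<in> \<rat>" "\<sigma> \<noteq> 0" using \<sigma> by auto
  \<comment> \<open>A constant term has the frequency \<open>\<alpha> * \<theta> m + 0\<close>.
    Proportionality of \<open>(\<theta> m, 0)\<close> to \<open>(\<theta> l, \<sigma>)\<close>
    forces the factor 0 and so \<open>\<theta> m = 0\<close>.\<close>
  have C0: "zc m C = 0" if m: "m \<in> L" for m
  proof (rule ccontr)
    assume "zc m C \<noteq> 0"
    then obtain j :: int where "(\<alpha> * \<theta> m + 0) * T = 2 * pi * j" using freqC[OF m] by blast
    from irrational_frequencies[OF irr T \<theta>_rat[OF l] \<theta>_rat[OF m] rat(1) _ rat(2) k this]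
    show False using rat(2) \<theta>_nz[OF m] by auto
  qed
  have other: "m = l \<and> \<sigma>' = \<sigma>" if m: "m \<in> L" and \<sigma>': "\<sigma>' \<in> {1, -1}" and nz': "amp m \<sigma>' \<noteq> 0" for m \<sigma>'
  proof -
    obtain j :: int where j: "(\<alpha> * \<theta> m + \<sigma>') * T = 2 * pi * j" using freq[OF m \<sigma>' nz'] by blast
    have "\<sigma>' \<in> \<rat>" using \<sigma>' by auto
    from irrational_frequencies[OF irr T \<theta>_rat[OF l] \<theta>_rat[OF m] rat(1) this rat(2) k j]
    obtain r where r: "\<theta> m = r * \<theta> l" "\<sigma>' = r * \<sigma>" by blast
    \<comment> \<open>\<open>r = -1\<close> is the opposite direction; injectivity of the absolute
      weights puts it into the same plane, where it would mean
      \<open>\<theta> l = - \<theta> l\<close>.\<close>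
    then have "r = 1 \<or> r = -1" using \<sigma> \<sigma>' by auto
    then have "\<bar>\<theta> m\<bar> = \<bar>\<theta> l\<bar>" using r by auto
    then have "m = l" using \<theta>_inj m l by (auto dest: inj_onD)
    then have "r = 1" using r \<theta>_nz[OF l] by auto
    then show ?thesis using \<open>m = l\<close> r by simp
  qed
  have m0: "zc m X = 0 \<and> zc m Y = 0" if "m \<in> L" "m \<noteq> l" for m
  proof -
    have "zc m X = (amp m 1 + amp m (-1)) / 2" "zc m Y = \<i> * (amp m 1 - amp m (-1)) / 2"
      by (simp_all add: amp_def algebra_simps)
    moreover have "amp m 1 = 0" "amp m (-1) = 0" using other[of m 1] other[of m "-1"] that by auto
    ultimately show ?thesis by simp
  qed
  have zlY: "zc l Y = of_real \<sigma> * \<i> * zc l X"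
  proof -
    have "amp l (- \<sigma>) = 0"
    proof (rule ccontr)
      assume "amp l (- \<sigma>) \<noteq> 0"
      from other[OF l _ this] \<sigma> show False by auto
    qed
    then show ?thesis using \<sigma> by (auto simp: amp_def complex_eq_iff)
  qed
  define w where "w = zc l X"
  have zl: "zc l (Yh \<tau>) = cis (\<sigma> * \<tau>) * w" for \<tau>
    using \<sigma> by (auto simp: zY C0[OF l] zlY w_def complex_eq_iff)
  have zm: "zc m (Yh \<tau>) = 0" if "m \<in> L" "m \<noteq> l" for m \<tau>
    using m0[OF that] C0[OF that(1)] by (simp add: zY)
  have sq: "(x \<bullet> e m)\<^sup>2 + (x \<bullet> f m)\<^sup>2 = (cmod (zc m x))\<^sup>2" for m x
    by (simp add: zc_def cmod_power2)
  \<comment> \<open>All plane coordinates now have constant modulus, so by \<open>rigid\<close>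
    nothing moves outside the plane \<open>l\<close>.\<close>
  have "\<exists>D. \<forall>\<tau>. Yh \<tau> = D + (\<Sum>m\<in>L. emb m (Yh \<tau> \<bullet> e m) (Yh \<tau> \<bullet> f m))"
  proof (rule rigid[where r = "\<lambda>m. if m = l then (cmod w)\<^sup>2 else 0"])
    show "(Yh \<tau> \<bullet> e m)\<^sup>2 + (Yh \<tau> \<bullet> f m)\<^sup>2 = (if m = l then (cmod w)\<^sup>2 else 0)" if "m \<in> L" for m \<tau>
      unfolding sq using zl zm that by (simp add: norm_mult)
  qed (use M in \<open>auto simp: Yh_def intro!: continuous_intros\<close>)
  then obtain D where D: "\<And>\<tau>. Yh \<tau> = D + (\<Sum>m\<in>L. emb m (Yh \<tau> \<bullet> e m) (Yh \<tau> \<bullet> f m))" by blast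
  have D': "Yh \<tau> = D + E l (cis (\<sigma> * \<tau>) * w)" for \<tau>
  proof -
    have "emb m (Yh \<tau> \<bullet> e m) (Yh \<tau> \<bullet> f m) = E m (zc m (Yh \<tau>))" for m by (simp add: E_def zc_def)
    then have "(\<Sum>m\<in>L. emb m (Yh \<tau> \<bullet> e m) (Yh \<tau> \<bullet> f m)) = (\<Sum>m\<in>L. if m = l then E l (cis (\<sigma> * \<tau>) * w) else 0)"
      using zl zm linear_0[OF E_linear] by (intro sum.cong) auto
    then show ?thesis using D[of \<tau>] l finL by simp
  qed
  have "2 *\<^sub>R Y = Yh (pi / 2) - Yh (- (pi / 2))" by (simp add: Yh_def scaleR_2)
  also have "\<dots> = E l (cis (\<sigma> * (pi / 2)) * w) - E l (cis (\<sigma> * - (pi / 2)) * w)" unfolding D' by simp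
  also have "\<dots> = E l (2 *\<^sub>R (of_real \<sigma> * \<i> * w))"
    unfolding linear_diff[OF E_linear, symmetric] left_diff_distrib[symmetric]
    using \<sigma> by (intro arg_cong[where f = "E l"]) (auto simp: complex_eq_iff)
  finally have "Y = E l (of_real \<sigma> * \<i> * w)" by (simp add: linear_scale[OF E_linear])
  then have wn: "\<kappa> * (cmod w)\<^sup>2 = 1"
    using speed \<sigma> by (auto simp: E_inner[OF l] norm_mult)
  have Yh_cen: "Yh \<tau> = cen l + E l (cis (\<sigma> * \<tau>) * w)" for \<tau>
  proof -
    have "Yh \<tau> = cen l + emb l (Yh \<tau> \<bullet> e l) (Yh \<tau> \<bullet> f l)"
    proof (rule single[OF _ l])
      show "Yh \<tau> \<in> M" using M by (simp add: Yh_def)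
      show "Yh \<tau> \<bullet> e m = 0 \<and> Yh \<tau> \<bullet> f m = 0" if "m \<in> L" "m \<noteq> l" for m
        using zm[OF that, of \<tau>] by (simp add: zc_def complex_eq_iff)
      show "\<kappa> * ((Yh \<tau> \<bullet> e l)\<^sup>2 + (Yh \<tau> \<bullet> f l)\<^sup>2) = 1"
        unfolding sq zl using wn by (simp add: norm_mult)
    qed
    moreover have "emb l (Yh \<tau> \<bullet> e l) (Yh \<tau> \<bullet> f l) = E l (zc l (Yh \<tau>))" by (simp add: E_def zc_def)
    ultimately show ?thesis using zl by simp
  qed
  \<comment> \<open>The rotation accumulated up to the starting time \<open>t0\<close> is absorbed
    into the initial phase.\<close>
  define w' where "w' = cis (\<alpha> * \<theta> l * t0) * w"
  have "c s = (ray_point \<alpha> l \<sigma> w' (T * s), t0 + T * s)" if s: "s \<in> I01" for s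
  proof -
    have "flow (\<alpha> * (t0 + T * s)) (Yh (T * s)) = cen l + E l (cis (\<theta> l * (\<alpha> * (t0 + T * s))) * (cis (\<sigma> * (T * s)) * w))"
      unfolding Yh_cen flow_circle[OF l] ..
    also have "cis (\<theta> l * (\<alpha> * (t0 + T * s))) * (cis (\<sigma> * (T * s)) * w) = cis ((\<alpha> * \<theta> l + \<sigma>) * (T * s)) * w'"
      unfolding w'_def by (simp add: mult.assoc[symmetric] cis_mult) (simp add: algebra_simps)
    finally show ?thesis using cs[OF s] by (simp add: ray_point_def Yh_def)
  qed
  moreover have "\<kappa> * (cmod w')\<^sup>2 = 1" using wn by (simp add: w'_def norm_mult)
  ultimately show ?thesis using l \<sigma> T k by blast
qed

end

section \<open>Realising and counting the light rays\<close>

text \<open>A class of curves closed under differentiation, so that smoothness on the closed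
  interval follows by induction.\<close>

definition trig :: "'a::real_normed_vector \<Rightarrow> 'a \<Rightarrow> 'a \<Rightarrow> 'a \<Rightarrow> real \<Rightarrow> real \<Rightarrow> 'a" where
  "trig A B P Q \<omega> s = A + s *\<^sub>R B + cos (\<omega> * s) *\<^sub>R P + sin (\<omega> * s) *\<^sub>R Q"

lemma trig_has_vector_derivative:
  "(trig A B P Q \<omega> has_vector_derivative trig B 0 (\<omega> *\<^sub>R Q) (- \<omega> *\<^sub>R P) \<omega> s) (at s within S)"
proof -
  have 1: "((\<lambda>s. cos (\<omega> * s)) has_real_derivative - (\<omega> * sin (\<omega> * s))) (at s within S)"
    and 2: "((\<lambda>s. sin (\<omega> * s)) has_real_derivative \<omega> * cos (\<omega> * s)) (at s within S)"
    and 3: "((\<lambda>s. s) has_real_derivative 1) (at s within S)"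
    by (auto intro!: derivative_eq_intros)
  show ?thesis
    unfolding trig_def[abs_def]
    by (rule has_vector_derivative_eq_rhs,
        rule has_vector_derivative_add[OF has_vector_derivative_add[OF has_vector_derivative_add[OF
          has_vector_derivative_const has_vector_derivative_scaleR[OF 3 has_vector_derivative_const]]
          has_vector_derivative_scaleR[OF 1 has_vector_derivative_const]]
          has_vector_derivative_scaleR[OF 2 has_vector_derivative_const]])
       (simp add: algebra_simps)
qed

lemma smooth_curve_trig:
  assumes "\<And>s. s \<in> I01 \<Longrightarrow> c s = trig A B P Q \<omega> s"
  shows "smooth_curve_on I01 c"
proof -
  have d: "(c has_vector_derivative trig B 0 (\<omega> *\<^sub>R Q) (- \<omega> *\<^sub>R P) \<omega> s) (at s within I01)"
    if "\<And>s. s \<in> I01 \<Longrightarrow> c s = trig A B P Q \<omega> s" "s \<in> I01" for c A B P Q s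
    by (rule has_vector_derivative_cong_open[OF trig_has_vector_derivative open_UNIV UNIV_I that(2)])
       (simp add: that(1))
  have "\<exists>A B P Q. \<forall>s\<in>I01. (velocity I01 ^^ k) c s = trig A B P Q \<omega> s" for k
  proof (induction k)
    case 0
    then show ?case using assms by auto
  next
    case (Suc k)
    then obtain A B P Q where "\<And>s. s \<in> I01 \<Longrightarrow> (velocity I01 ^^ k) c s = trig A B P Q \<omega> s" by blast
    from velocity_I01[OF d[OF this]] show ?case by auto
  qed
  then show ?thesis
    unfolding smooth_curve_on_def differentiable_on_def
    using d by (meson differentiableI_vector)
qed

context light_model
begin

text \<open>The amplitude, with phase 0, for which the circle has unit speed in the metric with
  factor \<kappa>.\<close>

definition radius :: complex where "radius = of_real (1 / sqrt \<kappa>)"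

lemma radius: "\<kappa> * (cmod radius)\<^sup>2 = 1" "radius \<noteq> 0"
  using kpos by (simp_all add: radius_def norm_divide power_divide)

definition ray :: "real \<Rightarrow> 'l \<Rightarrow> real \<Rightarrow> ('w \<times> real) set" where
  "ray \<alpha> l \<sigma> = range (\<lambda>\<tau>. (ray_point \<alpha> l \<sigma> radius \<tau>, \<tau>))"

definition translate :: "real \<Rightarrow> 'w \<times> real \<Rightarrow> 'w \<times> real" where
  "translate b = (\<lambda>(x, t). (x, t + b))"

lemma translate_translate: "translate a ` translate b ` S = translate (a + b) ` S"
  by (force simp: translate_def image_image split_beta)

lemma frequency_nonzero:
  assumes "\<alpha> \<notin> \<rat>" "l \<in> L" "\<sigma> \<in> {1, -1}"
  shows "\<alpha> * \<theta> l + \<sigma> \<noteq> 0"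
proof
  assume "\<alpha> * \<theta> l + \<sigma> = 0"
  then have "\<alpha> = - \<sigma> / \<theta> l" using \<theta>_nz[OF assms(2)] by (simp add: field_simps)
  moreover have "- \<sigma> / \<theta> l \<in> \<rat>" using assms(3) \<theta>_rat[OF assms(2)] by auto
  ultimately show False using assms(1) by simp
qed

text \<open>As the spatial motion closes up after \<open>T\<close>, the glued extension is the ray
  continued over all times. The image no longer mentions \<open>T\<close>, which is why iterates are
  equivalent.\<close>

lemma extended_image_ray:
  assumes T: "T \<noteq> 0" and per: "(\<alpha> * \<theta> l + \<sigma>) * T = 2 * pi * of_int k"
    and c: "\<And>s. s \<in> I01 \<Longrightarrow> c s = (ray_point \<alpha> l \<sigma> w (T * s), t0 + T * s)"
  shows "extended_image c = range (\<lambda>\<tau>. (ray_point \<alpha> l \<sigma> w \<tau>, t0 + \<tau>))"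
proof -
  have "(fst (c (frac s)), snd (c (frac s)) + of_int \<lfloor>s\<rfloor> * (snd (c 1) - snd (c 0)))
     = (ray_point \<alpha> l \<sigma> w (T * s), t0 + T * s)" for s
  proof -
    have fr: "frac s \<in> I01" by (simp add: frac_ge_0 less_imp_le[OF frac_lt_1])
    have "(\<alpha> * \<theta> l + \<sigma>) * (T * s) = (\<alpha> * \<theta> l + \<sigma>) * (T * frac s) + (\<alpha> * \<theta> l + \<sigma>) * T * of_int \<lfloor>s\<rfloor>"
      by (simp add: frac_def algebra_simps)
    also have "\<dots> = (\<alpha> * \<theta> l + \<sigma>) * (T * frac s) + 2 * pi * of_int (k * \<lfloor>s\<rfloor>)" unfolding per by simp
    finally have "cis ((\<alpha> * \<theta> l + \<sigma>) * (T * s)) = cis ((\<alpha> * \<theta> l + \<sigma>) * (T * frac s)) * cis (2 * pi * of_int (k * \<lfloor>s\<rfloor>))"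
      by (simp only: cis_mult)
    also have "cis (2 * pi * of_int (k * \<lfloor>s\<rfloor>)) = 1" by (rule cis_multiple_2pi) (rule Ints_of_int)
    finally have "ray_point \<alpha> l \<sigma> w (T * s) = ray_point \<alpha> l \<sigma> w (T * frac s)" by (simp add: ray_point_def)
    then show ?thesis using c[OF fr] c[of 0] c[of 1] by (simp add: frac_def algebra_simps)
  qed
  then have "extended_image c = range (\<lambda>s. (ray_point \<alpha> l \<sigma> w (T * s), t0 + T * s))"
    unfolding extended_image_def by simp
  also have "\<dots> = (\<lambda>\<tau>. (ray_point \<alpha> l \<sigma> w \<tau>, t0 + \<tau>)) ` range (\<lambda>s. T * s)"
    by (simp only: image_image)
  also have "range (\<lambda>s. T * s) = UNIV"
  proof (rule surjI)
    show "T * (\<tau> / T) = \<tau>" for \<tau> using T by simp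
  qed
  finally show ?thesis .
qed

text \<open>The frequency is nonzero, so an initial phase \<open>Arg w\<close> amounts to a time
  shift by \<open>Arg w / \<mu>\<close>.\<close>

lemma ray_translate:
  assumes w: "\<kappa> * (cmod w)\<^sup>2 = 1" and nz: "\<alpha> * \<theta> l + \<sigma> \<noteq> 0"
  shows "\<exists>b. range (\<lambda>\<tau>. (ray_point \<alpha> l \<sigma> w \<tau>, t0 + \<tau>)) = translate b ` ray \<alpha> l \<sigma>"
proof -
  define \<mu> where "\<mu> = \<alpha> * \<theta> l + \<sigma>"
  have "(cmod w)\<^sup>2 = (cmod radius)\<^sup>2" using w radius(1) kpos by (metis mult_left_cancel less_irrefl)
  then have "cmod w = cmod radius" by simp
  also have "\<dots> = 1 / sqrt \<kappa>" using kpos by (simp add: radius_def norm_divide)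
  finally have w': "w = radius * cis (Arg w)"
    using rcis_cmod_Arg[of w] by (simp add: rcis_def radius_def)
  define d where "d = Arg w / \<mu>"
  have "\<mu> * (\<tau> + d) = \<mu> * \<tau> + Arg w" for \<tau> using nz by (simp add: d_def \<mu>_def field_simps)
  then have "cis (\<mu> * \<tau>) * w = cis (\<mu> * (\<tau> + d)) * radius" for \<tau>
    by (subst w') (simp add: cis_mult[symmetric] mult_ac)
  then have rp: "ray_point \<alpha> l \<sigma> w \<tau> = ray_point \<alpha> l \<sigma> radius (\<tau> + d)" for \<tau>
    by (simp add: ray_point_def \<mu>_def)
  have "range (\<lambda>\<tau>. (ray_point \<alpha> l \<sigma> w \<tau>, t0 + \<tau>))
      = range (\<lambda>\<tau>. translate (t0 - d) (ray_point \<alpha> l \<sigma> radius (\<tau> + d), \<tau> + d))"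
    by (simp add: rp translate_def algebra_simps)
  also have "\<dots> = (\<lambda>\<tau>. translate (t0 - d) (ray_point \<alpha> l \<sigma> radius \<tau>, \<tau>)) ` range (\<lambda>\<tau>. \<tau> + d)"
    by (simp only: image_image)
  also have "range (\<lambda>\<tau>. \<tau> + d) = UNIV" by (rule surjI[where f = "\<lambda>\<tau>. \<tau> - d"]) simp
  finally show ?thesis by (auto simp: ray_def image_image)
qed

text \<open>The plane is recognised by the coordinate that does not vanish. Within one plane the
  frequencies for different \<open>\<sigma>\<close> differ by 2, so over a time
  \<open>pi / 2\<close> their rotations differ by the factor -1.\<close>

lemma ray_distinct:
  assumes l: "l \<in> L" "l' \<in> L" and s: "\<sigma> \<in> {1, -1}" "\<sigma>' \<in> {1, -1}"
    and eq: "translate b ` ray \<alpha> l \<sigma> = translate b' ` ray \<alpha> l' \<sigma>'"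
  shows "l = l' \<and> \<sigma> = \<sigma>'"
proof -
  have pt: "ray_point \<alpha> l \<sigma> radius \<tau> = ray_point \<alpha> l' \<sigma>' radius (\<tau> + b - b')" for \<tau>
  proof -
    have "translate b (ray_point \<alpha> l \<sigma> radius \<tau>, \<tau>) \<in> translate b ` ray \<alpha> l \<sigma>"
      unfolding ray_def by blast
    then have "translate b (ray_point \<alpha> l \<sigma> radius \<tau>, \<tau>) \<in> translate b' ` ray \<alpha> l' \<sigma>'"
      unfolding eq .
    then obtain \<tau>' where "(ray_point \<alpha> l \<sigma> radius \<tau>, \<tau> + b) = (ray_point \<alpha> l' \<sigma>' radius \<tau>', \<tau>' + b')"
      by (auto simp: ray_def translate_def)
    then show ?thesis by (simp add: algebra_simps)
  qed
  have zr: "zc m (ray_point \<alpha> l \<sigma> radius \<tau>) = (if l = m then cis ((\<alpha> * \<theta> l + \<sigma>) * \<tau>) * radius else 0)"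
    if "l \<in> L" "m \<in> L" for l \<sigma> m \<tau>
    using that by (simp add: ray_point_def linear_add[OF zc_linear] zc_cen zc_E)
  have ll: "l = l'"
  proof (rule ccontr)
    assume "l \<noteq> l'"
    then have "zc l (ray_point \<alpha> l \<sigma> radius 0) = 0" unfolding pt using zr[OF l(2,1)] by auto
    then show False using zr[OF l(1) l(1)] radius(2) by simp
  qed
  define \<mu> where "\<mu> = \<alpha> * \<theta> l + \<sigma>"
  define \<mu>' where "\<mu>' = \<alpha> * \<theta> l + \<sigma>'"
  have c: "cis (\<mu> * \<tau>) = cis (\<mu>' * (\<tau> + b - b'))" for \<tau>
    using zr[OF l(1,1), of \<sigma> \<tau>] zr[OF l(2,2), of \<sigma>' "\<tau> + b - b'"] pt[of \<tau>] radius(2) ll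
    by (simp add: \<mu>_def \<mu>'_def)
  have "cis (\<mu>' * (b - b')) = 1" using c[of 0] by simp
  then have cc: "cis (\<mu> * \<tau>) = cis (\<mu>' * \<tau>)" for \<tau>
    using c[of \<tau>] by (simp add: cis_mult[symmetric] distrib_left add_diff_eq[symmetric])
  have "cis ((\<mu> - \<mu>') * (pi / 2)) = cis (\<mu> * (pi / 2)) / cis (\<mu>' * (pi / 2))"
    unfolding left_diff_distrib by (rule cis_divide[symmetric])
  also have "\<dots> = 1" unfolding cc by simp
  finally have "cis ((\<mu> - \<mu>') * (pi / 2)) = 1" .
  moreover have "\<mu> - \<mu>' = \<sigma> - \<sigma>'" by (simp add: \<mu>_def \<mu>'_def)
  ultimately have "cis ((\<sigma> - \<sigma>') * (pi / 2)) = 1" by simp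
  then have "\<sigma> = \<sigma>'" using s by (auto simp: complex_eq_iff)
  then show ?thesis using ll by simp
qed

text \<open>Unwinding the ray leaves the circle about \<open>cen l\<close> run through with angular
  velocity \<open>\<sigma> * T\<close>, and its acceleration points to the centre, which
  \<open>circle_normal\<close> makes normal to \<open>M\<close>.\<close>

lemma ray_exists:
  assumes irr: "\<alpha> \<notin> \<rat>" and l: "l \<in> L" and \<sigma>: "\<sigma> \<in> {1, -1}"
  shows "\<exists>c. t_periodic M (lm \<alpha>) c \<and> (\<exists>b. extended_image c = translate b ` ray \<alpha> l \<sigma>)"
proof -
  define \<mu> where "\<mu> = \<alpha> * \<theta> l + \<sigma>"
  have \<mu>: "\<mu> \<noteq> 0" unfolding \<mu>_def by (rule frequency_nonzero[OF assms])
  define T where "T = 2 * pi / \<bar>\<mu>\<bar>"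
  have T: "T > 0" using \<mu> by (simp add: T_def)
  \<comment> \<open>\<open>T\<close> is the time of one turn; its direction depends on the sign of
    the frequency.\<close>
  define k :: int where "k = (if \<mu> > 0 then 1 else -1)"
  have per: "\<mu> * T = 2 * pi * k" using \<mu> by (auto simp: T_def k_def)
  define c where "c = (\<lambda>s. (ray_point \<alpha> l \<sigma> radius (T * s), 0 + T * s))"
  have cE: "cen l + E l (cis x * radius) = cen l + cos x *\<^sub>R E l radius + sin x *\<^sub>R E l (\<i> * radius)" for x
  proof -
    have "cis x * radius = cos x *\<^sub>R radius + sin x *\<^sub>R (\<i> * radius)"
      by (simp add: complex_eq_iff)
    then show ?thesis by (simp add: linear_add[OF E_linear] linear_scale[OF E_linear] del: scaleR_conv_of_real)
  qed
  define P where "P = (E l radius, 0::real)"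
  define Q where "Q = (E l (\<i> * radius), 0::real)"
  define A where "A = (cen l, 0::real)"
  define B where "B = (0::'w, T)"
  have ct: "c = trig A B P Q (\<mu> * T)"
    by (simp add: fun_eq_iff c_def trig_def ray_point_def \<mu>_def[symmetric] cE A_def B_def P_def Q_def mult.assoc)
  define c1 where "c1 = trig B 0 ((\<mu> * T) *\<^sub>R Q) (- (\<mu> * T) *\<^sub>R P) (\<mu> * T)"
  have c1: "(c has_vector_derivative c1 s) (at s within I01)" for s
    unfolding ct c1_def by (rule trig_has_vector_derivative)
  have sm: "smooth_curve_on I01 c" by (rule smooth_curve_trig) (simp add: ct)
  have circ: "\<kappa> * ((Re (cis x * radius))\<^sup>2 + (Im (cis x * radius))\<^sup>2) = 1" for x
    unfolding cmod_power2[symmetric] using radius(1) by (simp add: norm_mult)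
  have cM: "cen l + E l (cis x * radius) \<in> M" for x
    unfolding E_def by (rule circle_M[OF l circ])
  have cN: "c s \<in> N" for s using cM by (simp add: c_def ray_point_def)
  have sh: "shift (- \<alpha>) (c s) = (cen l + E l (cis (\<sigma> * T * s) * radius), T * s)" for s
  proof -
    have "flow (- \<alpha> * (T * s)) (ray_point \<alpha> l \<sigma> radius (T * s)) = cen l + E l (cis (\<theta> l * (- \<alpha> * (T * s))) * (cis (\<mu> * (T * s)) * radius))"
      unfolding ray_point_def \<mu>_def[symmetric] by (rule flow_circle[OF l])
    also have "cis (\<theta> l * (- \<alpha> * (T * s))) * (cis (\<mu> * (T * s)) * radius) = cis (\<sigma> * T * s) * radius"
      unfolding mult.assoc[symmetric] cis_mult by (simp add: \<mu>_def algebra_simps)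
    finally show ?thesis by (simp add: shift_def c_def)
  qed
  have sht: "(\<lambda>s. shift (- \<alpha>) (c s)) = trig A B P Q (\<sigma> * T)"
    by (simp add: fun_eq_iff sh trig_def cE A_def B_def P_def Q_def)
  define z1 where "z1 = trig B 0 ((\<sigma> * T) *\<^sub>R Q) (- (\<sigma> * T) *\<^sub>R P) (\<sigma> * T)"
  define z2 where "z2 = trig 0 0 ((\<sigma> * T) *\<^sub>R (- (\<sigma> * T) *\<^sub>R P)) (- (\<sigma> * T) *\<^sub>R ((\<sigma> * T) *\<^sub>R Q)) (\<sigma> * T)"
  have z1: "((\<lambda>s. shift (- \<alpha>) (c s)) has_vector_derivative z1 s) (at s within I01)" for s
    unfolding sht z1_def by (rule trig_has_vector_derivative)
  have z2: "(z1 has_vector_derivative z2 s) (at s within I01)" for s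
    unfolding z1_def z2_def by (rule trig_has_vector_derivative)
  have \<sigma>2: "\<sigma> * \<sigma> = 1" using \<sigma> by auto
  have z2f: "fst (z2 s) = - (T\<^sup>2) *\<^sub>R E l (cis (\<sigma> * T * s) * radius)" "snd (z2 s) = 0" for s
  proof -
    have "(\<sigma> * T) * (\<sigma> * T) = T\<^sup>2" using \<sigma>2 by (simp add: power2_eq_square algebra_simps)
    then show "fst (z2 s) = - (T\<^sup>2) *\<^sub>R E l (cis (\<sigma> * T * s) * radius)" "snd (z2 s) = 0"
      using cE[of "\<sigma> * T * s"] by (simp_all add: z2_def trig_def P_def Q_def algebra_simps)
  qed
  have uw: "unwound_geodesic \<alpha> c z1 z2"
    unfolding unwound_geodesic_def
  proof (intro ballI conjI z1 z2 z2f)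
    fix s \<eta> assume "\<eta> \<in> tangent M (fst (shift (- \<alpha>) (c s)))"
    then have "\<eta> \<in> tangent M (cen l + E l (cis (\<sigma> * T * s) * radius))" by (simp add: sh)
    then have "E l (cis (\<sigma> * T * s) * radius) \<bullet> \<eta> = 0"
      unfolding E_def by (rule circle_normal[OF l circ])
    then show "fst (z2 s) \<bullet> \<eta> = 0" by (simp add: z2f)
  qed
  have geod: "geodesic_on N (lm \<alpha>) I01 c" by (rule unwound_imp_geodesic[OF sm cN uw])
  have vel: "velocity I01 c s = c1 s" if "s \<in> I01" for s by (rule velocity_I01[OF c1 that])
  have null: "lm \<alpha> (c s) (c1 s) (c1 s) = 0" if s: "s \<in> I01" for s
  proof -
    have "shift' (- \<alpha>) (c s) (c1 s) = z1 s"
      by (rule vector_derivative_I01_unique[OF shift_derivative[OF c1] z1 s])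
    then have "lm \<alpha> (c s) (c1 s) (c1 s) = pb (z1 s) (z1 s)" by (simp add: lm_shift)
    moreover have "snd (z1 s) = T" by (simp add: z1_def trig_def B_def P_def Q_def)
    moreover have "fst (z1 s) = (\<sigma> * T) *\<^sub>R E l (\<i> * (cis (\<sigma> * T * s) * radius))"
    proof -
      have "\<i> * (cis (\<sigma> * T * s) * radius) = cos (\<sigma> * T * s) *\<^sub>R (\<i> * radius) - sin (\<sigma> * T * s) *\<^sub>R radius"
        by (simp add: complex_eq_iff)
      then show ?thesis
        by (simp add: z1_def trig_def B_def P_def Q_def linear_diff[OF E_linear] linear_scale[OF E_linear]
            scaleR_diff_right mult_ac)
    qed
    then have "fst (z1 s) \<bullet> fst (z1 s) = T\<^sup>2 * (cmod radius)\<^sup>2"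
      using \<sigma> by (auto simp: E_inner[OF l] norm_mult power2_eq_square)
    then have "\<kappa> * (fst (z1 s) \<bullet> fst (z1 s)) = T\<^sup>2" using radius(1) by (simp add: algebra_simps)
    ultimately show ?thesis by (simp add: pb_def power2_eq_square)
  qed
  have "c1 s \<noteq> 0" for s
  proof
    assume "c1 s = 0"
    then have "snd (c1 s) = 0" by simp
    then show False using T by (simp add: c1_def trig_def B_def P_def Q_def)
  qed
  then have "lightlike_geodesic N (lm \<alpha>) c"
    unfolding lightlike_geodesic_def using geod vel null by simp
  moreover have c01: "cos (\<mu> * T) = 1" "sin (\<mu> * T) = 0"
    unfolding per k_def by auto
  moreover have "fst (c 1) = fst (c 0)" "snd (c 1) = snd (c 0) + T"
    using c01 by (simp_all add: ct trig_def A_def B_def P_def Q_def)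
  moreover have "velocity I01 c 1 = velocity I01 c 0"
    using c01 by (simp add: vel c1_def trig_def)
  ultimately have "t_periodic M (lm \<alpha>) c" unfolding t_periodic_def using T by blast
  moreover have "\<exists>b. extended_image c = translate b ` ray \<alpha> l \<sigma>"
  proof -
    have "extended_image c = range (\<lambda>\<tau>. (ray_point \<alpha> l \<sigma> radius \<tau>, 0 + \<tau>))"
      by (rule extended_image_ray[OF _ per[unfolded \<mu>_def]]) (use T in \<open>auto simp: c_def\<close>)
    then show ?thesis using ray_translate[OF radius(1) \<mu>[unfolded \<mu>_def], of 0] by simp
  qed
  ultimately show ?thesis by blast
qed

lemma card_periodic_light_rays:
  assumes irr: "\<alpha> \<notin> \<rat>"
  shows "card (periodic_light_rays M (lm \<alpha>)) = 2 * card L"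
proof -
  define Q where "Q = (\<lambda>c (i :: 'l \<times> real). \<exists>b. extended_image c = translate b ` ray \<alpha> (fst i) (snd i))"
  define I where "I = L \<times> {1, -1::real}"
  have ex: "\<exists>i. i \<in> I \<and> Q c i" if tp: "t_periodic M (lm \<alpha>) c" for c
  proof -
    from periodic_ray_form[OF irr tp] obtain l \<sigma> w t0 T and k :: int where
      l: "l \<in> L" "\<sigma> \<in> {1, -1}" and T: "T > 0" and w: "\<kappa> * (cmod w)\<^sup>2 = 1"
      and k: "(\<alpha> * \<theta> l + \<sigma>) * T = 2 * pi * k" and c: "\<And>s. s \<in> I01 \<Longrightarrow> c s = (ray_point \<alpha> l \<sigma> w (T * s), t0 + T * s)"
      by blast
    have "extended_image c = range (\<lambda>\<tau>. (ray_point \<alpha> l \<sigma> w \<tau>, t0 + \<tau>))"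
      by (rule extended_image_ray[OF _ k c]) (use T in auto)
    then have "Q c (l, \<sigma>)"
      using ray_translate[OF w frequency_nonzero[OF irr l], of t0] by (simp add: Q_def)
    then show ?thesis using l by (auto simp: I_def)
  qed
  have un: "i = j" if "i \<in> I" "j \<in> I" "extended_image c = translate b ` ray \<alpha> (fst i) (snd i)"
    "extended_image c = translate b' ` ray \<alpha> (fst j) (snd j)" for c :: "real \<Rightarrow> 'w \<times> real" and b b' i j
    using ray_distinct[of "fst i" "fst j" "snd i" "snd j" b \<alpha> b'] that
    by (auto simp: I_def prod_eq_iff)
  have "card (periodic_light_rays M (lm \<alpha>)) = card I"
    unfolding periodic_light_rays_def
  proof (rule card_quotient_classes[where Q = Q])
    show "\<exists>!i. i \<in> I \<and> Q c i" if "c \<in> {c. t_periodic M (lm \<alpha>) c}" for c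
    proof -
      have c: "t_periodic M (lm \<alpha>) c" using that by simp
      obtain i where i: "i \<in> I" "Q c i" using ex[OF c] by (elim exE conjE)
      show ?thesis
      proof (rule ex1I[of _ i])
        fix j assume j: "j \<in> I \<and> Q c j"
        obtain b b' where "extended_image c = translate b ` ray \<alpha> (fst i) (snd i)"
          "extended_image c = translate b' ` ray \<alpha> (fst j) (snd j)"
          using i(2) j unfolding Q_def by (elim exE conjE)
        then show "j = i" by (rule un[OF i(1) conjunct1[OF j], symmetric])
      qed (use i in simp)
    qed
    show "\<exists>c\<in>{c. t_periodic M (lm \<alpha>) c}. Q c i" if "i \<in> I" for i
      using ray_exists[OF irr, of "fst i" "snd i"] that by (auto simp: Q_def I_def)
    show "light_ray_equiv M (lm \<alpha>) \<subseteq> {c. t_periodic M (lm \<alpha>) c} \<times> {c. t_periodic M (lm \<alpha>) c}"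
      by (auto simp: light_ray_equiv_def)
    show "(c, d) \<in> light_ray_equiv M (lm \<alpha>) \<longleftrightarrow> (\<exists>i\<in>I. Q c i \<and> Q d i)"
      if cd: "c \<in> {c. t_periodic M (lm \<alpha>) c}" "d \<in> {c. t_periodic M (lm \<alpha>) c}" for c d
    proof
      assume "(c, d) \<in> light_ray_equiv M (lm \<alpha>)"
      then obtain b where b: "extended_image d = translate b ` extended_image c"
        by (auto simp: light_ray_equiv_def translate_def)
      obtain i where "i \<in> I" "Q c i" using ex[of c] cd by (metis mem_Collect_eq)
      then obtain b' where i: "i \<in> I" "extended_image c = translate b' ` ray \<alpha> (fst i) (snd i)"
        by (auto simp: Q_def)
      then have "extended_image d = translate (b + b') ` ray \<alpha> (fst i) (snd i)"
        by (simp add: b translate_translate)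
      then show "\<exists>i\<in>I. Q c i \<and> Q d i" using i unfolding Q_def by blast
    next
      assume "\<exists>i\<in>I. Q c i \<and> Q d i"
      then obtain i b b' where "extended_image c = translate b ` ray \<alpha> (fst i) (snd i)"
        "extended_image d = translate b' ` ray \<alpha> (fst i) (snd i)" by (auto simp: Q_def)
      then have "extended_image d = translate (b' - b) ` extended_image c"
        by (simp add: translate_translate)
      then show "(c, d) \<in> light_ray_equiv M (lm \<alpha>)"
        using cd by (auto simp: light_ray_equiv_def translate_def)
    qed
  qed
  also have "card I = 2 * card L" by (simp add: I_def card_cartesian_product)
  finally show ?thesis .
qed

lemma small_generator: "\<exists>\<epsilon>>0. \<forall>\<alpha>. \<bar>\<alpha>\<bar> < \<epsilon> \<longrightarrow> (\<forall>x\<in>M. 1 - \<alpha>\<^sup>2 * (\<kappa> * (gen x \<bullet> gen x)) > 0)"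
proof -
  have "bounded (gen ` M)" by (rule bounded_linear_image[OF bounded_M bounded_linear_gen])
  then obtain K where K: "K > 0" "\<And>x. x \<in> M \<Longrightarrow> norm (gen x) \<le> K" by (auto simp: bounded_pos)
  define \<epsilon> where "\<epsilon> = 1 / (sqrt \<kappa> * K)"
  have "1 - \<alpha>\<^sup>2 * (\<kappa> * (gen x \<bullet> gen x)) > 0" if a: "\<bar>\<alpha>\<bar> < \<epsilon>" and x: "x \<in> M" for \<alpha> x
  proof -
    have "\<bar>\<alpha>\<bar> * sqrt \<kappa> * norm (gen x) \<le> \<bar>\<alpha>\<bar> * sqrt \<kappa> * K"
      using K x kpos by (intro mult_left_mono) auto
    also have "\<dots> < 1" using a K kpos by (simp add: \<epsilon>_def field_simps)
    finally have "(\<bar>\<alpha>\<bar> * sqrt \<kappa> * norm (gen x))\<^sup>2 < 1"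
      using kpos by (simp add: abs_square_less_1 abs_mult)
    then show ?thesis using kpos by (simp add: power_mult_distrib power2_norm_eq_inner mult.assoc)
  qed
  moreover have "\<epsilon> > 0" using K kpos by (simp add: \<epsilon>_def)
  ultimately show ?thesis by blast
qed

theorem light_rays_count:
  "\<exists>V. killing_field M (\<lambda>x v w. \<kappa> * (v \<bullet> w)) V \<and> (\<exists>\<epsilon>>0. \<forall>\<alpha>::real. \<alpha> \<notin> \<rat> \<and> \<bar>\<alpha>\<bar> < \<epsilon> \<longrightarrow>
     (\<forall>x\<in>M. 1 - \<alpha>\<^sup>2 * (\<kappa> * (V x \<bullet> V x)) > 0) \<and>
     card (periodic_light_rays M (stationary_metric (\<lambda>x v w. \<kappa> * (v \<bullet> w)) (\<lambda>x. - (\<alpha> *\<^sub>R V x))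
       (\<lambda>x. 1 - \<alpha>\<^sup>2 * (\<kappa> * (V x \<bullet> V x))))) = 2 * card L)"
proof -
  obtain \<epsilon> where "\<epsilon> > 0" "\<And>\<alpha>. \<bar>\<alpha>\<bar> < \<epsilon> \<Longrightarrow> \<forall>x\<in>M. 1 - \<alpha>\<^sup>2 * (\<kappa> * (gen x \<bullet> gen x)) > 0"
    using small_generator by blast
  then show ?thesis
    using killing card_periodic_light_rays unfolding lm_def by (intro exI[of _ gen] conjI exI[of _ \<epsilon>]) auto
qed

end

section \<open>Spheres\<close>

text \<open>A continuous function with finite range on the line is constant. It settles coordinates
  that are determined up to sign.\<close>

lemma continuous_square_constant:
  fixes g :: "real \<Rightarrow> real"
  assumes "continuous_on UNIV g" "\<And>t. (g t)\<^sup>2 = K"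
  shows "g t = g 0"
proof -
  have "g t \<in> {sqrt K, - sqrt K}" for t
    using real_sqrt_abs[of "g t"] assms(2)[of t] by (auto simp: abs_if split: if_splits)
  then have "finite (range g)" by (meson finite.emptyI finite.insertI finite_subset image_subsetI)
  then have "g constant_on UNIV"
    by (intro continuous_finite_range_constant assms(1)) auto
  then show ?thesis by (auto simp: constant_on_def)
qed

lemma sphere_tangent_iff:
  fixes x :: "'a::euclidean_space"
  assumes x: "x \<in> sphere 0 1"
  shows "v \<in> tangent (sphere 0 1) x \<longleftrightarrow> x \<bullet> v = 0"
proof
  assume "v \<in> tangent (sphere 0 1) x"
  then obtain \<gamma> where g: "\<forall>\<^sub>F s in nhds (0::real). \<gamma> s \<in> sphere 0 1" "\<gamma> 0 = x"
     "(\<gamma> has_vector_derivative v) (at 0)" by (auto simp: tangent_def)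
  have 1: "((\<lambda>s. \<gamma> s \<bullet> \<gamma> s) has_vector_derivative \<gamma> 0 \<bullet> v + v \<bullet> \<gamma> 0) (at 0)"
    by (rule bounded_bilinear.has_vector_derivative[OF bounded_bilinear_inner g(3) g(3)])
  obtain J where J: "open J" "0 \<in> J" "\<And>s. s \<in> J \<Longrightarrow> \<gamma> s \<in> sphere 0 1"
    using g(1) unfolding eventually_nhds by auto
  have "((\<lambda>s. 1::real) has_vector_derivative \<gamma> 0 \<bullet> v + v \<bullet> \<gamma> 0) (at 0)"
    by (rule has_vector_derivative_cong_open[OF 1 J(1,2)]) (use J(3) in \<open>auto simp: dot_square_norm\<close>)
  then have "\<gamma> 0 \<bullet> v + v \<bullet> \<gamma> 0 = 0"
    using vector_derivative_unique_at has_vector_derivative_const by blast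
  then show "x \<bullet> v = 0" using g(2) by (simp add: inner_commute)
next
  assume v: "x \<bullet> v = 0"
  have xx: "x \<bullet> x = 1" using x by (simp add: dot_square_norm)
  show "v \<in> tangent (sphere 0 1) x"
  proof (cases "v = 0")
    case True
    then show ?thesis by (intro tangentI[where \<gamma> = "\<lambda>_. x"]) (use x in auto)
  next
    case False
    define n where "n = norm v"
    have n: "n \<noteq> 0" "v \<bullet> v = n\<^sup>2" using False by (simp_all add: n_def dot_square_norm)
    show ?thesis
    proof (rule tangentI[where \<gamma> = "\<lambda>s. cos (n * s) *\<^sub>R x + (sin (n * s) / n) *\<^sub>R v"])
      have "norm (cos (n * s) *\<^sub>R x + (sin (n * s) / n) *\<^sub>R v) = 1" for s
      proof -
        have "(cos (n * s) *\<^sub>R x + (sin (n * s) / n) *\<^sub>R v) \<bullet> (cos (n * s) *\<^sub>R x + (sin (n * s) / n) *\<^sub>R v)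
           = (cos (n * s))\<^sup>2 + (sin (n * s))\<^sup>2"
          using n v by (simp add: inner_add_left inner_add_right xx inner_commute power2_eq_square field_simps)
        then show ?thesis by (simp add: norm_eq_1)
      qed
      then show "\<forall>\<^sub>F s in nhds 0. cos (n * s) *\<^sub>R x + (sin (n * s) / n) *\<^sub>R v \<in> sphere 0 1"
        by simp
      have 1: "((\<lambda>s. cos (n * s)) has_real_derivative 0) (at 0)"
        and 2: "((\<lambda>s. sin (n * s) / n) has_real_derivative 1) (at 0)"
        using n by (auto intro!: derivative_eq_intros)
      show "((\<lambda>s. cos (n * s) *\<^sub>R x + (sin (n * s) / n) *\<^sub>R v) has_vector_derivative v) (at 0)"
        using has_vector_derivative_add[OF has_vector_derivative_scaleR[OF 1 has_vector_derivative_const[of x]]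
            has_vector_derivative_scaleR[OF 2 has_vector_derivative_const[of v]]] by simp
    qed simp
  qed
qed

text \<open>Stereographic projection from \<open>e = \<plusminus>b\<close>.\<close>
lemma sphere_chart:
  fixes b :: "'a::euclidean_space"
  assumes b: "b \<in> Basis" and e: "e = b \<or> e = - b"
  shows "smooth_chart (sphere 0 1) (Basis - {b}) UNIV
     (\<lambda>u. inverse (1 + u \<bullet> u) *\<^sub>R (2 *\<^sub>R u + (u \<bullet> u - 1) *\<^sub>R e)) {x. x \<bullet> e \<noteq> 1}
     (\<lambda>x. inverse (1 - x \<bullet> e) *\<^sub>R (x - (x \<bullet> e) *\<^sub>R e))"
proof -
  define \<phi> where "\<phi> = (\<lambda>u. inverse (1 + u \<bullet> u) *\<^sub>R (2 *\<^sub>R u + (u \<bullet> u - 1) *\<^sub>R e))"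
  define \<psi> where "\<psi> = (\<lambda>x. inverse (1 - x \<bullet> e) *\<^sub>R (x - (x \<bullet> e) *\<^sub>R e))"
  have ee: "e \<bullet> e = 1" using b e by auto
  have sp: "span (Basis - {b}) = {u. u \<bullet> e = 0}"
  proof -
    have "span (Basis - {b}) = {x. \<forall>i\<in>Basis. i \<notin> Basis - {b} \<longrightarrow> x \<bullet> i = 0}"
      by (rule span_substd_basis) blast
    also have "\<dots> = {u. u \<bullet> b = 0}" using b by blast
    also have "\<dots> = {u. u \<bullet> e = 0}" using e by auto
    finally show ?thesis .
  qed
  have pos: "1 + u \<bullet> u > 0" for u :: 'a using inner_ge_zero[of u] by linarith
  have on: "\<phi> u \<bullet> \<phi> u = 1" "\<phi> u \<bullet> e = (u \<bullet> u - 1) / (1 + u \<bullet> u)" "\<psi> (\<phi> u) = u" if u: "u \<bullet> e = 0" for u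
  proof -
    have q: "1 + u \<bullet> u \<noteq> 0" using pos[of u] by simp
    have "\<phi> u \<bullet> \<phi> u = (inverse (1 + u \<bullet> u))\<^sup>2 * (4 * (u \<bullet> u) + (u \<bullet> u - 1)\<^sup>2)"
      using u ee by (simp add: \<phi>_def inner_add_left inner_add_right inner_commute power2_eq_square algebra_simps)
    also have "4 * (u \<bullet> u) + (u \<bullet> u - 1)\<^sup>2 = (1 + u \<bullet> u)\<^sup>2" by (simp add: power2_eq_square algebra_simps)
    finally show "\<phi> u \<bullet> \<phi> u = 1" using q by (simp flip: power_mult_distrib)
    show pe: "\<phi> u \<bullet> e = (u \<bullet> u - 1) / (1 + u \<bullet> u)"
      using u ee by (simp add: \<phi>_def inner_add_left divide_inverse mult.commute)
    have r: "1 - (q - 1) / (1 + q) = 2 / (1 + q)" "inverse (2 / (1 + q)) * (inverse (1 + q) * 2) = 1"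
      "inverse (1 + q) * (q - 1) - (q - 1) / (1 + q) = 0" if "1 + q \<noteq> 0" for q :: real
      using that by (simp_all add: field_simps)
    define q where "q = u \<bullet> u"
    have "\<psi> (\<phi> u) = inverse (2 / (1 + q)) *\<^sub>R (\<phi> u - ((q - 1) / (1 + q)) *\<^sub>R e)"
      unfolding \<psi>_def pe q_def[symmetric] r(1)[OF q[folded q_def]] ..
    also have "\<phi> u - ((q - 1) / (1 + q)) *\<^sub>R e = (inverse (1 + q) * 2) *\<^sub>R u
        + (inverse (1 + q) * (q - 1) - (q - 1) / (1 + q)) *\<^sub>R e"
    proof -
      have "a *\<^sub>R (2 *\<^sub>R u + c *\<^sub>R e) - k *\<^sub>R e = (a * 2) *\<^sub>R u + (a * c - k) *\<^sub>R e" for a c k :: real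
        by (simp add: algebra_simps)
      then show ?thesis unfolding \<phi>_def q_def[symmetric] .
    qed
    finally show "\<psi> (\<phi> u) = u"
      unfolding r(3)[OF q[folded q_def]] by (simp only: scaleR_zero_left add_0_right scaleR_scaleR r(2)[OF q[folded q_def]] scaleR_one)
  qed
  have im: "\<phi> ` (UNIV \<inter> span (Basis - {b})) = sphere 0 1 \<inter> {x. x \<bullet> e \<noteq> 1}"
  proof (intro set_eqI iffI)
    fix x assume "x \<in> \<phi> ` (UNIV \<inter> span (Basis - {b}))"
    then obtain u where u: "u \<bullet> e = 0" "x = \<phi> u" by (auto simp: sp)
    have "(u \<bullet> u - 1) / (1 + u \<bullet> u) \<noteq> 1" using pos[of u] by (simp add: field_simps)
    then show "x \<in> sphere 0 1 \<inter> {x. x \<bullet> e \<noteq> 1}" using on[OF u(1)] u(2) by (simp add: norm_eq_1)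
  next
    fix x assume "x \<in> sphere 0 1 \<inter> {x. x \<bullet> e \<noteq> 1}"
    then have x: "x \<bullet> x = 1" "x \<bullet> e \<noteq> 1" by (auto simp: dot_square_norm)
    define s where "s = x \<bullet> e"
    have s: "1 - s \<noteq> 0" using x by (simp add: s_def)
    have ue: "\<psi> x \<bullet> e = 0" by (simp add: \<psi>_def inner_diff_left ee)
    have "(x - s *\<^sub>R e) \<bullet> (x - s *\<^sub>R e) = (1 - s) * (1 + s)"
      by (simp add: inner_diff_left inner_diff_right ee x s_def inner_commute algebra_simps)
    then have "\<psi> x \<bullet> \<psi> x = inverse (1 - s) * (inverse (1 - s) * ((1 - s) * (1 + s)))"
      by (simp add: \<psi>_def s_def[symmetric])
    then have uu: "\<psi> x \<bullet> \<psi> x = (1 + s) / (1 - s)" using s by (simp add: divide_inverse)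
    have 1: "1 + (1 + s) / (1 - s) = 2 / (1 - s)" "(1 + s) / (1 - s) - 1 = 2 * s / (1 - s)"
      using s by (simp_all add: field_simps)
    have "\<phi> (\<psi> x) = inverse (2 / (1 - s)) *\<^sub>R (2 *\<^sub>R \<psi> x + (2 * s / (1 - s)) *\<^sub>R e)"
      unfolding \<phi>_def uu 1 ..
    also have "\<dots> = (inverse (2 / (1 - s)) * 2 * inverse (1 - s)) *\<^sub>R (x - s *\<^sub>R e) + (inverse (2 / (1 - s)) * (2 * s / (1 - s))) *\<^sub>R e"
      unfolding \<psi>_def s_def[symmetric] scaleR_add_right scaleR_scaleR mult.assoc ..
    also have "inverse (2 / (1 - s)) * 2 * inverse (1 - s) = 1" using s by (simp add: field_simps)
    also have "inverse (2 / (1 - s)) * (2 * s / (1 - s)) = s" using s by (simp add: field_simps)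
    also have "1 *\<^sub>R (x - s *\<^sub>R e) + s *\<^sub>R e = x" by simp
    finally have "\<phi> (\<psi> x) = x" .
    moreover have "\<psi> x \<in> UNIV \<inter> span (Basis - {b})" unfolding sp using ue by simp
    ultimately show "x \<in> \<phi> ` (UNIV \<inter> span (Basis - {b}))" by (intro image_eqI[where x = "\<psi> x"]) simp_all
  qed
  have "open {x::'a. x \<bullet> e \<noteq> 1}" by (intro open_Collect_neq continuous_intros)
  moreover have "smooth_on UNIV \<phi>" unfolding \<phi>_def smooth_on_def
    using pos by (intro allI Ck_on_scaleR Ck_on_inverse Ck_on_add Ck_on_diff Ck_on_inner Ck_on_const Ck_on_id)
      (auto simp: less_imp_neq[symmetric])
  moreover have "smooth_on {x. x \<bullet> e \<noteq> 1} \<psi>" unfolding \<psi>_def smooth_on_def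
    using \<open>open _\<close> by (intro allI Ck_on_scaleR Ck_on_inverse Ck_on_diff Ck_on_inner Ck_on_const Ck_on_id) auto
  ultimately show ?thesis
    unfolding smooth_chart_def \<phi>_def[symmetric] \<psi>_def[symmetric] using im on(3) sp by auto
qed

text \<open>Normality and the equation \<open>y s \<bullet> y s = 1\<close>, differentiated twice,
  give \<open>y2 s = - (y1 s \<bullet> y1 s) *\<^sub>R y s\<close>; the speed is constant, and one
  more differentiation finishes.\<close>

lemma sphere_geodesic:
  fixes y :: "real \<Rightarrow> 'a::euclidean_space"
  assumes M: "\<And>s. s \<in> I01 \<Longrightarrow> y s \<in> sphere 0 1"
    and d: "\<And>s. s \<in> I01 \<Longrightarrow> (y has_vector_derivative y1 s) (at s within I01)"
      "\<And>s. s \<in> I01 \<Longrightarrow> (y1 has_vector_derivative y2 s) (at s within I01)"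
      "\<And>s. s \<in> I01 \<Longrightarrow> (y2 has_vector_derivative y3 s) (at s within I01)"
    and nor: "\<And>s \<eta>. s \<in> I01 \<Longrightarrow> \<eta> \<in> tangent (sphere 0 1) (y s) \<Longrightarrow> y2 s \<bullet> \<eta> = 0" and s: "s \<in> I01"
  shows "y3 s = - (y1 s \<bullet> y1 s) *\<^sub>R y1 s"
proof -
  have yy: "y s \<bullet> y s = 1" if "s \<in> I01" for s using M[OF that] by (simp add: dot_square_norm)
  have 0: "g = 0" if "((\<lambda>s. c) has_vector_derivative g) (at s within I01)" "s \<in> I01" for c g :: real and s
    using vector_derivative_I01_unique[OF that(1) has_vector_derivative_const that(2)] .
  have yy1: "y s \<bullet> y1 s = 0" if s: "s \<in> I01" for s
  proof -
    have "((\<lambda>s. 1) has_vector_derivative y s \<bullet> y1 s + y1 s \<bullet> y s) (at s within I01)"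
      by (rule has_vector_derivative_cong_open[OF bounded_bilinear.has_vector_derivative[OF bounded_bilinear_inner
            d(1)[OF s] d(1)[OF s]] open_UNIV UNIV_I s]) (simp add: yy)
    from 0[OF this s] show ?thesis by (simp add: inner_commute)
  qed
  have yy2: "y s \<bullet> y2 s = - (y1 s \<bullet> y1 s)" if s: "s \<in> I01" for s
  proof -
    have "((\<lambda>s. 0) has_vector_derivative y s \<bullet> y2 s + y1 s \<bullet> y1 s) (at s within I01)"
      by (rule has_vector_derivative_cong_open[OF bounded_bilinear.has_vector_derivative[OF bounded_bilinear_inner
            d(1)[OF s] d(2)[OF s]] open_UNIV UNIV_I s]) (simp add: yy1)
    from 0[OF this s] show ?thesis by simp
  qed
  have y2: "y2 s = - (y1 s \<bullet> y1 s) *\<^sub>R y s" if s: "s \<in> I01" for s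
  proof -
    define w where "w = y2 s - (y s \<bullet> y2 s) *\<^sub>R y s"
    have "y s \<bullet> w = 0" by (simp add: w_def inner_diff_right yy[OF s])
    then have "y2 s \<bullet> w = 0" using nor[OF s] sphere_tangent_iff[OF M[OF s]] by blast
    then have "w \<bullet> w = 0" using \<open>y s \<bullet> w = 0\<close> by (simp add: w_def inner_diff_left)
    then show ?thesis using yy2[OF s] by (simp add: w_def eq_neg_iff_add_eq_0)
  qed
  have "((\<lambda>s. y1 s \<bullet> y1 s) has_vector_derivative y1 s \<bullet> y2 s + y2 s \<bullet> y1 s) (at s within I01)"
    by (rule bounded_bilinear.has_vector_derivative[OF bounded_bilinear_inner d(2)[OF s] d(2)[OF s]])
  moreover have "y1 s \<bullet> y2 s + y2 s \<bullet> y1 s = 0" using yy1[OF s] by (simp add: y2[OF s] inner_commute)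
  ultimately have n: "((\<lambda>s. - (y1 s \<bullet> y1 s)) has_real_derivative 0) (at s within I01)"
    using has_vector_derivative_minus by (fastforce simp: has_real_derivative_iff_has_vector_derivative)
  have "((\<lambda>s. - (y1 s \<bullet> y1 s) *\<^sub>R y s) has_vector_derivative - (y1 s \<bullet> y1 s) *\<^sub>R y1 s + 0 *\<^sub>R y s) (at s within I01)"
    by (rule has_vector_derivative_scaleR[OF n d(1)[OF s]])
  then have "(y2 has_vector_derivative - (y1 s \<bullet> y1 s) *\<^sub>R y1 s + 0 *\<^sub>R y s) (at s within I01)"
    by (rule has_vector_derivative_cong_open[OF _ open_UNIV UNIV_I s]) (simp add: y2)
  from vector_derivative_I01_unique[OF d(3)[OF s] this s] show ?thesis by simp
qed

lemma sum_even_odd: "(\<Sum>k<2 * n. g k) = (\<Sum>l<n. g (2 * l) + g (2 * l + 1 :: nat))" for g :: "nat \<Rightarrow> 'a::comm_monoid_add"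
  by (induction n) (simp_all add: add.assoc)

text \<open>Consecutive coordinate axes are paired into planes with weights 1 to \<open>n\<close>.
  In odd ambient dimension one axis is left over; if the plane coordinates have constant moduli, its
  coordinate has constant square, which gives \<open>rigid\<close>.\<close>

lemma sphere_light_model:
  assumes card: "CARD('m::finite) = 2 * n \<or> CARD('m) = 2 * n + 1"
  shows "\<exists>e f. light_model {..<n} e f (\<lambda>l. real (Suc l)) (sphere 0 1 :: (real^'m) set) 1 (\<lambda>_. 0)"
proof -
  obtain h :: "nat \<Rightarrow> 'm" where h: "bij_betw h {0..<CARD('m)} UNIV"
    using ex_bij_betw_nat_finite[of "UNIV :: 'm set"] by auto
  have hi: "h i = h j \<longleftrightarrow> i = j" if "i < CARD('m)" "j < CARD('m)" for i j
    using h that by (auto simp: bij_betw_def inj_on_def)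
  define ax where "ax = (\<lambda>k. axis (h k) 1 :: real^'m)"
  have ax: "ax i \<bullet> ax j = (if i = j then 1 else 0)" if "i < CARD('m)" "j < CARD('m)" for i j
    using hi[OF that] by (simp add: ax_def inner_axis_axis)
  define e where "e = (\<lambda>l::nat. ax (2 * l))"
  define f where "f = (\<lambda>l::nat. ax (2 * l + 1))"
  \<comment> \<open>The leftover axis; in even dimension the zero vector, so that one expansion
    serves both cases.\<close>
  define b where "b = (if CARD('m) = 2 * n then 0 else ax (2 * n))"
  interpret rotation_flow "{..<n}" e f "\<lambda>l. real (Suc l)"
  proof
    fix l m assume "l \<in> {..<n}" "m \<in> {..<n}"
    then have "2 * l + 1 < CARD('m)" "2 * m + 1 < CARD('m)" using card by auto
    then show "e l \<bullet> e m = (if l = m then 1 else 0)" "f l \<bullet> f m = (if l = m then 1 else 0)" "e l \<bullet> f m = 0"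
      using ax by (auto simp: e_def f_def) presburger
  qed simp
  have expand: "x = (\<Sum>l<n. emb l (x \<bullet> e l) (x \<bullet> f l)) + (x \<bullet> b) *\<^sub>R b" for x
  proof -
    have "x = (\<Sum>i\<in>UNIV. (x $ i) *\<^sub>R axis i 1)"
      by (simp add: vec_eq_iff axis_def if_distrib cong: if_cong)
    also have "\<dots> = (\<Sum>k\<in>{0..<CARD('m)}. (x $ h k) *\<^sub>R axis (h k) 1)"
      by (rule sum.reindex_bij_betw[OF h, symmetric])
    also have "\<dots> = (\<Sum>k<CARD('m). (x \<bullet> ax k) *\<^sub>R ax k)"
      by (simp add: ax_def inner_axis atLeast0LessThan)
    also have "\<dots> = (\<Sum>k<2 * n. (x \<bullet> ax k) *\<^sub>R ax k) + (x \<bullet> b) *\<^sub>R b"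
      using card by (auto simp: b_def)
    also have "(\<Sum>k<2 * n. (x \<bullet> ax k) *\<^sub>R ax k) = (\<Sum>l<n. emb l (x \<bullet> e l) (x \<bullet> f l))"
      unfolding sum_even_odd emb_def by (simp add: e_def f_def)
    finally show ?thesis .
  qed
  have norm2: "x \<bullet> x = (\<Sum>l<n. (x \<bullet> e l)\<^sup>2 + (x \<bullet> f l)\<^sup>2) + (x \<bullet> b)\<^sup>2" for x
  proof -
    have "x \<bullet> x = x \<bullet> ((\<Sum>l<n. emb l (x \<bullet> e l) (x \<bullet> f l)) + (x \<bullet> b) *\<^sub>R b)" using expand[of x] by simp
    then show ?thesis by (simp add: inner_add_right inner_sum_right emb_def power2_eq_square)
  qed
  have "light_model {..<n} e f (\<lambda>l. real (Suc l)) (sphere 0 1 :: (real^'m) set) 1 (\<lambda>_. 0)"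
  proof
    show "(1::real) > 0" by simp
    show "flow s x \<in> sphere 0 1" if "x \<in> sphere 0 1" for x s
      using that flow_isometry[of s x x] by (simp add: norm_eq_1)
    show "\<exists>B U \<phi> W \<psi>. smooth_chart (sphere 0 1) B U \<phi> W \<psi> \<and> x \<in> W" if "x \<in> sphere 0 1" for x :: "real^'m"
    proof -
      obtain b :: "real^'m" where b: "b \<in> Basis" using nonempty_Basis by blast
      have "x \<bullet> b \<noteq> 1 \<or> x \<bullet> (- b) \<noteq> 1" by auto
      then show ?thesis using sphere_chart[OF b, of b] sphere_chart[OF b, of "- b"] by blast
    qed
    show "inj_on (\<lambda>l. \<bar>real (Suc l)\<bar>) {..<n}" by (auto simp: inj_on_def)
    show "bounded (sphere 0 1 :: (real^'m) set)" by simp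
    show "y3 s = - (1 * (y1 s \<bullet> y1 s)) *\<^sub>R y1 s"
      if "\<And>s. s \<in> I01 \<Longrightarrow> y s \<in> sphere 0 1"
      "\<And>s. s \<in> I01 \<Longrightarrow> (y has_vector_derivative y1 s) (at s within I01)"
      "\<And>s. s \<in> I01 \<Longrightarrow> (y1 has_vector_derivative y2 s) (at s within I01)"
      "\<And>s. s \<in> I01 \<Longrightarrow> (y2 has_vector_derivative y3 s) (at s within I01)"
      "\<And>s \<eta>. s \<in> I01 \<Longrightarrow> \<eta> \<in> tangent (sphere 0 1) (y s) \<Longrightarrow> y2 s \<bullet> \<eta> = 0" "s \<in> I01"
      for y y1 y2 y3 :: "real \<Rightarrow> real^'m" and s
      unfolding mult_1 by (rule sphere_geodesic[OF that])
    show "\<exists>C. \<forall>\<tau>. y \<tau> = C + (\<Sum>l<n. emb l (y \<tau> \<bullet> e l) (y \<tau> \<bullet> f l))"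
      if y: "\<And>\<tau>::real. y \<tau> \<in> sphere 0 1" "continuous_on UNIV y"
        "\<And>l \<tau>. l \<in> {..<n} \<Longrightarrow> (y \<tau> \<bullet> e l)\<^sup>2 + (y \<tau> \<bullet> f l)\<^sup>2 = r l" for y r
    proof -
      have "(y \<tau> \<bullet> b)\<^sup>2 = 1 - (\<Sum>l<n. r l)" for \<tau>
        using norm2[of "y \<tau>"] y(1)[of \<tau>] y(3) by (simp add: dot_square_norm)
      then have const: "y \<tau> \<bullet> b = y 0 \<bullet> b" for \<tau>
        by (intro continuous_square_constant) (auto intro!: continuous_intros y(2))
      have "y \<tau> = (y 0 \<bullet> b) *\<^sub>R b + (\<Sum>l<n. emb l (y \<tau> \<bullet> e l) (y \<tau> \<bullet> f l))" for \<tau>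
        using trans[OF expand[of "y \<tau>"] add.commute] unfolding const[of \<tau>] .
      then show ?thesis by blast
    qed
    show "x = 0 + emb l (x \<bullet> e l) (x \<bullet> f l)"
      if x: "x \<in> sphere 0 1" "l \<in> {..<n}" "\<And>m. m \<in> {..<n} \<Longrightarrow> m \<noteq> l \<Longrightarrow> x \<bullet> e m = 0 \<and> x \<bullet> f m = 0"
       "1 * ((x \<bullet> e l)\<^sup>2 + (x \<bullet> f l)\<^sup>2) = 1" for x l
    proof -
      have "(\<Sum>m<n. (x \<bullet> e m)\<^sup>2 + (x \<bullet> f m)\<^sup>2) = (\<Sum>m<n. if m = l then 1 else 0)"
        using x by (intro sum.cong) auto
      then have "(x \<bullet> b)\<^sup>2 = 0" using norm2[of x] x(1,2) by (simp add: dot_square_norm)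
      moreover have "(\<Sum>m<n. emb m (x \<bullet> e m) (x \<bullet> f m)) = (\<Sum>m<n. if m = l then emb l (x \<bullet> e l) (x \<bullet> f l) else 0)"
        using x by (intro sum.cong) (auto simp: emb_def)
      ultimately show ?thesis using expand[of x] x(2) by simp
    qed
    have en: "emb l p q \<bullet> emb l p q = p\<^sup>2 + q\<^sup>2" if "l \<in> {..<n}" for l p q
      using that unfolding emb_def
      by (simp add: inner_add_left inner_add_right ee ff ef fe power2_eq_square del: lessThan_iff)
    show "0 + emb l p q \<in> sphere 0 1" if "l \<in> {..<n}" "1 * (p\<^sup>2 + q\<^sup>2) = 1" for l p q
      using en[OF that(1), of p q] that(2) by (simp add: norm_eq_1)
    then show "emb l p q \<bullet> v = 0" if "l \<in> {..<n}" "1 * (p\<^sup>2 + q\<^sup>2) = 1" "v \<in> tangent (sphere 0 1) (0 + emb l p q)" for l p q v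
      using that sphere_tangent_iff[of "emb l p q" v] by simp
  qed auto
  then show ?thesis by blast
qed

section \<open>Composition algebras\<close>

text \<open>Conjugation, the cancellation laws and the Moufang identity all follow from a
  multiplicative norm and a unit, so that the octonions are treated together with the associative
  algebras.\<close>

locale composition_algebra =
  fixes mul :: "'a::euclidean_space \<Rightarrow> 'a \<Rightarrow> 'a" (infixl "\<odot>" 70) and one :: 'a
  assumes bil: "bounded_bilinear mul"
    and norm_mul: "norm (x \<odot> y) = norm x * norm y"
    and one_left [simp]: "one \<odot> x = x" and one_right [simp]: "x \<odot> one = x"
begin

sublocale mul: bounded_bilinear mul by (rule bil)

definition re :: "'a \<Rightarrow> real" where "re x = x \<bullet> one"

text \<open>Reflection in the real axis, expressed by the inner product and the unit alone.\<close>

definition cj :: "'a \<Rightarrow> 'a" where "cj x = (2 * re x) *\<^sub>R one - x"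

lemmas mul_simps = mul.add_left mul.add_right mul.diff_left mul.diff_right mul.scaleR_left mul.scaleR_right
  mul.minus_left mul.minus_right mul.zero_left mul.zero_right

lemma norm_one [simp]: "norm one = 1"
proof -
  have "one \<noteq> 0"
  proof
    assume "one = 0"
    then have "x = 0" for x :: 'a using one_left[of x] mul.zero_left by metis
    then show False using nonempty_Basis nonzero_Basis by blast
  qed
  moreover have "norm one = norm one * norm one" using norm_mul[of one one] by simp
  ultimately show ?thesis by simp
qed

lemma inner_one [simp]: "one \<bullet> one = 1" by (simp add: dot_square_norm)

lemma re_one [simp]: "re one = 1" by (simp add: re_def)

lemma re_linear: "re (x + y) = re x + re y" "re (x - y) = re x - re y" "re (r *\<^sub>R x) = r * re x" "re 0 = 0"
  by (simp_all add: re_def inner_add_left inner_diff_left)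

lemma bounded_linear_re: "bounded_linear re"
  unfolding re_def[abs_def] by (rule bounded_linear_inner_left)

lemma bounded_linear_cj: "bounded_linear cj"
proof -
  have "linear cj" by (rule linearI) (simp_all add: cj_def re_linear algebra_simps)
  then show ?thesis by (simp add: linear_conv_bounded_linear)
qed

lemma cj_linear: "cj (x + y) = cj x + cj y" "cj (x - y) = cj x - cj y" "cj (r *\<^sub>R x) = r *\<^sub>R cj x" "cj 0 = 0"
  "cj (- x) = - cj x"
  using bounded_linear.linear[OF bounded_linear_cj] by (simp_all add: linear_add linear_diff linear_scale linear_0 linear_neg)

lemma cj_one [simp]: "cj one = one" by (simp add: cj_def scaleR_2)

lemma re_cj [simp]: "re (cj x) = re x" by (simp add: cj_def re_linear)

lemma cj_cj [simp]: "cj (cj x) = x" unfolding cj_def[of "cj x"] re_cj by (simp add: cj_def)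

lemma cj_inner: "cj x \<bullet> y = x \<bullet> cj y"
  by (simp add: cj_def inner_diff_left inner_diff_right re_def inner_commute)

lemma cj_inner_cj [simp]: "cj x \<bullet> cj y = x \<bullet> y" by (simp add: cj_inner)

lemma self_conjugate: "cj x = x \<Longrightarrow> x = re x *\<^sub>R one"
  unfolding cj_def by (metis (no_types) add_diff_cancel diff_add_cancel scaleR_2 scaleR_left_imp_eq scaleR_scaleR
      zero_neq_numeral)

lemma inner_mul_same_left: "(x \<odot> y) \<bullet> (x \<odot> z) = (x \<bullet> x) * (y \<bullet> z)"
proof -
  have n: "(x \<odot> y) \<bullet> (x \<odot> y) = (x \<bullet> x) * (y \<bullet> y)" for y
    by (simp add: dot_square_norm norm_mul power_mult_distrib)
  have "(x \<odot> (y + z)) \<bullet> (x \<odot> (y + z)) = (x \<bullet> x) * ((y + z) \<bullet> (y + z))" by (rule n)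
  then show ?thesis using n[of y] n[of z]
    by (simp add: mul_simps inner_add_left inner_add_right algebra_simps inner_commute)
qed

text \<open>Full polarisation of the multiplicative norm. Putting \<open>one\<close> for a factor
  yields the adjoints of left and right multiplication below; further identities are then read off
  by testing with inner products.\<close>

lemma inner_mul_exchange: "(x \<odot> y) \<bullet> (z \<odot> w) + (z \<odot> y) \<bullet> (x \<odot> w) = 2 * (x \<bullet> z) * (y \<bullet> w)"
proof -
  have "((x + z) \<odot> y) \<bullet> ((x + z) \<odot> w) = ((x + z) \<bullet> (x + z)) * (y \<bullet> w)" by (rule inner_mul_same_left)
  then show ?thesis using inner_mul_same_left[of x y w] inner_mul_same_left[of z y w]
    by (simp add: mul_simps inner_add_left inner_add_right algebra_simps inner_commute)
qed

lemma adj_left: "(x \<odot> y) \<bullet> w = y \<bullet> (cj x \<odot> w)"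
  using inner_mul_exchange[of x y one w]
  by (simp add: cj_def mul_simps inner_diff_right re_def algebra_simps)

lemma adj_right: "(y \<odot> x) \<bullet> w = y \<bullet> (w \<odot> cj x)"
  using inner_mul_exchange[of y x w one]
  by (simp add: cj_def mul_simps inner_diff_right re_def algebra_simps inner_commute)

lemma eq_by_inner: "(\<And>w. x \<bullet> w = y \<bullet> w) \<Longrightarrow> x = y" for x y :: 'a
  by (metis vector_eq_rdot)

text \<open>A form of the left alternative law: the polarised norm identity with \<open>x\<close>
  moved across the inner product.\<close>

lemma cancel_left: "cj x \<odot> (x \<odot> y) = (x \<bullet> x) *\<^sub>R y"
proof (rule eq_by_inner)
  fix w show "(cj x \<odot> (x \<odot> y)) \<bullet> w = ((x \<bullet> x) *\<^sub>R y) \<bullet> w"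
    using inner_mul_same_left[of x y w] by (simp add: adj_left[of "cj x"])
qed

lemma inner_mul_same_right: "(y \<odot> x) \<bullet> (z \<odot> x) = (y \<bullet> z) * (x \<bullet> x)"
  using inner_mul_exchange[of y x z x] by (simp add: inner_commute)

lemma cancel_right: "(y \<odot> x) \<odot> cj x = (x \<bullet> x) *\<^sub>R y"
proof (rule eq_by_inner)
  fix w show "((y \<odot> x) \<odot> cj x) \<bullet> w = ((x \<bullet> x) *\<^sub>R y) \<bullet> w"
    using inner_mul_same_right[of y x w] by (simp add: adj_right[of _ "cj x"])
qed

lemma cancel_left': "x \<odot> (cj x \<odot> y) = (x \<bullet> x) *\<^sub>R y"
  using cancel_left[of "cj x" y] by simp

lemma cancel_right': "(y \<odot> cj x) \<odot> x = (x \<bullet> x) *\<^sub>R y"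
  using cancel_right[of y "cj x"] by simp

lemma mul_cj: "x \<odot> cj x = (x \<bullet> x) *\<^sub>R one" "cj x \<odot> x = (x \<bullet> x) *\<^sub>R one"
  using cancel_right[of one x] cancel_left[of x one] by simp_all

lemma cj_mul: "cj (x \<odot> y) = cj y \<odot> cj x"
proof (rule eq_by_inner)
  fix w
  have "cj (x \<odot> y) \<bullet> w = y \<bullet> (cj x \<odot> cj w)" by (simp add: cj_inner adj_left)
  also have "\<dots> = (y \<odot> w) \<bullet> cj x" by (simp add: adj_right)
  also have "\<dots> = (cj y \<odot> cj x) \<bullet> w" using adj_left[of y w "cj x"] by (simp add: inner_commute)
  finally show "cj (x \<odot> y) \<bullet> w = (cj y \<odot> cj x) \<bullet> w" .
qed

text \<open>The left-hand side depends on \<open>y\<close> and \<open>z\<close> through \<open>y \<odot> z\<close> only.\<close>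
lemma mul_sandwich: "(x \<odot> y) \<odot> (z \<odot> x) = (2 * ((y \<odot> z) \<bullet> cj x)) *\<^sub>R x - (x \<bullet> x) *\<^sub>R cj (y \<odot> z)"
proof (rule eq_by_inner)
  fix t
  have "((x \<odot> y) \<odot> (z \<odot> x)) \<bullet> t = (x \<odot> y) \<bullet> (t \<odot> (cj x \<odot> cj z))"
    by (simp add: adj_right[of _ "z \<odot> x"] cj_mul)
  also have "\<dots> = 2 * (x \<bullet> t) * (y \<bullet> (cj x \<odot> cj z)) - (t \<odot> y) \<bullet> (x \<odot> (cj x \<odot> cj z))"
    using inner_mul_exchange[of x y t "cj x \<odot> cj z"] by simp
  also have "x \<odot> (cj x \<odot> cj z) = (x \<bullet> x) *\<^sub>R cj z" by (rule cancel_left')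
  also have "y \<bullet> (cj x \<odot> cj z) = (y \<odot> z) \<bullet> cj x" by (simp add: adj_right)
  also have "(t \<odot> y) \<bullet> ((x \<bullet> x) *\<^sub>R cj z) = (x \<bullet> x) * (cj (y \<odot> z) \<bullet> t)"
    using adj_right[of t y "cj z"] by (simp add: cj_mul inner_commute)
  finally show "((x \<odot> y) \<odot> (z \<odot> x)) \<bullet> t = ((2 * ((y \<odot> z) \<bullet> cj x)) *\<^sub>R x - (x \<bullet> x) *\<^sub>R cj (y \<odot> z)) \<bullet> t"
    by (simp add: inner_diff_left)
qed

text \<open>Both sides are sandwiches as in \<open>mul_sandwich\<close> with the same middle
  product, the right one having \<open>one\<close> as its second middle factor.\<close>

lemma moufang: "(x \<odot> y) \<odot> (z \<odot> x) = (x \<odot> (y \<odot> z)) \<odot> x"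
  using mul_sandwich[of x y z] mul_sandwich[of x "y \<odot> z" one] by simp

lemma re_mul: "re (x \<odot> y) = x \<bullet> cj y"
  unfolding re_def using adj_right[of x y one] by simp

end

text \<open>The doubling step of Hurwitz. In the squared norm of a product the cross terms cancel by
  moving factors across the inner product, and this is where associativity of the original algebra
  enters.\<close>

lemma composition_algebra_doubling:
  fixes mul :: "'a::euclidean_space \<Rightarrow> 'a \<Rightarrow> 'a"
  assumes "composition_algebra mul one" and assoc: "\<And>x y z. mul (mul x y) z = mul x (mul y z)"
    and cj: "cj = composition_algebra.cj one"
  shows "composition_algebra (cd_mult mul cj) (one, 0)"
    and "composition_algebra.cj (one, 0) = cd_cnj cj"
proof -
  interpret composition_algebra mul one by fact
  have cj': "cj = composition_algebra.cj one" by (rule assms)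
  note l = mul_simps cj_linear
  have nrm: "norm (cd_mult mul cj x y) = norm x * norm y" for x y
  proof -
    obtain a b c d where xy: "x = (a, b)" "y = (c, d)" by (metis prod.exhaust)
    have "mul a c \<bullet> mul (cj d) b = mul d a \<bullet> mul b (cj c)"
    proof -
      have "mul a c \<bullet> mul (cj d) b = b \<bullet> mul d (mul a c)" using adj_left[of "cj d" b "mul a c"]
        by (simp add: inner_commute cj')
      also have "\<dots> = mul d a \<bullet> mul b (cj c)" using adj_right[of b "cj c" "mul d a"]
        by (simp add: inner_commute cj' assoc)
      finally show ?thesis .
    qed
    then have "cd_mult mul cj x y \<bullet> cd_mult mul cj x y =
       mul a c \<bullet> mul a c + mul (cj d) b \<bullet> mul (cj d) b + mul d a \<bullet> mul d a + mul b (cj c) \<bullet> mul b (cj c)"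
      by (simp add: xy cd_mult_def inner_diff_left inner_diff_right inner_add_left inner_add_right inner_commute)
    also have "\<dots> = (a \<bullet> a) * (c \<bullet> c) + (d \<bullet> d) * (b \<bullet> b) + (d \<bullet> d) * (a \<bullet> a) + (b \<bullet> b) * (c \<bullet> c)"
      by (simp add: inner_mul_same_left cj')
    also have "\<dots> = (x \<bullet> x) * (y \<bullet> y)" by (simp add: xy algebra_simps)
    finally have "(norm (cd_mult mul cj x y))\<^sup>2 = (norm x * norm y)\<^sup>2"
      by (simp add: power2_norm_eq_inner power_mult_distrib)
    then show ?thesis by simp
  qed
  have lin: "bounded_bilinear (cd_mult mul cj)"
  proof
    show "\<exists>K. \<forall>a b. norm (cd_mult mul cj a b) \<le> norm a * norm b * K"
      by (rule exI[of _ 1]) (simp add: nrm)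
  qed (auto simp: cd_mult_def l cj' algebra_simps)
  show ca: "composition_algebra (cd_mult mul cj) (one, 0)"
  proof (rule composition_algebra.intro)
    show "bounded_bilinear (cd_mult mul cj)" by (rule lin)
    show "cd_mult mul cj (one, 0) x = x" "cd_mult mul cj x (one, 0) = x" for x
      by (cases x; simp add: cd_mult_def l cj')+
  qed (rule nrm)
  show "composition_algebra.cj (one, 0) = cd_cnj cj"
    by (rule ext) (auto simp: composition_algebra.cj_def[OF ca] composition_algebra.re_def[OF ca] cd_cnj_def cj' cj_def re_def)
qed

interpretation complex_alg: composition_algebra "(*) :: complex \<Rightarrow> complex \<Rightarrow> complex" 1
  by unfold_locales (auto simp: norm_mult algebra_simps intro: exI[of _ 1])

lemma complex_cj: "complex_alg.cj = cnj"
  by (rule ext) (simp add: complex_alg.cj_def complex_alg.re_def complex_eq_iff inner_complex_def)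

lemma quat_mult_assoc: "quat_mult (quat_mult x y) z = quat_mult x (quat_mult y z)"
  by (cases x; cases y; cases z) (simp add: quat_mult_def cd_mult_def algebra_simps)

interpretation quat_alg: composition_algebra quat_mult "(1, 0)"
  unfolding quat_mult_def
  by (rule composition_algebra_doubling(1)) (auto simp: complex_alg.composition_algebra_axioms complex_cj)

lemma quat_cj: "quat_alg.cj = quat_cnj"
  unfolding quat_cnj_def
  by (rule composition_algebra_doubling(2)[where mul = "(*)"]) (auto simp: complex_alg.composition_algebra_axioms complex_cj)

interpretation oct_alg: composition_algebra oct_mult oct_one
  unfolding oct_mult_def oct_one_def zero_prod_def[symmetric]
  by (rule composition_algebra_doubling(1))
     (auto simp: quat_alg.composition_algebra_axioms quat_cj quat_mult_assoc)

lemma oct_cj: "oct_alg.cj = oct_cnj"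
  unfolding oct_cnj_def oct_one_def zero_prod_def[symmetric]
  by (rule composition_algebra_doubling(2)[where mul = quat_mult])
     (auto simp: quat_alg.composition_algebra_axioms quat_cj quat_mult_assoc)

section \<open>Projective spaces over composition algebras\<close>

lemma inner_matrix: "(A :: 'a::real_inner^'n^'m) \<bullet> B = (\<Sum>i\<in>UNIV. \<Sum>j\<in>UNIV. A$i$j \<bullet> B$i$j)"
  by (simp add: inner_vec_def)

lemma bounded_linear_entry: "bounded_linear (\<lambda>A :: 'a::real_normed_vector^'n^'m. A $ i $ j)"
  using bounded_linear_compose[OF bounded_linear_vec_nth bounded_linear_vec_nth] .

lemma sum_UNIV_pair:
  fixes g :: "'i::finite \<Rightarrow> 'b::comm_monoid_add"
  assumes "i \<noteq> k"
  shows "(\<Sum>a\<in>UNIV. g a) = g i + g k + (\<Sum>a\<in>UNIV - {i, k}. g a)"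
proof -
  have "UNIV - {i} - {k} = UNIV - {i, k}" by auto
  then show ?thesis
    using sum.remove[of UNIV i g] sum.remove[of "UNIV - {i}" k g] assms by (simp add: add.assoc)
qed

lemma card_3_split:
  assumes "CARD('m::finite) = 3" "i \<noteq> (k::'m)"
  obtains b where "b \<noteq> i" "b \<noteq> k" "UNIV = {i, k, b}"
proof -
  have "card (UNIV - {i, k}) = 1" using assms by (simp add: card_Diff_subset)
  then obtain b where "UNIV - {i, k} = {b}" by (auto simp: card_1_singleton_iff)
  then show ?thesis using that[of b] by blast
qed

text \<open>The disjunction admits the octonions in size 3: there a vector with one nuclear
  coordinate has just two others, a situation that \<open>good_relation\<close> can handle.\<close>

locale projective_space = composition_algebra mul one
  for mul :: "'a::euclidean_space \<Rightarrow> 'a \<Rightarrow> 'a" (infixl "\<odot>" 70) and one +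
  fixes idx :: "'m::finite \<Rightarrow> nat"
  assumes assoc_or_3: "(\<forall>x y z. (x \<odot> y) \<odot> z = x \<odot> (y \<odot> z)) \<or> CARD('m) = 3"
begin

text \<open>The condition \<open>A\<^sub>i\<^sub>k A\<^sub>k\<^sub>j = A\<^sub>k\<^sub>k A\<^sub>i\<^sub>j\<close> says that \<open>A\<close> has rank one in a form that does not involve
  associativity.\<close>
definition PM :: "('a^'m^'m) set" where
  "PM = {A. (\<forall>i j. A$j$i = cj (A$i$j)) \<and> (\<forall>i j k. A$i$k \<odot> A$k$j = re (A$k$k) *\<^sub>R A$i$j) \<and>
     (\<Sum>i\<in>UNIV. re (A$i$i)) = 1}"

text \<open>The nucleus: elements that associate with all others in each of the three positions. It
  contains the real multiples of the unit.\<close>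

definition nuc :: "'a \<Rightarrow> bool" where
  "nuc n \<longleftrightarrow> (\<forall>x y. (n \<odot> x) \<odot> y = n \<odot> (x \<odot> y) \<and> (x \<odot> n) \<odot> y = x \<odot> (n \<odot> y) \<and> (x \<odot> y) \<odot> n = x \<odot> (y \<odot> n))"

lemma nucD: assumes "nuc n"
  shows "(n \<odot> x) \<odot> y = n \<odot> (x \<odot> y)" "(x \<odot> n) \<odot> y = x \<odot> (n \<odot> y)" "(x \<odot> y) \<odot> n = x \<odot> (y \<odot> n)"
  using assms by (auto simp: nuc_def)

lemma nuc_real: "nuc (r *\<^sub>R one)" "nuc one" "nuc 0"
  by (simp_all add: nuc_def mul_simps)

lemma nuc_cj: "nuc n \<Longrightarrow> nuc (cj n)"
  unfolding nuc_def by (simp add: cj_def mul_simps)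

definition outer :: "'a^'m \<Rightarrow> 'a^'m \<Rightarrow> 'a^'m^'m" where
  "outer v w = (\<chi> i j. v$i \<odot> cj (w$j))"

lemma outer_nth [simp]: "outer v w $ i $ j = v$i \<odot> cj (w$j)" by (simp add: outer_def)

lemma bounded_bilinear_outer: "bounded_bilinear outer"
proof -
  have 1: "linear (\<lambda>v. outer v w)" "linear (outer v)" for v w
    by (auto intro!: linearI simp: vec_eq_iff mul_simps cj_linear)
  then have "bilinear outer" by (simp add: bilinear_def)
  then show ?thesis by (simp add: bilinear_conv_bounded_bilinear)
qed

text \<open>At most two coordinates lie outside the nucleus. This replaces associativity in showing
  that \<open>outer v v\<close> has rank one.\<close>

definition good :: "'a^'m \<Rightarrow> bool" where
  "good v \<longleftrightarrow> (\<exists>i k. \<forall>b. b \<noteq> i \<longrightarrow> b \<noteq> k \<longrightarrow> nuc (v$b))"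

text \<open>Among the three indices either one has a nuclear coordinate or two coincide. In each
  case rebracketing, a cancellation law or multiplicativity of the norm gives the relation.\<close>

lemma good_relation:
  assumes "good v"
  shows "(v$a \<odot> cj (v$l)) \<odot> (v$l \<odot> cj (v$j)) = (v$l \<bullet> v$l) *\<^sub>R (v$a \<odot> cj (v$j))"
proof -
  obtain i k where ik: "\<And>b. b \<noteq> i \<Longrightarrow> b \<noteq> k \<Longrightarrow> nuc (v$b)" using assms by (auto simp: good_def)
  consider "nuc (v$a)" | "nuc (v$j)" | "nuc (v$l)" | "a = l" | "l = j" | "a = j" using ik by metis
  then show ?thesis
  proof cases
    case 1 then show ?thesis by (simp add: nucD cancel_left mul_simps)
  next
    case 2
    then show ?thesis using nucD(3)[OF nuc_cj[OF 2], of "v$a \<odot> cj (v$l)" "v$l", symmetric]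
      by (simp add: cancel_right' mul_simps)
  next
    case 3 then show ?thesis using nucD(2)[OF nuc_cj[OF 3]] by (simp add: cancel_left mul_simps)
  next
    case 4 then show ?thesis by (simp add: mul_cj mul_simps)
  next
    case 5 then show ?thesis by (simp add: mul_cj mul_simps)
  next
    case 6
    have "v$l \<odot> cj (v$a) = cj (v$a \<odot> cj (v$l))" by (simp add: cj_mul)
    then have "(v$a \<odot> cj (v$l)) \<odot> (v$l \<odot> cj (v$a)) = ((v$a \<odot> cj (v$l)) \<bullet> (v$a \<odot> cj (v$l))) *\<^sub>R one"
      by (simp only: mul_cj(1))
    also have "\<dots> = (v$l \<bullet> v$l) *\<^sub>R (v$a \<odot> cj (v$a))"
      by (simp add: inner_mul_same_left mul_cj mult.commute)
    finally show ?thesis using 6 by simp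
  qed
qed

lemma re_mul_cj: "re (x \<odot> cj y) = x \<bullet> y" by (simp add: re_mul)

lemma outer_PM:
  assumes "good v" "v \<bullet> v \<noteq> 0"
  shows "(1 / (v \<bullet> v)) *\<^sub>R outer v v \<in> PM"
proof -
  have "v \<bullet> v = (\<Sum>i\<in>UNIV. v$i \<bullet> v$i)" by (simp add: inner_vec_def)
  then have "(\<Sum>i\<in>UNIV. re (((1 / (v \<bullet> v)) *\<^sub>R outer v v)$i$i)) = 1"
    using assms(2) by (simp add: re_linear re_mul_cj sum_divide_distrib[symmetric])
  then show ?thesis
    unfolding PM_def using good_relation[OF assms(1)]
    by (auto simp: cj_linear cj_mul mul_simps re_linear re_mul_cj)
qed

lemma PM_D:
  assumes "A \<in> PM"
  shows PM_herm: "A$j$i = cj (A$i$j)" and PM_rel: "A$i$k \<odot> A$k$j = re (A$k$k) *\<^sub>R A$i$j"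
    and PM_tr: "(\<Sum>i\<in>UNIV. re (A$i$i)) = 1"
  using assms unfolding PM_def by blast+

lemma PM_diag: "A \<in> PM \<Longrightarrow> A$i$i = re (A$i$i) *\<^sub>R one"
  using PM_herm[of A i i] self_conjugate by metis

lemma PM_entry:
  assumes "A \<in> PM" shows "A$i$j \<bullet> A$i$j = re (A$i$i) * re (A$j$j)"
proof -
  have "re (A$i$j \<odot> A$j$i) = re (A$j$j) * re (A$i$i)"
    using PM_rel[OF assms, of i j i] by (simp add: re_linear)
  then show ?thesis using PM_herm[OF assms, of j i] by (simp add: re_mul mult.commute)
qed

lemma PM_diag_nonneg:
  assumes "A \<in> PM" shows "re (A$k$k) \<ge> 0"
proof -
  have "re (A$k$k) = re (A$k$k) * (\<Sum>i\<in>UNIV. re (A$i$i))" using PM_tr[OF assms] by simp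
  also have "\<dots> = (\<Sum>i\<in>UNIV. A$k$i \<bullet> A$k$i)" by (simp add: PM_entry[OF assms] sum_distrib_left)
  also have "\<dots> \<ge> 0" by (intro sum_nonneg) simp
  finally show ?thesis .
qed

lemma PM_norm:
  assumes "A \<in> PM" shows "A \<bullet> A = 1"
  by (simp add: inner_matrix PM_entry[OF assms] PM_tr[OF assms] flip: sum_distrib_left sum_distrib_right)

lemma PM_nonzero_diag: "A \<in> PM \<Longrightarrow> \<exists>k. re (A$k$k) \<noteq> 0"
proof (rule ccontr)
  assume A: "A \<in> PM" and "\<nexists>k. re (A$k$k) \<noteq> 0"
  then show False using PM_tr[OF A] by simp
qed

definition col :: "'m \<Rightarrow> 'a^'m^'m \<Rightarrow> 'a^'m" where "col l A = (\<chi> i. A$i$l)"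

text \<open>The rank-one relation recovers the matrix from any column whose diagonal entry is
  nonzero.\<close>

lemma PM_col:
  assumes A: "A \<in> PM" and l: "re (A$l$l) \<noteq> 0"
  shows "A = (1 / re (A$l$l)) *\<^sub>R outer (col l A) (col l A)" "col l A \<bullet> col l A = re (A$l$l)"
proof -
  show "A = (1 / re (A$l$l)) *\<^sub>R outer (col l A) (col l A)"
    using l PM_rel[OF A, of _ l] PM_herm[OF A, symmetric] by (simp add: vec_eq_iff col_def)
  show "col l A \<bullet> col l A = re (A$l$l)"
    using PM_tr[OF A] by (simp add: inner_vec_def col_def PM_entry[OF A] flip: sum_distrib_right)
qed

lemma good_if_nuc: "nuc (v$k) \<Longrightarrow> good v"
proof -
  assume k: "nuc (v$k)"
  show "good v"
  proof (cases "\<forall>x y z. (x \<odot> y) \<odot> z = x \<odot> (y \<odot> z)")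
    case True
    then show ?thesis by (auto simp: good_def nuc_def)
  next
    case False
    then have c: "CARD('m) = 3" using assoc_or_3 by blast
    then have "\<not> UNIV \<subseteq> {k}" using card_mono[of "{k}" "UNIV :: 'm set"] by auto
    then obtain i where "i \<noteq> k" by blast
    obtain b where "b \<noteq> i" "b \<noteq> k" and b: "UNIV = {i, k, b}" by (rule card_3_split[OF c \<open>i \<noteq> k\<close>])
    have "nuc (v$a)" if "a \<noteq> i" "a \<noteq> b" for a
    proof -
      have "a \<in> {i, k, b}" unfolding b[symmetric] by (rule UNIV_I)
      then show ?thesis using that k by simp
    qed
    then show ?thesis unfolding good_def by (intro exI allI impI)
  qed
qed

text \<open>The two indices allowed to be non-nuclear can be prescribed. In the nonassociative case
  let \<open>b\<close> be the third index: if its diagonal entry is nonzero, column \<open>b\<close>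
  has this real entry as its coordinate at \<open>b\<close>; otherwise row \<open>b\<close>
  vanishes, and any column with nonzero diagonal entry will do.\<close>

lemma PM_representation:
  assumes A: "A \<in> PM" and ik: "i \<noteq> k"
  shows "\<exists>v. v \<bullet> v \<noteq> 0 \<and> A = (1 / (v \<bullet> v)) *\<^sub>R outer v v \<and> (\<forall>b. b \<noteq> i \<longrightarrow> b \<noteq> k \<longrightarrow> nuc (v$b))"
proof -
  have "\<exists>l. re (A$l$l) \<noteq> 0 \<and> (\<forall>b. b \<noteq> i \<longrightarrow> b \<noteq> k \<longrightarrow> nuc (col l A $ b))"
  proof (cases "\<forall>x y z. (x \<odot> y) \<odot> z = x \<odot> (y \<odot> z)")
    case True
    then show ?thesis using PM_nonzero_diag[OF A] by (auto simp: nuc_def)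
  next
    case False
    then have "CARD('m) = 3" using assoc_or_3 by blast
    obtain b where "b \<noteq> i" "b \<noteq> k" and U: "UNIV = {i, k, b}"
      by (rule card_3_split[OF \<open>CARD('m) = 3\<close> ik])
    have b: "a = b" if "a \<noteq> i" "a \<noteq> k" for a
    proof -
      have "a \<in> {i, k, b}" unfolding U[symmetric] by (rule UNIV_I)
      then show ?thesis using that by simp
    qed
    show ?thesis
    proof (cases "re (A$b$b) = 0")
      case True
      obtain l where l: "re (A$l$l) \<noteq> 0" using PM_nonzero_diag[OF A] by blast
      have "A$b$l \<bullet> A$b$l = 0" using PM_entry[OF A] True by simp
      then have "col l A $ b = 0" by (simp add: col_def)
      then have "nuc (col l A $ c)" if "c \<noteq> i" "c \<noteq> k" for c
        using b[OF that] nuc_real(3) by simp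
      then show ?thesis using l by blast
    next
      case False
      have "nuc (A $ b $ b)" using nuc_real(1)[of "re (A$b$b)"] unfolding PM_diag[OF A, of b, symmetric] .
      then have "nuc (col b A $ b)" by (simp add: col_def)
      then have "nuc (col b A $ c)" if "c \<noteq> i" "c \<noteq> k" for c
        using b[OF that] by simp
      then show ?thesis using False by blast
    qed
  qed
  then obtain l where l: "re (A$l$l) \<noteq> 0" "\<forall>b. b \<noteq> i \<longrightarrow> b \<noteq> k \<longrightarrow> nuc (col l A $ b)" by blast
  then show ?thesis using PM_col[OF A l(1)] by (intro exI[of _ "col l A"]) simp
qed

section \<open>Affine charts\<close>

text \<open>Homogeneous coordinates of a point in the affine chart where the \<open>k\<close>-th
  coordinate is one. The affine coordinates are stored in column \<open>k\<close> of a matrix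
  because the coordinate space has to lie in the ambient space of the manifold.\<close>

definition lift :: "'m \<Rightarrow> 'a^'m^'m \<Rightarrow> 'a^'m" where
  "lift k u = (\<chi> i. if i = k then one else u$i$k)"

definition chart_basis :: "'m \<Rightarrow> ('a^'m^'m) set" where
  "chart_basis k = {axis i (axis k b) | i b. i \<noteq> k \<and> b \<in> Basis}"

lemma span_chart_basis: "span (chart_basis k) = {u. \<forall>i j. (j \<noteq> k \<or> i = k) \<longrightarrow> u$i$j = 0}"
proof -
  have sub: "chart_basis k \<subseteq> Basis" by (auto simp: chart_basis_def Basis_vec_def)
  have "span (chart_basis k) = {x. \<forall>b\<in>Basis. b \<notin> chart_basis k \<longrightarrow> x \<bullet> b = 0}"
    by (rule span_substd_basis[OF sub])
  also have "\<dots> = {u. \<forall>i j. (j \<noteq> k \<or> i = k) \<longrightarrow> u$i$j = 0}"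
  proof (intro set_eqI iffI CollectI allI impI ballI)
    fix u :: "'a^'m^'m" and i j assume u: "u \<in> {x. \<forall>b\<in>Basis. b \<notin> chart_basis k \<longrightarrow> x \<bullet> b = 0}" and ij: "j \<noteq> k \<or> i = k"
    show "u$i$j = 0"
    proof (rule euclidean_eqI)
      fix b :: 'a assume b: "b \<in> Basis"
      then have "axis i (axis j b) \<noteq> axis i' (axis k b')" if "i' \<noteq> k" for i' b'
        using ij that nonzero_Basis[OF b] by (auto simp: axis_eq_axis)
      then have "axis i (axis j b) \<notin> chart_basis k" by (auto simp: chart_basis_def)
      moreover have "axis i (axis j b) \<in> (Basis :: ('a^'m^'m) set)" using b by (auto simp: Basis_vec_def)
      ultimately have "u \<bullet> axis i (axis j b) = 0" using u by blast
      then show "u$i$j \<bullet> b = 0 \<bullet> b" by (simp add: inner_axis)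
    qed
  next
    fix u b assume u: "u \<in> {u::'a^'m^'m. \<forall>i j. (j \<noteq> k \<or> i = k) \<longrightarrow> u$i$j = 0}" and b: "b \<in> Basis" "b \<notin> chart_basis k"
    then obtain i j c where c: "b = axis i (axis j c)" "c \<in> Basis" by (auto simp: Basis_vec_def)
    then have "j \<noteq> k \<or> i = k" using b(2) by (auto simp: chart_basis_def)
    then show "u \<bullet> b = 0" using u c by (simp add: inner_axis)
  qed
  finally show ?thesis .
qed

lemma lift_inner:
  assumes "u \<in> span (chart_basis k)"
  shows "lift k u \<bullet> lift k u = 1 + u \<bullet> u"
proof -
  have z: "u$i$j = 0" if "j \<noteq> k \<or> i = k" for i j using assms that by (auto simp: span_chart_basis)
  have "(\<Sum>j\<in>UNIV. u$i$j \<bullet> u$i$j) = (\<Sum>j\<in>UNIV. if j = k then u$i$k \<bullet> u$i$k else 0)" for i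
    using z by (intro sum.cong) auto
  then have "u \<bullet> u = (\<Sum>i\<in>UNIV. u$i$k \<bullet> u$i$k)" by (simp add: inner_matrix)
  also have "\<dots> = (\<Sum>i\<in>UNIV - {k}. u$i$k \<bullet> u$i$k)"
    using z by (intro sum.mono_neutral_right) auto
  finally have "u \<bullet> u = (\<Sum>i\<in>UNIV - {k}. u$i$k \<bullet> u$i$k)" .
  moreover have "lift k u \<bullet> lift k u = 1 + (\<Sum>i\<in>UNIV - {k}. u$i$k \<bullet> u$i$k)"
    unfolding inner_vec_def sum.remove[OF finite UNIV_I[of k]] by (simp add: lift_def)
  ultimately show ?thesis by simp
qed

text \<open>The coordinate \<open>one\<close> at \<open>k\<close> is nuclear, so every lifted vector
  represents a point; the inverse divides column \<open>k\<close> by its diagonal entry.\<close>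

lemma PM_chart:
  "smooth_chart PM (chart_basis k) UNIV (\<lambda>u. inverse (1 + u \<bullet> u) *\<^sub>R outer (lift k u) (lift k u))
     {A. re (A$k$k) \<noteq> 0} (\<lambda>A. \<chi> i j. if j = k \<and> i \<noteq> k then inverse (re (A$k$k)) *\<^sub>R A$i$k else 0)"
proof -
  define \<phi> where "\<phi> = (\<lambda>u. inverse (1 + u \<bullet> u) *\<^sub>R outer (lift k u) (lift k u))"
  define \<psi> :: "'a^'m^'m \<Rightarrow> 'a^'m^'m" where
    "\<psi> = (\<lambda>A. \<chi> i j. if j = k \<and> i \<noteq> k then inverse (re (A$k$k)) *\<^sub>R A$i$k else 0)"
  have pos: "1 + u \<bullet> u > 0" for u :: "'a^'m^'m" using inner_ge_zero[of u] by linarith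
  have phi: "\<phi> u = (1 / (lift k u \<bullet> lift k u)) *\<^sub>R outer (lift k u) (lift k u)" if "u \<in> span (chart_basis k)" for u
    using lift_inner[OF that] by (simp add: \<phi>_def inverse_eq_divide)
  have phi_M: "\<phi> u \<in> PM" if u: "u \<in> span (chart_basis k)" for u
    unfolding phi[OF u]
  proof (rule outer_PM)
    show "good (lift k u)" by (rule good_if_nuc[of _ k]) (simp add: lift_def nuc_real)
    show "lift k u \<bullet> lift k u \<noteq> 0" unfolding lift_inner[OF u] using pos[of u] by simp
  qed
  have phi_nth: "\<phi> u $ i $ k = inverse (1 + u \<bullet> u) *\<^sub>R (if i = k then one else u$i$k)" for u i
    by (simp add: \<phi>_def lift_def)
  have inv: "\<psi> (\<phi> u) = u" if "u \<in> span (chart_basis k)" for u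
  proof -
    have "\<psi> (\<phi> u) $ i $ j = u $ i $ j" for i j
      using that pos[of u] by (auto simp: \<psi>_def phi_nth re_linear span_chart_basis)
    then show ?thesis by (simp add: vec_eq_iff)
  qed
  have psi_span: "\<psi> A \<in> span (chart_basis k)" for A by (auto simp: \<psi>_def span_chart_basis)
  have surj: "\<phi> (\<psi> A) = A" if A: "A \<in> PM" "re (A$k$k) \<noteq> 0" for A
  proof -
    have lc: "lift k (\<psi> A) = (1 / re (A$k$k)) *\<^sub>R col k A"
    proof -
      have "A$k$k = re (A$k$k) *\<^sub>R one" by (rule PM_diag[OF A(1)])
      then have "(1 / re (A$k$k)) *\<^sub>R A$k$k = one" using A(2) by (metis nonzero_eq_divide_eq scaleR_one scaleR_scaleR)
      then show ?thesis by (auto simp: vec_eq_iff lift_def \<psi>_def col_def inverse_eq_divide)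
    qed
    have "lift k (\<psi> A) \<bullet> lift k (\<psi> A) = 1 / re (A$k$k)"
      unfolding lc using PM_col(2)[OF A] A(2) by simp
    then have "\<phi> (\<psi> A) = re (A$k$k) *\<^sub>R outer (lift k (\<psi> A)) (lift k (\<psi> A))"
      unfolding phi[OF psi_span] by simp
    also have "\<dots> = (1 / re (A$k$k)) *\<^sub>R outer (col k A) (col k A)"
      unfolding lc bounded_bilinear.scaleR_left[OF bounded_bilinear_outer] bounded_bilinear.scaleR_right[OF bounded_bilinear_outer]
      using A(2) by simp
    also have "\<dots> = A" using PM_col(1)[OF A] by simp
    finally show ?thesis .
  qed
  have im: "\<phi> ` (UNIV \<inter> span (chart_basis k)) = PM \<inter> {A. re (A$k$k) \<noteq> 0}"
  proof (intro set_eqI iffI)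
    fix A assume "A \<in> \<phi> ` (UNIV \<inter> span (chart_basis k))"
    then obtain u where u: "u \<in> span (chart_basis k)" "A = \<phi> u" by auto
    then show "A \<in> PM \<inter> {A. re (A$k$k) \<noteq> 0}"
      using phi_M[OF u(1)] pos[of u] by (simp add: phi_nth re_linear)
  next
    fix A assume "A \<in> PM \<inter> {A. re (A$k$k) \<noteq> 0}"
    then have "A \<in> PM" "re (A$k$k) \<noteq> 0" by auto
    from surj[OF this] psi_span[of A] show "A \<in> \<phi> ` (UNIV \<inter> span (chart_basis k))"
      by (intro image_eqI[where x = "\<psi> A"]) auto
  qed
  have Ckre: "Ck_on n S (\<lambda>A. re (A$k$k))" if "open S" for n and S :: "('a^'m^'m) set"
    by (intro Ck_on_linear that bounded_linear_compose[OF bounded_linear_re] bounded_linear_entry)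
  have oW: "open {A :: 'a^'m^'m. re (A$k$k) \<noteq> 0}"
    by (intro open_Collect_neq continuous_on_const linear_continuous_on
        bounded_linear_compose[OF bounded_linear_re] bounded_linear_entry)
  have "smooth_on UNIV \<phi>"
    unfolding smooth_on_def
  proof
    fix n
    have "Ck_on n UNIV (\<lambda>u::'a^'m^'m. if i = k then one else u$i$k)" for i
      by (cases "i = k") (auto intro: Ck_on_const Ck_on_linear bounded_linear_entry)
    then have "Ck_on n UNIV (lift k)"
      unfolding lift_def[abs_def] by (intro Ck_on_vec_lambda) auto
    then show "Ck_on n UNIV \<phi>" unfolding \<phi>_def
      using pos by (intro Ck_on_scaleR Ck_on_inverse Ck_on_add Ck_on_inner Ck_on_const Ck_on_id
          Ck_on_bilinear[OF _ bounded_bilinear_outer]) (auto simp: less_imp_neq[symmetric])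
  qed
  moreover have "smooth_on {A. re (A$k$k) \<noteq> 0} \<psi>"
    unfolding smooth_on_def
  proof
    fix n
    have "Ck_on n {A. re (A$k$k) \<noteq> 0} (\<lambda>A::'a^'m^'m. if j = k \<and> i \<noteq> k then inverse (re (A$k$k)) *\<^sub>R A$i$k else 0)" for i j
    proof (cases "j = k \<and> i \<noteq> k")
      case True
      have "Ck_on n {A. re (A$k$k) \<noteq> 0} (\<lambda>A::'a^'m^'m. inverse (re (A$k$k)) *\<^sub>R A$i$k)"
        by (intro oW Ck_on_scaleR Ck_on_inverse Ckre Ck_on_linear bounded_linear_entry) simp
      then show ?thesis using True by simp
    next
      case False
      then have "\<not> (j = k \<and> i \<noteq> k)" .
      then show ?thesis unfolding if_not_P[OF \<open>\<not> (j = k \<and> i \<noteq> k)\<close>] by (intro Ck_on_const oW)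
    qed
    then show "Ck_on n {A. re (A$k$k) \<noteq> 0} \<psi>"
      unfolding \<psi>_def by (intro Ck_on_vec_lambda oW)
  qed
  moreover have "chart_basis k \<subseteq> Basis" by (auto simp: chart_basis_def Basis_vec_def)
  ultimately show ?thesis
    unfolding smooth_chart_def \<phi>_def[symmetric] \<psi>_def[symmetric] using im inv oW by auto
qed

subsection \<open>Transitivity\<close>

definition star :: "'a^'m^'m \<Rightarrow> 'a^'m^'m" where "star A = (\<chi> a b. cj (A$b$a))"

text \<open>Rotation by the matrix \<open>((c, -s u), (s u\<^sup>*, c))\<close> in the coordinates \<open>i\<close>, \<open>k\<close>; \<open>givens\<close> is the
  corresponding conjugation.\<close>
definition vrot :: "'m \<Rightarrow> 'm \<Rightarrow> 'a \<Rightarrow> real \<Rightarrow> real \<Rightarrow> 'a^'m \<Rightarrow> 'a^'m" where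
  "vrot i k u c s v = (\<chi> a. if a = i then c *\<^sub>R v$i - s *\<^sub>R (u \<odot> v$k)
     else if a = k then s *\<^sub>R (cj u \<odot> v$i) + c *\<^sub>R v$k else v$a)"

definition mrot :: "'m \<Rightarrow> 'm \<Rightarrow> 'a \<Rightarrow> real \<Rightarrow> real \<Rightarrow> 'a^'m^'m \<Rightarrow> 'a^'m^'m" where
  "mrot i k u c s A = (\<chi> a b. vrot i k u c s (col b A) $ a)"

definition givens :: "'m \<Rightarrow> 'm \<Rightarrow> 'a \<Rightarrow> real \<Rightarrow> real \<Rightarrow> 'a^'m^'m \<Rightarrow> 'a^'m^'m" where
  "givens i k u c s A = star (mrot i k u c s (star (mrot i k u c s A)))"

lemma star_inner: "star A \<bullet> star B = A \<bullet> B"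
  unfolding inner_matrix star_def by (simp, subst sum.swap) simp

lemma linear_givens: "linear (givens i k u c s)"
  by (rule linearI)
     (auto simp: vec_eq_iff givens_def star_def mrot_def vrot_def col_def mul_simps cj_linear algebra_simps cong: if_cong)

context
  fixes i k :: 'm and u :: 'a and c s :: real
  assumes ik: "i \<noteq> k" and u: "u \<bullet> u = 1" and cs: "c\<^sup>2 + s\<^sup>2 = 1"
begin

abbreviation "vr \<equiv> vrot i k u c s"

lemma vrot_inner: "vr v \<bullet> vr w = v \<bullet> w"
proof -
  have rest: "(\<Sum>a\<in>UNIV - {i, k}. vr v $ a \<bullet> vr w $ a) = (\<Sum>a\<in>UNIV - {i, k}. v $ a \<bullet> w $ a)"
    by (intro sum.cong) (auto simp: vrot_def)
  have "vr v $ i \<bullet> vr w $ i + vr v $ k \<bullet> vr w $ k = (c\<^sup>2 + s\<^sup>2) * (v$i \<bullet> w$i + v$k \<bullet> w$k)"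
    using ik u inner_mul_same_left[of u "v$k" "w$k"] inner_mul_same_left[of "cj u" "v$i" "w$i"]
      adj_left[of u "v$k" "w$i"] adj_left[of u "w$k" "v$i"]
    by (simp add: vrot_def inner_add_left inner_add_right inner_diff_left inner_diff_right inner_commute
        power2_eq_square algebra_simps)
  then show ?thesis unfolding inner_vec_def sum_UNIV_pair[OF ik] rest using cs by simp
qed

lemma mrot_inner: "mrot i k u c s A \<bullet> mrot i k u c s B = A \<bullet> B"
proof -
  have "mrot i k u c s A \<bullet> mrot i k u c s B = (\<Sum>b\<in>UNIV. vr (col b A) \<bullet> vr (col b B))"
    unfolding inner_matrix inner_vec_def by (subst sum.swap) (simp add: mrot_def)
  also have "\<dots> = A \<bullet> B"
    unfolding vrot_inner unfolding inner_matrix inner_vec_def by (subst (2) sum.swap) (simp add: col_def)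
  finally show ?thesis .
qed

lemma givens_inner: "givens i k u c s A \<bullet> givens i k u c s B = A \<bullet> B"
  by (simp add: givens_def star_inner mrot_inner)

text \<open>At the indices other than \<open>i\<close> and \<open>k\<close> nuclearity permits
  rebracketing. In the remaining 2 by 2 block the norm identities settle the diagonal; off the
  diagonal the critical product \<open>(u \<odot> (q \<odot> cj p)) \<odot> u\<close>, or its
  analogue with \<open>cj u\<close>, is rebracketed by the Moufang identity.\<close>

lemma givens_outer:
  assumes nuc: "\<And>b. b \<noteq> i \<Longrightarrow> b \<noteq> k \<Longrightarrow> nuc (v$b)"
  shows "givens i k u c s (outer v v) = outer (vr v) (vr v)"
proof -
  define R where "R = mrot i k u c s (outer v v)"
  define p where "p = v$i" define q where "q = v$k"
  have nc: "nuc (cj (v$b))" if "b \<noteq> i" "b \<noteq> k" for b by (rule nuc_cj[OF nuc[OF that]])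
  have R1: "R$a$b = vr v $ a \<odot> cj (v$b)" if "b \<noteq> i" "b \<noteq> k" for a b
    using nucD(3)[OF nc[OF that]] by (simp add: R_def mrot_def vrot_def col_def mul_simps)
  have R2: "R$a$b = v$a \<odot> cj (v$b)" if "a \<noteq> i" "a \<noteq> k" for a b
    using that by (simp add: R_def mrot_def vrot_def col_def)
  have ki: "k \<noteq> i" using ik by simp
  have Rii: "R$i$i = (c * (p \<bullet> p)) *\<^sub>R one - s *\<^sub>R (u \<odot> (q \<odot> cj p))"
    and Rik: "R$i$k = c *\<^sub>R (p \<odot> cj q) - (s * (q \<bullet> q)) *\<^sub>R u"
    and Rki: "R$k$i = (s * (p \<bullet> p)) *\<^sub>R cj u + c *\<^sub>R (q \<odot> cj p)"
    and Rkk: "R$k$k = s *\<^sub>R (cj u \<odot> (p \<odot> cj q)) + (c * (q \<bullet> q)) *\<^sub>R one"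
    using ki by (simp_all add: R_def mrot_def vrot_def col_def p_def q_def mul_cj mul_simps)
  define p' where "p' = c *\<^sub>R p - s *\<^sub>R (u \<odot> q)"
  define q' where "q' = s *\<^sub>R (cj u \<odot> p) + c *\<^sub>R q"
  have vp: "vr v $ i = p'" "vr v $ k = q'" using ki by (simp_all add: vrot_def p'_def q'_def p_def q_def)
  have ip: "re (u \<odot> (q \<odot> cj p)) = p \<bullet> (u \<odot> q)" "re (cj u \<odot> (p \<odot> cj q)) = q \<bullet> (cj u \<odot> p)"
    using adj_left[of u "q \<odot> cj p" one] adj_right[of q "cj p" "cj u"] adj_left[of u q p]
      adj_left[of "cj u" "p \<odot> cj q" one] adj_right[of p "cj q" u] adj_left[of "cj u" p q]
    by (simp_all add: re_def inner_commute)
  have twice: "x + cj x = (2 * re x) *\<^sub>R one" for x by (simp add: cj_def)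
  have G: "givens i k u c s (outer v v) $ a $ b = cj (vr (\<chi> b. cj (R$a$b)) $ b)" for a b
    by (simp add: givens_def star_def mrot_def col_def R_def)
  have Gii: "givens i k u c s (outer v v) $ i $ i = p' \<odot> cj p'"
  proof -
    have "givens i k u c s (outer v v) $ i $ i = c *\<^sub>R R$i$i - s *\<^sub>R (R$i$k \<odot> cj u)"
      unfolding G by (simp add: vrot_def cj_linear cj_mul)
    also have "\<dots> = (c\<^sup>2 * (p \<bullet> p)) *\<^sub>R one - (c * s) *\<^sub>R (u \<odot> (q \<odot> cj p) + cj (u \<odot> (q \<odot> cj p))) + (s\<^sup>2 * (q \<bullet> q)) *\<^sub>R one"
      unfolding Rii Rik using u by (simp add: mul_simps mul_cj cj_mul power2_eq_square algebra_simps)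
    also have "\<dots> = (p' \<bullet> p') *\<^sub>R one"
      unfolding twice ip p'_def using u inner_mul_same_left[of u q q]
      by (simp add: inner_diff_left inner_diff_right inner_commute power2_eq_square algebra_simps)
    finally show ?thesis by (simp add: mul_cj)
  qed
  have Gkk: "givens i k u c s (outer v v) $ k $ k = q' \<odot> cj q'"
  proof -
    have "givens i k u c s (outer v v) $ k $ k = s *\<^sub>R (R$k$i \<odot> u) + c *\<^sub>R R$k$k"
      unfolding G using ki by (simp add: vrot_def cj_linear cj_mul)
    also have "\<dots> = (s\<^sup>2 * (p \<bullet> p)) *\<^sub>R one + (c * s) *\<^sub>R (cj u \<odot> (p \<odot> cj q) + cj (cj u \<odot> (p \<odot> cj q))) + (c\<^sup>2 * (q \<bullet> q)) *\<^sub>R one"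
      unfolding Rki Rkk using u by (simp add: mul_simps mul_cj cj_mul power2_eq_square algebra_simps)
    also have "\<dots> = (q' \<bullet> q') *\<^sub>R one"
      unfolding twice ip q'_def using u inner_mul_same_left[of "cj u" p p]
      by (simp add: inner_add_left inner_add_right inner_commute power2_eq_square algebra_simps)
    finally show ?thesis by (simp add: mul_cj)
  qed
  have Gik: "givens i k u c s (outer v v) $ i $ k = p' \<odot> cj q'"
  proof -
    have "givens i k u c s (outer v v) $ i $ k = s *\<^sub>R (R$i$i \<odot> u) + c *\<^sub>R R$i$k"
      unfolding G using ki by (simp add: vrot_def cj_linear cj_mul)
    also have "\<dots> = p' \<odot> cj q'"
      unfolding Rii Rik p'_def q'_def using moufang[of u q "cj p"] cancel_right[of u q] cancel_left[of "cj p" u]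
      by (simp add: mul_simps cj_linear cj_mul power2_eq_square algebra_simps)
    finally show ?thesis .
  qed
  have Gki: "givens i k u c s (outer v v) $ k $ i = q' \<odot> cj p'"
  proof -
    have "givens i k u c s (outer v v) $ k $ i = c *\<^sub>R R$k$i - s *\<^sub>R (R$k$k \<odot> cj u)"
      unfolding G by (simp add: vrot_def cj_linear cj_mul)
    also have "\<dots> = q' \<odot> cj p'"
      unfolding Rki Rkk p'_def q'_def using moufang[of "cj u" p "cj q"] cancel_right[of "cj u" p] cancel_left[of "cj q" "cj u"]
      by (simp add: mul_simps cj_linear cj_mul power2_eq_square algebra_simps)
    finally show ?thesis .
  qed
  have "givens i k u c s (outer v v) $ a $ b = vr v $ a \<odot> cj (vr v $ b)" for a b
  proof -
    consider "b \<noteq> i" "b \<noteq> k" | "b = i \<or> b = k" "a \<noteq> i" "a \<noteq> k" | "b = i \<or> b = k" "a = i \<or> a = k" by blast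
    then show ?thesis
    proof cases
      case 1
      then have "givens i k u c s (outer v v) $ a $ b = R$a$b" unfolding G by (simp add: vrot_def)
      moreover have "vr v $ b = v $ b" using 1 by (simp add: vrot_def)
      ultimately show ?thesis using R1[OF 1] by simp
    next
      case 2
      have "(\<chi> b. cj (R$a$b)) = (\<chi> b. v$b \<odot> cj (v$a))"
        using R2[OF 2(2,3)] by (simp add: vec_eq_iff cj_mul)
      then have "givens i k u c s (outer v v) $ a $ b = cj (vr v $ b \<odot> cj (v$a))"
        unfolding G using nucD(3)[OF nc[OF 2(2,3)]] by (simp add: vrot_def mul_simps)
      moreover have "vr v $ a = v $ a" using 2 by (simp add: vrot_def)
      ultimately show ?thesis by (simp add: cj_mul)
    next
      case 3
      then show ?thesis using Gii Gik Gki Gkk vp by auto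
    qed
  qed
  then show ?thesis by (simp add: vec_eq_iff)
qed

lemma vrot_inverse: "vrot i k u c (- s) (vr v) = v"
proof -
  have "(c\<^sup>2 + s\<^sup>2) *\<^sub>R x = x" for x :: 'a using cs by simp
  then have "c *\<^sub>R c *\<^sub>R x + s *\<^sub>R s *\<^sub>R x = x" for x :: 'a by (simp add: power2_eq_square scaleR_add_left)
  moreover have "u \<odot> (cj u \<odot> x) = x" "cj u \<odot> (u \<odot> x) = x" for x
    using cancel_left'[of u x] cancel_left[of u x] u by simp_all
  ultimately show ?thesis using ik
    by (auto simp: vec_eq_iff vrot_def mul_simps algebra_simps)
qed

lemma givens_PM:
  assumes A: "A \<in> PM"
  shows "givens i k u c s A \<in> PM"
    and "\<exists>v. A = (1 / (v \<bullet> v)) *\<^sub>R outer v v \<and> givens i k u c s A = (1 / (v \<bullet> v)) *\<^sub>R outer (vr v) (vr v) \<and>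
      (\<forall>b. b \<noteq> i \<longrightarrow> b \<noteq> k \<longrightarrow> nuc (v$b))"
proof -
  obtain v where v: "v \<bullet> v \<noteq> 0" "A = (1 / (v \<bullet> v)) *\<^sub>R outer v v" "\<And>b. b \<noteq> i \<Longrightarrow> b \<noteq> k \<Longrightarrow> nuc (v$b)"
    using PM_representation[OF A ik] by blast
  have g: "givens i k u c s A = (1 / (v \<bullet> v)) *\<^sub>R outer (vr v) (vr v)"
    using givens_outer[OF v(3)] by (subst v(2)) (simp add: linear_scale[OF linear_givens])
  then show "\<exists>v. A = (1 / (v \<bullet> v)) *\<^sub>R outer v v \<and> givens i k u c s A = (1 / (v \<bullet> v)) *\<^sub>R outer (vr v) (vr v) \<and>
      (\<forall>b. b \<noteq> i \<longrightarrow> b \<noteq> k \<longrightarrow> nuc (v$b))" using v by blast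
  have "good (vr v)" unfolding good_def using v(3)
    by (intro exI[of _ i] exI[of _ k]) (auto simp: vrot_def)
  from outer_PM[OF this] show "givens i k u c s A \<in> PM" unfolding g using v(1) by (simp add: vrot_inner)
qed

end

lemma givens_inverse:
  assumes "i \<noteq> k" "u \<bullet> u = 1" "c\<^sup>2 + s\<^sup>2 = 1" "A \<in> PM"
  shows "givens i k u c (- s) (givens i k u c s A) = A"
proof -
  obtain v where v: "A = (1 / (v \<bullet> v)) *\<^sub>R outer v v"
    "givens i k u c s A = (1 / (v \<bullet> v)) *\<^sub>R outer (vrot i k u c s v) (vrot i k u c s v)"
    "\<And>b. b \<noteq> i \<Longrightarrow> b \<noteq> k \<Longrightarrow> nuc (v$b)" using givens_PM(2)[OF assms] by blast
  have s': "c\<^sup>2 + (- s)\<^sup>2 = 1" using assms(3) by simp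
  have "givens i k u c (- s) (outer (vrot i k u c s v) (vrot i k u c s v)) = outer v v"
    using givens_outer[OF assms(1,2) s', of "vrot i k u c s v"] v(3)
    by (simp add: vrot_inverse[OF assms(1-3)]) (simp add: vrot_def)
  then have "givens i k u c (- s) (givens i k u c s A) = (1 / (v \<bullet> v)) *\<^sub>R outer v v"
    unfolding v(2) linear_scale[OF linear_givens] by (rule arg_cong)
  then show ?thesis unfolding v(1)[symmetric] .
qed

text \<open>The inverse is asked for on \<open>PM\<close> only, which is where
  \<open>givens_inverse\<close> provides it; it carries over to tangent vectors by differentiating
  along curves in \<open>PM\<close>.\<close>

definition isometry_pair :: "('a^'m^'m \<Rightarrow> 'a^'m^'m) \<Rightarrow> ('a^'m^'m \<Rightarrow> 'a^'m^'m) \<Rightarrow> bool" where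
  "isometry_pair g h \<longleftrightarrow> linear g \<and> linear h \<and> (\<forall>x y. g x \<bullet> g y = x \<bullet> y) \<and>
     (\<forall>A\<in>PM. g A \<in> PM \<and> h A \<in> PM \<and> h (g A) = A \<and> g (h A) = A)"

lemma isometry_pair_givens:
  assumes "i \<noteq> k" "u \<bullet> u = 1" "c\<^sup>2 + s\<^sup>2 = 1"
  shows "isometry_pair (givens i k u c s) (givens i k u c (- s))"
proof -
  have s': "c\<^sup>2 + (- s)\<^sup>2 = 1" using assms(3) by simp
  show ?thesis
    unfolding isometry_pair_def
    using givens_inner[OF assms] givens_PM(1)[OF assms] givens_PM(1)[OF assms(1,2) s']
      givens_inverse[OF assms] givens_inverse[OF assms(1,2) s'] by (auto simp: linear_givens)
qed

lemma isometry_pair_compose: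
  "isometry_pair g h \<Longrightarrow> isometry_pair g' h' \<Longrightarrow> isometry_pair (g' \<circ> g) (h \<circ> h')"
  unfolding isometry_pair_def by (auto simp: linear_compose)

definition unit_matrix :: "'m \<Rightarrow> 'a^'m^'m" where
  "unit_matrix k = (\<chi> i j. if i = k \<and> j = k then one else 0)"

text \<open>A suitable rotation makes one nonzero diagonal entry vanish and creates no new one, so
  induction on their number ends at a coordinate point.\<close>

lemma transitive:
  assumes "A \<in> PM"
  shows "\<exists>g h k. isometry_pair g h \<and> g A = unit_matrix k"
  using assms
proof (induction "card {i. re (A$i$i) \<noteq> 0}" arbitrary: A rule: less_induct)
  case less
  note A = less.prems
  obtain k where k: "re (A$k$k) \<noteq> 0" using PM_nonzero_diag[OF A] by blast
  show ?case
  proof (cases "\<exists>i. i \<noteq> k \<and> re (A$i$i) \<noteq> 0")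
    case False
    then have z: "re (A$i$i) = 0" if "i \<noteq> k" for i using that by blast
    have "A$i$j = (if i = k \<and> j = k then one else 0)" for i j
    proof (cases "i = k \<and> j = k")
      case True
      have "(\<Sum>i\<in>UNIV. re (A$i$i)) = (\<Sum>i\<in>UNIV. if i = k then re (A$k$k) else 0)"
        using z by (intro sum.cong) auto
      then have "re (A$k$k) = 1" using PM_tr[OF A] by simp
      then show ?thesis using True PM_diag[OF A, of k] by simp
    next
      case False
      then have "A$i$j \<bullet> A$i$j = 0" unfolding PM_entry[OF A] using z by auto
      then show ?thesis using False by auto
    qed
    then have "id A = unit_matrix k" by (simp add: unit_matrix_def vec_eq_iff)
    moreover have "isometry_pair id id" by (simp add: isometry_pair_def linear_id)
    ultimately show ?thesis by blast
  next
    case True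
    then obtain i where i: "i \<noteq> k" "re (A$i$i) \<noteq> 0" by blast
    define p where "p = sqrt (re (A$i$i))" define q where "q = sqrt (re (A$k$k))"
    have pq: "p > 0" "q > 0" "p\<^sup>2 = re (A$i$i)" "q\<^sup>2 = re (A$k$k)"
      using i(2) k PM_diag_nonneg[OF A, of i] PM_diag_nonneg[OF A, of k] by (auto simp: p_def q_def)
    have nx: "norm (A$i$k) = p * q"
    proof -
      have "(norm (A$i$k))\<^sup>2 = (p * q)\<^sup>2"
        using PM_entry[OF A, of i k] pq by (simp add: power2_norm_eq_inner power_mult_distrib)
      then show ?thesis using pq by (simp add: power2_eq_iff_nonneg)
    qed
    \<comment> \<open>The phase of the entry \<open>A$i$k\<close>, whose norm is
      \<open>p * q\<close>.\<close>
    define u where "u = (1 / (p * q)) *\<^sub>R A$i$k"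
    define d where "d = sqrt (p\<^sup>2 + q\<^sup>2)"
    have "p\<^sup>2 + q\<^sup>2 > 0" using pq(1,2) by (simp add: add_pos_pos)
    then have d: "d > 0" "d\<^sup>2 = p\<^sup>2 + q\<^sup>2" by (simp_all add: d_def)
    \<comment> \<open>Chosen so that \<open>c * p = s * q\<close>: the new diagonal entry at
      \<open>i\<close> will be the square of \<open>c * p - s * q\<close>.\<close>
    define c where "c = q / d" define s where "s = p / d"
    have u1: "u \<bullet> u = 1" using nx pq by (simp add: u_def dot_square_norm power2_eq_square)
    have cs: "c\<^sup>2 + s\<^sup>2 = 1" using d pq(1,2) by (simp add: c_def s_def power_divide flip: add_divide_distrib)
    define G where "G = givens i k u c s"
    have iso: "isometry_pair G (givens i k u c (- s))"
      unfolding G_def by (rule isometry_pair_givens[OF i(1) u1 cs])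
    then have GA: "G A \<in> PM" using A by (simp add: isometry_pair_def)
    have Aik: "A$i$k = (p * q) *\<^sub>R u" using pq by (simp add: u_def)
    have Aki: "A$k$i = (p * q) *\<^sub>R cj u" using PM_herm[OF A, of k i] Aik by (simp add: cj_linear)
    have Aii: "A$i$i = p\<^sup>2 *\<^sub>R one" and Akk: "A$k$k = q\<^sup>2 *\<^sub>R one" using PM_diag[OF A] pq by metis+
    have G_ii: "G A $ i $ i = 0"
    proof -
      have "G A $ i $ i = c *\<^sub>R (c *\<^sub>R A$i$i - s *\<^sub>R (u \<odot> A$k$i)) - s *\<^sub>R ((c *\<^sub>R A$i$k - s *\<^sub>R (u \<odot> A$k$k)) \<odot> cj u)"
        by (simp add: G_def givens_def star_def mrot_def vrot_def col_def cj_linear cj_mul)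
      also have "\<dots> = (c * p - s * q)\<^sup>2 *\<^sub>R one"
        unfolding Aii Akk Aik Aki using u1
        by (simp add: mul_simps mul_cj power2_eq_square algebra_simps) (simp flip: scaleR_add_left)
      also have "c * p - s * q = 0" by (simp add: c_def s_def)
      finally show ?thesis by simp
    qed
    have G_bb: "G A $ b $ b = A $ b $ b" if "b \<noteq> i" "b \<noteq> k" for b
      using that by (simp add: G_def givens_def star_def mrot_def vrot_def col_def)
    have "{j. re (G A$j$j) \<noteq> 0} \<subseteq> {j. re (A$j$j) \<noteq> 0} - {i}"
    proof
      fix j assume j: "j \<in> {j. re (G A$j$j) \<noteq> 0}"
      then have "j \<noteq> i" using G_ii by (auto simp: re_linear)
      then show "j \<in> {j. re (A$j$j) \<noteq> 0} - {i}" using j G_bb[of j] k by (cases "j = k") auto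
    qed
    then have "card {j. re (G A$j$j) \<noteq> 0} < card {j. re (A$j$j) \<noteq> 0}"
      using i(2) by (intro psubset_card_mono) auto
    from less.hyps[OF this GA] obtain g h l where gh: "isometry_pair g h" "g (G A) = unit_matrix l" by blast
    have "(g \<circ> G) A = unit_matrix l" using gh(2) by simp
    with isometry_pair_compose[OF iso gh(1)] show ?thesis by blast
  qed
qed

end

subsection \<open>Geodesics\<close>

text \<open>Three derivatives at once, because the relations defining \<open>PM\<close> are
  differentiated to third order by the Leibniz rule.\<close>

definition jet3 :: "(real \<Rightarrow> 'b::real_normed_vector) \<Rightarrow> (real \<Rightarrow> 'b) \<Rightarrow> (real \<Rightarrow> 'b) \<Rightarrow> (real \<Rightarrow> 'b) \<Rightarrow> bool" where
  "jet3 f f1 f2 f3 \<longleftrightarrow> (\<forall>s\<in>I01. (f has_vector_derivative f1 s) (at s within I01) \<and>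
     (f1 has_vector_derivative f2 s) (at s within I01) \<and> (f2 has_vector_derivative f3 s) (at s within I01))"

lemma jet3_linear:
  "bounded_linear h \<Longrightarrow> jet3 f f1 f2 f3 \<Longrightarrow> jet3 (\<lambda>s. h (f s)) (\<lambda>s. h (f1 s)) (\<lambda>s. h (f2 s)) (\<lambda>s. h (f3 s))"
  unfolding jet3_def by (auto intro: bounded_linear.has_vector_derivative)

lemma jet3_bilinear:
  assumes p: "bounded_bilinear p" and f: "jet3 f f1 f2 f3" and g: "jet3 g g1 g2 g3"
  shows "jet3 (\<lambda>s. p (f s) (g s)) (\<lambda>s. p (f s) (g1 s) + p (f1 s) (g s))
    (\<lambda>s. p (f s) (g2 s) + 2 *\<^sub>R p (f1 s) (g1 s) + p (f2 s) (g s))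
    (\<lambda>s. p (f s) (g3 s) + 3 *\<^sub>R p (f1 s) (g2 s) + 3 *\<^sub>R p (f2 s) (g1 s) + p (f3 s) (g s))"
proof -
  interpret bounded_bilinear p by fact
  note d = has_vector_derivative
  have three: "3 *\<^sub>R x = x + x + x" for x :: 'c using scaleR_add_left[of 2 1 x] by (simp add: scaleR_2)
  show ?thesis
    unfolding jet3_def
  proof (intro ballI conjI)
    fix s assume s: "s \<in> I01"
    have F: "(f has_vector_derivative f1 s) (at s within I01)" "(f1 has_vector_derivative f2 s) (at s within I01)"
      "(f2 has_vector_derivative f3 s) (at s within I01)"
      and G: "(g has_vector_derivative g1 s) (at s within I01)" "(g1 has_vector_derivative g2 s) (at s within I01)"
      "(g2 has_vector_derivative g3 s) (at s within I01)"
      using f g s by (auto simp: jet3_def)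
    show "((\<lambda>s. p (f s) (g s)) has_vector_derivative p (f s) (g1 s) + p (f1 s) (g s)) (at s within I01)"
      by (rule d[OF F(1) G(1)])
    show "((\<lambda>s. p (f s) (g1 s) + p (f1 s) (g s)) has_vector_derivative
        p (f s) (g2 s) + 2 *\<^sub>R p (f1 s) (g1 s) + p (f2 s) (g s)) (at s within I01)"
      by (rule has_vector_derivative_eq_rhs[OF has_vector_derivative_add[OF d[OF F(1) G(2)] d[OF F(2) G(1)]]])
         (simp add: scaleR_2)
    show "((\<lambda>s. p (f s) (g2 s) + 2 *\<^sub>R p (f1 s) (g1 s) + p (f2 s) (g s)) has_vector_derivative
        p (f s) (g3 s) + 3 *\<^sub>R p (f1 s) (g2 s) + 3 *\<^sub>R p (f2 s) (g1 s) + p (f3 s) (g s)) (at s within I01)"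
      by (rule has_vector_derivative_eq_rhs[OF has_vector_derivative_add[OF has_vector_derivative_add[OF
            d[OF F(1) G(3)] bounded_linear.has_vector_derivative[OF bounded_linear_scaleR_right d[OF F(2) G(2)]]]
            d[OF F(3) G(1)]]])
         (simp add: scaleR_2 scaleR_add_right three)
  qed
qed

lemma jet3_unique:
  assumes f: "jet3 f f1 f2 f3" and g: "jet3 g g1 g2 g3" and eq: "\<And>s. s \<in> I01 \<Longrightarrow> f s = g s" and s: "s \<in> I01"
  shows "f1 s = g1 s" "f2 s = g2 s" "f3 s = g3 s"
proof -
  have tr: "f' r = g' r" if h: "\<And>s. s \<in> I01 \<Longrightarrow> h s = k s" "(h has_vector_derivative f' r) (at r within I01)"
     "(k has_vector_derivative g' r) (at r within I01)" and r: "r \<in> I01" for h k f' g' :: "real \<Rightarrow> 'a" and r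
    by (rule vector_derivative_I01_unique[OF has_vector_derivative_cong_open[OF h(2) open_UNIV UNIV_I r] h(3) r])
       (rule h(1))
  have 1: "f1 s = g1 s" if "s \<in> I01" for s
    using tr[of f g f1 s g1] eq f g that by (auto simp: jet3_def)
  have 2: "f2 s = g2 s" if "s \<in> I01" for s
    using tr[of f1 g1 f2 s g2] 1 f g that by (auto simp: jet3_def)
  have 3: "f3 s = g3 s" if "s \<in> I01" for s
    using tr[of f2 g2 f3 s g3] 2 f g that by (auto simp: jet3_def)
  show "f1 s = g1 s" "f2 s = g2 s" "f3 s = g3 s" using 1 2 3 s by auto
qed

lemma jet3_const: "jet3 (\<lambda>s. c) (\<lambda>s. 0) (\<lambda>s. 0) (\<lambda>s. 0)"
  by (simp add: jet3_def)

lemma jet3_D: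
  assumes "jet3 y y1 y2 y3" "s \<in> I01"
  shows "(y has_vector_derivative y1 s) (at s within I01)" "(y1 has_vector_derivative y2 s) (at s within I01)"
    "(y2 has_vector_derivative y3 s) (at s within I01)"
  using assms by (auto simp: jet3_def)

context projective_space
begin

text \<open>The tangent vector at \<open>A\<close> that arises when the affine coordinates move in
  the direction \<open>t\<close>; the last term comes from the normalisation. For fixed
  \<open>t\<close> it is an explicit expression in \<open>A\<close>, so being normal to it can be
  differentiated along a curve.\<close>

definition Zt :: "'m \<Rightarrow> 'a^'m^'m \<Rightarrow> 'a^'m \<Rightarrow> 'a^'m^'m" where
  "Zt k A t = outer t (col k A) + outer (col k A) t - (2 * (col k A \<bullet> t)) *\<^sub>R A"

lemma bounded_linear_col: "bounded_linear (col k)"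
proof -
  have "linear (col k)" by (rule linearI) (simp_all add: col_def vec_eq_iff)
  then show ?thesis by (simp add: linear_conv_bounded_linear)
qed

lemmas outer_bb = bounded_bilinear.scaleR_left[OF bounded_bilinear_outer] bounded_bilinear.scaleR_right[OF bounded_bilinear_outer]

lemma Zt_tangent:
  assumes A: "A \<in> PM" and a: "re (A$k$k) \<noteq> 0" and t: "t$k = 0"
  shows "Zt k A t \<in> tangent PM A"
proof -
  define a where "a = re (A$k$k)"
  define v0 where "v0 = (1 / a) *\<^sub>R col k A"
  define v where "v = (\<lambda>\<epsilon>. v0 + \<epsilon> *\<^sub>R t)"
  have anz: "a \<noteq> 0" using a by (simp add: a_def)
  have n0: "v0 \<bullet> v0 = 1 / a" using PM_col(2)[OF A a] anz by (simp add: v0_def a_def)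
  have vk: "v \<epsilon> $ k = one" for \<epsilon>
  proof -
    have "A$k$k = a *\<^sub>R one" using PM_diag[OF A] by (simp add: a_def)
    then show ?thesis using t anz by (simp add: v_def v0_def col_def)
  qed
  have vnz: "v \<epsilon> \<bullet> v \<epsilon> \<noteq> 0" for \<epsilon>
  proof
    assume "v \<epsilon> \<bullet> v \<epsilon> = 0"
    then have "v \<epsilon> $ k = 0" by simp
    then show False using vk[of \<epsilon>] norm_one by simp
  qed
  have dv: "(v has_vector_derivative t) (at 0)"
    unfolding v_def by (auto intro!: derivative_eq_intros)
  show ?thesis
  proof (rule tangentI[where \<gamma> = "\<lambda>\<epsilon>. (1 / (v \<epsilon> \<bullet> v \<epsilon>)) *\<^sub>R outer (v \<epsilon>) (v \<epsilon>)"])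
    have "(1 / (v \<epsilon> \<bullet> v \<epsilon>)) *\<^sub>R outer (v \<epsilon>) (v \<epsilon>) \<in> PM" for \<epsilon>
      by (rule outer_PM[OF good_if_nuc[of _ k] vnz]) (simp add: vk nuc_real)
    then show "\<forall>\<^sub>F \<epsilon> in nhds 0. (1 / (v \<epsilon> \<bullet> v \<epsilon>)) *\<^sub>R outer (v \<epsilon>) (v \<epsilon>) \<in> PM" by simp
    have o0: "a *\<^sub>R outer v0 v0 = A"
      using PM_col(1)[OF A a] anz by (simp add: v0_def outer_bb a_def[symmetric])
    then show "(1 / (v 0 \<bullet> v 0)) *\<^sub>R outer (v 0) (v 0) = A" using anz by (simp add: v_def n0)
    have "((\<lambda>\<epsilon>. v \<epsilon> \<bullet> v \<epsilon>) has_vector_derivative v 0 \<bullet> t + t \<bullet> v 0) (at 0)"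
      by (rule bounded_bilinear.has_vector_derivative[OF bounded_bilinear_inner dv dv])
    then have "((\<lambda>\<epsilon>. v \<epsilon> \<bullet> v \<epsilon>) has_real_derivative 2 * (v0 \<bullet> t)) (at 0)"
      by (simp add: has_real_derivative_iff_has_vector_derivative v_def inner_commute)
    from DERIV_inverse_fun[OF this vnz]
    have d1: "((\<lambda>\<epsilon>. 1 / (v \<epsilon> \<bullet> v \<epsilon>)) has_real_derivative - (2 * a\<^sup>2 * (v0 \<bullet> t))) (at 0)"
      using anz by (simp add: inverse_eq_divide v_def n0 power2_eq_square mult_ac)
    have "((\<lambda>\<epsilon>. outer (v \<epsilon>) (v \<epsilon>)) has_vector_derivative outer (v 0) t + outer t (v 0)) (at 0)"
      by (rule bounded_bilinear.has_vector_derivative[OF bounded_bilinear_outer dv dv])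
    from has_vector_derivative_scaleR[OF d1 this]
    have "((\<lambda>\<epsilon>. (1 / (v \<epsilon> \<bullet> v \<epsilon>)) *\<^sub>R outer (v \<epsilon>) (v \<epsilon>)) has_vector_derivative
       a *\<^sub>R (outer v0 t + outer t v0) + (- (2 * a\<^sup>2 * (v0 \<bullet> t))) *\<^sub>R outer v0 v0) (at 0)"
      using anz by (simp add: v_def n0)
    moreover have "a *\<^sub>R (outer v0 t + outer t v0) + (- (2 * a\<^sup>2 * (v0 \<bullet> t))) *\<^sub>R outer v0 v0 = Zt k A t"
    proof -
      have "(2 * a\<^sup>2 * (v0 \<bullet> t)) *\<^sub>R outer v0 v0 = (2 * a * (v0 \<bullet> t)) *\<^sub>R A"
        unfolding o0[symmetric] by (simp add: power2_eq_square mult_ac)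
      moreover have "2 * a * (v0 \<bullet> t) = 2 * (col k A \<bullet> t)" using anz by (simp add: v0_def)
      moreover have "a *\<^sub>R (outer v0 t + outer t v0) = outer (col k A) t + outer t (col k A)"
        using anz by (simp add: v0_def outer_bb scaleR_add_right)
      ultimately show ?thesis by (simp add: Zt_def)
    qed
    ultimately show "((\<lambda>\<epsilon>. (1 / (v \<epsilon> \<bullet> v \<epsilon>)) *\<^sub>R outer (v \<epsilon>) (v \<epsilon>)) has_vector_derivative Zt k A t) (at 0)"
      by simp
  qed
qed

lemma herm_inner_outer:
  assumes "\<And>i j. X$j$i = cj (X$i$j)"
  shows "X \<bullet> outer w t = X \<bullet> outer t w"
proof -
  have "X$i$j \<bullet> (w$i \<odot> cj (t$j)) = X$j$i \<bullet> (t$j \<odot> cj (w$i))" for i j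
    using cj_inner_cj[of "X$i$j" "w$i \<odot> cj (t$j)"] assms[of j i] by (simp add: cj_mul)
  then show ?thesis unfolding inner_matrix by (subst (2) sum.swap) simp
qed

text \<open>At a coordinate point the first derivative is determined by its column \<open>h\<close>.
  The differentiated relations and the constant trace give the entries of the higher derivatives
  outside row and column \<open>k\<close>, and the diagonal one at \<open>k\<close>. The rest of row
  and column \<open>k\<close> vanishes for \<open>y2\<close> by normality; for \<open>y3\<close> it
  comes from normality differentiated along the curve.\<close>

lemma geodesic_at_unit_matrix:
  assumes M: "\<And>s. s \<in> I01 \<Longrightarrow> y s \<in> PM" and jet: "jet3 y y1 y2 y3"
    and nor: "\<And>s \<eta>. s \<in> I01 \<Longrightarrow> \<eta> \<in> tangent PM (y s) \<Longrightarrow> y2 s \<bullet> \<eta> = 0"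
    and s: "s \<in> I01" and unit: "y s = unit_matrix k"
  shows "y3 s = - (2 * (y1 s \<bullet> y1 s)) *\<^sub>R y1 s"
proof -
  have ent: "jet3 (\<lambda>s. y s$i$j) (\<lambda>s. y1 s$i$j) (\<lambda>s. y2 s$i$j) (\<lambda>s. y3 s$i$j)" for i j
    by (rule jet3_linear[OF bounded_linear_entry jet])
  have herm: "y1 s$j$i = cj (y1 s$i$j)" "y2 s$j$i = cj (y2 s$i$j)" "y3 s$j$i = cj (y3 s$i$j)" for i j
    using jet3_unique[OF ent[of j i] jet3_linear[OF bounded_linear_cj ent[of i j]] PM_herm[OF M] s] by auto
  have diag: "y1 s$i$i = re (y1 s$i$i) *\<^sub>R one" "y2 s$i$i = re (y2 s$i$i) *\<^sub>R one" "y3 s$i$i = re (y3 s$i$i) *\<^sub>R one" for i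
    using self_conjugate herm(1)[of i i, symmetric] herm(2)[of i i, symmetric] herm(3)[of i i, symmetric] by metis+
  have Y: "y s$i$j = (if i = k \<and> j = k then one else 0)" for i j by (simp add: unit unit_matrix_def)
  define h where "h = col k (y1 s)"
  define \<eta> where "\<eta> = h \<bullet> h"
  have hn: "h$i = y1 s$i$k" for i by (simp add: h_def col_def)
  have hn': "y1 s$k$j = cj (h$j)" for j using herm(1)[of k j] by (simp add: hn)
  have rek: "jet3 (\<lambda>s. re (y s$k$k)) (\<lambda>s. re (y1 s$k$k)) (\<lambda>s. re (y2 s$k$k)) (\<lambda>s. re (y3 s$k$k))"
    by (rule jet3_linear[OF bounded_linear_re ent])
  have rel: "y s$i$k \<odot> y1 s$k$j + y1 s$i$k \<odot> y s$k$j = re (y s$k$k) *\<^sub>R y1 s$i$j + re (y1 s$k$k) *\<^sub>R y s$i$j"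
     "y s$i$k \<odot> y2 s$k$j + 2 *\<^sub>R (y1 s$i$k \<odot> y1 s$k$j) + y2 s$i$k \<odot> y s$k$j =
      re (y s$k$k) *\<^sub>R y2 s$i$j + 2 *\<^sub>R re (y1 s$k$k) *\<^sub>R y1 s$i$j + re (y2 s$k$k) *\<^sub>R y s$i$j"
     "y s$i$k \<odot> y3 s$k$j + 3 *\<^sub>R (y1 s$i$k \<odot> y2 s$k$j) + 3 *\<^sub>R (y2 s$i$k \<odot> y1 s$k$j) + y3 s$i$k \<odot> y s$k$j =
      re (y s$k$k) *\<^sub>R y3 s$i$j + 3 *\<^sub>R re (y1 s$k$k) *\<^sub>R y2 s$i$j + 3 *\<^sub>R re (y2 s$k$k) *\<^sub>R y1 s$i$j + re (y3 s$k$k) *\<^sub>R y s$i$j"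
    for i j
    using jet3_unique[OF jet3_bilinear[OF bil ent[of i k] ent[of k j]]
        jet3_bilinear[OF bounded_bilinear_scaleR rek ent[of i j]] PM_rel[OF M] s] by auto
  have lin_tr: "bounded_linear (\<lambda>A :: 'a^'m^'m. \<Sum>i\<in>UNIV. re (A$i$i))"
    by (intro bounded_linear_sum bounded_linear_compose[OF bounded_linear_re bounded_linear_entry])
  have tr: "(\<Sum>i\<in>UNIV. re (y1 s$i$i)) = 0" "(\<Sum>i\<in>UNIV. re (y2 s$i$i)) = 0" "(\<Sum>i\<in>UNIV. re (y3 s$i$i)) = 0"
    using jet3_unique[OF jet3_linear[OF lin_tr jet] jet3_const[of 1] PM_tr[OF M] s] by auto
  have y1_ij: "y1 s$i$j = 0" if "i \<noteq> k" "j \<noteq> k" for i j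
    using rel(1)[of i j] that by (simp add: Y mul_simps)
  have y1_kk: "re (y1 s$k$k) = 0"
  proof -
    have "(\<Sum>i\<in>UNIV. re (y1 s$i$i)) = (\<Sum>i\<in>UNIV. if i = k then re (y1 s$k$k) else 0)"
      by (intro sum.cong) (auto simp: y1_ij re_linear)
    then show ?thesis using tr(1) by simp
  qed
  have hk: "h$k = 0" using diag(1)[of k] y1_kk by (simp add: hn)
  have y2_ij: "y2 s$i$j = 2 *\<^sub>R (h$i \<odot> cj (h$j))" if "i \<noteq> k" "j \<noteq> k" for i j
  proof -
    have "y1 s$i$k \<odot> y1 s$k$j = h$i \<odot> cj (h$j)" by (simp only: hn[symmetric] hn')
    then show ?thesis using rel(2)[of i j] that by (simp add: Y mul_simps y1_ij)
  qed
  \<comment> \<open>The trace is constant, and the diagonal entries away from \<open>k\<close> sum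
    to \<open>2 * \<eta>\<close>.\<close>
  have y2_kk: "re (y2 s$k$k) = - 2 * \<eta>"
  proof -
    have "(\<Sum>i\<in>UNIV. re (y2 s$i$i)) = (\<Sum>i\<in>UNIV. (if i = k then re (y2 s$k$k) else 0) + 2 * (h$i \<bullet> h$i))"
      by (intro sum.cong) (auto simp: y2_ij re_linear re_mul_cj hk)
    also have "\<dots> = re (y2 s$k$k) + 2 * \<eta>" by (simp add: sum.distrib \<eta>_def inner_vec_def sum_distrib_left)
    finally show ?thesis using tr(2) by simp
  qed
  have col_unit: "X \<bullet> outer t (col k (y s)) = col k X \<bullet> t" for X t
  proof -
    have "X$i$j \<bullet> (t$i \<odot> cj (col k (y s) $ j)) = (if j = k then X$i$k \<bullet> t$i else 0)" for i j
      by (simp add: col_def Y cj_linear mul_simps)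
    then show ?thesis by (simp add: inner_matrix) (simp add: inner_vec_def col_def)
  qed
  have colt: "col k (y s) \<bullet> t = 0" if "t$k = 0" for t
  proof -
    have "col k (y s) $ i \<bullet> t $ i = 0" for i using that by (simp add: col_def Y)
    then show ?thesis by (simp add: inner_vec_def)
  qed
  have Zin: "X \<bullet> Zt k (y s) t = 2 * (col k X \<bullet> t)" if "t$k = 0" "\<And>i j. X$j$i = cj (X$i$j)" for X t
    using herm_inner_outer[OF that(2), of "col k (y s)" t] that(1)
    by (simp add: Zt_def inner_add_right inner_diff_right col_unit colt)
  have nz: "re (y s$k$k) \<noteq> 0" by (simp add: Y)
  have dd: "(\<Sum>i\<in>UNIV. \<Sum>j\<in>UNIV. if i = k then (if j = k then x else 0) else 0) = x" for x :: real
  proof -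
    have "(\<Sum>j\<in>UNIV. if i = k then (if j = k then x else 0) else 0) = (if i = k then x else 0)" for i by simp
    then show ?thesis by simp
  qed
  have y2_ik: "y2 s$i$k = 0" if "i \<noteq> k" for i
  proof -
    define t where "t = (axis i (y2 s$i$k) :: 'a^'m)"
    have t: "t$k = 0" using that by (simp add: t_def axis_def)
    have "y2 s \<bullet> Zt k (y s) t = 0" by (rule nor[OF s Zt_tangent[OF M[OF s] nz t]])
    then have "col k (y2 s) \<bullet> t = 0" using Zin[OF t herm(2)] by simp
    then show ?thesis by (simp add: t_def inner_axis col_def)
  qed
  have y2_kj: "y2 s$k$j = 0" if "j \<noteq> k" for j using herm(2)[of k j] y2_ik[OF that] by (simp add: cj_linear)
  have y3_ij: "y3 s$i$j = 0" if "i \<noteq> k" "j \<noteq> k" for i j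
    using rel(3)[of i j] that by (simp add: Y mul_simps y1_kk y2_ik y2_kj y1_ij)
  have y3_kk: "re (y3 s$k$k) = 0"
  proof -
    have "(\<Sum>i\<in>UNIV. re (y3 s$i$i)) = (\<Sum>i\<in>UNIV. if i = k then re (y3 s$k$k) else 0)"
      by (intro sum.cong) (auto simp: y3_ij re_linear)
    then show ?thesis using tr(3) by simp
  qed
  \<comment> \<open>Normality at \<open>s\<close> alone says nothing about \<open>y3 s\<close>. But
    \<open>y2 r \<bullet> Zt k (y r) t = 0\<close> holds for all \<open>r\<close> near
    \<open>s\<close>, and its derivative at \<open>s\<close> contains \<open>y3 s\<close>.\<close>
  have key: "col k (y3 s) \<bullet> t = - (4 * \<eta>) * (h \<bullet> t)" if t: "t$k = 0" for t
  proof -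
    have contk: "continuous_on I01 (\<lambda>s. re (y s$k$k))"
      unfolding continuous_on_eq_continuous_within
      using jet3_D(1)[OF rek] has_vector_derivative_continuous by blast
    have "open (- {0::real})" by (rule open_Compl) simp
    from contk[unfolded continuous_on_topological, rule_format, OF s this] nz
    obtain J where J: "open J" "s \<in> J" "\<And>r. r \<in> J \<Longrightarrow> r \<in> I01 \<Longrightarrow> re (y r$k$k) \<noteq> 0" by auto
    have zero: "y2 r \<bullet> Zt k (y r) t = 0" if r: "r \<in> J" "r \<in> I01" for r
      by (rule nor[OF r(2) Zt_tangent[OF M[OF r(2)] J(3)[OF r] t]])
    have dcol: "((\<lambda>r. col k (y r)) has_vector_derivative h) (at s within I01)"
      unfolding h_def by (rule bounded_linear.has_vector_derivative[OF bounded_linear_col jet3_D(1)[OF jet s]])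
    have o1: "((\<lambda>r. outer t (col k (y r))) has_vector_derivative outer t h) (at s within I01)"
      by (rule bounded_linear.has_vector_derivative[OF bounded_bilinear.bounded_linear_right[OF bounded_bilinear_outer] dcol])
    have o2: "((\<lambda>r. outer (col k (y r)) t) has_vector_derivative outer h t) (at s within I01)"
      by (rule bounded_linear.has_vector_derivative[OF bounded_bilinear.bounded_linear_left[OF bounded_bilinear_outer] dcol])
    have "((\<lambda>r. 2 * (col k (y r) \<bullet> t)) has_vector_derivative 2 * (h \<bullet> t)) (at s within I01)"
      by (rule bounded_linear.has_vector_derivative[OF bounded_linear_compose[OF bounded_linear_mult_right bounded_linear_inner_left] dcol])
    then have o3: "((\<lambda>r. 2 * (col k (y r) \<bullet> t)) has_real_derivative 2 * (h \<bullet> t)) (at s within I01)"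
      by (simp add: has_real_derivative_iff_has_vector_derivative)
    define Z' where "Z' = outer t h + outer h t - (2 * (h \<bullet> t)) *\<^sub>R y s"
    have dZ: "((\<lambda>r. Zt k (y r) t) has_vector_derivative Z') (at s within I01)"
      unfolding Zt_def
      by (rule has_vector_derivative_eq_rhs[OF has_vector_derivative_diff[OF has_vector_derivative_add[OF o1 o2]
            has_vector_derivative_scaleR[OF o3 jet3_D(1)[OF jet s]]]])
         (simp add: Z'_def colt[OF t])
    have "((\<lambda>r. 0) has_vector_derivative y2 s \<bullet> Z' + y3 s \<bullet> Zt k (y s) t) (at s within I01)"
      by (rule has_vector_derivative_cong_open[OF bounded_bilinear.has_vector_derivative[OF bounded_bilinear_inner
            jet3_D(3)[OF jet s] dZ] J(1,2) s]) (rule zero)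
    then have "y2 s \<bullet> Z' + y3 s \<bullet> Zt k (y s) t = 0"
      using vector_derivative_I01_unique[OF _ has_vector_derivative_const s] by blast
    moreover have "y3 s \<bullet> Zt k (y s) t = 2 * (col k (y3 s) \<bullet> t)" by (rule Zin[OF t herm(3)])
    moreover have "y2 s \<bullet> Z' = 8 * \<eta> * (h \<bullet> t)"
    proof -
      have "y2 s$i$j \<bullet> (t$i \<odot> cj (h$j)) = 2 * ((h$i \<bullet> t$i) * (h$j \<bullet> h$j))" for i j
      proof (cases "i = k \<or> j = k")
        case True
        then show ?thesis using t hk by (auto simp: cj_linear mul_simps)
      next
        case False
        then show ?thesis using inner_mul_same_right[of "h$i" "cj (h$j)" "t$i"] by (simp add: y2_ij)
      qed
      then have "y2 s \<bullet> outer t h = 2 * (h \<bullet> t) * \<eta>"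
        by (simp add: inner_matrix) (simp add: inner_vec_def \<eta>_def sum_product sum_distrib_left mult_ac)
      moreover have "y2 s \<bullet> outer h t = y2 s \<bullet> outer t h" by (rule herm_inner_outer[OF herm(2)])
      moreover have "y2 s \<bullet> y s = - 2 * \<eta>"
      proof -
        have "y2 s$i$j \<bullet> y s$i$j = (if i = k then (if j = k then re (y2 s$k$k) else 0) else 0)" for i j
          by (simp add: Y re_def)
        then show ?thesis unfolding inner_matrix using dd y2_kk by simp
      qed
      ultimately show ?thesis by (simp add: Z'_def inner_add_right inner_diff_right)
    qed
    ultimately show ?thesis by simp
  qed
  have y3_ik: "y3 s$i$k = - (4 * \<eta>) *\<^sub>R h$i" if "i \<noteq> k" for i
  proof (rule eq_by_inner)
    fix x :: 'a
    have "(axis i x :: 'a^'m) $ k = 0" using that by (simp add: axis_def)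
    from key[OF this] show "y3 s$i$k \<bullet> x = (- (4 * \<eta>) *\<^sub>R h$i) \<bullet> x"
      by (simp add: inner_axis col_def)
  qed
  \<comment> \<open>From \<open>y r \<bullet> y r = 1\<close>, differentiated twice.\<close>
  have speed: "y1 s \<bullet> y1 s = 2 * \<eta>"
  proof -
    have 1: "((\<lambda>s. 1::real) has_vector_derivative y r \<bullet> y1 r + y1 r \<bullet> y r) (at r within I01)" if r: "r \<in> I01" for r
      by (rule has_vector_derivative_cong_open[OF bounded_bilinear.has_vector_derivative[OF bounded_bilinear_inner
            jet3_D(1)[OF jet r] jet3_D(1)[OF jet r]] open_UNIV UNIV_I r]) (simp add: PM_norm[OF M])
    have yy1: "y r \<bullet> y1 r = 0" if "r \<in> I01" for r
      using vector_derivative_I01_unique[OF 1[OF that] has_vector_derivative_const that] by (simp add: inner_commute)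
    have 2: "((\<lambda>s. 0::real) has_vector_derivative y s \<bullet> y2 s + y1 s \<bullet> y1 s) (at s within I01)"
      by (rule has_vector_derivative_cong_open[OF bounded_bilinear.has_vector_derivative[OF bounded_bilinear_inner
            jet3_D(1)[OF jet s] jet3_D(2)[OF jet s]] open_UNIV UNIV_I s]) (simp add: yy1)
    have "y s \<bullet> y2 s + y1 s \<bullet> y1 s = 0"
      using vector_derivative_I01_unique[OF 2 has_vector_derivative_const s] by simp
    moreover have "y s \<bullet> y2 s = - 2 * \<eta>"
    proof -
      have "y s$i$j \<bullet> y2 s$i$j = (if i = k then (if j = k then re (y2 s$k$k) else 0) else 0)" for i j
        by (simp add: Y re_def inner_commute)
      then show ?thesis unfolding inner_matrix using dd y2_kk by simp
    qed
    ultimately show ?thesis by simp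
  qed
  have "y3 s$i$j = - (4 * \<eta>) *\<^sub>R y1 s$i$j" for i j
  proof -
    consider "i \<noteq> k" "j \<noteq> k" | "i = k" "j = k" | "i \<noteq> k" "j = k" | "i = k" "j \<noteq> k" by blast
    then show ?thesis
    proof cases
      case 1 then show ?thesis by (simp add: y1_ij y3_ij)
    next
      case 2 then show ?thesis using diag(1)[of k] diag(3)[of k] y1_kk y3_kk by simp
    next
      case 3 then show ?thesis using y3_ik by (simp add: hn)
    next
      case 4 then show ?thesis using y3_ik[of j] herm(3)[of k j] hn'[of j] by (simp add: cj_linear)
    qed
  qed
  then show ?thesis by (simp add: vec_eq_iff speed)
qed

text \<open>A linear isometry preserving \<open>PM\<close> moves the point \<open>y s\<close> to a
  coordinate point; hypotheses and conclusion are invariant under it.\<close>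

lemma PM_geodesic:
  assumes M: "\<And>s. s \<in> I01 \<Longrightarrow> y s \<in> PM" and jet: "jet3 y y1 y2 y3"
    and nor: "\<And>s \<eta>. s \<in> I01 \<Longrightarrow> \<eta> \<in> tangent PM (y s) \<Longrightarrow> y2 s \<bullet> \<eta> = 0" and s: "s \<in> I01"
  shows "y3 s = - (2 * (y1 s \<bullet> y1 s)) *\<^sub>R y1 s"
proof -
  obtain g h k where gh: "isometry_pair g h" and gk: "g (y s) = unit_matrix k" using transitive[OF M[OF s]] by blast
  have g: "linear g" "bounded_linear g" and h: "bounded_linear h" and gi: "\<And>x y. g x \<bullet> g y = x \<bullet> y"
    and gM: "\<And>A. A \<in> PM \<Longrightarrow> g A \<in> PM" "\<And>A. A \<in> PM \<Longrightarrow> h A \<in> PM" "\<And>A. A \<in> PM \<Longrightarrow> h (g A) = A"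
      "\<And>A. A \<in> PM \<Longrightarrow> g (h A) = A"
    using gh by (auto simp: isometry_pair_def linear_conv_bounded_linear)
  have nor': "g (y2 r) \<bullet> \<eta> = 0" if r: "r \<in> I01" and \<eta>: "\<eta> \<in> tangent PM (g (y r))" for r \<eta>
  proof -
    have h\<eta>: "h \<eta> \<in> tangent PM (y r)"
      using tangent_image[OF \<eta> bounded_linear_imp_has_derivative[OF h] gM(2)] gM(3)[OF M[OF r]] by simp
    obtain \<gamma> where ga: "\<forall>\<^sub>F s in nhds (0::real). \<gamma> s \<in> PM" "(\<gamma> has_vector_derivative \<eta>) (at 0)"
      using \<eta> by (auto simp: tangent_def)
    then obtain J where J: "open J" "0 \<in> J" "\<And>s. s \<in> J \<Longrightarrow> \<gamma> s \<in> PM" unfolding eventually_nhds by auto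
    have "(\<gamma> has_vector_derivative g (h \<eta>)) (at 0)"
      by (rule has_vector_derivative_cong_open[OF bounded_linear.has_vector_derivative[OF g(2)
            bounded_linear.has_vector_derivative[OF h ga(2)]] J(1,2)]) (auto simp: gM(4) J(3))
    then have "g (h \<eta>) = \<eta>" using vector_derivative_unique_at ga(2) by blast
    then have "g (y2 r) \<bullet> \<eta> = y2 r \<bullet> h \<eta>" using gi[of "y2 r" "h \<eta>"] by simp
    then show ?thesis using nor[OF r h\<eta>] by simp
  qed
  have "g (y3 s) = - (2 * (g (y1 s) \<bullet> g (y1 s))) *\<^sub>R g (y1 s)"
    by (rule geodesic_at_unit_matrix[where y = "\<lambda>s. g (y s)", OF gM(1)[OF M]
          jet3_linear[OF g(2) jet] nor' s gk])
  then have "g (y3 s + (2 * (y1 s \<bullet> y1 s)) *\<^sub>R y1 s) = 0"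
    by (simp add: gi linear_add[OF g(1)] linear_scale[OF g(1)])
  then have "(y3 s + (2 * (y1 s \<bullet> y1 s)) *\<^sub>R y1 s) \<bullet> (y3 s + (2 * (y1 s \<bullet> y1 s)) *\<^sub>R y1 s) = 0"
    using gi by (metis inner_zero_left)
  then have "y3 s + (2 * (y1 s \<bullet> y1 s)) *\<^sub>R y1 s = 0" by simp
  then show ?thesis by (simp add: eq_neg_iff_add_eq_0)
qed

lemma PM_tangent_inner: "v \<in> tangent PM A \<Longrightarrow> A \<bullet> v = 0"
proof -
  assume "v \<in> tangent PM A"
  then obtain \<gamma> where g: "\<forall>\<^sub>F s in nhds (0::real). \<gamma> s \<in> PM" "\<gamma> 0 = A"
     "(\<gamma> has_vector_derivative v) (at 0)" by (auto simp: tangent_def)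
  obtain J where J: "open J" "0 \<in> J" "\<And>s. s \<in> J \<Longrightarrow> \<gamma> s \<in> PM"
    using g(1) unfolding eventually_nhds by auto
  have "((\<lambda>s. 1::real) has_vector_derivative \<gamma> 0 \<bullet> v + v \<bullet> \<gamma> 0) (at 0)"
    by (rule has_vector_derivative_cong_open[OF bounded_bilinear.has_vector_derivative[OF bounded_bilinear_inner g(3) g(3)] J(1,2)])
       (auto simp: PM_norm J(3))
  then have "\<gamma> 0 \<bullet> v + v \<bullet> \<gamma> 0 = 0"
    using vector_derivative_unique_at has_vector_derivative_const by blast
  then show ?thesis using g(2) by (simp add: inner_commute)
qed

text \<open>A vanishing diagonal entry is minimal, since the diagonal entries are nonnegative.\<close>
lemma PM_tangent_diag:
  assumes v: "v \<in> tangent PM A" and b: "re (A$b$b) = 0"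
  shows "re (v$b$b) = 0"
proof -
  obtain \<gamma> where g: "\<forall>\<^sub>F s in nhds (0::real). \<gamma> s \<in> PM" "\<gamma> 0 = A"
     "(\<gamma> has_vector_derivative v) (at 0)" using v by (auto simp: tangent_def)
  obtain J where J: "open J" "0 \<in> J" "\<And>s. s \<in> J \<Longrightarrow> \<gamma> s \<in> PM"
    using g(1) unfolding eventually_nhds by auto
  obtain d where d: "d > 0" "ball 0 d \<subseteq> J" using J(1,2) open_contains_ball by blast
  have "((\<lambda>s. re (\<gamma> s$b$b)) has_real_derivative re (v$b$b)) (at 0)"
    using bounded_linear.has_vector_derivative[OF bounded_linear_compose[OF bounded_linear_re bounded_linear_entry] g(3)]
    by (simp add: has_real_derivative_iff_has_vector_derivative)
  then show ?thesis
  proof (rule DERIV_local_min[OF _ d(1)], intro allI impI)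
    fix s :: real assume "\<bar>0 - s\<bar> < d"
    then have "\<gamma> s \<in> PM" using J(3) d(2) by (auto simp: dist_real_def)
    then show "re (\<gamma> 0$b$b) \<le> re (\<gamma> s$b$b)" using PM_diag_nonneg b g(2) by simp
  qed
qed

lemma PM_tangent_trace: "v \<in> tangent PM A \<Longrightarrow> (\<Sum>i\<in>UNIV. re (v$i$i)) = 0"
proof -
  assume "v \<in> tangent PM A"
  then obtain \<gamma> where g: "\<forall>\<^sub>F s in nhds (0::real). \<gamma> s \<in> PM" "(\<gamma> has_vector_derivative v) (at 0)"
    by (auto simp: tangent_def)
  obtain J where J: "open J" "0 \<in> J" "\<And>s. s \<in> J \<Longrightarrow> \<gamma> s \<in> PM"
    using g(1) unfolding eventually_nhds by auto
  have lin_tr: "bounded_linear (\<lambda>A :: 'a^'m^'m. \<Sum>i\<in>UNIV. re (A$i$i))"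
    by (intro bounded_linear_sum bounded_linear_compose[OF bounded_linear_re bounded_linear_entry])
  have "((\<lambda>s. 1::real) has_vector_derivative (\<Sum>i\<in>UNIV. re (v$i$i))) (at 0)"
    by (rule has_vector_derivative_cong_open[OF bounded_linear.has_vector_derivative[OF lin_tr g(2)] J(1,2)])
       (auto simp: PM_tr J(3))
  then show ?thesis using vector_derivative_unique_at has_vector_derivative_const by blast
qed

end

subsection \<open>Torus actions\<close>

text \<open>Normalising factor: an off-diagonal entry of a Hermitian matrix occurs twice, once
  conjugated.\<close>

definition isqrt2 :: real where "isqrt2 = 1 / sqrt 2"

lemma isqrt2 [simp]: "isqrt2 * (isqrt2 * x) = x / 2" "isqrt2 * (sqrt 2 * x) = x" "isqrt2 * sqrt 2 = 1"
  "isqrt2 + isqrt2 = sqrt 2" "isqrt2 * isqrt2 = 1 / 2"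
  by (simp_all add: isqrt2_def real_div_sqrt)

text \<open>The orthonormal basis \<open>cb r\<close>, \<open>cf r\<close> groups the algebra into
  planes, and each entry above the diagonal contributes a copy of them, turning at the speeds
  \<open>freq i j r\<close>. The numbering \<open>idx\<close> tells the entries above the diagonal
  from those below.\<close>

locale projective_data = projective_space mul one idx
  for mul :: "'a::euclidean_space \<Rightarrow> 'a \<Rightarrow> 'a" (infixl "\<odot>" 70) and one and idx :: "'m::finite \<Rightarrow> nat" +
  fixes R :: "'r set" and cb cf :: "'r \<Rightarrow> 'a" and freq :: "'m \<Rightarrow> 'm \<Rightarrow> 'r \<Rightarrow> real"
  assumes idx_inj: "inj idx" and finR: "finite R"
    and bb: "\<lbrakk>r \<in> R; q \<in> R\<rbrakk> \<Longrightarrow> cb r \<bullet> cb q = (if r = q then 1 else 0)"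
      "\<lbrakk>r \<in> R; q \<in> R\<rbrakk> \<Longrightarrow> cf r \<bullet> cf q = (if r = q then 1 else 0)"
      "\<lbrakk>r \<in> R; q \<in> R\<rbrakk> \<Longrightarrow> cb r \<bullet> cf q = 0"
    and expand: "x = (\<Sum>r\<in>R. (x \<bullet> cb r) *\<^sub>R cb r + (x \<bullet> cf r) *\<^sub>R cf r)"
    and freq_rat: "\<lbrakk>idx i < idx j; r \<in> R\<rbrakk> \<Longrightarrow> freq i j r \<in> \<rat>"
    and freq_nz: "\<lbrakk>idx i < idx j; r \<in> R\<rbrakk> \<Longrightarrow> freq i j r \<noteq> 0"
    and freq_inj: "\<lbrakk>idx i < idx j; idx i' < idx j'; r \<in> R; r' \<in> R; \<bar>freq i j r\<bar> = \<bar>freq i' j' r'\<bar>\<rbrakk>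
      \<Longrightarrow> i = i' \<and> j = j' \<and> r = r'"
begin

definition pairs :: "('m \<times> 'm) set" where "pairs = {(i, j). idx i < idx j}"

definition planes :: "(('m \<times> 'm) \<times> 'r) set" where "planes = pairs \<times> R"

definition rot :: "('r \<Rightarrow> real) \<Rightarrow> real \<Rightarrow> 'a \<Rightarrow> 'a" where
  "rot w s x = (\<Sum>r\<in>R. (cos (w r * s) * (x \<bullet> cb r) - sin (w r * s) * (x \<bullet> cf r)) *\<^sub>R cb r
     + (cos (w r * s) * (x \<bullet> cf r) + sin (w r * s) * (x \<bullet> cb r)) *\<^sub>R cf r)"

text \<open>The action of the torus on the \<open>(i, j)\<close> entry of a Hermitian matrix, determined below the
  diagonal by the entries above it.\<close>
definition turn :: "real \<Rightarrow> 'm \<Rightarrow> 'm \<Rightarrow> 'a \<Rightarrow> 'a" where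
  "turn s i j x = (if idx i < idx j then rot (freq i j) s x
     else if idx j < idx i then cj (rot (freq j i) s (cj x)) else x)"

definition slots :: "'m \<Rightarrow> 'm \<Rightarrow> 'a \<Rightarrow> 'a^'m^'m" where
  "slots i j x = isqrt2 *\<^sub>R (axis i (axis j x) + axis j (axis i (cj x)))"

definition pe :: "('m \<times> 'm) \<times> 'r \<Rightarrow> 'a^'m^'m" where "pe = (\<lambda>((i, j), r). slots i j (cb r))"
definition pf :: "('m \<times> 'm) \<times> 'r \<Rightarrow> 'a^'m^'m" where "pf = (\<lambda>((i, j), r). slots i j (cf r))"
definition pfreq :: "('m \<times> 'm) \<times> 'r \<Rightarrow> real" where "pfreq = (\<lambda>((i, j), r). freq i j r)"
text \<open>Centre of the projective line through the \<open>i\<close>-th and \<open>j\<close>-th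
  coordinate points, which is a round sphere; each weight plane of the entry cuts it in a great
  circle.\<close>

definition pcen :: "('m \<times> 'm) \<times> 'r \<Rightarrow> 'a^'m^'m" where
  "pcen = (\<lambda>((i, j), r). (1 / 2) *\<^sub>R (axis i (axis i one) + axis j (axis j one)))"

lemma rot_inner:
  assumes "r \<in> R"
  shows "rot w s x \<bullet> cb r = cos (w r * s) * (x \<bullet> cb r) - sin (w r * s) * (x \<bullet> cf r)"
    "rot w s x \<bullet> cf r = cos (w r * s) * (x \<bullet> cf r) + sin (w r * s) * (x \<bullet> cb r)"
proof -
  have "rot w s x \<bullet> cb r = (\<Sum>q\<in>R. if q = r then cos (w r * s) * (x \<bullet> cb r) - sin (w r * s) * (x \<bullet> cf r) else 0)"
    unfolding rot_def inner_sum_left using assms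
    by (intro sum.cong refl) (auto simp: inner_add_left bb bb(3)[unfolded inner_commute[of "cb _"]])
  then show "rot w s x \<bullet> cb r = cos (w r * s) * (x \<bullet> cb r) - sin (w r * s) * (x \<bullet> cf r)"
    using assms finR by simp
  have "rot w s x \<bullet> cf r = (\<Sum>q\<in>R. if q = r then cos (w r * s) * (x \<bullet> cf r) + sin (w r * s) * (x \<bullet> cb r) else 0)"
    unfolding rot_def inner_sum_left using assms
    by (intro sum.cong refl) (auto simp: inner_add_left bb)
  then show "rot w s x \<bullet> cf r = cos (w r * s) * (x \<bullet> cf r) + sin (w r * s) * (x \<bullet> cb r)"
    using assms finR by simp
qed

lemma inner_expand: "x \<bullet> y = (\<Sum>r\<in>R. (x \<bullet> cb r) * (y \<bullet> cb r) + (x \<bullet> cf r) * (y \<bullet> cf r))"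
proof -
  have "x \<bullet> y = x \<bullet> (\<Sum>r\<in>R. (y \<bullet> cb r) *\<^sub>R cb r + (y \<bullet> cf r) *\<^sub>R cf r)" using expand[of y] by simp
  then show ?thesis by (simp add: inner_sum_right inner_add_right mult.commute)
qed

lemma rot_isometry: "rot w s x \<bullet> rot w s x = x \<bullet> x"
proof -
  have "(c * a - n * b) * (c * a - n * b) + (c * b + n * a) * (c * b + n * a) = a * a + b * b"
    if "c\<^sup>2 + n\<^sup>2 = 1" for a b c n :: real
  proof -
    have "(c * a - n * b) * (c * a - n * b) + (c * b + n * a) * (c * b + n * a) = (c\<^sup>2 + n\<^sup>2) * (a * a + b * b)"
      by (simp add: power2_eq_square algebra_simps)
    then show ?thesis using that by simp
  qed
  then show ?thesis
    unfolding inner_expand[of "rot w s x" "rot w s x"] inner_expand[of x x]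
    by (intro sum.cong refl) (simp add: rot_inner)
qed

lemma linear_rot: "linear (rot w s)"
  by (rule linearI)
     (simp_all add: rot_def inner_add_left algebra_simps sum.distrib scaleR_sum_right sum_subtractf)

lemma linear_cj: "linear cj" by (rule bounded_linear.linear[OF bounded_linear_cj])

lemma linear_turn: "linear (turn s i j)"
proof -
  have "linear (\<lambda>x. cj (rot (freq j i) s (cj x)))"
    using linear_compose[OF linear_compose[OF linear_cj linear_rot] linear_cj] by (simp add: o_def)
  then show ?thesis unfolding turn_def[abs_def]
    by (cases "idx i < idx j"; cases "idx j < idx i") (auto simp: linear_rot linear_ident)
qed

lemma turn_isometry: "turn s i j x \<bullet> turn s i j x = x \<bullet> x"
  by (simp add: turn_def rot_isometry)

lemma turn_cj: "turn s j i (cj x) = cj (turn s i j x)"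
  by (auto simp: turn_def)

lemma turn_same [simp]: "turn s i i x = x"
  by (simp add: turn_def)

lemma axis_axis_inner: "(axis i (axis j x) :: 'a^'m^'m) \<bullet> axis i' (axis j' y) = (if i = i' \<and> j = j' then x \<bullet> y else 0)"
  by (simp add: inner_axis_axis)

lemma slots_inner:
  assumes "idx i < idx j" "idx i' < idx j'"
  shows "slots i j x \<bullet> slots i' j' y = (if i = i' \<and> j = j' then x \<bullet> y else 0)"
proof -
  have "slots i j x \<bullet> slots i' j' y = isqrt2 * (isqrt2 *
      ((if i = i' \<and> j = j' then x \<bullet> y else 0) + (if j = i' \<and> i = j' then cj x \<bullet> y else 0))
    + isqrt2 * ((if i = j' \<and> j = i' then x \<bullet> cj y else 0) + (if j = j' \<and> i = i' then x \<bullet> y else 0)))"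
    by (simp only: slots_def inner_add_left inner_add_right axis_axis_inner inner_scaleR_left inner_scaleR_right cj_inner_cj)
  moreover have "(j = i' \<and> i = j') = False" "(i = j' \<and> j = i') = False" using assms by auto
  ultimately have "slots i j x \<bullet> slots i' j' y = isqrt2 * (isqrt2 * (if i = i' \<and> j = j' then x \<bullet> y else 0)
    + isqrt2 * (if i = i' \<and> j = j' then x \<bullet> y else 0))"
    by (simp only: if_False add_0_left add_0_right conj_commute)
  then show ?thesis by (simp only: distrib_left[symmetric] isqrt2(1)) simp
qed

lemma herm_inner_slots:
  assumes "A$j$i = cj (A$i$j)"
  shows "A \<bullet> slots i j x = sqrt 2 * (A$i$j \<bullet> x)"
proof -
  have "A \<bullet> slots i j x = (isqrt2 + isqrt2) * (A$i$j \<bullet> x)"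
    using assms by (simp only: slots_def inner_add_right inner_axis inner_scaleR_right cj_inner_cj distrib_left distrib_right)
  then show ?thesis by simp
qed

sublocale rotation_flow planes pe pf pfreq
proof
  have "finite pairs" by (rule finite_subset[of _ UNIV]) auto
  then show "finite planes" using finR by (simp add: planes_def)
  fix l m assume "l \<in> planes" "m \<in> planes"
  then obtain i j r i' j' r' where l: "l = ((i, j), r)" "idx i < idx j" "r \<in> R"
    and m: "m = ((i', j'), r')" "idx i' < idx j'" "r' \<in> R" by (auto simp: planes_def pairs_def)
  show "pe l \<bullet> pe m = (if l = m then 1 else 0)" "pf l \<bullet> pf m = (if l = m then 1 else 0)" "pe l \<bullet> pf m = 0"
    using l m by (auto simp: pe_def pf_def slots_inner bb)
qed

lemma slots_linear: "slots i j (x + y) = slots i j x + slots i j y" "slots i j (c *\<^sub>R x) = c *\<^sub>R slots i j x" "slots i j 0 = 0"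
  by (simp_all add: slots_def vec_eq_iff axis_def cj_linear algebra_simps)

lemma emb_slots: "emb ((i, j), r) a b = slots i j (a *\<^sub>R cb r + b *\<^sub>R cf r)"
  unfolding emb_def by (simp add: pe_def pf_def slots_linear)

lemma slots_nth: "slots i j x $ a $ b = isqrt2 *\<^sub>R ((if a = i \<and> b = j then x else 0) + (if a = j \<and> b = i then cj x else 0))"
  apply (simp only: slots_def axis_def vector_scaleR_component vector_add_component vec_lambda_beta)
  apply (auto simp only: zero_index vec_lambda_beta if_True if_False split: if_splits)
  done

lemma sum_slots: "finite S \<Longrightarrow> slots i j (\<Sum>r\<in>S. g r) = (\<Sum>r\<in>S. slots i j (g r))"
  by (induction S rule: finite_induct) (simp_all add: slots_linear)

lemma sum_emb_nth:
  "(\<Sum>l\<in>planes. emb l (p l) (q l)) $ a $ b = isqrt2 *\<^sub>R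
     (if idx a < idx b then \<Sum>r\<in>R. p ((a, b), r) *\<^sub>R cb r + q ((a, b), r) *\<^sub>R cf r
      else if idx b < idx a then cj (\<Sum>r\<in>R. p ((b, a), r) *\<^sub>R cb r + q ((b, a), r) *\<^sub>R cf r) else 0)"
proof -
  define X where "X = (\<lambda>ij. \<Sum>r\<in>R. p (ij, r) *\<^sub>R cb r + q (ij, r) *\<^sub>R cf r)"
  have fp: "finite pairs" by (rule finite_subset[of _ UNIV]) auto
  have "(\<Sum>l\<in>planes. emb l (p l) (q l)) = (\<Sum>ij\<in>pairs. \<Sum>r\<in>R. emb (ij, r) (p (ij, r)) (q (ij, r)))"
    unfolding planes_def by (simp add: sum.cartesian_product split_def)
  also have "\<dots> = (\<Sum>ij\<in>pairs. slots (fst ij) (snd ij) (X ij))"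
    unfolding X_def by (intro sum.cong refl) (auto simp: sum_slots[OF finR] emb_slots)
  finally have 1: "(\<Sum>l\<in>planes. emb l (p l) (q l)) = (\<Sum>ij\<in>pairs. slots (fst ij) (snd ij) (X ij))" .
  have "(\<Sum>l\<in>planes. emb l (p l) (q l)) $ a $ b = (\<Sum>ij\<in>pairs. isqrt2 *\<^sub>R
     ((if ij = (a, b) then X (a, b) else 0) + (if ij = (b, a) then cj (X (b, a)) else 0)))"
    unfolding 1 sum_component slots_nth
    by (intro sum.cong refl arg_cong[where f = "(*\<^sub>R) isqrt2"] arg_cong2[where f = "(+)"]) auto
  also have "\<dots> = isqrt2 *\<^sub>R ((if (a, b) \<in> pairs then X (a, b) else 0) + (if (b, a) \<in> pairs then cj (X (b, a)) else 0))"
    using fp by (simp add: scaleR_sum_right[symmetric] sum.distrib)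
  finally show ?thesis by (auto simp: X_def pairs_def)
qed

lemma PM_inner_plane:
  assumes A: "A \<in> PM"
  shows "A \<bullet> pe ((i, j), r) = sqrt 2 * (A$i$j \<bullet> cb r)" "A \<bullet> pf ((i, j), r) = sqrt 2 * (A$i$j \<bullet> cf r)"
  using herm_inner_slots[OF PM_herm[OF A]] by (simp_all add: pe_def pf_def)

text \<open>The planes together span the Hermitian matrices with zero diagonal, so projecting to
  them removes exactly the diagonal, which the torus fixes.\<close>

lemma PM_sum_emb:
  assumes A: "A \<in> PM"
  shows "(\<Sum>l\<in>planes. emb l (A \<bullet> pe l) (A \<bullet> pf l)) $ a $ b = (if a = b then 0 else A $ a $ b)"
proof -
  have "(\<Sum>r\<in>R. (A \<bullet> pe ((a, b), r)) *\<^sub>R cb r + (A \<bullet> pf ((a, b), r)) *\<^sub>R cf r) = sqrt 2 *\<^sub>R A$a$b" for a b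
    by (subst (2) expand) (simp add: PM_inner_plane[OF A] scaleR_sum_right scaleR_add_right)
  moreover have "idx a < idx b \<or> idx b < idx a \<or> a = b" using idx_inj by (metis injD linorder_neqE_nat)
  ultimately show ?thesis
    using PM_herm[OF A, of a b] unfolding sum_emb_nth by (auto simp: cj_linear)
qed

text \<open>Reading the flow entry by entry is what allows it to be compared with the
  multiplication.\<close>

lemma flow_nth:
  assumes A: "A \<in> PM"
  shows "flow s A $ a $ b = turn s a b (A $ a $ b)"
proof -
  have c: "(\<Sum>r\<in>R. ((cos (freq a b r * s) - 1) * (A \<bullet> pe ((a, b), r)) - sin (freq a b r * s) * (A \<bullet> pf ((a, b), r))) *\<^sub>R cb r
       + ((cos (freq a b r * s) - 1) * (A \<bullet> pf ((a, b), r)) + sin (freq a b r * s) * (A \<bullet> pe ((a, b), r))) *\<^sub>R cf r)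
     = sqrt 2 *\<^sub>R (rot (freq a b) s (A$a$b) - A$a$b)" for a b
  proof -
    have "rot (freq a b) s (A$a$b) - A$a$b = rot (freq a b) s (A$a$b) - (\<Sum>r\<in>R. (A$a$b \<bullet> cb r) *\<^sub>R cb r + (A$a$b \<bullet> cf r) *\<^sub>R cf r)"
      using expand[of "A$a$b"] by simp
    then show ?thesis
      unfolding rot_def sum_subtractf[symmetric] scaleR_sum_right PM_inner_plane[OF A]
      by (simp only: scaleR_sum_right) (intro sum.cong refl, simp add: algebra_simps)
  qed
  have "idx a < idx b \<or> idx b < idx a \<or> a = b" using idx_inj by (metis injD linorder_neqE_nat)
  then show ?thesis
    using PM_herm[OF A, of a b] unfolding flow_def vector_add_component sum_emb_nth
    by (auto simp: pfreq_def c turn_def cj_linear)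
qed

text \<open>The square of the index set splits into the positions above, below and on the
  diagonal.\<close>

lemma card_pairs: "2 * card pairs = CARD('m) * CARD('m) - CARD('m)"
proof -
  define D where "D = {(i, i) | i :: 'm. True}"
  have p': "card (prod.swap ` pairs) = card pairs" by (rule card_image) (auto simp: inj_on_def)
  have D: "D = (\<lambda>i. (i, i)) ` UNIV" by (auto simp: D_def)
  have cD: "card D = CARD('m)" unfolding D by (rule card_image) (simp add: inj_on_def)
  have f: "finite X" for X :: "('m \<times> 'm) set" by (rule finite_subset[of _ UNIV]) auto
  have U: "(UNIV :: ('m \<times> 'm) set) = pairs \<union> prod.swap ` pairs \<union> D"
  proof (intro set_eqI iffI)
    fix p :: "'m \<times> 'm"
    obtain a b where p: "p = (a, b)" by fastforce
    have "idx a < idx b \<or> idx b < idx a \<or> a = b" using idx_inj by (metis injD linorder_neqE_nat)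
    then show "p \<in> pairs \<union> prod.swap ` pairs \<union> D"
      unfolding p D_def pairs_def by (auto simp: image_iff)
  qed simp
  have "CARD('m \<times> 'm) = card (pairs \<union> prod.swap ` pairs \<union> D)" using U by simp
  also have "\<dots> = card pairs + card (prod.swap ` pairs) + card D"
    using f by (subst card_Un_disjoint, simp, simp, force simp: pairs_def D_def,
        subst card_Un_disjoint) (auto simp: pairs_def)
  finally show ?thesis using p' cD by (simp add: card_prod)
qed

end

section \<open>Torus-invariant projective spaces as light models\<close>

text \<open>The rotations of the entries have to respect products of entries. For distinct indices
  this is a condition on the frequencies; for the octonions it is triality.\<close>

locale projective_light = projective_data mul one idx R cb cf freq
  for mul :: "'a::euclidean_space \<Rightarrow> 'a \<Rightarrow> 'a" (infixl "\<odot>" 70) and one and idx :: "'m::finite \<Rightarrow> nat"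
    and R :: "'r set" and cb cf freq +
  assumes turn_mul: "\<lbrakk>i \<noteq> j; j \<noteq> k; i \<noteq> k\<rbrakk> \<Longrightarrow> turn s i k x \<odot> turn s k j y = turn s i j (x \<odot> y)"
begin

text \<open>For three distinct indices the rank-one relation is preserved by
  \<open>turn_mul\<close>, for equal outer indices because rotations preserve norms; the remaining
  cases contain a real diagonal factor, which does not move.\<close>

lemma flow_PM:
  assumes A: "A \<in> PM"
  shows "flow s A \<in> PM"
proof -
  have real: "turn s k j (r *\<^sub>R x) = r *\<^sub>R turn s k j x" for k j r x
    by (rule linear_scale[OF linear_turn])
  have rel: "turn s i k (A$i$k) \<odot> turn s k j (A$k$j) = re (A$k$k) *\<^sub>R turn s i j (A$i$j)" for i j k
  proof -
    consider "i = k" | "k = j" | "i = j" "i \<noteq> k" | "i \<noteq> j" "j \<noteq> k" "i \<noteq> k" by blast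
    then show ?thesis
    proof cases
      case 1
      then show ?thesis using PM_diag[OF A, of k] mul.scaleR_left by (metis one_left turn_same)
    next
      case 2
      then show ?thesis using PM_diag[OF A, of k] mul.scaleR_right by (metis one_right turn_same)
    next
      case 3
      have "turn s k i (A$k$i) = cj (turn s i k (A$i$k))" using PM_herm[OF A, of k i] turn_cj by metis
      then have "turn s i k (A$i$k) \<odot> turn s k i (A$k$i) = (re (A$i$i) * re (A$k$k)) *\<^sub>R one"
        by (simp add: mul_cj turn_isometry PM_entry[OF A])
      also have "\<dots> = re (A$k$k) *\<^sub>R A$i$i"
        by (subst (2) PM_diag[OF A]) simp
      finally show ?thesis using 3 by simp
    next
      case 4
      then show ?thesis by (simp add: turn_mul PM_rel[OF A] real)
    qed
  qed
  have "turn s j i (A$j$i) = cj (turn s i j (A$i$j))" for i j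
    unfolding PM_herm[OF A, of j i] by (rule turn_cj)
  then show ?thesis
    unfolding PM_def mem_Collect_eq flow_nth[OF A] turn_same using rel PM_tr[OF A] by blast
qed

lemma PM_light_model: "light_model planes pe pf pfreq PM 2 pcen"
proof
  show "(2::real) > 0" by simp
  show "flow s x \<in> PM" if "x \<in> PM" for s x using that by (rule flow_PM)
  show "\<exists>B U \<phi> W \<psi>. smooth_chart PM B U \<phi> W \<psi> \<and> x \<in> W" if x: "x \<in> PM" for x
    using PM_nonzero_diag[OF x] PM_chart by blast
  show "pfreq l \<in> \<rat>" "pfreq l \<noteq> 0" if "l \<in> planes" for l
    using that freq_rat freq_nz by (auto simp: planes_def pairs_def pfreq_def)
  show "inj_on (\<lambda>l. \<bar>pfreq l\<bar>) planes"
    by (rule inj_onI) (auto simp: planes_def pairs_def pfreq_def dest: freq_inj)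
  show "bounded PM"
  proof -
    have "norm A \<le> 1" if "A \<in> PM" for A using PM_norm[OF that] norm_eq_1[of A] by simp
    then show ?thesis by (auto simp: bounded_iff)
  qed
  show "y3 s = - (2 * (y1 s \<bullet> y1 s)) *\<^sub>R y1 s"
    if "\<And>s. s \<in> I01 \<Longrightarrow> y s \<in> PM"
    "\<And>s. s \<in> I01 \<Longrightarrow> (y has_vector_derivative y1 s) (at s within I01)"
    "\<And>s. s \<in> I01 \<Longrightarrow> (y1 has_vector_derivative y2 s) (at s within I01)"
    "\<And>s. s \<in> I01 \<Longrightarrow> (y2 has_vector_derivative y3 s) (at s within I01)"
    "\<And>s \<eta>. s \<in> I01 \<Longrightarrow> \<eta> \<in> tangent PM (y s) \<Longrightarrow> y2 s \<bullet> \<eta> = 0" "s \<in> I01"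
    for y y1 y2 y3 s
    by (rule PM_geodesic[OF that(1) _ that(5,6)]) (use that(2-4) in \<open>auto simp: jet3_def\<close>)
  show "\<exists>C. \<forall>\<tau>. y \<tau> = C + (\<Sum>l\<in>planes. emb l (y \<tau> \<bullet> pe l) (y \<tau> \<bullet> pf l))"
    if y: "\<And>\<tau>::real. y \<tau> \<in> PM" "continuous_on UNIV y"
      "\<And>l \<tau>. l \<in> planes \<Longrightarrow> (y \<tau> \<bullet> pe l)\<^sup>2 + (y \<tau> \<bullet> pf l)\<^sup>2 = r l" for y r
  proof -
    have c: "\<exists>K. \<forall>\<tau>. y \<tau>$i$j \<bullet> y \<tau>$i$j = K" if "i \<noteq> j" for i j
    proof -
      have up: "\<exists>K. \<forall>\<tau>. y \<tau>$i$j \<bullet> y \<tau>$i$j = K" if ij: "idx i < idx j" for i j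
      proof (intro exI allI)
        fix \<tau>
        have "(y \<tau>$i$j \<bullet> cb q)\<^sup>2 + (y \<tau>$i$j \<bullet> cf q)\<^sup>2 = r ((i, j), q) / 2" if "q \<in> R" for q
          using y(3)[of "((i, j), q)" \<tau>] ij that
          by (simp add: planes_def pairs_def PM_inner_plane[OF y(1)] power_mult_distrib)
        then show "y \<tau>$i$j \<bullet> y \<tau>$i$j = (\<Sum>q\<in>R. r ((i, j), q) / 2)"
          unfolding inner_expand[of "y \<tau>$i$j" "y \<tau>$i$j"] power2_eq_square by (intro sum.cong) auto
      qed
      have "idx i < idx j \<or> idx j < idx i" using that idx_inj by (metis injD linorder_neqE_nat)
      moreover have "y \<tau>$i$j \<bullet> y \<tau>$i$j = y \<tau>$j$i \<bullet> y \<tau>$j$i" for \<tau>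
        by (simp add: PM_entry[OF y(1)])
      ultimately show ?thesis using up[of i j] up[of j i] by auto
    qed
    have d: "re (y \<tau>$i$i) = re (y 0$i$i)" for i \<tau>
    proof -
      have "\<forall>j. \<exists>K. j \<noteq> i \<longrightarrow> (\<forall>\<tau>. re (y \<tau>$i$i) * re (y \<tau>$j$j) = K)"
        using c PM_entry[OF y(1)] by metis
      then obtain K where K: "\<And>j \<tau>. j \<noteq> i \<Longrightarrow> re (y \<tau>$i$i) * re (y \<tau>$j$j) = K j" by metis
      \<comment> \<open>Write a_i for the diagonal entries. As their sum is 1, a_i equals its square
        plus the products a_i a_j over the other j, which are squared norms of entries and hence
        constant. So a_i solves a fixed quadratic equation with centre 1/2.\<close>
      have "(re (y \<tau>$i$i) - 1 / 2)\<^sup>2 = 1 / 4 - (\<Sum>j\<in>UNIV - {i}. K j)" for \<tau>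
      proof -
        have "re (y \<tau>$i$i) = re (y \<tau>$i$i) * (\<Sum>j\<in>UNIV. re (y \<tau>$j$j))" using PM_tr[OF y(1)] by simp
        also have "(\<Sum>j\<in>UNIV. re (y \<tau>$j$j)) = re (y \<tau>$i$i) + (\<Sum>j\<in>UNIV - {i}. re (y \<tau>$j$j))"
          by (rule sum.remove) auto
        also have "re (y \<tau>$i$i) * \<dots> = re (y \<tau>$i$i) * re (y \<tau>$i$i) + (\<Sum>j\<in>UNIV - {i}. K j)"
          using K by (simp add: distrib_left sum_distrib_left)
        finally show ?thesis by (simp add: power2_eq_square algebra_simps)
      qed
      moreover have "continuous_on UNIV (\<lambda>\<tau>. re (y \<tau>$i$i) - 1 / 2)"
        by (intro continuous_on_diff continuous_on_const
            continuous_on_compose2[OF linear_continuous_on[OF bounded_linear_compose[OF bounded_linear_re bounded_linear_entry]] y(2)]) auto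
      ultimately have "re (y \<tau>$i$i) - 1 / 2 = re (y 0$i$i) - 1 / 2"
        using continuous_square_constant[of "\<lambda>\<tau>. re (y \<tau>$i$i) - 1 / 2"] by blast
      then show ?thesis by simp
    qed
    define C where "C = y 0 - (\<Sum>l\<in>planes. emb l (y 0 \<bullet> pe l) (y 0 \<bullet> pf l))"
    have "y \<tau> = C + (\<Sum>l\<in>planes. emb l (y \<tau> \<bullet> pe l) (y \<tau> \<bullet> pf l))" for \<tau>
    proof -
      have "y \<tau> $ a $ b = (C + (\<Sum>l\<in>planes. emb l (y \<tau> \<bullet> pe l) (y \<tau> \<bullet> pf l))) $ a $ b" for a b
      proof (cases "a = b")
        case True
        have "y \<tau> $ b $ b = y 0 $ b $ b" using PM_diag[OF y(1), of \<tau> b] PM_diag[OF y(1), of 0 b] d[of \<tau> b] by simp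
        then show ?thesis using True
          unfolding C_def vector_add_component vector_minus_component PM_sum_emb[OF y(1)] by simp
      next
        case False
        then show ?thesis
          unfolding C_def vector_add_component vector_minus_component PM_sum_emb[OF y(1)] by simp
      qed
      then show ?thesis by (simp add: vec_eq_iff)
    qed
    then show ?thesis by blast
  qed
  show "x = pcen l + emb l (x \<bullet> pe l) (x \<bullet> pf l)"
    if x: "x \<in> PM" "l \<in> planes" and z: "\<And>m. m \<in> planes \<Longrightarrow> m \<noteq> l \<Longrightarrow> x \<bullet> pe m = 0 \<and> x \<bullet> pf m = 0"
      and n: "2 * ((x \<bullet> pe l)\<^sup>2 + (x \<bullet> pf l)\<^sup>2) = 1" for x l
  proof -
    obtain i j r where l: "l = ((i, j), r)" "idx i < idx j" "r \<in> R" using x(2) by (auto simp: planes_def pairs_def)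
    have ij: "i \<noteq> j" using l by auto
    have "x$i$j \<bullet> x$i$j = (\<Sum>q\<in>R. if q = r then 1 / 4 else 0)"
    proof -
      have "(x$i$j \<bullet> cb q) * (x$i$j \<bullet> cb q) + (x$i$j \<bullet> cf q) * (x$i$j \<bullet> cf q) = (if q = r then 1 / 4 else 0)" if q: "q \<in> R" for q
      proof (cases "q = r")
        case True
        have "4 * ((x$i$j \<bullet> cb r)\<^sup>2 + (x$i$j \<bullet> cf r)\<^sup>2) = 1"
          using n by (simp add: l PM_inner_plane[OF x(1)] power_mult_distrib)
        then show ?thesis using True by (simp add: power2_eq_square)
      next
        case False
        then have "x \<bullet> pe ((i, j), q) = 0 \<and> x \<bullet> pf ((i, j), q) = 0"
          using z[of "((i, j), q)"] l q by (auto simp: planes_def pairs_def)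
        then show ?thesis using False by (simp add: PM_inner_plane[OF x(1)])
      qed
      then show ?thesis unfolding inner_expand[of "x$i$j" "x$i$j"] by (intro sum.cong) auto
    qed
    then have aij: "re (x$i$i) * re (x$j$j) = 1 / 4" using l(3) finR PM_entry[OF x(1), of i j] by simp
    \<comment> \<open>A further diagonal entry would, together with that at \<open>i\<close>,
      produce a nonzero entry in another plane.\<close>
    have xb: "re (x$b$b) = 0" if b: "b \<noteq> i" "b \<noteq> j" for b
    proof -
      have z0: "x$p$q = 0" if pq: "idx p < idx q" "(p, q) \<noteq> (i, j)" for p q
      proof -
        have "x$p$q \<bullet> cb t = 0 \<and> x$p$q \<bullet> cf t = 0" if "t \<in> R" for t
        proof -
          have "((p, q), t) \<in> planes" "((p, q), t) \<noteq> l" using that pq l by (auto simp: planes_def pairs_def)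
          from z[OF this] show ?thesis by (simp add: PM_inner_plane[OF x(1)])
        qed
        then show ?thesis using expand[of "x$p$q"] by simp
      qed
      have "idx b < idx i \<or> idx i < idx b" using b idx_inj by (metis injD linorder_neqE_nat)
      then have "x$b$i = 0 \<or> x$i$b = 0" using z0[of b i] z0[of i b] b ij by auto
      then have "re (x$b$b) * re (x$i$i) = 0" using PM_entry[OF x(1), of b i] PM_entry[OF x(1), of i b] by auto
      then show ?thesis using aij by auto
    qed
    have "re (x$i$i) + re (x$j$j) = 1"
      using PM_tr[OF x(1)] xb unfolding sum_UNIV_pair[OF ij] by simp
    \<comment> \<open>Sum 1 and product 1/4 force both diagonal entries to be 1/2.\<close>
    then have "(re (x$i$i) - re (x$j$j))\<^sup>2 = 0" using aij by algebra
    then have half: "re (x$i$i) = 1 / 2" "re (x$j$j) = 1 / 2" using \<open>re (x$i$i) + re (x$j$j) = 1\<close> by auto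
    have sl: "(\<Sum>m\<in>planes. emb m (x \<bullet> pe m) (x \<bullet> pf m)) = emb l (x \<bullet> pe l) (x \<bullet> pf l)"
    proof -
      have "(\<Sum>m\<in>planes. emb m (x \<bullet> pe m) (x \<bullet> pf m)) = (\<Sum>m\<in>planes. if m = l then emb l (x \<bullet> pe l) (x \<bullet> pf l) else 0)"
        using z by (intro sum.cong) (auto simp: emb_def)
      then show ?thesis using x(2) finL by simp
    qed
    have "x $ a $ b = (pcen l + emb l (x \<bullet> pe l) (x \<bullet> pf l)) $ a $ b" for a b
    proof (cases "a = b")
      case True
      have reb: "re (x$b$b) = (if b = i \<or> b = j then 1 / 2 else 0)" using half xb[of b] by auto
      have "x$b$b = (if b = i \<or> b = j then 1 / 2 else 0) *\<^sub>R one"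
        using PM_diag[OF x(1), of b] unfolding reb .
      then show ?thesis using True ij PM_sum_emb[OF x(1), of b b] unfolding sl
        by (auto simp: pcen_def l axis_def)
    next
      case False
      then have "pcen l $ a $ b = 0" by (auto simp: pcen_def l axis_def)
      then show ?thesis using False PM_sum_emb[OF x(1), of a b] unfolding sl by simp
    qed
    then show ?thesis by (simp add: vec_eq_iff)
  qed
  show circ: "pcen l + emb l p q \<in> PM" if x: "l \<in> planes" and n: "2 * (p\<^sup>2 + q\<^sup>2) = 1" for l p q
  proof -
    obtain i j r where l: "l = ((i, j), r)" "idx i < idx j" "r \<in> R" using x by (auto simp: planes_def pairs_def)
    have ij: "i \<noteq> j" using l by auto
    define w where "w = sqrt 2 *\<^sub>R (p *\<^sub>R cb r + q *\<^sub>R cf r)"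
    have "cf r \<bullet> cb r = 0" using bb(3)[OF l(3,3)] by (simp add: inner_commute)
    then have "(p *\<^sub>R cb r + q *\<^sub>R cf r) \<bullet> (p *\<^sub>R cb r + q *\<^sub>R cf r) = p\<^sup>2 + q\<^sup>2"
      by (simp add: inner_add_left inner_add_right bb l(3) power2_eq_square)
    then have "w \<bullet> w = (sqrt 2)\<^sup>2 * (p\<^sup>2 + q\<^sup>2)"
      unfolding w_def inner_scaleR_left inner_scaleR_right power2_eq_square[of "sqrt 2"] by (simp only: mult.assoc)
    then have ww: "w \<bullet> w = 1" using n by simp
    \<comment> \<open>This vector has squared norm 2, and half of \<open>outer v v\<close> has
      diagonal entries 1/2 and the entry \<open>w / 2\<close> at \<open>(i, j)\<close>, as a point
      of the circle should.\<close>
    define v where "v = (\<chi> a. if a = i then one else if a = j then cj w else 0)"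
    have v2: "v \<bullet> v = 2" unfolding inner_vec_def sum_UNIV_pair[OF ij] using ij ww by (simp add: v_def)
    have "good v" unfolding good_def by (intro exI[of _ i] exI[of _ j]) (simp add: v_def nuc_real)
    from outer_PM[OF this] have "(1 / 2) *\<^sub>R outer v v \<in> PM" by (simp add: v2)
    moreover have "pcen l + emb l p q = (1 / 2) *\<^sub>R outer v v"
    proof -
      have em: "emb l p q = slots i j (isqrt2 *\<^sub>R w)" by (simp add: l emb_slots w_def)
      have e: "(emb l p q) $ a $ b = (1 / 2) *\<^sub>R ((if a = i \<and> b = j then w else 0) + (if a = j \<and> b = i then cj w else 0))" for a b
        unfolding em slots_linear(2) vector_scaleR_component slots_nth scaleR_scaleR isqrt2(5) ..
      have jj: "cj w \<odot> w = one" using mul_cj(2)[of w] ww by simp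
      have "(pcen l + emb l p q) $ a $ b = ((1 / 2) *\<^sub>R outer v v) $ a $ b" for a b
        unfolding vector_add_component e using ij
        by (auto simp: pcen_def l axis_def v_def jj cj_linear mul_simps)
      then show ?thesis by (simp add: vec_eq_iff)
    qed
    ultimately show ?thesis by simp
  qed
  show "pcen l \<bullet> pe m = 0 \<and> pcen l \<bullet> pf m = 0" if "l \<in> planes" "m \<in> planes" for l m
    using that by (auto simp: planes_def pairs_def pcen_def pe_def pf_def slots_def inner_add_left inner_add_right axis_axis_inner)
  show "emb l p q \<bullet> v = 0"
    if x: "l \<in> planes" and n: "2 * (p\<^sup>2 + q\<^sup>2) = 1" and v: "v \<in> tangent PM (pcen l + emb l p q)" for l p q v
  proof -
    obtain i j r where l: "l = ((i, j), r)" "idx i < idx j" "r \<in> R" using x by (auto simp: planes_def pairs_def)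
    have ij: "i \<noteq> j" using l by auto
    have "(pcen l + emb l p q) \<bullet> v = 0" by (rule PM_tangent_inner[OF v])
    \<comment> \<open>The inner product with \<open>pcen l\<close> is half the sum of the diagonal
      entries at \<open>i\<close> and \<open>j\<close>. A tangent vector has trace zero, and its
      other diagonal entries vanish at this point.\<close>
    moreover have "pcen l \<bullet> v = 0"
    proof -
      have "re (v$b$b) = 0" if b: "b \<noteq> i" "b \<noteq> j" for b
      proof (rule PM_tangent_diag[OF v])
        have "(pcen l + emb l p q) $ b $ b = 0" using b by (simp add: l pcen_def emb_slots slots_nth axis_def)
        then show "re ((pcen l + emb l p q) $ b $ b) = 0" by (simp add: re_linear)
      qed
      then have "re (v$i$i) + re (v$j$j) = 0"
        using PM_tangent_trace[OF v] unfolding sum_UNIV_pair[OF ij] by simp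
      then show ?thesis by (simp add: l pcen_def inner_add_left inner_add_right inner_commute[of _ v] inner_axis re_def)
    qed
    ultimately show ?thesis by (simp add: inner_add_left)
  qed
qed

lemma PM_light_rays:
  "\<exists>V. killing_field PM projective_metric V \<and> (\<exists>\<epsilon>>0. \<forall>\<alpha>::real. \<alpha> \<notin> \<rat> \<and> \<bar>\<alpha>\<bar> < \<epsilon> \<longrightarrow>
     (let \<delta> = (\<lambda>x. - (\<alpha> *\<^sub>R V x)); \<beta> = (\<lambda>x. 1 - \<alpha>\<^sup>2 * projective_metric x (V x) (V x)) in
       (\<forall>x\<in>PM. \<beta> x > 0) \<and>
       card (periodic_light_rays PM (stationary_metric projective_metric \<delta> \<beta>))
         = card R * (CARD('m) * CARD('m) - CARD('m))))"
proof -
  have m: "projective_metric = (\<lambda>(x :: 'a^'m^'m) v w. 2 * (v \<bullet> w))" by (simp add: projective_metric_def fun_eq_iff)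
  have "2 * card planes = card R * (CARD('m) * CARD('m) - CARD('m))"
    unfolding card_pairs[symmetric] by (simp add: planes_def card_cartesian_product)
  then show ?thesis
    using light_model.light_rays_count[OF PM_light_model] unfolding m Let_def by simp
qed

end

section \<open>The classical projective spaces\<close>

lemma sum_UNIV_3:
  fixes g :: "'m::finite \<Rightarrow> 'z::comm_monoid_add"
  assumes card: "CARD('m) = 3" and ne: "i \<noteq> j" "i \<noteq> k" "j \<noteq> k"
  shows "(\<Sum>x\<in>UNIV. g x) = g i + g j + g k"
proof -
  have "card {i, j, k} = CARD('m)" using ne card by simp
  then have U: "UNIV = {i, j, k}" by (intro card_subset_eq[symmetric]) auto
  show ?thesis unfolding U using ne by (simp add: add.assoc)
qed

context projective_space
begin

text \<open>A column with nonzero diagonal entry, divided by the root of that entry, is a unit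
  vector representing the matrix.\<close>

lemma PM_eq_outer:
  assumes assoc: "\<And>x y z. (x \<odot> y) \<odot> z = x \<odot> (y \<odot> z)"
  shows "{(\<chi> i j. v$i \<odot> cj (v$j)) | v :: 'a^'m. norm v = 1} = PM"
proof (intro set_eqI iffI)
  fix A assume "A \<in> {(\<chi> i j. v$i \<odot> cj (v$j)) | v :: 'a^'m. norm v = 1}"
  then obtain v where v: "A = outer v v" "v \<bullet> v = 1" by (auto simp: outer_def dot_square_norm)
  have "good v" by (simp add: good_def nuc_def assoc)
  from outer_PM[OF this] show "A \<in> PM" using v by simp
next
  fix A assume A: "A \<in> PM"
  obtain l where l: "re (A$l$l) \<noteq> 0" using PM_nonzero_diag[OF A] by blast
  define a where "a = re (A$l$l)"
  have a: "a > 0" using l PM_diag_nonneg[OF A, of l] by (simp add: a_def)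
  define v where "v = (1 / sqrt a) *\<^sub>R col l A"
  have s: "1 / sqrt a * (1 / sqrt a) = 1 / a" using a by simp
  have "v \<bullet> v = (1 / sqrt a * (1 / sqrt a)) * (col l A \<bullet> col l A)"
    unfolding v_def inner_scaleR_left inner_scaleR_right by (simp only: mult.assoc)
  then have "v \<bullet> v = 1" unfolding s PM_col(2)[OF A l] using a by (simp add: a_def)
  moreover have "outer v v = (1 / sqrt a * (1 / sqrt a)) *\<^sub>R outer (col l A) (col l A)"
    unfolding v_def outer_bb scaleR_scaleR ..
  then have "A = outer v v" unfolding s using PM_col(1)[OF A l] by (simp add: a_def)
  ultimately show "A \<in> {(\<chi> i j. v$i \<odot> cj (v$j)) | v :: 'a^'m. norm v = 1}"
    by (auto simp: outer_def norm_eq_1)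
qed

text \<open>In size 3 the diagonal equations are three linear equations for the three squared norms
  of off-diagonal entries, which they determine from the diagonal. Each off-diagonal equation
  contains a single product of off-diagonal entries and can be solved for it. Together these are the
  rank-one relations.\<close>

lemma PM_eq_idempotents:
  assumes card: "CARD('m) = 3"
  shows "{A :: 'a^'m^'m. (\<forall>i j. A $ j $ i = cj (A $ i $ j)) \<and> (\<forall>i j. (\<Sum>k\<in>UNIV. A $ i $ k \<odot> A $ k $ j) = A $ i $ j) \<and>
     (\<Sum>i\<in>UNIV. A $ i $ i) = one} = PM"
proof (intro set_eqI iffI)
  fix A :: "'a^'m^'m" assume A: "A \<in> PM"
  have "(\<Sum>k\<in>UNIV. A $ i $ k \<odot> A $ k $ j) = A $ i $ j" for i j
    by (simp add: PM_rel[OF A] PM_tr[OF A] flip: scaleR_sum_left)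
  moreover have "(\<Sum>i\<in>UNIV. A $ i $ i) = (\<Sum>i\<in>UNIV. re (A $ i $ i) *\<^sub>R one)"
    by (rule sum.cong[OF refl PM_diag[OF A]])
  then have "(\<Sum>i\<in>UNIV. A $ i $ i) = one" by (simp add: PM_tr[OF A] flip: scaleR_sum_left)
  ultimately show "A \<in> {A :: 'a^'m^'m. (\<forall>i j. A $ j $ i = cj (A $ i $ j)) \<and> (\<forall>i j. (\<Sum>k\<in>UNIV. A $ i $ k \<odot> A $ k $ j) = A $ i $ j) \<and>
     (\<Sum>i\<in>UNIV. A $ i $ i) = one}" using PM_herm[OF A] by blast
next
  fix A :: "'a^'m^'m" assume "A \<in> {A :: 'a^'m^'m. (\<forall>i j. A $ j $ i = cj (A $ i $ j)) \<and> (\<forall>i j. (\<Sum>k\<in>UNIV. A $ i $ k \<odot> A $ k $ j) = A $ i $ j) \<and>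
     (\<Sum>i\<in>UNIV. A $ i $ i) = one}"
  then have h: "\<And>i j. A $ j $ i = cj (A $ i $ j)" and idem: "\<And>i j. (\<Sum>k\<in>UNIV. A $ i $ k \<odot> A $ k $ j) = A $ i $ j"
    and tr: "(\<Sum>i\<in>UNIV. A $ i $ i) = one" by blast+
  define a where "a = (\<lambda>i. re (A $ i $ i))"
  have d: "A $ i $ i = a i *\<^sub>R one" for i
    unfolding a_def by (rule self_conjugate) (rule h[symmetric])
  have tr1: "(\<Sum>i\<in>UNIV. a i) = 1"
  proof -
    have "re (\<Sum>i\<in>UNIV. A $ i $ i) = (\<Sum>i\<in>UNIV. a i)"
      unfolding a_def by (rule linear_sum[OF bounded_linear.linear[OF bounded_linear_re]])
    then show ?thesis using tr by simp
  qed
  define n where "n = (\<lambda>i j. A $ i $ j \<bullet> A $ i $ j)"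
  have nsym: "n i j = n j i" for i j unfolding n_def using h[of i j] by simp
  have ndiag: "n i i = a i * a i" for i unfolding n_def d by simp
  have AA: "A $ i $ k \<odot> A $ k $ i = n i k *\<^sub>R one" for i k
    using mul_cj(1)[of "A $ i $ k"] h[of k i] by (simp add: n_def)
  have sn: "(\<Sum>k\<in>UNIV. n i k) = a i" for i
  proof -
    have "(\<Sum>k\<in>UNIV. n i k) *\<^sub>R one = a i *\<^sub>R one"
      using idem[of i i] unfolding AA d[of i] by (simp add: scaleR_sum_left)
    then have "re ((\<Sum>k\<in>UNIV. n i k) *\<^sub>R one) = re (a i *\<^sub>R one)" by (rule arg_cong)
    then show ?thesis by (simp add: re_linear)
  qed
  note sum3 = sum_UNIV_3[OF card]
  have off: "n i j = a i * a j \<and> (\<forall>k. k \<noteq> i \<longrightarrow> k \<noteq> j \<longrightarrow> A $ i $ k \<odot> A $ k $ j = a k *\<^sub>R A $ i $ j)" if ij: "i \<noteq> j" for i j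
  proof -
    obtain k where k: "k \<noteq> i" "k \<noteq> j" by (rule card_3_split[OF card ij])
    have t: "a i + a j + a k = 1" using tr1 sum3[of i j k a] ij k by simp
    have e1: "n i i + n i j + n i k = a i" using sn[of i] sum3[of i j k "n i"] ij k by simp
    have e2: "n j i + n j j + n j k = a j" using sn[of j] sum3[of i j k "n j"] ij k by simp
    have e3: "n k i + n k j + n k k = a k" using sn[of k] sum3[of i j k "n k"] ij k by simp
    \<comment> \<open>Sum of the equations for \<open>i\<close> and \<open>j\<close> minus the one
      for \<open>k\<close>.\<close>
    have "2 * n i j = a i * (1 - a i) + a j * (1 - a j) - a k * (1 - a k)"
      using e1 e2 e3 nsym[of i j] nsym[of i k] nsym[of j k] unfolding ndiag by (simp add: algebra_simps)
    also have "\<dots> = 2 * (a i * a j)"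
    proof -
      have ak: "a k = 1 - a i - a j" using t by simp
      show ?thesis unfolding ak by (simp add: algebra_simps)
    qed
    finally have nij: "n i j = a i * a j" by simp
    have "A $ i $ k' \<odot> A $ k' $ j = a k' *\<^sub>R A $ i $ j" if k': "k' \<noteq> i" "k' \<noteq> j" for k'
    proof -
      have t: "a i + a j + a k' = 1" using tr1 sum3[of i j k' a] ij k' by simp
      have "A $ i $ i \<odot> A $ i $ j + A $ i $ j \<odot> A $ j $ j + A $ i $ k' \<odot> A $ k' $ j = A $ i $ j"
        using idem[of i j] sum3[of i j k' "\<lambda>k. A $ i $ k \<odot> A $ k $ j"] ij k' by simp
      then have "A $ i $ k' \<odot> A $ k' $ j = (1 - a i - a j) *\<^sub>R A $ i $ j"
        unfolding d[of i] d[of j] by (simp add: mul_simps algebra_simps)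
      moreover have "1 - a i - a j = a k'" using t by simp
      ultimately show ?thesis by simp
    qed
    then show ?thesis using nij by blast
  qed
  have rel: "A $ i $ k \<odot> A $ k $ j = re (A $ k $ k) *\<^sub>R A $ i $ j" for i j k
  proof -
    consider "k = i" | "k = j" | "i = j" "k \<noteq> i" | "i \<noteq> j" "k \<noteq> i" "k \<noteq> j" by blast
    then have "A $ i $ k \<odot> A $ k $ j = a k *\<^sub>R A $ i $ j"
    proof cases
      case 1 then show ?thesis unfolding 1 d[of i] by (simp add: mul_simps)
    next
      case 2 then show ?thesis unfolding 2 d[of j] by (simp add: mul_simps)
    next
      case 3
      then show ?thesis using AA[of i k] off[of i k] d[of i] by (simp add: mult.commute)
    next
      case 4 then show ?thesis using off by blast
    qed
    then show ?thesis by (simp add: a_def)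
  qed
  show "A \<in> PM" unfolding PM_def mem_Collect_eq using h rel tr1 unfolding a_def by blast
qed

end

section \<open>Compatibility of the rotations with the multiplication, and choice of weights\<close>

context projective_data
begin

definition compatible :: "real \<Rightarrow> 'm \<Rightarrow> 'm \<Rightarrow> 'm \<Rightarrow> bool" where
  "compatible s i k j \<longleftrightarrow> (\<forall>x y. turn s i k x \<odot> turn s k j y = turn s i j (x \<odot> y))"

text \<open>Conjugation reverses both products and positions.\<close>

lemma compatible_reverse:
  assumes "compatible s i k j" shows "compatible s j k i"
  unfolding compatible_def
proof (intro allI)
  fix x y
  have "turn s j k x \<odot> turn s k i y = cj (turn s k j (cj x)) \<odot> cj (turn s i k (cj y))"
    by (simp add: turn_cj[symmetric])
  also have "\<dots> = cj (turn s i k (cj y) \<odot> turn s k j (cj x))" by (simp add: cj_mul)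
  also have "\<dots> = cj (turn s i j (cj (x \<odot> y)))" using assms by (simp add: compatible_def cj_mul)
  also have "\<dots> = turn s j i (x \<odot> y)" by (simp add: turn_cj[symmetric])
  finally show "turn s j k x \<odot> turn s k i y = turn s j i (x \<odot> y)" .
qed

text \<open>Multiplying by the conjugate of the first factor solves for the second. Together with
  \<open>compatible_reverse\<close> this yields all six orders of three indices from one.\<close>

lemma compatible_swap:
  assumes "compatible s i k j" shows "compatible s k i j"
  unfolding compatible_def
proof (intro allI)
  fix x w
  show "turn s k i x \<odot> turn s i j w = turn s k j (x \<odot> w)"
  proof (cases "x = 0")
    case True
    then show ?thesis using linear_0[OF linear_turn] by (simp add: mul_simps)
  next
    case False
    define y where "y = (1 / (x \<bullet> x)) *\<^sub>R (x \<odot> w)"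
    define u where "u = turn s i k (cj x)"
    have "cj x \<odot> y = w" using False by (simp add: y_def mul_simps cancel_left)
    then have 1: "turn s i j w = u \<odot> turn s k j y" using assms by (simp add: compatible_def u_def)
    have uu: "u \<bullet> u = x \<bullet> x" by (simp add: u_def turn_isometry)
    have "turn s k i x = cj u" using turn_cj[of s k i "cj x"] by (simp add: u_def)
    then have "turn s k i x \<odot> turn s i j w = (x \<bullet> x) *\<^sub>R turn s k j y"
      unfolding 1 by (simp add: cancel_left uu)
    also have "\<dots> = turn s k j (x \<odot> w)"
      using False linear_scale[OF linear_turn, of s k j "x \<bullet> x" y] by (simp add: y_def)
    finally show ?thesis .
  qed
qed

end

text \<open>Uniqueness of balanced ternary expansions: after division by the smaller power the sign
  is what remains modulo 3. Powers of 3 as weights thus keep all their sums and differences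
  apart.\<close>

lemma power3_sum_unique:
  fixes a b c d :: nat and \<sigma> \<sigma>' :: int
  assumes ab: "a < b" "c < d" and s: "\<sigma> \<in> {1, -1}" "\<sigma>' \<in> {1, -1}" and eq: "3 ^ b + \<sigma> * 3 ^ a = 3 ^ d + \<sigma>' * (3::int) ^ c"
  shows "a = c \<and> b = d \<and> \<sigma> = \<sigma>'"
proof -
  have no: False if "a < b" "c < d" "a < c" "\<sigma> \<in> {1, -1}" "3 ^ b + \<sigma> * 3 ^ a = 3 ^ d + \<sigma>' * (3::int) ^ c"
    for a b c d :: nat and \<sigma> \<sigma>' :: int
  proof -
    have p: "(3::int) ^ k = 3 ^ a * 3 * 3 ^ (k - Suc a)" if "a < k" for k
      using that by (simp flip: power_Suc power_add add: mult.assoc)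
    have "3 ^ a * (3 * 3 ^ (b - Suc a) + \<sigma>) = 3 ^ a * (3 * (3 ^ (d - Suc a) + \<sigma>' * (3::int) ^ (c - Suc a)))"
      using that(5) p[of b] p[of c] p[of d] that by (simp add: algebra_simps)
    then have "3 * 3 ^ (b - Suc a) + \<sigma> = 3 * (3 ^ (d - Suc a) + \<sigma>' * (3::int) ^ (c - Suc a))" by simp
    then have "3 dvd \<sigma>" by (metis dvd_add_right_iff dvd_triv_left)
    then show False using that(4) by auto
  qed
  have ac: "a = c" using no[OF ab] no[OF ab(2,1)] s eq by (metis linorder_neqE_nat)
  have p: "(3::int) ^ k = 3 ^ a * (3 * 3 ^ (k - Suc a))" if "a < k" for k
    using that by (simp flip: power_Suc power_add)
  have "3 ^ a * (3 * 3 ^ (b - Suc a) + \<sigma>) = 3 ^ a * (3 * (3::int) ^ (d - Suc a) + \<sigma>')"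
    using eq p[of b] p[of d] ab unfolding ac by (simp add: algebra_simps)
  then have e: "3 * 3 ^ (b - Suc a) + \<sigma> = 3 * (3::int) ^ (d - Suc a) + \<sigma>'" by simp
  have "\<sigma> = \<sigma>'" using s e by auto presburger+
  then have "(3::int) ^ b = 3 ^ d" using eq ac by simp
  then show ?thesis using ac \<open>\<sigma> = \<sigma>'\<close> by simp
qed

lemma power3_freq_inj:
  fixes a b c d :: nat and \<sigma> \<sigma>' :: int
  assumes "a < b" "c < d" "\<sigma> \<in> {1, -1}" "\<sigma>' \<in> {1, -1}"
    "\<bar>real_of_int \<sigma> * 3 ^ a + 3 ^ b\<bar> = \<bar>real_of_int \<sigma>' * 3 ^ c + 3 ^ d\<bar>"
  shows "a = c \<and> b = d \<and> \<sigma> = \<sigma>'"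
proof -
  have pos: "real_of_int \<sigma> * 3 ^ a + 3 ^ b > 0" if "a < b" "\<sigma> \<in> {1, -1}" for a b and \<sigma> :: int
    using that power_strict_increasing[of a b "3::real"] by (auto intro: add_pos_pos)
  have "real_of_int (3 ^ b + \<sigma> * 3 ^ a) = real_of_int (3 ^ d + \<sigma>' * 3 ^ c)"
    using assms(5) pos[OF assms(1,3)] pos[OF assms(2,4)] by (simp add: add.commute)
  then have "3 ^ b + \<sigma> * 3 ^ a = 3 ^ d + \<sigma>' * (3::int) ^ c" by (simp only: of_int_eq_iff)
  from power3_sum_unique[OF assms(1-4) this] show ?thesis .
qed

lemma power3_neq: "a < b \<Longrightarrow> (3::real) ^ a < 3 ^ b"
  by (simp add: power_strict_increasing)

text \<open>The torus is conjugation by diagonal unitary matrices with the entries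
  \<open>cis (3 ^ idx i * s)\<close>, which turns the entry \<open>(i, j)\<close> at the difference
  of the two speeds.\<close>

lemma complex_projective_light:
  fixes idx :: "'m::finite \<Rightarrow> nat"
  assumes inj: "inj idx"
  shows "projective_light (*) (1::complex) idx {0::nat} (\<lambda>_. 1) (\<lambda>_. \<i>) (\<lambda>i j _. 3 ^ idx i - 3 ^ idx j)"
proof -
  interpret projective_data "(*)" "1::complex" idx "{0::nat}" "\<lambda>_. 1" "\<lambda>_. \<i>" "\<lambda>i j _. 3 ^ idx i - 3 ^ idx j"
  proof
    show "(\<forall>x y z. x * y * z = x * (y * z :: complex)) \<or> CARD('m) = 3" by (simp add: mult.assoc)
    show "i = i' \<and> j = j' \<and> r = r'" if h: "idx i < idx j" "idx i' < idx j'" "r \<in> {0}" "r' \<in> {0}"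
      "\<bar>3 ^ idx i - 3 ^ idx j\<bar> = \<bar>3 ^ idx i' - 3 ^ idx j' :: real\<bar>" for i j i' j' r and r' :: nat
    proof -
      have "\<bar>real_of_int (-1) * 3 ^ idx i + 3 ^ idx j\<bar> = \<bar>real_of_int (-1) * 3 ^ idx i' + 3 ^ idx j'\<bar>"
        using h(5) by (simp add: abs_minus_commute)
      from power3_freq_inj[OF h(1,2) _ _ this] show ?thesis using h inj by (auto dest: injD)
    qed
    show "3 ^ idx i - 3 ^ idx j \<noteq> (0::real)" if "idx i < idx j" for i j using power3_neq[OF that] by simp
    show "x = (\<Sum>r\<in>{0::nat}. (x \<bullet> 1) *\<^sub>R 1 + (x \<bullet> \<i>) *\<^sub>R \<i>)" for x :: complex
      by (simp add: complex_eq_iff inner_complex_def)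
  qed (use inj in \<open>auto simp: inner_complex_def\<close>)
  have rot: "rot w s x = cis (w 0 * s) * x" for w s x
    by (simp add: rot_def complex_eq_iff inner_complex_def algebra_simps)
  have turn: "turn s i j x = cis ((3 ^ idx i - 3 ^ idx j) * s) * x" if "i \<noteq> j" for s i j x
  proof -
    have "idx i \<noteq> idx j" using that inj by (auto dest: injD)
    then show ?thesis
      by (auto simp: turn_def rot complex_cj cis_cnj algebra_simps)
  qed
  show ?thesis
  proof
    show "turn s i k x * turn s k j y = turn s i j (x * y)" if "i \<noteq> j" "j \<noteq> k" "i \<noteq> k" for s i j k x y
    proof -
      have "cis ((3 ^ idx i - 3 ^ idx k) * s) * cis ((3 ^ idx k - 3 ^ idx j) * s) = cis ((3 ^ idx i - 3 ^ idx j) * s)"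
        unfolding cis_mult by (simp add: algebra_simps)
      then show ?thesis using that by (simp add: turn)
    qed
  qed
qed

definition quat_unit :: "complex \<Rightarrow> nat \<Rightarrow> quat" where
  "quat_unit z r = (if r = 0 then (z, 0) else (0, z))"

lemma lessThan_2: "{..<2::nat} = {0, 1}" by auto

text \<open>Conjugation by the same diagonal matrices, with complex numbers inside the quaternions.
  A complex factor on the right acts on the second component through its conjugate, whence sums of
  the weights besides differences.\<close>

lemma quat_projective_light:
  fixes idx :: "'m::finite \<Rightarrow> nat"
  assumes inj: "inj idx"
  shows "projective_light quat_mult (1, 0) idx {..<2} (quat_unit 1) (quat_unit \<i>)
    (\<lambda>i j r. if r = 0 then 3 ^ idx i - 3 ^ idx j else 3 ^ idx i + 3 ^ idx j)"
proof -
  define freq :: "'m \<Rightarrow> 'm \<Rightarrow> nat \<Rightarrow> real" where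
    "freq = (\<lambda>i j r. if r = 0 then 3 ^ idx i - 3 ^ idx j else 3 ^ idx i + 3 ^ idx j)"
  interpret projective_data quat_mult "(1, 0)" idx "{..<2}" "quat_unit 1" "quat_unit \<i>" freq
  proof
    show "(\<forall>x y z. quat_mult (quat_mult x y) z = quat_mult x (quat_mult y z)) \<or> CARD('m) = 3"
      by (simp add: quat_mult_assoc)
    show "i = i' \<and> j = j' \<and> r = r'" if h: "idx i < idx j" "idx i' < idx j'" "r \<in> {..<2}" "r' \<in> {..<2}"
      "\<bar>freq i j r\<bar> = \<bar>freq i' j' r'\<bar>" for i j i' j' r r'
    proof -
      define \<sigma> where "\<sigma> = (\<lambda>r::nat. if r = 0 then - 1 else 1 :: int)"
      have f: "\<bar>freq i j r\<bar> = \<bar>real_of_int (\<sigma> r) * 3 ^ idx i + 3 ^ idx j\<bar>" for i j r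
        by (auto simp: freq_def \<sigma>_def abs_minus_commute)
      have "idx i = idx i' \<and> idx j = idx j' \<and> \<sigma> r = \<sigma> r'"
        by (rule power3_freq_inj[OF h(1,2)]) (use h(5) in \<open>auto simp: f \<sigma>_def\<close>)
      then show ?thesis using h(3,4) inj by (auto simp: \<sigma>_def dest: injD split: if_splits)
    qed
    show "freq i j r \<noteq> 0" if "idx i < idx j" for i j r
      using power3_neq[OF that] zero_less_power[of "3::real" "idx i"] zero_less_power[of "3::real" "idx j"]
      by (auto simp: freq_def simp del: zero_less_power)
    show "x = (\<Sum>r<2. (x \<bullet> quat_unit 1 r) *\<^sub>R quat_unit 1 r + (x \<bullet> quat_unit \<i> r) *\<^sub>R quat_unit \<i> r)" for x
      by (cases x) (simp add: lessThan_2 quat_unit_def complex_eq_iff inner_complex_def)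
  qed (use inj in \<open>auto simp: inner_complex_def quat_unit_def freq_def\<close>)
  have rot: "rot w s (x, y) = (cis (w 0 * s) * x, cis (w 1 * s) * y)" for w s x y
    unfolding rot_def by (simp add: lessThan_2 quat_unit_def complex_eq_iff inner_complex_def algebra_simps)
  have turn: "turn s i j (x, y) = (cis ((3 ^ idx i - 3 ^ idx j) * s) * x, cis ((3 ^ idx i + 3 ^ idx j) * s) * y)"
    if "i \<noteq> j" for s i j x y
  proof -
    have "idx i \<noteq> idx j" using that inj by (auto dest: injD)
    then show ?thesis
      unfolding turn_def by (auto simp: rot quat_cj quat_cnj_def cd_cnj_def freq_def cis_cnj algebra_simps)
  qed
  have "projective_light quat_mult (1, 0) idx {..<2} (quat_unit 1) (quat_unit \<i>) freq"
  proof
    show "quat_mult (turn s i k x) (turn s k j y) = turn s i j (quat_mult x y)" if ne: "i \<noteq> j" "j \<noteq> k" "i \<noteq> k" for s i j k x y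
    proof -
      define t where "t = (\<lambda>a::real. cis (a * s))"
      have t0: "cis (a * s) = t a" for a by (simp add: t_def)
      have t1: "(t a * p) * (t b * q) = t (a + b) * (p * q)" for a b p q
        unfolding t_def distrib_right cis_mult[symmetric] by (simp only: mult_ac)
      have t2: "cnj (t a * p) = t (- a) * cnj p" for a p by (simp add: t_def cis_cnj)
      obtain x1 x2 y1 y2 where xy: "x = (x1, x2)" "y = (y1, y2)" by fastforce
      show ?thesis
        using ne unfolding xy quat_mult_def cd_mult_def split_conv
        by (simp add: turn t0 t1 t2 right_diff_distrib distrib_left del: complex_cnj_mult)
          (simp add: algebra_simps)
    qed
  qed
  then show ?thesis by (simp add: freq_def)
qed

definition oct_unit :: "complex \<Rightarrow> nat \<Rightarrow> oct" where
  "oct_unit z r = (if r = 0 then ((z, 0), 0) else if r = 1 then ((0, z), 0)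
     else if r = 2 then (0, (z, 0)) else (0, (0, z)))"

text \<open>The weights of a torus element in the three eight-dimensional representations that are related
  by triality; the general solution of the linear system expressing compatibility with the octonion
  product has rows \<open>(a, a+b+c, a+b+d, a+c+d)\<close>, \<open>(b, c, d, 2a+b+c+d)\<close>, \<open>(a+b, a+c, a+d, a+b+c+d)\<close>.\<close>
definition oct_freq :: "nat \<Rightarrow> nat \<Rightarrow> nat \<Rightarrow> real" where
  "oct_freq i j r = (if j = 1 then [1, 13, 31, 37] ! r
     else if i = 1 then [3, 9, 27, 41] ! r else [4, 10, 28, 40] ! r)"

lemma lessThan_4: "{..<4::nat} = {0, 1, 2, 3}" by auto

lemma less_3_cases: "i < j \<Longrightarrow> j < 3 \<Longrightarrow> (i, j) = (0, 1) \<or> (i, j) = (0, 2) \<or> (i, j) = (1, 2::nat)"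
  by auto

text \<open>The table \<open>oct_freq\<close> is the solution for \<open>a = 1\<close>,
  \<open>b = 3\<close>, \<open>c = 9\<close>, \<open>d = 27\<close>; its twelve values are positive
  and distinct. The product is checked for one order of the indices, and the other five follow by
  \<open>compatible_swap\<close> and \<open>compatible_reverse\<close>.\<close>

lemma oct_projective_light:
  fixes idx :: "3 \<Rightarrow> nat"
  assumes inj: "inj idx" and range: "\<And>i. idx i < 3"
  shows "projective_light oct_mult oct_one idx {..<4} (oct_unit 1) (oct_unit \<i>)
    (\<lambda>i j. oct_freq (idx i) (idx j))"
proof -
  have r4: "r = 0 \<or> r = 1 \<or> r = 2 \<or> r = 3" if "r \<in> {..<4}" for r :: nat using that by auto
  interpret projective_data oct_mult oct_one idx "{..<4}" "oct_unit 1" "oct_unit \<i>" "\<lambda>i j. oct_freq (idx i) (idx j)"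
  proof
    show "(\<forall>x y z. oct_mult (oct_mult x y) z = oct_mult x (oct_mult y z)) \<or> CARD(3) = 3" by simp
    show "i = i' \<and> j = j' \<and> r = r'" if h: "idx i < idx j" "idx i' < idx j'" "r \<in> {..<4}" "r' \<in> {..<4}"
      "\<bar>oct_freq (idx i) (idx j) r\<bar> = \<bar>oct_freq (idx i') (idx j') r'\<bar>" for i j i' j' r r'
    proof -
      have "idx i = idx i' \<and> idx j = idx j' \<and> r = r'"
        using less_3_cases[OF h(1) range] less_3_cases[OF h(2) range] r4[OF h(3)] r4[OF h(4)] h(5)
        by (elim disjE) (simp_all add: oct_freq_def)
      then show ?thesis using inj by (auto dest: injD)
    qed
    show "oct_freq (idx i) (idx j) r \<in> \<rat>" "oct_freq (idx i) (idx j) r \<noteq> 0" if "idx i < idx j" "r \<in> {..<4}" for i j r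
      using r4[OF that(2)] by (auto simp: oct_freq_def)
    show "x = (\<Sum>r<4. (x \<bullet> oct_unit 1 r) *\<^sub>R oct_unit 1 r + (x \<bullet> oct_unit \<i> r) *\<^sub>R oct_unit \<i> r)" for x
    proof -
      obtain a b c d where "x = ((a, b), (c, d))" by (metis prod.exhaust)
      then show ?thesis
        by (simp add: lessThan_4 oct_unit_def complex_eq_iff inner_complex_def zero_prod_def)
    qed
  qed (use inj in \<open>auto simp: inner_complex_def oct_unit_def zero_prod_def dest!: r4\<close>)
  have rot: "rot w s ((a, b), (c, d)) = ((cis (w 0 * s) * a, cis (w 1 * s) * b), (cis (w 2 * s) * c, cis (w 3 * s) * d))"
    for w s a b c d
    unfolding rot_def by (simp add: lessThan_4 oct_unit_def complex_eq_iff inner_complex_def zero_prod_def algebra_simps)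
  have "bij_betw idx UNIV {..<3}"
    unfolding bij_betw_def
  proof
    show "inj idx" by (rule inj)
    have "idx ` UNIV \<subseteq> {..<3}" using range by auto
    moreover have "card (idx ` UNIV) = 3" using card_image[OF inj] by simp
    ultimately show "range idx = {..<3}" by (intro card_subset_eq) auto
  qed
  then have onto: "\<exists>i. idx i = k" if "k < 3" for k using that unfolding bij_betw_def by (metis imageE lessThan_iff)
  obtain a where a: "idx a = 0" using onto[of 0] by auto
  obtain b where b: "idx b = 1" using onto[of 1] by auto
  obtain c where c: "idx c = 2" using onto[of 2] by auto
  note abc = a b c
  have all: "i = a \<or> i = b \<or> i = c" for i
  proof -
    have "idx i = idx a \<or> idx i = idx b \<or> idx i = idx c" using range[of i] abc by auto
    then show ?thesis using inj by (auto dest: injD)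
  qed
  have base: "compatible s a b c" for s
    unfolding compatible_def
  proof (intro allI)
    fix x y :: oct
    obtain p1 p2 q1 q2 where x: "x = ((p1, p2), (q1, q2))" by (metis prod.exhaust)
    obtain r1 r2 s1 s2 where y: "y = ((r1, r2), (s1, s2))" by (metis prod.exhaust)
    define t where "t = (\<lambda>a::real. cis (a * s))"
      have t0: "cis (a * s) = t a" for a by (simp add: t_def)
    have t01: "cis s = t 1" by (simp add: t_def)
    have t1: "(t a * p) * (t b * q) = t (a + b) * (p * q)" for a b p q
      unfolding t_def distrib_right cis_mult[symmetric] by (simp only: mult_ac)
    have t2: "cnj (t a * p) = t (- a) * cnj p" for a p by (simp add: t_def cis_cnj)
    have turns: "turn s a b z = rot (oct_freq 0 1) s z" "turn s b c z = rot (oct_freq 1 2) s z"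
      "turn s a c z = rot (oct_freq 0 2) s z" for z
      by (simp_all add: turn_def abc)
    show "oct_mult (turn s a b x) (turn s b c y) = turn s a c (oct_mult x y)"
      unfolding turns x y oct_mult_def quat_mult_def quat_cnj_def cd_mult_def cd_cnj_def split_conv rot
      by (simp add: rot oct_freq_def t0 t01 t1 t2 right_diff_distrib distrib_left
          del: complex_cnj_mult mult_minus_right mult_minus_left)
  qed
  have "compatible s i k j" if "i \<noteq> j" "j \<noteq> k" "i \<noteq> k" for s i k j
  proof -
    note 1 = base[of s]
    note 2 = compatible_swap[OF 1]
    note 3 = compatible_reverse[OF 1]
    note 4 = compatible_reverse[OF 2]
    note 5 = compatible_swap[OF 3]
    note 6 = compatible_reverse[OF 5]
    show ?thesis using all[of i] all[of j] all[of k] that 1 2 3 4 5 6 by auto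
  qed
  then show ?thesis
    by unfold_locales (auto simp: compatible_def)
qed

section \<open>The counts for the model spaces\<close>

lemma sphere_light_rays:
  assumes card: "CARD('m::finite) = 2 * n \<or> CARD('m) = 2 * n + 1"
  shows "\<exists>V. killing_field (unit_sphere :: (real^'m) set) round_metric V \<and>
    (\<exists>\<epsilon>>0. \<forall>\<alpha>::real. \<alpha> \<notin> \<rat> \<and> \<bar>\<alpha>\<bar> < \<epsilon> \<longrightarrow>
      (let \<delta> = (\<lambda>x. - (\<alpha> *\<^sub>R V x)); \<beta> = (\<lambda>x. 1 - \<alpha>\<^sup>2 * round_metric x (V x) (V x)) in
        (\<forall>x\<in>(unit_sphere :: (real^'m) set). \<beta> x > 0) \<and>
        card (periodic_light_rays (unit_sphere :: (real^'m) set) (stationary_metric round_metric \<delta> \<beta>)) = 2 * n))"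
proof -
  obtain e f where
    "light_model {..<n} e f (\<lambda>l. real (Suc l)) (sphere 0 1 :: (real^'m) set) 1 (\<lambda>_. 0)"
    using sphere_light_model[OF card] by blast
  note count = light_model.light_rays_count[OF this]
  have m: "round_metric = (\<lambda>(x :: real^'m) v w. 1 * (v \<bullet> w))" by (simp add: round_metric_def fun_eq_iff)
  show ?thesis using count unfolding unit_sphere_def m Let_def by simp
qed

theorem proposition3p4:
  fixes n :: nat
  assumes "n \<ge> 1"
  shows
    "(CARD('e) = 2 * n + 1 \<longrightarrow>
        (\<exists>V. killing_field (unit_sphere :: (real^'e) set) round_metric V \<and>
          (\<exists>\<epsilon>>0. \<forall>\<alpha>::real. \<alpha> \<notin> \<rat> \<and> \<bar>\<alpha>\<bar> < \<epsilon> \<longrightarrow>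
            (let \<delta> = (\<lambda>x. - (\<alpha> *\<^sub>R V x)); \<beta> = (\<lambda>x. 1 - \<alpha>\<^sup>2 * round_metric x (V x) (V x)) in
              (\<forall>x\<in>(unit_sphere :: (real^'e) set). \<beta> x > 0) \<and>
              card (periodic_light_rays (unit_sphere :: (real^'e) set) (stationary_metric round_metric \<delta> \<beta>)) = 2 * n)))) \<and>
     (CARD('o) = 2 * n \<longrightarrow>
        (\<exists>V. killing_field (unit_sphere :: (real^'o) set) round_metric V \<and>
          (\<exists>\<epsilon>>0. \<forall>\<alpha>::real. \<alpha> \<notin> \<rat> \<and> \<bar>\<alpha>\<bar> < \<epsilon> \<longrightarrow>
            (let \<delta> = (\<lambda>x. - (\<alpha> *\<^sub>R V x)); \<beta> = (\<lambda>x. 1 - \<alpha>\<^sup>2 * round_metric x (V x) (V x)) in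
              (\<forall>x\<in>(unit_sphere :: (real^'o) set). \<beta> x > 0) \<and>
              card (periodic_light_rays (unit_sphere :: (real^'o) set) (stationary_metric round_metric \<delta> \<beta>)) = 2 * n)))) \<and>
     (CARD('p) = n + 1 \<longrightarrow>
        (\<exists>V. killing_field (complex_projective_space :: (complex^'p^'p) set) projective_metric V \<and>
          (\<exists>\<epsilon>>0. \<forall>\<alpha>::real. \<alpha> \<notin> \<rat> \<and> \<bar>\<alpha>\<bar> < \<epsilon> \<longrightarrow>
            (let \<delta> = (\<lambda>x. - (\<alpha> *\<^sub>R V x)); \<beta> = (\<lambda>x. 1 - \<alpha>\<^sup>2 * projective_metric x (V x) (V x)) in
              (\<forall>x\<in>(complex_projective_space :: (complex^'p^'p) set). \<beta> x > 0) \<and>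
              card (periodic_light_rays (complex_projective_space :: (complex^'p^'p) set) (stationary_metric projective_metric \<delta> \<beta>)) = n * (n + 1))))) \<and>
     (CARD('p) = n + 1 \<longrightarrow>
        (\<exists>V. killing_field (quaternionic_projective_space :: (quat^'p^'p) set) projective_metric V \<and>
          (\<exists>\<epsilon>>0. \<forall>\<alpha>::real. \<alpha> \<notin> \<rat> \<and> \<bar>\<alpha>\<bar> < \<epsilon> \<longrightarrow>
            (let \<delta> = (\<lambda>x. - (\<alpha> *\<^sub>R V x)); \<beta> = (\<lambda>x. 1 - \<alpha>\<^sup>2 * projective_metric x (V x) (V x)) in
              (\<forall>x\<in>(quaternionic_projective_space :: (quat^'p^'p) set). \<beta> x > 0) \<and>
              card (periodic_light_rays (quaternionic_projective_space :: (quat^'p^'p) set) (stationary_metric projective_metric \<delta> \<beta>)) = 2 * n * (n + 1))))) \<and>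
     ((\<exists>V. killing_field cayley_plane projective_metric V \<and>
          (\<exists>\<epsilon>>0. \<forall>\<alpha>::real. \<alpha> \<notin> \<rat> \<and> \<bar>\<alpha>\<bar> < \<epsilon> \<longrightarrow>
            (let \<delta> = (\<lambda>x. - (\<alpha> *\<^sub>R V x)); \<beta> = (\<lambda>x. 1 - \<alpha>\<^sup>2 * projective_metric x (V x) (V x)) in
              (\<forall>x\<in>cayley_plane. \<beta> x > 0) \<and>
              card (periodic_light_rays cayley_plane (stationary_metric projective_metric \<delta> \<beta>)) = 24))))"
proof -
  obtain idx :: "'p \<Rightarrow> nat" where idx: "inj idx"
    using finite_imp_inj_to_nat_seg[of "UNIV :: 'p set"] by auto
  obtain h :: "3 \<Rightarrow> nat" where "bij_betw h UNIV {0..<CARD(3)}"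
    using ex_bij_betw_finite_nat[of "UNIV :: 3 set"] by auto
  then have h: "inj h" "\<And>i. h i < 3" by (auto simp: bij_betw_def)
  interpret C: projective_light "(*)" "1::complex" idx "{0::nat}" "\<lambda>_. 1" "\<lambda>_. \<i>" "\<lambda>i j _. 3 ^ idx i - 3 ^ idx j"
    by (rule complex_projective_light[OF idx])
  interpret H: projective_light quat_mult "(1, 0)" idx "{..<2}" "quat_unit 1" "quat_unit \<i>"
    "\<lambda>i j r. if r = 0 then 3 ^ idx i - 3 ^ idx j else 3 ^ idx i + 3 ^ idx j"
    by (rule quat_projective_light[OF idx])
  interpret O: projective_light oct_mult oct_one h "{..<4}" "oct_unit 1" "oct_unit \<i>" "\<lambda>i j. oct_freq (h i) (h j)"
    by (rule oct_projective_light[OF h])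
  have PC: "C.PM = (complex_projective_space :: (complex^'p^'p) set)"
    unfolding complex_projective_space_def complex_cj[symmetric]
    by (rule C.PM_eq_outer[symmetric]) (rule mult.assoc)
  have PH: "H.PM = (quaternionic_projective_space :: (quat^'p^'p) set)"
    unfolding quaternionic_projective_space_def quat_cj[symmetric]
    by (rule H.PM_eq_outer[symmetric]) (rule quat_mult_assoc)
  have PO: "O.PM = cayley_plane"
    unfolding cayley_plane_def oct_cj[symmetric]
    by (rule O.PM_eq_idempotents[symmetric]) simp
  \<comment> \<open>Twice the number of entries above the diagonal.\<close>
  have count: "CARD('p) * CARD('p) - CARD('p) = n * (n + 1)" if "CARD('p) = n + 1"
    unfolding that by simp
  show ?thesis
  proof (intro conjI impI, goal_cases)
    case 1 then show ?case by (intro sphere_light_rays) simp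
  next
    case 2 then show ?case by (intro sphere_light_rays) simp
  next
    case 3 then show ?case
      using C.PM_light_rays unfolding PC count[OF 3] by simp
  next
    case 4 then show ?case
      using H.PM_light_rays unfolding PH count[OF 4] by (simp add: mult.assoc)
  next
    case 5 show ?case
      using O.PM_light_rays unfolding PO by simp
  qed
qed

end
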